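(* Let $\mathcal{T}$ be a triangulated category with a Serre functor $\mathbb{S}$. (i) The assignments $\mathcal{X}\mapsto\Psi(\mathcal{X}):={}^{\bot}\mathcal{X}[1]$ and $\mathcal{U}\mapsto\Phi(\mathcal{U}):=\mathcal{U}\cap{}^{\bot}\mathcal{U}[1]$ induce maps $\Psi:\mathsf{Rigid}(\mathcal{T})\to\mathsf{Ext}(\mathcal{T})$ and $\Phi:\mathsf{Ext}(\mathcal{T})\to\mathsf{Rigid}(\mathcal{T})$, where $\mathsf{Rigid}(\mathcal{T})$ is the class of functorially finite rigid subcategories $\mathcal{X}$ of $\mathcal{T}$ such that $\mathbb{S}(\mathcal{X})=\mathcal{X}[2]$, and $\mathsf{Ext}(\mathcal{T})$ is the class of functorially finite extension closed subcategories $\mathcal{U}$ of $\mathcal{T}$ such that $\mathbb{S}(\mathcal{U})=\mathcal{U}[2]$. (ii) $\Phi\Psi(\mathcal{X})=\mathcal{X}$ for all $\mathcal{X}\in\mathsf{Rigid}(\mathcal{T})$, and $\mathcal{U}\subseteq\Psi\Phi(\mathcal{U})$ for all $\mathcal{U}\in\mathsf{Ext}(\mathcal{T})$. Moreover $\Psi$ and $\Phi$ induce mutually inverse bijections $\Psi:\mathsf{Rigid}(\mathcal{T})\to\mathsf{MaxExt}(\mathcal{T})$ and $\Phi:\mathsf{MaxExt}(\mathcal{T})\to\mathsf{Rigid}(\mathcal{T})$ between $\mathsf{Rigid}(\mathcal{T})$ and the subclass $\mathsf{MaxExt}(\mathcal{T})$ of $\mathsf{Ext}(\mathcal{T})$ consisting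 of all maximal subcategories. (iii) For any $\mathcal{U}\in\mathsf{Ext}(\mathcal{T})$, the subfactor category $\mathcal{U}/\Phi(\mathcal{U})$ is a triangulated subcategory of $\mathcal{T}/\Phi(\mathcal{U})$, and for any $\mathcal{X}\in\mathsf{Rigid}(\mathcal{T})$, the subfactor category $\Psi(\mathcal{X})/\mathcal{X}$ is a maximal triangulated subcategory of $\mathcal{T}/\mathcal{X}$.
   Context: $\mathcal{T}$ is a Hom-finite $k$-linear triangulated category over a field $k$ with split idempotents and shift $[1]$; a Serre functor is a triangulated equivalence $\mathbb{S}:\mathcal{T}\to\mathcal{T}$ with natural bifunctorial isomorphisms $\mathrm{Hom}_k(\mathcal{T}(A,B),k)\cong\mathcal{T}(B,\mathbb{S}(A))$. Subcategories are full, additive, closed under isomorphisms and direct summands. $\mathcal{X}$ is rigid if $\mathcal{T}(\mathcal{X},\mathcal{X}[1])=0$. $\mathcal{X}^{\bot}=\{A\mid\mathcal{T}(\mathcal{X},A)=0\}$, ${}^{\bot}\mathcal{X}=\{A\mid\mathcal{T}(A,\mathcal{X})=0\}$, ${}^{\bot}\mathcal{X}[1]=({}^{\bot}\mathcal{X})[1]$. A right $\mathcal{X}$-approximation of $A$ is a map $X_A\to A$, $X_A\in\mathcal{X}$, with $\mathcal{T}(\mathcal{X},X_A)\to\mathcal{T}(\mathcal{X},A)$ surjective; left approximations are dual; $\mathcal{X}$ is functorially finite if every object has both. If $\mathcal{U}$ is extension closed with $\mathbb{S}(\mathcal{U})=\mathcal{U}[2]$, then ${}^{\bot}\mathcal{U}[1]=\mathcal{U}^{\bot}[-1]$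 and the heart of $\mathcal{U}$ is $\mathcal{U}\cap{}^{\bot}\mathcal{U}[1]$. Such a $\mathcal{U}$ is maximal if, for every extension closed $\mathcal{V}$ with $\mathbb{S}(\mathcal{V})=\mathcal{V}[2]$ having the same heart as $\mathcal{U}$, the inclusion $\mathcal{U}\subseteq\mathcal{V}$ implies $\mathcal{U}=\mathcal{V}$. For $\mathcal{X}$ functorially finite, $\mathcal{T}/\mathcal{X}$ (objects of $\mathcal{T}$, morphisms modulo maps factoring through $\mathcal{X}$) is pretriangulated: choose triangles $\Omega^1_{\mathcal{X}}(A)\to X^0_A\to A\to\Omega^1_{\mathcal{X}}(A)[1]$ and $\Sigma^1_{\mathcal{X}}(A)[-1]\to A\to X^A_0\to\Sigma^1_{\mathcal{X}}(A)$ with $X^0_A\to A$ a right and $A\to X^A_0$ a left $\mathcal{X}$-approximation; these give an adjoint pair of endofunctors $(\Sigma^1_{\mathcal{X}},\Omega^1_{\mathcal{X}})$ of $\mathcal{T}/\mathcal{X}$. Right triangles are the diagrams isomorphic to $A\to B\to C\to\Sigma^1_{\mathcal{X}}(A)$ obtained from $A\to B$ by completing $\Sigma^1_{\mathcal{X}}(A)[-1]\to A\to B$ to a triangle $\Sigma^1_{\mathcal{X}}(A)[-1]\to B\to C\to\Sigma^1_{\mathcal{X}}(A)$ in $\mathcal{T}$; left triangles are the diagrams isomorphic to $\Omega^1_{\mathcal{X}}(C)\to A\to B\to C$ obtained from $B\to C$ by completing $B\to C\to\Omega^1_{\mathcal{X}}(C)[1]$ to a triangle $\Omega^1_{\mathcal{X}}(C)\to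 A\to B\to\Omega^1_{\mathcal{X}}(C)[1]$. A full subcategory $\mathcal{S}$ of $\mathcal{T}/\mathcal{X}$ is a triangulated subcategory if it is closed under $\Sigma^1_{\mathcal{X}},\Omega^1_{\mathcal{X}}$ and under the left and right triangles built on its morphisms, and the restricted structure is triangulated (the restrictions of $\Sigma^1_{\mathcal{X}},\Omega^1_{\mathcal{X}}$ to $\mathcal{S}$ are equivalences). *)

theory Defs
  imports Main "HOL-Library.FuncSet"
begin

section \<open>Additive categories\<close>

text \<open>Morphisms live in one type and the hom-sets are pairwise disjoint, so that
  composition and addition need not be indexed by objects.\<close>

record ('o, 'm) acat =
  ob :: "'o set"
  hom :: "'o \<Rightarrow> 'o \<Rightarrow> 'm set"
  idm :: "'o \<Rightarrow> 'm"
  comp :: "'m \<Rightarrow> 'm \<Rightarrow> 'm" (infixl "\<cdot>\<index>" 70)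
  add :: "'m \<Rightarrow> 'm \<Rightarrow> 'm" (infixl "\<oplus>\<index>" 65)
  neg :: "'m \<Rightarrow> 'm" ("\<ominus>\<index> _" [81] 80)
  zero :: "'o \<Rightarrow> 'o \<Rightarrow> 'm"

locale category =
  fixes C :: "('o, 'm, 'z) acat_scheme" (structure)
  assumes hom_ob: "f \<in> hom C A B \<Longrightarrow> A \<in> ob C \<and> B \<in> ob C"
    and hom_disjoint: "f \<in> hom C A B \<Longrightarrow> f \<in> hom C A' B' \<Longrightarrow> A = A' \<and> B = B'"
    and idm_hom: "A \<in> ob C \<Longrightarrow> idm C A \<in> hom C A A"
    and comp_hom: "f \<in> hom C A B \<Longrightarrow> g \<in> hom C B D \<Longrightarrow> g \<cdot> f \<in> hom C A D"
    and comp_idm: "f \<in> hom C A B \<Longrightarrow> f \<cdot> idm C A = f"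
    and idm_comp: "f \<in> hom C A B \<Longrightarrow> idm C B \<cdot> f = f"
    and comp_assoc: "f \<in> hom C A B \<Longrightarrow> g \<in> hom C B D \<Longrightarrow> h \<in> hom C D E \<Longrightarrow>
      (h \<cdot> g) \<cdot> f = h \<cdot> (g \<cdot> f)"

locale preadditive_category = category +
  assumes add_hom: "f \<in> hom C A B \<Longrightarrow> g \<in> hom C A B \<Longrightarrow> f \<oplus> g \<in> hom C A B"
    and zero_hom: "A \<in> ob C \<Longrightarrow> B \<in> ob C \<Longrightarrow> zero C A B \<in> hom C A B"
    and neg_hom: "f \<in> hom C A B \<Longrightarrow> \<ominus> f \<in> hom C A B"
    and add_assoc: "f \<in> hom C A B \<Longrightarrow> g \<in> hom C A B \<Longrightarrow> h \<in> hom C A B \<Longrightarrow>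
      (f \<oplus> g) \<oplus> h = f \<oplus> (g \<oplus> h)"
    and add_commute: "f \<in> hom C A B \<Longrightarrow> g \<in> hom C A B \<Longrightarrow> f \<oplus> g = g \<oplus> f"
    and add_zero: "f \<in> hom C A B \<Longrightarrow> f \<oplus> zero C A B = f"
    and add_neg: "f \<in> hom C A B \<Longrightarrow> f \<oplus> \<ominus> f = zero C A B"
    and comp_add_left: "f \<in> hom C A B \<Longrightarrow> g \<in> hom C B D \<Longrightarrow> g' \<in> hom C B D \<Longrightarrow>
      (g \<oplus> g') \<cdot> f = (g \<cdot> f) \<oplus> (g' \<cdot> f)"
    and comp_add_right: "f \<in> hom C A B \<Longrightarrow> f' \<in> hom C A B \<Longrightarrow> g \<in> hom C B D \<Longrightarrow>
      g \<cdot> (f \<oplus> f') = (g \<cdot> f) \<oplus> (g \<cdot> f')"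

definition zero_object :: "('o, 'm, 'z) acat_scheme \<Rightarrow> 'o \<Rightarrow> bool" where
  "zero_object C Z \<longleftrightarrow> Z \<in> ob C \<and> idm C Z = zero C Z Z"

definition biproduct ::
  "('o, 'm, 'z) acat_scheme \<Rightarrow> 'o \<Rightarrow> 'o \<Rightarrow> 'o \<Rightarrow> 'm \<Rightarrow> 'm \<Rightarrow> 'm \<Rightarrow> 'm \<Rightarrow> bool" where
  "biproduct C A B P i j p q \<longleftrightarrow>
    i \<in> hom C A P \<and> j \<in> hom C B P \<and> p \<in> hom C P A \<and> q \<in> hom C P B \<and>
    p \<cdot>\<^bsub>C\<^esub> i = idm C A \<and> q \<cdot>\<^bsub>C\<^esub> j = idm C B \<and>
    p \<cdot>\<^bsub>C\<^esub> j = zero C B A \<and> q \<cdot>\<^bsub>C\<^esub> i = zero C A B \<and>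
    (i \<cdot>\<^bsub>C\<^esub> p) \<oplus>\<^bsub>C\<^esub> (j \<cdot>\<^bsub>C\<^esub> q) = idm C P"

locale additive_category = preadditive_category +
  assumes zero_object_ex: "\<exists>Z. zero_object C Z"
    and biproduct_ex: "A \<in> ob C \<Longrightarrow> B \<in> ob C \<Longrightarrow> \<exists>P i j p q. biproduct C A B P i j p q"

definition is_iso :: "('o, 'm, 'z) acat_scheme \<Rightarrow> 'o \<Rightarrow> 'o \<Rightarrow> 'm \<Rightarrow> bool" where
  "is_iso C A B f \<longleftrightarrow> f \<in> hom C A B \<and>
    (\<exists>g \<in> hom C B A. g \<cdot>\<^bsub>C\<^esub> f = idm C A \<and> f \<cdot>\<^bsub>C\<^esub> g = idm C B)"

definition isomorphic :: "('o, 'm, 'z) acat_scheme \<Rightarrow> 'o \<Rightarrow> 'o \<Rightarrow> bool" where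
  "isomorphic C A B \<longleftrightarrow> (\<exists>f. is_iso C A B f)"

definition idempotents_split :: "('o, 'm, 'z) acat_scheme \<Rightarrow> bool" where
  "idempotents_split C \<longleftrightarrow> (\<forall>A. \<forall>e \<in> hom C A A. e \<cdot>\<^bsub>C\<^esub> e = e \<longrightarrow>
    (\<exists>B. \<exists>r \<in> hom C A B. \<exists>s \<in> hom C B A. s \<cdot>\<^bsub>C\<^esub> r = e \<and> r \<cdot>\<^bsub>C\<^esub> s = idm C B))"

section \<open>Functors\<close>

record ('o, 'm, 'p, 'n) fctr =
  fob :: "'o \<Rightarrow> 'p"
  far :: "'m \<Rightarrow> 'n"

definition is_functor ::
  "('o, 'm, 'y) acat_scheme \<Rightarrow> ('p, 'n, 'z) acat_scheme \<Rightarrow> ('o, 'm, 'p, 'n) fctr \<Rightarrow> bool" where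
  "is_functor C D F \<longleftrightarrow>
    (\<forall>A \<in> ob C. fob F A \<in> ob D) \<and>
    (\<forall>A B. \<forall>f \<in> hom C A B. far F f \<in> hom D (fob F A) (fob F B)) \<and>
    (\<forall>A \<in> ob C. far F (idm C A) = idm D (fob F A)) \<and>
    (\<forall>A B E. \<forall>f \<in> hom C A B. \<forall>g \<in> hom C B E. far F (g \<cdot>\<^bsub>C\<^esub> f) = far F g \<cdot>\<^bsub>D\<^esub> far F f)"

definition is_additive_functor ::
  "('o, 'm, 'y) acat_scheme \<Rightarrow> ('p, 'n, 'z) acat_scheme \<Rightarrow> ('o, 'm, 'p, 'n) fctr \<Rightarrow> bool" where
  "is_additive_functor C D F \<longleftrightarrow> is_functor C D F \<and>
    (\<forall>A B. \<forall>f \<in> hom C A B. \<forall>g \<in> hom C A B. far F (f \<oplus>\<^bsub>C\<^esub> g) = far F f \<oplus>\<^bsub>D\<^esub> far F g)"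

definition functor_id :: "('o, 'm, 'o, 'm) fctr" where
  "functor_id = \<lparr>fob = id, far = id\<rparr>"

definition functor_comp ::
  "('p, 'n, 'q, 'l) fctr \<Rightarrow> ('o, 'm, 'p, 'n) fctr \<Rightarrow> ('o, 'm, 'q, 'l) fctr" where
  "functor_comp G F = \<lparr>fob = fob G \<circ> fob F, far = far G \<circ> far F\<rparr>"

definition nat_iso ::
  "('o, 'm, 'y) acat_scheme \<Rightarrow> ('p, 'n, 'z) acat_scheme \<Rightarrow>
    ('o, 'm, 'p, 'n) fctr \<Rightarrow> ('o, 'm, 'p, 'n) fctr \<Rightarrow> ('o \<Rightarrow> 'n) \<Rightarrow> bool" where
  "nat_iso C D F G \<tau> \<longleftrightarrow>
    (\<forall>A \<in> ob C. is_iso D (fob F A) (fob G A) (\<tau> A)) \<and>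
    (\<forall>A B. \<forall>f \<in> hom C A B. far G f \<cdot>\<^bsub>D\<^esub> \<tau> A = \<tau> B \<cdot>\<^bsub>D\<^esub> far F f)"

definition is_equivalence ::
  "('o, 'm, 'y) acat_scheme \<Rightarrow> ('p, 'n, 'z) acat_scheme \<Rightarrow> ('o, 'm, 'p, 'n) fctr \<Rightarrow> bool" where
  "is_equivalence C D F \<longleftrightarrow> is_functor C D F \<and>
    (\<exists>G. is_functor D C G \<and>
      (\<exists>\<tau>. nat_iso C C (functor_comp G F) functor_id \<tau>) \<and>
      (\<exists>\<tau>. nat_iso D D (functor_comp F G) functor_id \<tau>))"

section \<open>Triangulated categories\<close>

definition triangle_shape ::
  "('o, 'm, 'z) acat_scheme \<Rightarrow> ('o, 'm, 'o, 'm) fctr \<Rightarrow> 'o \<Rightarrow> 'o \<Rightarrow> 'o \<Rightarrow> 'm \<Rightarrow> 'm \<Rightarrow> 'm \<Rightarrow> bool" where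
  "triangle_shape C S A B D f g h \<longleftrightarrow> f \<in> hom C A B \<and> g \<in> hom C B D \<and> h \<in> hom C D (fob S A)"

definition triangle_iso ::
  "('o, 'm, 'z) acat_scheme \<Rightarrow> ('o, 'm, 'o, 'm) fctr \<Rightarrow> 'm \<times> 'm \<times> 'm \<Rightarrow> 'm \<times> 'm \<times> 'm \<Rightarrow> bool" where
  "triangle_iso C S t t' \<longleftrightarrow>
    (case t of (f, g, h) \<Rightarrow> case t' of (f', g', h') \<Rightarrow>
      \<exists>A B D A' B' D' a b d.
        triangle_shape C S A B D f g h \<and> triangle_shape C S A' B' D' f' g' h' \<and>
        is_iso C A A' a \<and> is_iso C B B' b \<and> is_iso C D D' d \<and>
        f' \<cdot>\<^bsub>C\<^esub> a = b \<cdot>\<^bsub>C\<^esub> f \<and> g' \<cdot>\<^bsub>C\<^esub> b = d \<cdot>\<^bsub>C\<^esub> g \<and> h' \<cdot>\<^bsub>C\<^esub> d = far S a \<cdot>\<^bsub>C\<^esub> h)"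

text \<open>Here the suspension is only an additive autoequivalence, so that the notion applies to the
  subfactor categories as well; for the ambient category it is assumed to be an automorphism
  below.\<close>

locale triangulated_category = additive_category C
  for C :: "('o, 'm, 'z) acat_scheme" (structure) +
  fixes S :: "('o, 'm, 'o, 'm) fctr"
    and \<Delta> :: "('m \<times> 'm \<times> 'm) set"
  assumes suspension_additive: "is_additive_functor C C S"
    and suspension_equivalence: "is_equivalence C C S"
    and tri_shape: "(f, g, h) \<in> \<Delta> \<Longrightarrow> \<exists>A B D. triangle_shape C S A B D f g h"
    and tri_iso_closed: "t \<in> \<Delta> \<Longrightarrow> triangle_iso C S t t' \<Longrightarrow> t' \<in> \<Delta>"
    and tri_idm: "A \<in> ob C \<Longrightarrow> zero_object C Z \<Longrightarrow>
      (idm C A, zero C A Z, zero C Z (fob S A)) \<in> \<Delta>"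
    and tri_complete: "f \<in> hom C A B \<Longrightarrow> \<exists>g h. (f, g, h) \<in> \<Delta>"
    and tri_rotate: "triangle_shape C S A B D f g h \<Longrightarrow>
      (f, g, h) \<in> \<Delta> \<longleftrightarrow> (g, h, \<ominus> far S f) \<in> \<Delta>"
    and tri_morphism: "(f, g, h) \<in> \<Delta> \<Longrightarrow> (f', g', h') \<in> \<Delta> \<Longrightarrow>
      triangle_shape C S A B D f g h \<Longrightarrow> triangle_shape C S A' B' D' f' g' h' \<Longrightarrow>
      a \<in> hom C A A' \<Longrightarrow> b \<in> hom C B B' \<Longrightarrow> f' \<cdot> a = b \<cdot> f \<Longrightarrow>
      \<exists>d \<in> hom C D D'. g' \<cdot> b = d \<cdot> g \<and> h' \<cdot> d = far S a \<cdot> h"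
    and octahedral:
      "triangle_shape C S A B D f f' f'' \<Longrightarrow> (f, f', f'') \<in> \<Delta> \<Longrightarrow>
       triangle_shape C S B E F g g' g'' \<Longrightarrow> (g, g', g'') \<in> \<Delta> \<Longrightarrow>
       triangle_shape C S A E G (g \<cdot> f) k k' \<Longrightarrow> (g \<cdot> f, k, k') \<in> \<Delta> \<Longrightarrow>
       \<exists>u \<in> hom C D G. \<exists>v \<in> hom C G F. (u, v, far S f' \<cdot> g'') \<in> \<Delta> \<and>
         u \<cdot> f' = k \<cdot> g \<and> k' \<cdot> u = f'' \<and> v \<cdot> k = g' \<and> g'' \<cdot> v = far S f \<cdot> k'"

section \<open>Linear structure and Serre functors\<close>

record ('o, 'm, 'k) lincat = "('o, 'm) acat" +
  scal :: "'k \<Rightarrow> 'm \<Rightarrow> 'm"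

inductive_set lin_span :: "('o, 'm, 'k) lincat \<Rightarrow> 'o \<Rightarrow> 'o \<Rightarrow> 'm set \<Rightarrow> 'm set"
  for T A B G where
  "zero T A B \<in> lin_span T A B G"
| "g \<in> G \<Longrightarrow> g \<in> lin_span T A B G"
| "f \<in> lin_span T A B G \<Longrightarrow> g \<in> lin_span T A B G \<Longrightarrow> f \<oplus>\<^bsub>T\<^esub> g \<in> lin_span T A B G"
| "f \<in> lin_span T A B G \<Longrightarrow> scal T c f \<in> lin_span T A B G"

locale hom_finite_linear_category = additive_category T
  for T :: "('o, 'm, 'k::field) lincat" (structure) +
  assumes scal_hom: "f \<in> hom T A B \<Longrightarrow> scal T c f \<in> hom T A B"
    and scal_one: "f \<in> hom T A B \<Longrightarrow> scal T 1 f = f"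
    and scal_scal: "f \<in> hom T A B \<Longrightarrow> scal T c (scal T d f) = scal T (c * d) f"
    and scal_add_left: "f \<in> hom T A B \<Longrightarrow> scal T (c + d) f = scal T c f \<oplus> scal T d f"
    and scal_add_right: "f \<in> hom T A B \<Longrightarrow> g \<in> hom T A B \<Longrightarrow>
      scal T c (f \<oplus> g) = scal T c f \<oplus> scal T c g"
    and scal_comp_left: "f \<in> hom T A B \<Longrightarrow> g \<in> hom T B D \<Longrightarrow> scal T c g \<cdot> f = scal T c (g \<cdot> f)"
    and scal_comp_right: "f \<in> hom T A B \<Longrightarrow> g \<in> hom T B D \<Longrightarrow> g \<cdot> scal T c f = scal T c (g \<cdot> f)"
    and hom_finite: "A \<in> ob T \<Longrightarrow> B \<in> ob T \<Longrightarrow>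
      \<exists>G \<subseteq> hom T A B. finite G \<and> lin_span T A B G = hom T A B"

definition is_linear_functor ::
  "('o, 'm, 'k) lincat \<Rightarrow> ('o, 'm, 'o, 'm) fctr \<Rightarrow> bool" where
  "is_linear_functor T F \<longleftrightarrow> is_additive_functor T T F \<and>
    (\<forall>A B c. \<forall>f \<in> hom T A B. far F (scal T c f) = scal T c (far F f))"

text \<open>The shift is an automorphism \<open>Sh\<close>, written \<open>[1]\<close> in the comments, with inverse \<open>Us\<close>, that
  is \<open>[-1]\<close>.\<close>

locale linear_triangulated_category =
  hom_finite_linear_category T + triangulated_category T Sh \<Delta>
  for T :: "('o, 'm, 'k::field) lincat" (structure)
    and Sh Us :: "('o, 'm, 'o, 'm) fctr"
    and \<Delta> :: "('m \<times> 'm \<times> 'm) set" +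
  assumes split: "idempotents_split T"
    and shift_linear: "is_linear_functor T Sh"
    and unshift_functor: "is_functor T T Us"
    and shift_unshift_ob: "A \<in> ob T \<Longrightarrow> fob Sh (fob Us A) = A"
    and unshift_shift_ob: "A \<in> ob T \<Longrightarrow> fob Us (fob Sh A) = A"
    and shift_unshift: "f \<in> hom T A B \<Longrightarrow> far Sh (far Us f) = f"
    and unshift_shift: "f \<in> hom T A B \<Longrightarrow> far Us (far Sh f) = f"

definition triangulated_equivalence ::
  "('o, 'm, 'k) lincat \<Rightarrow> ('o, 'm, 'o, 'm) fctr \<Rightarrow> ('m \<times> 'm \<times> 'm) set \<Rightarrow>
    ('o, 'm, 'o, 'm) fctr \<Rightarrow> bool" where
  "triangulated_equivalence T Sh \<Delta> F \<longleftrightarrow>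
    is_linear_functor T F \<and> is_equivalence T T F \<and>
    (\<exists>\<phi>. nat_iso T T (functor_comp F Sh) (functor_comp Sh F) \<phi> \<and>
      (\<forall>A B D f g h. triangle_shape T Sh A B D f g h \<and> (f, g, h) \<in> \<Delta> \<longrightarrow>
        (far F f, far F g, \<phi> A \<cdot>\<^bsub>T\<^esub> far F h) \<in> \<Delta>))"

definition dual :: "('o, 'm, 'k::field) lincat \<Rightarrow> 'o \<Rightarrow> 'o \<Rightarrow> ('m \<Rightarrow> 'k) set" where
  "dual T A B = {\<phi> \<in> extensional (hom T A B).
    (\<forall>f \<in> hom T A B. \<forall>g \<in> hom T A B. \<phi> (f \<oplus>\<^bsub>T\<^esub> g) = \<phi> f + \<phi> g) \<and>
    (\<forall>c. \<forall>f \<in> hom T A B. \<phi> (scal T c f) = c * \<phi> f)}"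

text \<open>\<open>\<eta> A B\<close> is the isomorphism from the dual of \<open>T(A, B)\<close> to \<open>T(B, F A)\<close>.\<close>

definition serre_functor ::
  "('o, 'm, 'k::field) lincat \<Rightarrow> ('o, 'm, 'o, 'm) fctr \<Rightarrow> ('m \<times> 'm \<times> 'm) set \<Rightarrow>
    ('o, 'm, 'o, 'm) fctr \<Rightarrow> bool" where
  "serre_functor T Sh \<Delta> F \<longleftrightarrow> triangulated_equivalence T Sh \<Delta> F \<and>
    (\<exists>\<eta>.
      (\<forall>A \<in> ob T. \<forall>B \<in> ob T.
        bij_betw (\<eta> A B) (dual T A B) (hom T B (fob F A)) \<and>
        (\<forall>\<phi> \<in> dual T A B. \<forall>\<psi> \<in> dual T A B.
          \<eta> A B (\<lambda>f \<in> hom T A B. \<phi> f + \<psi> f) = \<eta> A B \<phi> \<oplus>\<^bsub>T\<^esub> \<eta> A B \<psi>) \<and>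
        (\<forall>c. \<forall>\<phi> \<in> dual T A B. \<eta> A B (\<lambda>f \<in> hom T A B. c * \<phi> f) = scal T c (\<eta> A B \<phi>))) \<and>
      (\<forall>A A' B B'. \<forall>a \<in> hom T A A'. \<forall>b \<in> hom T B' B. \<forall>\<phi> \<in> dual T A B.
        \<eta> A' B' (\<lambda>f \<in> hom T A' B'. \<phi> (b \<cdot>\<^bsub>T\<^esub> f \<cdot>\<^bsub>T\<^esub> a)) =
          far F a \<cdot>\<^bsub>T\<^esub> \<eta> A B \<phi> \<cdot>\<^bsub>T\<^esub> b))"

section \<open>Subcategories\<close>

text \<open>A full subcategory is given by its set of objects.\<close>

definition subcategory :: "('o, 'm, 'z) acat_scheme \<Rightarrow> 'o set \<Rightarrow> bool" where
  "subcategory C X \<longleftrightarrow> X \<subseteq> ob C \<and>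
    (\<exists>Z \<in> X. zero_object C Z) \<and>
    (\<forall>A B. A \<in> X \<and> isomorphic C A B \<longrightarrow> B \<in> X) \<and>
    (\<forall>A B P i j p q. biproduct C A B P i j p q \<longrightarrow>
      (P \<in> X \<longleftrightarrow> A \<in> X \<and> B \<in> X))"

definition ess_image ::
  "('o, 'm, 'z) acat_scheme \<Rightarrow> ('o, 'm, 'o, 'm) fctr \<Rightarrow> 'o set \<Rightarrow> 'o set" where
  "ess_image C F X = {B. \<exists>A \<in> X. isomorphic C (fob F A) B}"

definition right_perp :: "('o, 'm, 'z) acat_scheme \<Rightarrow> 'o set \<Rightarrow> 'o set" where
  "right_perp C X = {A \<in> ob C. \<forall>B \<in> X. hom C B A = {zero C B A}}"

definition left_perp :: "('o, 'm, 'z) acat_scheme \<Rightarrow> 'o set \<Rightarrow> 'o set" where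
  "left_perp C X = {A \<in> ob C. \<forall>B \<in> X. hom C A B = {zero C A B}}"

definition rigid :: "('o, 'm, 'z) acat_scheme \<Rightarrow> ('o, 'm, 'o, 'm) fctr \<Rightarrow> 'o set \<Rightarrow> bool" where
  "rigid C Sh X \<longleftrightarrow>
    (\<forall>A \<in> X. \<forall>B \<in> ess_image C Sh X. hom C A B = {zero C A B})"

definition extension_closed ::
  "('o, 'm, 'z) acat_scheme \<Rightarrow> ('o, 'm, 'o, 'm) fctr \<Rightarrow> ('m \<times> 'm \<times> 'm) set \<Rightarrow> 'o set \<Rightarrow> bool" where
  "extension_closed C Sh \<Delta> U \<longleftrightarrow>
    (\<forall>A B D f g h. triangle_shape C Sh A B D f g h \<and> (f, g, h) \<in> \<Delta> \<and> A \<in> U \<and> D \<in> U \<longrightarrow> B \<in> U)"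

definition right_approx :: "('o, 'm, 'z) acat_scheme \<Rightarrow> 'o set \<Rightarrow> 'o \<Rightarrow> 'o \<Rightarrow> 'm \<Rightarrow> bool" where
  "right_approx C X P A r \<longleftrightarrow> P \<in> X \<and> r \<in> hom C P A \<and>
    (\<forall>Q \<in> X. \<forall>f \<in> hom C Q A. \<exists>g \<in> hom C Q P. r \<cdot>\<^bsub>C\<^esub> g = f)"

definition left_approx :: "('o, 'm, 'z) acat_scheme \<Rightarrow> 'o set \<Rightarrow> 'o \<Rightarrow> 'o \<Rightarrow> 'm \<Rightarrow> bool" where
  "left_approx C X A P l \<longleftrightarrow> P \<in> X \<and> l \<in> hom C A P \<and>
    (\<forall>Q \<in> X. \<forall>f \<in> hom C A Q. \<exists>g \<in> hom C P Q. g \<cdot>\<^bsub>C\<^esub> l = f)"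

definition functorially_finite :: "('o, 'm, 'z) acat_scheme \<Rightarrow> 'o set \<Rightarrow> bool" where
  "functorially_finite C X \<longleftrightarrow>
    (\<forall>A \<in> ob C. (\<exists>P r. right_approx C X P A r) \<and> (\<exists>P l. left_approx C X A P l))"

text \<open>The condition that the Serre functor \<open>F\<close> maps \<open>X\<close> onto \<open>X[2]\<close>.\<close>

definition serre_stable ::
  "('o, 'm, 'z) acat_scheme \<Rightarrow> ('o, 'm, 'o, 'm) fctr \<Rightarrow> ('o, 'm, 'o, 'm) fctr \<Rightarrow> 'o set \<Rightarrow> bool" where
  "serre_stable C Sh F X \<longleftrightarrow> ess_image C F X = ess_image C Sh (ess_image C Sh X)"

definition Psi :: "('o, 'm, 'z) acat_scheme \<Rightarrow> ('o, 'm, 'o, 'm) fctr \<Rightarrow> 'o set \<Rightarrow> 'o set" where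
  "Psi C Sh X = ess_image C Sh (left_perp C X)"

definition Phi :: "('o, 'm, 'z) acat_scheme \<Rightarrow> ('o, 'm, 'o, 'm) fctr \<Rightarrow> 'o set \<Rightarrow> 'o set" where
  "Phi C Sh U = U \<inter> ess_image C Sh (left_perp C U)"

definition Rigid ::
  "('o, 'm, 'z) acat_scheme \<Rightarrow> ('o, 'm, 'o, 'm) fctr \<Rightarrow> ('o, 'm, 'o, 'm) fctr \<Rightarrow> 'o set set" where
  "Rigid C Sh F =
    {X. subcategory C X \<and> functorially_finite C X \<and> rigid C Sh X \<and> serre_stable C Sh F X}"

definition Ext ::
  "('o, 'm, 'z) acat_scheme \<Rightarrow> ('o, 'm, 'o, 'm) fctr \<Rightarrow> ('m \<times> 'm \<times> 'm) set \<Rightarrow>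
    ('o, 'm, 'o, 'm) fctr \<Rightarrow> 'o set set" where
  "Ext C Sh \<Delta> F =
    {U. subcategory C U \<and> functorially_finite C U \<and> extension_closed C Sh \<Delta> U \<and>
      serre_stable C Sh F U}"

text \<open>The competitors \<open>V\<close> in the definition of maximality need not be functorially finite;
  \<open>Phi\<close> computes the heart.\<close>

definition MaxExt ::
  "('o, 'm, 'z) acat_scheme \<Rightarrow> ('o, 'm, 'o, 'm) fctr \<Rightarrow> ('m \<times> 'm \<times> 'm) set \<Rightarrow>
    ('o, 'm, 'o, 'm) fctr \<Rightarrow> 'o set set" where
  "MaxExt C Sh \<Delta> F =
    {U \<in> Ext C Sh \<Delta> F. \<forall>V. subcategory C V \<and> extension_closed C Sh \<Delta> V \<and>
      serre_stable C Sh F V \<and> Phi C Sh V = Phi C Sh U \<and> U \<subseteq> V \<longrightarrow> U = V}"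

section \<open>Factor categories\<close>

definition factors_through :: "('o, 'm, 'z) acat_scheme \<Rightarrow> 'o set \<Rightarrow> 'o \<Rightarrow> 'o \<Rightarrow> 'm \<Rightarrow> bool" where
  "factors_through C X A B f \<longleftrightarrow> (\<exists>P \<in> X. \<exists>a \<in> hom C A P. \<exists>b \<in> hom C P B. f = b \<cdot>\<^bsub>C\<^esub> a)"

definition mod_class :: "('o, 'm, 'z) acat_scheme \<Rightarrow> 'o set \<Rightarrow> 'm \<Rightarrow> 'm set" where
  "mod_class C X f = {g. \<exists>A B. f \<in> hom C A B \<and> g \<in> hom C A B \<and>
    factors_through C X A B (g \<oplus>\<^bsub>C\<^esub> \<ominus>\<^bsub>C\<^esub> f)}"

text \<open>A morphism of the factor category is a residue class of morphisms. The unions below are over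
  representatives and run over sets that all coincide.\<close>

definition factor_cat :: "('o, 'm, 'z) acat_scheme \<Rightarrow> 'o set \<Rightarrow> ('o, 'm set) acat" where
  "factor_cat C X = \<lparr>
    ob = ob C,
    hom = (\<lambda>A B. mod_class C X ` hom C A B),
    idm = (\<lambda>A. mod_class C X (idm C A)),
    comp = (\<lambda>G F. \<Union>g \<in> G. \<Union>f \<in> F. mod_class C X (g \<cdot>\<^bsub>C\<^esub> f)),
    add = (\<lambda>F G. \<Union>f \<in> F. \<Union>g \<in> G. mod_class C X (f \<oplus>\<^bsub>C\<^esub> g)),
    neg = (\<lambda>F. \<Union>f \<in> F. mod_class C X (\<ominus>\<^bsub>C\<^esub> f)),
    zero = (\<lambda>A B. mod_class C X (zero C A B))\<rparr>"

definition full_subcat :: "('o, 'm, 'z) acat_scheme \<Rightarrow> 'o set \<Rightarrow> ('o, 'm) acat" where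
  "full_subcat C Y = \<lparr>
    ob = Y,
    hom = (\<lambda>A B. if A \<in> Y \<and> B \<in> Y then hom C A B else {}),
    idm = idm C,
    comp = comp C,
    add = add C,
    neg = neg C,
    zero = zero C\<rparr>"

text \<open>
  A choice of approximation triangles: an object and three morphisms for every object \<open>A\<close>. Read as
  left approximations they form the triangle
  \<open>\<Sigma>A[-1] \<rightarrow> A \<rightarrow> X\<^sub>0 \<rightarrow> \<Sigma>A\<close> with \<open>apx_ob A = \<Sigma>A\<close>, and read as right approximations the triangle
  \<open>\<Omega>A \<rightarrow> X\<^sub>0 \<rightarrow> A \<rightarrow> \<Omega>A[1]\<close> with \<open>apx_ob A = \<Omega>A\<close>.
\<close>

record ('o, 'm) apx =
  apx_ob :: "'o \<Rightarrow> 'o"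
  apx1 :: "'o \<Rightarrow> 'm"
  apx2 :: "'o \<Rightarrow> 'm"
  apx3 :: "'o \<Rightarrow> 'm"

definition left_apx_choice ::
  "('o, 'm, 'z) acat_scheme \<Rightarrow> ('o, 'm, 'o, 'm) fctr \<Rightarrow> ('o, 'm, 'o, 'm) fctr \<Rightarrow>
    ('m \<times> 'm \<times> 'm) set \<Rightarrow> 'o set \<Rightarrow> ('o, 'm) apx \<Rightarrow> bool" where
  "left_apx_choice C Sh Us \<Delta> X L \<longleftrightarrow> (\<forall>A \<in> ob C. apx_ob L A \<in> ob C \<and>
    (\<exists>P. triangle_shape C Sh (fob Us (apx_ob L A)) A P (apx1 L A) (apx2 L A) (apx3 L A) \<and>
      (apx1 L A, apx2 L A, apx3 L A) \<in> \<Delta> \<and> left_approx C X A P (apx2 L A)))"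

definition right_apx_choice ::
  "('o, 'm, 'z) acat_scheme \<Rightarrow> ('o, 'm, 'o, 'm) fctr \<Rightarrow>
    ('m \<times> 'm \<times> 'm) set \<Rightarrow> 'o set \<Rightarrow> ('o, 'm) apx \<Rightarrow> bool" where
  "right_apx_choice C Sh \<Delta> X R \<longleftrightarrow> (\<forall>A \<in> ob C. apx_ob R A \<in> ob C \<and>
    (\<exists>P. triangle_shape C Sh (apx_ob R A) P A (apx1 R A) (apx2 R A) (apx3 R A) \<and>
      (apx1 R A, apx2 R A, apx3 R A) \<in> \<Delta> \<and> right_approx C X P A (apx2 R A)))"

text \<open>The functors \<open>\<Sigma>\<close> and \<open>\<Omega>\<close> send the class of \<open>f\<close> to the class of \<open>s\<close>, where \<open>s\<close> is the
  corresponding component of any morphism of approximation triangles that extends \<open>f\<close>.\<close>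

definition Sigma_functor ::
  "('o, 'm, 'z) acat_scheme \<Rightarrow> ('o, 'm, 'o, 'm) fctr \<Rightarrow> 'o set \<Rightarrow> ('o, 'm) apx \<Rightarrow>
    ('o, 'm set, 'o, 'm set) fctr" where
  "Sigma_functor C Us X L = \<lparr>
    fob = apx_ob L,
    far = (\<lambda>F. \<Union>{mod_class C X s | s. \<exists>A B P Q x. \<exists>f \<in> F.
      f \<in> hom C A B \<and> apx2 L A \<in> hom C A P \<and> apx2 L B \<in> hom C B Q \<and>
      x \<in> hom C P Q \<and> s \<in> hom C (apx_ob L A) (apx_ob L B) \<and>
      apx1 L B \<cdot>\<^bsub>C\<^esub> far Us s = f \<cdot>\<^bsub>C\<^esub> apx1 L A \<and>
      apx2 L B \<cdot>\<^bsub>C\<^esub> f = x \<cdot>\<^bsub>C\<^esub> apx2 L A \<and>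
      apx3 L B \<cdot>\<^bsub>C\<^esub> x = s \<cdot>\<^bsub>C\<^esub> apx3 L A})\<rparr>"

definition Omega_functor ::
  "('o, 'm, 'z) acat_scheme \<Rightarrow> ('o, 'm, 'o, 'm) fctr \<Rightarrow> 'o set \<Rightarrow> ('o, 'm) apx \<Rightarrow>
    ('o, 'm set, 'o, 'm set) fctr" where
  "Omega_functor C Sh X R = \<lparr>
    fob = apx_ob R,
    far = (\<lambda>F. \<Union>{mod_class C X s | s. \<exists>A B P Q x. \<exists>f \<in> F.
      f \<in> hom C A B \<and> apx2 R A \<in> hom C P A \<and> apx2 R B \<in> hom C Q B \<and>
      x \<in> hom C P Q \<and> s \<in> hom C (apx_ob R A) (apx_ob R B) \<and>
      apx1 R B \<cdot>\<^bsub>C\<^esub> s = x \<cdot>\<^bsub>C\<^esub> apx1 R A \<and>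
      apx2 R B \<cdot>\<^bsub>C\<^esub> x = f \<cdot>\<^bsub>C\<^esub> apx2 R A \<and>
      apx3 R B \<cdot>\<^bsub>C\<^esub> f = far Sh s \<cdot>\<^bsub>C\<^esub> apx3 R A})\<rparr>"

definition right_triangles ::
  "('o, 'm, 'z) acat_scheme \<Rightarrow> ('o, 'm, 'o, 'm) fctr \<Rightarrow> ('m \<times> 'm \<times> 'm) set \<Rightarrow> 'o set \<Rightarrow>
    ('o, 'm) apx \<Rightarrow> ('m set \<times> 'm set \<times> 'm set) set" where
  "right_triangles C Us \<Delta> X L = {t. \<exists>A B D f g h.
    f \<in> hom C A B \<and> g \<in> hom C B D \<and> h \<in> hom C D (apx_ob L A) \<and>
    (f \<cdot>\<^bsub>C\<^esub> apx1 L A, g, h) \<in> \<Delta> \<and>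
    triangle_iso (factor_cat C X) (Sigma_functor C Us X L)
      (mod_class C X f, mod_class C X g, mod_class C X h) t}"

definition left_triangle_shape ::
  "('o, 'm, 'z) acat_scheme \<Rightarrow> ('o, 'm, 'o, 'm) fctr \<Rightarrow> 'o \<Rightarrow> 'o \<Rightarrow> 'o \<Rightarrow> 'm \<Rightarrow> 'm \<Rightarrow> 'm \<Rightarrow> bool" where
  "left_triangle_shape C Om A B D f g h \<longleftrightarrow> f \<in> hom C (fob Om D) A \<and> g \<in> hom C A B \<and> h \<in> hom C B D"

definition left_triangle_iso ::
  "('o, 'm, 'z) acat_scheme \<Rightarrow> ('o, 'm, 'o, 'm) fctr \<Rightarrow> 'm \<times> 'm \<times> 'm \<Rightarrow> 'm \<times> 'm \<times> 'm \<Rightarrow> bool" where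
  "left_triangle_iso C Om t t' \<longleftrightarrow>
    (case t of (f, g, h) \<Rightarrow> case t' of (f', g', h') \<Rightarrow>
      \<exists>A B D A' B' D' a b d.
        left_triangle_shape C Om A B D f g h \<and> left_triangle_shape C Om A' B' D' f' g' h' \<and>
        is_iso C A A' a \<and> is_iso C B B' b \<and> is_iso C D D' d \<and>
        f' \<cdot>\<^bsub>C\<^esub> far Om d = a \<cdot>\<^bsub>C\<^esub> f \<and> g' \<cdot>\<^bsub>C\<^esub> a = b \<cdot>\<^bsub>C\<^esub> g \<and> h' \<cdot>\<^bsub>C\<^esub> b = d \<cdot>\<^bsub>C\<^esub> h)"

definition left_triangles ::
  "('o, 'm, 'z) acat_scheme \<Rightarrow> ('o, 'm, 'o, 'm) fctr \<Rightarrow> ('m \<times> 'm \<times> 'm) set \<Rightarrow> 'o set \<Rightarrow>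
    ('o, 'm) apx \<Rightarrow> ('m set \<times> 'm set \<times> 'm set) set" where
  "left_triangles C Sh \<Delta> X R = {t. \<exists>A B D f g h.
    f \<in> hom C (apx_ob R D) A \<and> g \<in> hom C A B \<and> h \<in> hom C B D \<and>
    (f, g, apx3 R D \<cdot>\<^bsub>C\<^esub> h) \<in> \<Delta> \<and>
    left_triangle_iso (factor_cat C X) (Omega_functor C Sh X R)
      (mod_class C X f, mod_class C X g, mod_class C X h) t}"

section \<open>Triangulated subcategories of factor categories\<close>

text \<open>The full subcategory of the factor category with object set \<open>Y\<close>. That the restricted
  structure is triangulated is spelled out completely: the right triangles with all objects in
  \<open>Y\<close> satisfy the axioms of a triangulated category with suspension \<open>\<Sigma>\<close> (in particular \<open>\<Sigma>\<close> is an
  equivalence on \<open>Y\<close>), and \<open>\<Omega>\<close> is an equivalence on \<open>Y\<close> as well.\<close>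

definition triangulated_subcategory ::
  "('o, 'm, 'z) acat_scheme \<Rightarrow> ('o, 'm, 'o, 'm) fctr \<Rightarrow> ('o, 'm, 'o, 'm) fctr \<Rightarrow>
    ('m \<times> 'm \<times> 'm) set \<Rightarrow> 'o set \<Rightarrow> ('o, 'm) apx \<Rightarrow> ('o, 'm) apx \<Rightarrow> 'o set \<Rightarrow> bool" where
  "triangulated_subcategory C Sh Us \<Delta> X L R Y \<longleftrightarrow>
    (let Q = factor_cat C X; QY = full_subcat Q Y;
         \<Sigma> = Sigma_functor C Us X L; \<Omega> = Omega_functor C Sh X R;
         RT = right_triangles C Us \<Delta> X L; LT = left_triangles C Sh \<Delta> X R
     in subcategory Q Y \<and>
        (\<forall>A \<in> Y. fob \<Sigma> A \<in> Y \<and> fob \<Omega> A \<in> Y) \<and>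
        (\<forall>A B D f g h. (f, g, h) \<in> RT \<and> triangle_shape Q \<Sigma> A B D f g h \<and>
          A \<in> Y \<and> B \<in> Y \<longrightarrow> D \<in> Y) \<and>
        (\<forall>A B D f g h. (f, g, h) \<in> LT \<and> left_triangle_shape Q \<Omega> A B D f g h \<and>
          B \<in> Y \<and> D \<in> Y \<longrightarrow> A \<in> Y) \<and>
        triangulated_category QY \<Sigma>
          {(f, g, h) \<in> RT. \<exists>A B D. triangle_shape QY \<Sigma> A B D f g h} \<and>
        is_equivalence QY QY \<Sigma> \<and> is_equivalence QY QY \<Omega>)"

text \<open>Maximality is with respect to inclusion among all triangulated subcategories; the whole
  factor category is not excluded.\<close>

definition maximal_triangulated_subcategory ::
  "('o, 'm, 'z) acat_scheme \<Rightarrow> ('o, 'm, 'o, 'm) fctr \<Rightarrow> ('o, 'm, 'o, 'm) fctr \<Rightarrow>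
    ('m \<times> 'm \<times> 'm) set \<Rightarrow> 'o set \<Rightarrow> ('o, 'm) apx \<Rightarrow> ('o, 'm) apx \<Rightarrow> 'o set \<Rightarrow> bool" where
  "maximal_triangulated_subcategory C Sh Us \<Delta> X L R Y \<longleftrightarrow>
    triangulated_subcategory C Sh Us \<Delta> X L R Y \<and>
    (\<forall>Y'. triangulated_subcategory C Sh Us \<Delta> X L R Y' \<and> Y \<subseteq> Y' \<longrightarrow> Y' = Y)"

end

theory Submission
  imports Defs
begin

text \<open>
  Let \<open>U\<close> be extension closed with \<open>\<S>(U) = U[2]\<close>. Serre duality shows that \<open>T(B, U[1]) = 0\<close> is equivalent
  to \<open>T(U, B[1]) = 0\<close>, so the heart \<open>X\<close> of \<open>U\<close> consists of the objects of \<open>U\<close> that are projective, and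
  equally of those that are injective, with respect to triangles with terms in \<open>U\<close>. Since Hom spaces
  are finite dimensional, approximations can be chosen minimal, and Wakamatsu's lemma for the
  \<open>U\<close>-approximations of \<open>A[-1]\<close> and \<open>A[1]\<close> gives \<open>U\<close> enough projectives and injectives. Hence \<open>U\<close>
  behaves like a Frobenius category and, as in Happel's theorem, \<open>U/X\<close> is triangulated: its triangles
  are those induced by the triangles \<open>A \<rightarrow> B \<rightarrow> D \<rightarrow> A[1]\<close> of \<open>T\<close> with terms in \<open>U\<close>, and an octahedron
  in \<open>U/X\<close> is one of \<open>T\<close> on morphisms whose cones lie in \<open>U\<close>.

  Conversely let \<open>X\<close> be rigid with \<open>\<S>(X) = X[2]\<close>. The third object of a triangle on a left or right
  \<open>X\<close>-approximation lies, suitably shifted, in \<open>\<Psi>(X)\<close>, and such triangles yield the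
  \<open>\<Psi>(X)\<close>-approximations. If \<open>A\<close> lies in the
  heart of \<open>\<Psi>(X)\<close>, the map from \<open>A\<close> to the cone of its right \<open>X\<close>-approximation vanishes, so \<open>A\<close> is a
  summand of an object of \<open>X\<close>. Both maximality statements are formal: \<open>U \<subseteq> \<Psi>\<Phi>(U)\<close>, and \<open>\<Omega>B\<close> lies in
  \<open>\<Psi>(X)\<close> for every \<open>B\<close>, while \<open>\<Omega>\<close> is dense on a triangulated subcategory.
\<close>

section \<open>Arrows in additive categories\<close>

text \<open>Two connecting maps link T with T/X: \<delta> from \<Sigma>A to A[1] and \<omega> from A
  to (\<Omega>A)[1]. For A and D in U, composing with \<delta> identifies T(D, \<Sigma>A) modulo X
  with T(D, A[1]), and \<omega> identifies T(\<Omega>A, D) modulo X with T(A, D[1]), because T(U,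
  X[1]) and T(X, U[1]) vanish. Equalities of residue classes thus become equations in T, and
  \<Sigma> and \<Omega> are mutually inverse on U/X. The obstacle is that cones of morphisms of U
  may leave U and that triangles modulo X are given only up to isomorphism. So the axioms are
  checked on model triangles, backward rotation follows from the five lemma, and one octahedron up
  to isomorphism for each composable pair suffices. Finite dimension enters as linear dependence:
  among the powers of an endomorphism it yields Fitting idempotents, and it bounds families of
  orthogonal idempotents, so discarding summands stops at a minimal approximation. The duality
  behind the heart: T(W, B[1]) is dual to T(B[1], \<S>W), and \<S>W is W'[2] with W' in U, which
  leaves T(B, W'[1]).\<close>

context category
begin

text \<open>Hom-sets are disjoint, so a morphism determines its ends. With \<open>arr\<close>,
  \<open>dm\<close> and \<open>cd\<close>, composability becomes a set of equations between objects,
  and no intermediate object has to be guessed when composites are rearranged.\<close>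

definition arr :: "'m \<Rightarrow> bool" where
  "arr f \<longleftrightarrow> (\<exists>A B. f \<in> hom C A B)"

definition dm :: "'m \<Rightarrow> 'o" where
  "dm f = (THE A. \<exists>B. f \<in> hom C A B)"

definition cd :: "'m \<Rightarrow> 'o" where
  "cd f = (THE B. \<exists>A. f \<in> hom C A B)"

lemma dm_eq: "f \<in> hom C A B \<Longrightarrow> dm f = A"
  unfolding dm_def by (rule the_equality) (auto dest: hom_disjoint)

lemma cd_eq: "f \<in> hom C A B \<Longrightarrow> cd f = B"
  unfolding cd_def by (rule the_equality) (auto dest: hom_disjoint)

lemma arr_in_hom: "arr f \<Longrightarrow> f \<in> hom C (dm f) (cd f)"
  by (auto simp: arr_def dm_eq cd_eq)

lemma hom_iff:
  "f \<in> hom C A B \<longleftrightarrow> arr f \<and> dm f = A \<and> cd f = B \<and> A \<in> ob C \<and> B \<in> ob C"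
  using arr_in_hom dm_eq cd_eq hom_ob by (metis arr_def)

lemma dm_ob [simp]: "arr f \<Longrightarrow> dm f \<in> ob C" and cd_ob [simp]: "arr f \<Longrightarrow> cd f \<in> ob C"
  using arr_in_hom hom_ob by blast+

lemma comp_arr [simp]:
  assumes "arr f" "arr g" "cd f = dm g"
  shows "arr (g \<cdot> f)" "dm (g \<cdot> f) = dm f" "cd (g \<cdot> f) = cd g"
  using comp_hom[of f "dm f" "cd f" g "cd g"] assms arr_in_hom by (auto simp: hom_iff)

lemma idm_arr [simp]:
  assumes "A \<in> ob C"
  shows "arr (idm C A)" "dm (idm C A) = A" "cd (idm C A) = A"
  using idm_hom[OF assms] by (auto simp: hom_iff)

lemma comp_idm_arr [simp]: "arr f \<Longrightarrow> dm f = A \<Longrightarrow> f \<cdot> idm C A = f"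
  using arr_in_hom comp_idm by blast

lemma idm_comp_arr [simp]: "arr f \<Longrightarrow> cd f = A \<Longrightarrow> idm C A \<cdot> f = f"
  using arr_in_hom idm_comp by blast

lemma comp_assoc_arr [simp]:
  "arr f \<Longrightarrow> arr g \<Longrightarrow> arr h \<Longrightarrow> cd f = dm g \<Longrightarrow> cd g = dm h \<Longrightarrow> (h \<cdot> g) \<cdot> f = h \<cdot> (g \<cdot> f)"
  by (metis arr_in_hom comp_assoc)

text \<open>Since \<open>comp_assoc_arr\<close> associates composites to the right, an equation between composites
  is also needed in this form to be usable inside longer composites.\<close>

lemma comp_extend1:
  assumes "k \<cdot> l = m" "k \<in> hom C B D" "l \<in> hom C A B" "w \<in> hom C W A"
  shows "k \<cdot> (l \<cdot> w) = m \<cdot> w"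
  using comp_assoc[OF assms(4,3,2)] assms(1) by simp

lemma comp_extend:
  assumes "k \<cdot> l = k' \<cdot> l'" "k \<in> hom C B D" "l \<in> hom C A B" "k' \<in> hom C B' D" "l' \<in> hom C A B'"
    "w \<in> hom C W A"
  shows "k \<cdot> (l \<cdot> w) = k' \<cdot> (l' \<cdot> w)"
  using comp_assoc[OF assms(6,3,2)] comp_assoc[OF assms(6,5,4)] assms(1) by simp

lemma comp_extend1_arr:
  assumes "k \<cdot> l = m" "k \<in> hom C B D" "l \<in> hom C A B" "arr w" "cd w = A"
  shows "k \<cdot> (l \<cdot> w) = m \<cdot> w"
  using comp_extend1[OF assms(1-3), of w] assms(4,5) arr_in_hom by blast

lemma comp_extend_arr:
  assumes "k \<cdot> l = k' \<cdot> l'" "k \<in> hom C B D" "l \<in> hom C A B" "k' \<in> hom C B' D" "l' \<in> hom C A B'"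
    "arr w" "cd w = A"
  shows "k \<cdot> (l \<cdot> w) = k' \<cdot> (l' \<cdot> w)"
  using comp_extend[OF assms(1-5), of w] assms(6,7) arr_in_hom by blast

lemma is_isoI:
  "f \<in> hom C A B \<Longrightarrow> g \<in> hom C B A \<Longrightarrow> g \<cdot> f = idm C A \<Longrightarrow> f \<cdot> g = idm C B \<Longrightarrow> is_iso C A B f"
  unfolding is_iso_def by blast

lemma is_isoE:
  assumes "is_iso C A B f"
  obtains g where "f \<in> hom C A B" "g \<in> hom C B A" "g \<cdot> f = idm C A" "f \<cdot> g = idm C B"
    "is_iso C B A g"
  using assms unfolding is_iso_def by blast

lemma is_iso_hom: "is_iso C A B f \<Longrightarrow> f \<in> hom C A B"
  unfolding is_iso_def by blast

lemma is_iso_idm: "A \<in> ob C \<Longrightarrow> is_iso C A A (idm C A)"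
  by (rule is_isoI[of _ _ _ "idm C A"]) (simp_all add: hom_iff)

lemma is_iso_comp:
  assumes "is_iso C A B f" "is_iso C B D g"
  shows "is_iso C A D (g \<cdot> f)"
proof -
  obtain f' where f: "f \<in> hom C A B" "f' \<in> hom C B A" "f' \<cdot> f = idm C A" "f \<cdot> f' = idm C B"
    using assms(1) by (rule is_isoE)
  obtain g' where g: "g \<in> hom C B D" "g' \<in> hom C D B" "g' \<cdot> g = idm C B" "g \<cdot> g' = idm C D"
    using assms(2) by (rule is_isoE)
  have 1: "g' \<cdot> (g \<cdot> f) = f"
    using comp_extend1[OF g(3,2,1) f(1)] f g by (simp add: hom_iff)
  have 2: "f \<cdot> (f' \<cdot> g') = g'"
    using comp_extend1[OF f(4,1,2) g(2)] f g by (simp add: hom_iff)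
  show ?thesis
    by (rule is_isoI[of _ _ _ "f' \<cdot> g'"]) (use f g 1 2 in \<open>simp_all add: hom_iff\<close>)
qed

text \<open>The two one-sided inverses coincide, since
  \<open>g = g \<cdot> (f \<cdot> h) = h\<close>. In \<open>tri_five\<close> and
  \<open>fitting\<close> they are found by separate arguments.\<close>

lemma is_iso_of_inverses:
  assumes "f \<in> hom C A B" "g \<in> hom C B A" "h \<in> hom C B A" "g \<cdot> f = idm C A" "f \<cdot> h = idm C B"
  shows "is_iso C A B f"
proof -
  have "g = g \<cdot> (f \<cdot> h)" using assms(2,5) by (simp add: hom_iff)
  also have "\<dots> = h" using comp_extend1[OF assms(4,2,1,3)] assms(3) by (simp add: hom_iff)
  finally show ?thesis using assms by (auto intro: is_isoI)
qed

lemma isomorphic_refl: "A \<in> ob C \<Longrightarrow> isomorphic C A A"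
  unfolding isomorphic_def using is_iso_idm by blast

lemma isomorphic_sym: "isomorphic C A B \<Longrightarrow> isomorphic C B A"
  unfolding isomorphic_def by (metis is_isoE)

lemma isomorphic_trans: "isomorphic C A B \<Longrightarrow> isomorphic C B D \<Longrightarrow> isomorphic C A D"
  unfolding isomorphic_def using is_iso_comp by blast

lemma isomorphic_ob: "isomorphic C A B \<Longrightarrow> A \<in> ob C \<and> B \<in> ob C"
  unfolding isomorphic_def using is_iso_hom hom_ob by blast

end

section \<open>Functors and equivalences of categories\<close>

lemma functor_ob: "is_functor C D F \<Longrightarrow> A \<in> ob C \<Longrightarrow> fob F A \<in> ob D"
  and functor_hom: "is_functor C D F \<Longrightarrow> f \<in> hom C A B \<Longrightarrow> far F f \<in> hom D (fob F A) (fob F B)"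
  and functor_idm: "is_functor C D F \<Longrightarrow> A \<in> ob C \<Longrightarrow> far F (idm C A) = idm D (fob F A)"
  and functor_comp: "is_functor C D F \<Longrightarrow> f \<in> hom C A B \<Longrightarrow> g \<in> hom C B E \<Longrightarrow>
    far F (g \<cdot>\<^bsub>C\<^esub> f) = far F g \<cdot>\<^bsub>D\<^esub> far F f"
  unfolding is_functor_def by blast+

context category
begin

lemma functor_is_iso:
  assumes "is_functor C D F" "is_iso C A B f"
  shows "is_iso D (fob F A) (fob F B) (far F f)"
proof -
  obtain g where g: "f \<in> hom C A B" "g \<in> hom C B A" "g \<cdot> f = idm C A" "f \<cdot> g = idm C B"
    using assms(2) by (rule is_isoE)
  note F = functor_hom[OF assms(1)] functor_comp[OF assms(1), symmetric] functor_idm[OF assms(1)]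
  show ?thesis
    unfolding is_iso_def using g F(1)[OF g(1)] F(1)[OF g(2)] F(2)[OF g(1,2)] F(2)[OF g(2,1)]
      F(3)[of A] F(3)[of B] hom_ob[OF g(1)] by auto
qed

lemma functor_isomorphic:
  "is_functor C D F \<Longrightarrow> isomorphic C A B \<Longrightarrow> isomorphic D (fob F A) (fob F B)"
  unfolding isomorphic_def using functor_is_iso by blast

text \<open>Naturality writes \<open>f \<cdot> \<tau> A\<close> in terms of \<open>far F f\<close>
  alone, and \<open>\<tau> A\<close> can be cancelled. Only one natural isomorphism is involved, so
  the lemma applies equally to the quasi-inverse in \<open>equivalence_full\<close>.\<close>

lemma faithful_of_nat_iso:
  assumes F: "is_functor C D F" and \<tau>: "nat_iso C C (functor_comp G F) functor_id \<tau>"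
    and f: "f \<in> hom C A B" and g: "g \<in> hom C A B" and eq: "far F f = far F g"
  shows "f = g"
proof -
  have "A \<in> ob C" using f hom_ob by blast
  then have "is_iso C (fob G (fob F A)) A (\<tau> A)"
    using \<tau> unfolding nat_iso_def by (simp add: functor_comp_def functor_id_def)
  then obtain t where t: "\<tau> A \<in> hom C (fob G (fob F A)) A" "t \<in> hom C A (fob G (fob F A))"
      "t \<cdot> \<tau> A = idm C (fob G (fob F A))" "\<tau> A \<cdot> t = idm C A"
    by (rule is_isoE)
  have "f \<cdot> \<tau> A = \<tau> B \<cdot> far G (far F f)" "g \<cdot> \<tau> A = \<tau> B \<cdot> far G (far F g)"
    using \<tau> f g unfolding nat_iso_def by (simp_all add: functor_comp_def functor_id_def)
  then have "f \<cdot> \<tau> A = g \<cdot> \<tau> A" using eq by simp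
  then have "f \<cdot> (\<tau> A \<cdot> t) = g \<cdot> (\<tau> A \<cdot> t)"
    using comp_assoc[OF t(2) t(1) f] comp_assoc[OF t(2) t(1) g] by simp
  then show ?thesis using t f g by (simp add: hom_iff)
qed

lemma equivalence_faithful:
  assumes "is_equivalence C C F" "f \<in> hom C A B" "g \<in> hom C A B" "far F f = far F g"
  shows "f = g"
  using assms faithful_of_nat_iso unfolding is_equivalence_def by metis

lemma equivalence_full:
  assumes F: "is_equivalence C C F" and A: "A \<in> ob C" and B: "B \<in> ob C"
    and f: "f \<in> hom C (fob F A) (fob F B)"
  obtains g where "g \<in> hom C A B" "far F g = f"
proof -
  obtain G \<tau> \<sigma> where F1: "is_functor C C F" and G: "is_functor C C G"
    and \<tau>: "nat_iso C C (functor_comp G F) functor_id \<tau>"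
    and \<sigma>: "nat_iso C C (functor_comp F G) functor_id \<sigma>"
    using F unfolding is_equivalence_def by blast
  have "is_iso C (fob G (fob F A)) A (\<tau> A)" "is_iso C (fob G (fob F B)) B (\<tau> B)"
    using \<tau> A B unfolding nat_iso_def by (simp_all add: functor_comp_def functor_id_def)
  then obtain a b where a: "\<tau> A \<in> hom C (fob G (fob F A)) A" "a \<in> hom C A (fob G (fob F A))"
      "a \<cdot> \<tau> A = idm C (fob G (fob F A))"
    and b: "\<tau> B \<in> hom C (fob G (fob F B)) B" "b \<in> hom C B (fob G (fob F B))"
      "b \<cdot> \<tau> B = idm C (fob G (fob F B))"
    by (metis is_isoE)
  \<comment> \<open>Conjugating \<open>far G f\<close> by the natural isomorphism gives
    \<open>far G (far F g) = far G f\<close>; faithfulness of G, read off from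
    \<open>\<sigma>\<close>, then removes G.\<close>
  define g where "g = \<tau> B \<cdot> (far G f \<cdot> a)"
  have Gf: "far G f \<in> hom C (fob G (fob F A)) (fob G (fob F B))" using functor_hom[OF G f] .
  have g: "g \<in> hom C A B" unfolding g_def using a b Gf by (simp add: hom_iff)
  have Fg: "far F g \<in> hom C (fob F A) (fob F B)" using functor_hom[OF F1 g] .
  have GFg: "far G (far F g) \<in> hom C (fob G (fob F A)) (fob G (fob F B))"
    using functor_hom[OF G Fg] .
  have "g \<cdot> \<tau> A = \<tau> B \<cdot> far G (far F g)"
    using \<tau> g unfolding nat_iso_def by (simp add: functor_comp_def functor_id_def)
  moreover have "g \<cdot> \<tau> A = \<tau> B \<cdot> far G f"
    unfolding g_def using a b Gf by (simp add: hom_iff)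
  ultimately have "b \<cdot> (\<tau> B \<cdot> far G (far F g)) = b \<cdot> (\<tau> B \<cdot> far G f)" by simp
  then have "far G (far F g) = far G f"
    using comp_extend1[OF b(3,2,1) GFg] comp_extend1[OF b(3,2,1) Gf] GFg Gf by (simp add: hom_iff)
  then have "far F g = f" using faithful_of_nat_iso[OF G \<sigma> Fg f] by simp
  with g that show thesis by blast
qed

lemma equivalence_dense:
  assumes "is_equivalence C C F" "B \<in> ob C"
  obtains A where "A \<in> ob C" "isomorphic C (fob F A) B"
proof -
  obtain G \<sigma> where G: "is_functor C C G" and \<sigma>: "nat_iso C C (functor_comp F G) functor_id \<sigma>"
    using assms unfolding is_equivalence_def by blast
  have "is_iso C (fob F (fob G B)) B (\<sigma> B)"
    using \<sigma> assms(2) unfolding nat_iso_def by (simp add: functor_comp_def functor_id_def)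
  then show thesis using that[of "fob G B"] functor_ob[OF G assms(2)] unfolding isomorphic_def by blast
qed

lemma equivalence_functor: "is_equivalence C D F \<Longrightarrow> is_functor C D F"
  unfolding is_equivalence_def by blast

lemma equivalence_reflects_iso:
  assumes F: "is_equivalence C C F" and f: "f \<in> hom C A B"
    and iso: "is_iso C (fob F A) (fob F B) (far F f)"
  shows "is_iso C A B f"
proof -
  note F1 = equivalence_functor[OF F]
  obtain h where h: "h \<in> hom C (fob F B) (fob F A)" "h \<cdot> far F f = idm C (fob F A)"
      "far F f \<cdot> h = idm C (fob F B)"
    using iso by (metis is_isoE)
  have A: "A \<in> ob C" and B: "B \<in> ob C" using f hom_ob by blast+
  obtain g where g: "g \<in> hom C B A" "far F g = h" using equivalence_full[OF F B A h(1)] .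
  have "far F (g \<cdot> f) = far F (idm C A)" "far F (f \<cdot> g) = far F (idm C B)"
    using functor_comp[OF F1 f g(1)] functor_comp[OF F1 g(1) f] h g functor_idm[OF F1] A B by auto
  then have "g \<cdot> f = idm C A" "f \<cdot> g = idm C B"
    using equivalence_faithful[OF F] comp_hom f g(1) idm_hom A B by blast+
  then show ?thesis using f g(1) by (auto intro: is_isoI)
qed

lemma equivalence_reflects_isomorphic:
  assumes "is_equivalence C C F" "A \<in> ob C" "B \<in> ob C" "isomorphic C (fob F A) (fob F B)"
  shows "isomorphic C A B"
proof -
  obtain f where f: "is_iso C (fob F A) (fob F B) f" using assms(4) unfolding isomorphic_def by blast
  obtain g where "g \<in> hom C A B" "far F g = f"
    using equivalence_full[OF assms(1-3) is_iso_hom[OF f]] .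
  then show ?thesis
    using equivalence_reflects_iso[OF assms(1), of g A B] f unfolding isomorphic_def by blast
qed

end

section \<open>Sums, zero morphisms and biproducts\<close>

context preadditive_category
begin

lemma zero_arr [simp]:
  assumes "A \<in> ob C" "B \<in> ob C"
  shows "arr (zero C A B)" "dm (zero C A B) = A" "cd (zero C A B) = B"
  using zero_hom[OF assms] by (auto simp: hom_iff)

lemma add_arr [simp]:
  assumes "arr f" "arr g" "dm f = dm g" "cd f = cd g"
  shows "arr (f \<oplus> g)" "dm (f \<oplus> g) = dm g" "cd (f \<oplus> g) = cd g"
  using add_hom[of f "dm f" "cd f" g] assms by (auto simp: hom_iff)

lemma neg_arr [simp]:
  assumes "arr f"
  shows "arr (\<ominus> f)" "dm (\<ominus> f) = dm f" "cd (\<ominus> f) = cd f"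
  using neg_hom[OF arr_in_hom[OF assms]] by (auto simp: hom_iff)

lemma add_zero_arr [simp]: "arr f \<Longrightarrow> dm f = A \<Longrightarrow> cd f = B \<Longrightarrow> f \<oplus> zero C A B = f"
  using add_zero arr_in_hom by blast

lemma add_neg_arr [simp]: "arr f \<Longrightarrow> f \<oplus> \<ominus> f = zero C (dm f) (cd f)"
  using add_neg arr_in_hom by blast

lemma add_assoc_arr:
  "arr f \<Longrightarrow> arr g \<Longrightarrow> arr h \<Longrightarrow> dm f = dm g \<Longrightarrow> cd f = cd g \<Longrightarrow> dm g = dm h \<Longrightarrow> cd g = cd h \<Longrightarrow>
    (f \<oplus> g) \<oplus> h = f \<oplus> (g \<oplus> h)"
  by (metis arr_in_hom add_assoc)

lemma add_commute_arr: "arr f \<Longrightarrow> arr g \<Longrightarrow> dm f = dm g \<Longrightarrow> cd f = cd g \<Longrightarrow> f \<oplus> g = g \<oplus> f"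
  by (metis arr_in_hom add_commute)

lemma add_left_commute_arr:
  "arr f \<Longrightarrow> arr g \<Longrightarrow> arr h \<Longrightarrow> dm f = dm g \<Longrightarrow> cd f = cd g \<Longrightarrow> dm g = dm h \<Longrightarrow> cd g = cd h \<Longrightarrow>
    f \<oplus> (g \<oplus> h) = g \<oplus> (f \<oplus> h)"
  by (metis add_assoc_arr add_commute_arr)

lemmas add_ac_arr = add_assoc_arr add_commute_arr add_left_commute_arr

lemma zero_add_arr [simp]: "arr f \<Longrightarrow> dm f = A \<Longrightarrow> cd f = B \<Longrightarrow> zero C A B \<oplus> f = f"
  by (metis add_commute_arr add_zero_arr zero_arr dm_ob cd_ob)

lemma neg_add_arr [simp]: "arr f \<Longrightarrow> \<ominus> f \<oplus> f = zero C (dm f) (cd f)"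
  by (metis add_commute_arr add_neg_arr neg_arr)

lemma add_neg_cancel [simp]:
  "arr f \<Longrightarrow> arr g \<Longrightarrow> dm f = dm g \<Longrightarrow> cd f = cd g \<Longrightarrow> f \<oplus> (\<ominus> f \<oplus> g) = g"
  "arr f \<Longrightarrow> arr g \<Longrightarrow> dm f = dm g \<Longrightarrow> cd f = cd g \<Longrightarrow> \<ominus> f \<oplus> (f \<oplus> g) = g"
  using add_assoc_arr[of f "\<ominus> f" g] add_assoc_arr[of "\<ominus> f" f g] by simp_all

lemma add_left_imp_eq:
  "arr f \<Longrightarrow> arr g \<Longrightarrow> arr h \<Longrightarrow> dm f = dm g \<Longrightarrow> cd f = cd g \<Longrightarrow> dm f = dm h \<Longrightarrow> cd f = cd h \<Longrightarrow>
    f \<oplus> g = f \<oplus> h \<Longrightarrow> g = h"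
  by (metis add_neg_cancel(2))

lemma neg_unique: "arr f \<Longrightarrow> arr g \<Longrightarrow> dm f = dm g \<Longrightarrow> cd f = cd g \<Longrightarrow>
    f \<oplus> g = zero C (dm f) (cd f) \<Longrightarrow> g = \<ominus> f"
  by (metis add_left_imp_eq add_neg_arr neg_arr)

lemma neg_neg_arr [simp]: "arr f \<Longrightarrow> \<ominus> (\<ominus> f) = f"
  by (rule neg_unique[symmetric]) simp_all

lemma neg_zero [simp]: "A \<in> ob C \<Longrightarrow> B \<in> ob C \<Longrightarrow> \<ominus> (zero C A B) = zero C A B"
  by (rule neg_unique[symmetric]) simp_all

lemma neg_add_distrib [simp]:
  assumes "arr f" "arr g" "dm f = dm g" "cd f = cd g"
  shows "\<ominus> (f \<oplus> g) = \<ominus> f \<oplus> \<ominus> g"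
proof -
  have 1: "(f \<oplus> g) \<oplus> (\<ominus> f \<oplus> \<ominus> g) = (g \<oplus> f) \<oplus> (\<ominus> f \<oplus> \<ominus> g)"
    by (simp only: add_commute_arr[OF assms])
  have 2: "\<dots> = g \<oplus> (f \<oplus> (\<ominus> f \<oplus> \<ominus> g))"
     by (rule add_assoc_arr) (simp_all add: assms)
  have 3: "\<dots> = g \<oplus> \<ominus> g"
     by (simp add: assms)
  have 4: "(f \<oplus> g) \<oplus> (\<ominus> f \<oplus> \<ominus> g) = zero C (dm (f \<oplus> g)) (cd (f \<oplus> g))"
   unfolding 1 2 3 by (simp add: assms)
  show ?thesis by (rule neg_unique[symmetric, OF _ _ _ _ 4]) (simp_all add: assms)
qed

lemma neg_inject: "\<ominus> f = \<ominus> g \<Longrightarrow> arr f \<Longrightarrow> arr g \<Longrightarrow> f = g"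
  by (metis neg_neg_arr)

lemma diff_eq_zero_iff:
  "f \<in> hom C A B \<Longrightarrow> g \<in> hom C A B \<Longrightarrow> f \<oplus> \<ominus> g = zero C A B \<longleftrightarrow> f = g"
  by (metis add_commute_arr add_neg hom_iff neg_arr neg_neg_arr neg_unique)

lemma comp_zero_right [simp]:
  assumes "arr g" "A \<in> ob C" "dm g = B" "cd g = D"
  shows "g \<cdot> zero C A B = zero C A D"
proof -
  let ?z = "g \<cdot> zero C A B"
  have B: "B \<in> ob C" and D: "D \<in> ob C" using assms by auto
  have "?z = g \<cdot> (zero C A B \<oplus> zero C A B)" using assms B by simp
  also have "\<dots> = ?z \<oplus> ?z"
    by (rule comp_add_right[of _ A B _ _ D]) (use assms B D in \<open>auto simp: hom_iff\<close>)
  finally have "?z \<oplus> zero C A D = ?z \<oplus> ?z" using assms B D by simp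
  then show ?thesis using add_left_imp_eq[of ?z "zero C A D" ?z] assms B D by simp
qed

lemma comp_zero_left [simp]:
  assumes "arr f" "D \<in> ob C" "cd f = B" "dm f = A"
  shows "zero C B D \<cdot> f = zero C A D"
proof -
  let ?z = "zero C B D \<cdot> f"
  have B: "B \<in> ob C" and A: "A \<in> ob C" using assms by auto
  have "?z = (zero C B D \<oplus> zero C B D) \<cdot> f" using assms B by simp
  also have "\<dots> = ?z \<oplus> ?z"
    by (rule comp_add_left[of _ A B _ D]) (use assms A B in \<open>auto simp: hom_iff\<close>)
  finally have "?z \<oplus> zero C A D = ?z \<oplus> ?z" using assms A B by simp
  then show ?thesis using add_left_imp_eq[of ?z "zero C A D" ?z] assms A B by simp
qed

lemma comp_add_left_arr:
  "arr f \<Longrightarrow> arr g \<Longrightarrow> arr g' \<Longrightarrow> cd f = dm g \<Longrightarrow> dm g = dm g' \<Longrightarrow> cd g = cd g' \<Longrightarrow>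
    (g \<oplus> g') \<cdot> f = (g \<cdot> f) \<oplus> (g' \<cdot> f)"
  by (metis arr_in_hom comp_add_left)

lemma comp_add_right_arr:
  "arr f \<Longrightarrow> arr f' \<Longrightarrow> arr g \<Longrightarrow> cd f = dm g \<Longrightarrow> dm f = dm f' \<Longrightarrow> cd f = cd f' \<Longrightarrow>
    g \<cdot> (f \<oplus> f') = (g \<cdot> f) \<oplus> (g \<cdot> f')"
  by (metis arr_in_hom comp_add_right)

lemma comp_neg_left [simp]:
  assumes "arr f" "arr g" "cd f = dm g"
  shows "\<ominus> g \<cdot> f = \<ominus> (g \<cdot> f)"
  by (rule neg_unique) (use assms in \<open>simp_all add: comp_add_left_arr[symmetric]\<close>)

lemma comp_neg_right [simp]:
  assumes "arr f" "arr g" "cd f = dm g"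
  shows "g \<cdot> \<ominus> f = \<ominus> (g \<cdot> f)"
  by (rule neg_unique) (use assms in \<open>simp_all add: comp_add_right_arr[symmetric]\<close>)

lemmas distrib_arr = comp_add_left_arr comp_add_right_arr

lemma additive_functor_zero:
  assumes F: "is_additive_functor C C F" and ob: "A \<in> ob C" "B \<in> ob C"
  shows "far F (zero C A B) = zero C (fob F A) (fob F B)"
proof -
  let ?z = "far F (zero C A B)"
  have F': "is_functor C C F" using F unfolding is_additive_functor_def by blast
  have z: "?z \<in> hom C (fob F A) (fob F B)" using functor_hom[OF F' zero_hom[OF ob]] .
  have "far F (zero C A B \<oplus> zero C A B) = ?z \<oplus> ?z"
    using F zero_hom[OF ob] unfolding is_additive_functor_def by blast
  then have "?z \<oplus> zero C (fob F A) (fob F B) = ?z \<oplus> ?z" using z ob by (simp add: hom_iff)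
  then show ?thesis using add_left_imp_eq[of ?z "zero C (fob F A) (fob F B)" ?z] z by (simp add: hom_iff)
qed

lemma additive_functor_neg:
  assumes F: "is_additive_functor C C F" and f: "f \<in> hom C A B"
  shows "far F (\<ominus> f) = \<ominus> (far F f)"
proof -
  have F': "is_functor C C F" using F unfolding is_additive_functor_def by blast
  have n: "\<ominus> f \<in> hom C A B" using f neg_hom by blast
  have ob: "A \<in> ob C" "B \<in> ob C" using f by (auto simp: hom_iff)
  have "far F (f \<oplus> \<ominus> f) = far F f \<oplus> far F (\<ominus> f)"
    using F f n unfolding is_additive_functor_def by blast
  then have "far F f \<oplus> far F (\<ominus> f) = zero C (fob F A) (fob F B)"
    using f additive_functor_zero[OF F ob] by (simp add: hom_iff)
  then show ?thesis
    using functor_hom[OF F' f] functor_hom[OF F' n] by (intro neg_unique) (simp_all add: hom_iff)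
qed

lemma zero_object_hom_from: "zero_object C Z \<Longrightarrow> f \<in> hom C Z A \<Longrightarrow> f = zero C Z A"
  unfolding zero_object_def by (metis comp_zero_right comp_idm_arr hom_iff)

lemma zero_objects_iso:
  "zero_object C Z \<Longrightarrow> zero_object C Z' \<Longrightarrow> is_iso C Z Z' (zero C Z Z')"
  by (rule is_isoI[of _ _ _ "zero C Z' Z"]) (auto simp: zero_object_def hom_iff)

lemma is_iso_neg:
  assumes "is_iso C A B f"
  shows "is_iso C A B (\<ominus> f)"
proof -
  obtain g where "f \<in> hom C A B" "g \<in> hom C B A" "g \<cdot> f = idm C A" "f \<cdot> g = idm C B"
    using assms by (rule is_isoE)
  then show ?thesis by (intro is_isoI[of _ _ _ "\<ominus> g"]) (simp_all add: hom_iff)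
qed

lemma biproducts_isomorphic:
  assumes 1: "biproduct C A B P i j p q" and 2: "biproduct C A B P' i' j' p' q'"
  shows "isomorphic C P P'"
proof -
  note b = 1[unfolded biproduct_def] and b' = 2[unfolded biproduct_def]
  have h: "i \<in> hom C A P" "j \<in> hom C B P" "p \<in> hom C P A" "q \<in> hom C P B"
    "p \<cdot> i = idm C A" "q \<cdot> j = idm C B" "p \<cdot> j = zero C B A" "q \<cdot> i = zero C A B" using b by blast+
  have h': "i' \<in> hom C A P'" "j' \<in> hom C B P'" "p' \<in> hom C P' A" "q' \<in> hom C P' B"
    "p' \<cdot> i' = idm C A" "q' \<cdot> j' = idm C B" "p' \<cdot> j' = zero C B A" "q' \<cdot> i' = zero C A B"
    using b' by blast+
  note x = comp_extend1_arr[OF h(5,3,1)] comp_extend1_arr[OF h(6,4,2)]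
    comp_extend1_arr[OF h(7,3,2)] comp_extend1_arr[OF h(8,4,1)]
    comp_extend1_arr[OF h'(5,3,1)] comp_extend1_arr[OF h'(6,4,2)]
    comp_extend1_arr[OF h'(7,3,2)] comp_extend1_arr[OF h'(8,4,1)]
  have "is_iso C P P' ((i' \<cdot> p) \<oplus> (j' \<cdot> q))"
    by (rule is_isoI[of _ _ _ "(i \<cdot> p') \<oplus> (j \<cdot> q')"])
      (use h h' x b b' in \<open>simp_all add: hom_iff distrib_arr\<close>)
  then show ?thesis unfolding isomorphic_def by blast
qed

text \<open>The complement of A in P is obtained by splitting the idempotent
  \<open>idm C P \<oplus> \<ominus> (s \<cdot> r)\<close>. In this way closure under direct summands
  becomes closure under retracts, the form in which it is used later.\<close>

lemma biproduct_of_retract: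
  assumes sp: "idempotents_split C" and s: "s \<in> hom C A P" and r: "r \<in> hom C P A"
    and rs: "r \<cdot> s = idm C A"
  obtains B j q where "biproduct C A B P s j r q"
proof -
  have ob: "A \<in> ob C" "P \<in> ob C" using s by (auto simp: hom_iff)
  define e where "e = idm C P \<oplus> \<ominus> (s \<cdot> r)"
  have e: "e \<in> hom C P P" unfolding e_def using s r ob by (simp add: hom_iff)
  have rs': "r \<cdot> (s \<cdot> r) = r" using comp_extend1[OF rs r s r] r by (simp add: hom_iff)
  have srs: "s \<cdot> (r \<cdot> s) = s" using rs s by (simp add: hom_iff)
  have re: "r \<cdot> e = zero C P A" "e \<cdot> s = zero C A P" unfolding e_def
    using s r ob rs' srs by (simp_all add: hom_iff distrib_arr)
  have "e \<cdot> e = e \<oplus> \<ominus> (s \<cdot> (r \<cdot> e))" using s r ob e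
    by (subst (1) e_def) (simp add: hom_iff distrib_arr)
  then have "e \<cdot> e = e" using re s e ob by (simp add: hom_iff)
  then obtain B q j where q: "q \<in> hom C P B" "j \<in> hom C B P" "j \<cdot> q = e" "q \<cdot> j = idm C B"
    using sp e unfolding idempotents_split_def by metis
  have qj: "q \<cdot> (j \<cdot> q) = q" "j \<cdot> (q \<cdot> j) = j"
    using comp_extend1[OF q(4,1,2,1)] q by (simp_all add: hom_iff)
  have "r \<cdot> j = (r \<cdot> e) \<cdot> j" using q qj r e by (simp add: hom_iff flip: q(3))
  then have 1: "r \<cdot> j = zero C B A" using re q ob by (simp add: hom_iff)
  have "q \<cdot> s = q \<cdot> (e \<cdot> s)"
    using q s comp_extend1_arr[OF q(4,1,2), of "q \<cdot> s"] by (simp add: hom_iff flip: q(3))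
  then have 2: "q \<cdot> s = zero C A B" using re q ob by (simp add: hom_iff)
  have "(s \<cdot> r) \<oplus> (j \<cdot> q) = idm C P"
    unfolding q(3) e_def using s r ob by (simp add: hom_iff add_ac_arr)
  then show thesis using that[of B j q] s r q rs 1 2 unfolding biproduct_def by simp
qed

end

section \<open>Weak triangulated categories\<close>

text \<open>Compared with \<open>triangulated_category\<close>, the octahedral axiom is missing and the rotation axiom is
  assumed in the forward direction only.\<close>

locale weak_triangulated_category = additive_category C
  for C :: "('o, 'm, 'z) acat_scheme" (structure) +
  fixes S :: "('o, 'm, 'o, 'm) fctr"
    and \<Delta> :: "('m \<times> 'm \<times> 'm) set"
  assumes S_additive: "is_additive_functor C C S"
    and S_equivalence: "is_equivalence C C S"
    and tri_has_shape: "(f, g, h) \<in> \<Delta> \<Longrightarrow> \<exists>A B D. triangle_shape C S A B D f g h"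
    and tri_closed_iso: "t \<in> \<Delta> \<Longrightarrow> triangle_iso C S t t' \<Longrightarrow> t' \<in> \<Delta>"
    and tri_of_idm: "A \<in> ob C \<Longrightarrow> zero_object C Z \<Longrightarrow>
      (idm C A, zero C A Z, zero C Z (fob S A)) \<in> \<Delta>"
    and tri_completion: "f \<in> hom C A B \<Longrightarrow> \<exists>g h. (f, g, h) \<in> \<Delta>"
    and tri_rotate_forward: "triangle_shape C S A B D f g h \<Longrightarrow>
      (f, g, h) \<in> \<Delta> \<Longrightarrow> (g, h, \<ominus> far S f) \<in> \<Delta>"
    and tri_extend: "(f, g, h) \<in> \<Delta> \<Longrightarrow> (f', g', h') \<in> \<Delta> \<Longrightarrow>
      triangle_shape C S A B D f g h \<Longrightarrow> triangle_shape C S A' B' D' f' g' h' \<Longrightarrow>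
      a \<in> hom C A A' \<Longrightarrow> b \<in> hom C B B' \<Longrightarrow> f' \<cdot> a = b \<cdot> f \<Longrightarrow>
      \<exists>d \<in> hom C D D'. g' \<cdot> b = d \<cdot> g \<and> h' \<cdot> d = far S a \<cdot> h"
begin

lemma S_functor: "is_functor C C S"
  using S_additive unfolding is_additive_functor_def by blast

lemma S_ob [simp]: "A \<in> ob C \<Longrightarrow> fob S A \<in> ob C"
  using functor_ob[OF S_functor] .

lemma S_arr [simp]:
  assumes "arr f"
  shows "arr (far S f)" "dm (far S f) = fob S (dm f)" "cd (far S f) = fob S (cd f)"
  using functor_hom[OF S_functor arr_in_hom[OF assms]] by (auto simp: hom_iff)

lemma S_comp [simp]:
  "arr f \<Longrightarrow> arr g \<Longrightarrow> cd f = dm g \<Longrightarrow> far S (g \<cdot> f) = far S g \<cdot> far S f"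
  using functor_comp[OF S_functor, of f "dm f" "cd f" g "cd g"] arr_in_hom by metis

lemma S_idm [simp]: "A \<in> ob C \<Longrightarrow> far S (idm C A) = idm C (fob S A)"
  using functor_idm[OF S_functor] .

lemma S_zero [simp]: "A \<in> ob C \<Longrightarrow> B \<in> ob C \<Longrightarrow> far S (zero C A B) = zero C (fob S A) (fob S B)"
  using additive_functor_zero[OF S_additive] .

lemma S_neg [simp]: "arr f \<Longrightarrow> far S (\<ominus> f) = \<ominus> (far S f)"
  using additive_functor_neg[OF S_additive arr_in_hom] .

lemma S_add [simp]:
  assumes "arr f" "arr g" "dm f = dm g" "cd f = cd g"
  shows "far S (f \<oplus> g) = far S f \<oplus> far S g"
  using S_additive assms arr_in_hom[OF assms(1)] arr_in_hom[OF assms(2)]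
  unfolding is_additive_functor_def by metis

lemma S_faithful: "f \<in> hom C A B \<Longrightarrow> g \<in> hom C A B \<Longrightarrow> far S f = far S g \<Longrightarrow> f = g"
  using equivalence_faithful[OF S_equivalence] .

text \<open>The class \<open>\<Delta>\<close> records only morphisms; \<open>tri\<close> keeps the
  three objects as well, so that typing facts are at hand in every diagram.\<close>

definition tri :: "'o \<Rightarrow> 'o \<Rightarrow> 'o \<Rightarrow> 'm \<Rightarrow> 'm \<Rightarrow> 'm \<Rightarrow> bool" where
  "tri A B D f g h \<longleftrightarrow> triangle_shape C S A B D f g h \<and> (f, g, h) \<in> \<Delta>"

lemma tri_hom:
  assumes "tri A B D f g h"
  shows "f \<in> hom C A B" "g \<in> hom C B D" "h \<in> hom C D (fob S A)"
  using assms unfolding tri_def triangle_shape_def by blast+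

lemma triI:
  "f \<in> hom C A B \<Longrightarrow> g \<in> hom C B D \<Longrightarrow> h \<in> hom C D (fob S A) \<Longrightarrow> (f, g, h) \<in> \<Delta> \<Longrightarrow> tri A B D f g h"
  unfolding tri_def triangle_shape_def by blast

lemma tri_ex:
  assumes f: "f \<in> hom C A B"
  obtains D g h where "tri A B D f g h"
proof -
  obtain g h where "(f, g, h) \<in> \<Delta>" using tri_completion[OF f] by blast
  moreover from this obtain A' B' D where "triangle_shape C S A' B' D f g h"
    using tri_has_shape by blast
  moreover have "A' = A" "B' = B"
    using hom_disjoint[OF f] calculation(2) unfolding triangle_shape_def by blast+
  ultimately show thesis using that unfolding tri_def by blast
qed

lemma tri_rot: "tri A B D f g h \<Longrightarrow> tri B D (fob S A) g h (\<ominus> far S f)"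
  unfolding tri_def using tri_rotate_forward[of A B D f g h]
  by (auto simp: triangle_shape_def hom_iff)

lemma tri_mor:
  assumes "tri A B D f g h" "tri A' B' D' f' g' h'" "a \<in> hom C A A'" "b \<in> hom C B B'"
    "f' \<cdot> a = b \<cdot> f"
  obtains d where "d \<in> hom C D D'" "g' \<cdot> b = d \<cdot> g" "h' \<cdot> d = far S a \<cdot> h"
  using assms tri_extend[of f g h f' g' h' A B D A' B' D' a b] unfolding tri_def by blast

lemma tri_transport:
  assumes "tri A B D f g h" "f' \<in> hom C A' B'" "g' \<in> hom C B' D'" "h' \<in> hom C D' (fob S A')"
    "is_iso C A A' a" "is_iso C B B' b" "is_iso C D D' d"
    "f' \<cdot> a = b \<cdot> f" "g' \<cdot> b = d \<cdot> g" "h' \<cdot> d = far S a \<cdot> h"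
  shows "tri A' B' D' f' g' h'"
proof -
  have "triangle_iso C S (f, g, h) (f', g', h')"
    using assms unfolding triangle_iso_def tri_def triangle_shape_def prod.case
    by (rule_tac x = A in exI, rule_tac x = B in exI, rule_tac x = D in exI,
        rule_tac x = A' in exI, rule_tac x = B' in exI, rule_tac x = D' in exI,
        rule_tac x = a in exI, rule_tac x = b in exI, rule_tac x = d in exI) simp
  then show ?thesis using assms(1-4) tri_closed_iso unfolding tri_def triangle_shape_def by blast
qed

lemma tri_idm:
  "A \<in> ob C \<Longrightarrow> zero_object C Z \<Longrightarrow> tri A A Z (idm C A) (zero C A Z) (zero C Z (fob S A))"
  by (rule triI) (auto simp: hom_iff zero_object_def tri_of_idm)

text \<open>Two rotations of an identity triangle. As S is only an equivalence, the start is an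
  object whose suspension is isomorphic to W, and the sign from rotating is absorbed by the
  isomorphism \<open>\<ominus> \<beta>\<close>.\<close>

lemma tri_zero_idm:
  assumes W: "W \<in> ob C" and Z: "zero_object C Z"
  shows "tri Z W W (zero C Z W) (idm C W) (zero C W (fob S Z))"
proof -
  obtain W' \<beta> where W': "W' \<in> ob C" and \<beta>: "is_iso C (fob S W') W \<beta>"
    using equivalence_dense[OF S_equivalence W] unfolding isomorphic_def by blast
  have Z': "Z \<in> ob C" using Z unfolding zero_object_def by blast
  note \<beta>' = is_iso_hom[OF \<beta>]
  note tri_rot[OF tri_rot[OF tri_idm[OF W' Z]]]
  then show ?thesis
    by (rule tri_transport[OF _ _ _ _ is_iso_idm[OF Z'] \<beta> is_iso_neg[OF \<beta>]])
      (use W W' Z' \<beta>' in \<open>simp_all add: hom_iff\<close>)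
qed

text \<open>The pair \<open>(idm C A, f)\<close> extends to a morphism from the identity triangle of
  A, whose third component starts in a zero object.\<close>

lemma tri_comp_zero:
  assumes t: "tri A B D f g h"
  shows "g \<cdot> f = zero C A D"
proof -
  obtain Z where Z: "zero_object C Z" using zero_object_ex by blast
  have Z': "Z \<in> ob C" using Z unfolding zero_object_def by blast
  note h = tri_hom[OF t]
  have A: "A \<in> ob C" using h by (simp add: hom_iff)
  obtain d where "d \<in> hom C Z D" "g \<cdot> f = d \<cdot> zero C A Z"
    by (rule tri_mor[OF tri_idm[OF A Z] t, of "idm C A" f]) (use h in \<open>auto simp: hom_iff\<close>)
  then show ?thesis using A Z' by (simp add: hom_iff)
qed

lemma tri_comp_zero2: "tri A B D f g h \<Longrightarrow> h \<cdot> g = zero C B (fob S A)"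
  using tri_comp_zero[OF tri_rot] .

lemma tri_comp_zero3:
  assumes t: "tri A B D f g h"
  shows "far S f \<cdot> h = zero C D (fob S B)"
proof -
  note h = tri_hom[OF t]
  have "\<ominus> (far S f \<cdot> h) = \<ominus> (zero C D (fob S B))"
    using tri_comp_zero[OF tri_rot[OF tri_rot[OF t]]] h by (simp add: hom_iff)
  then show ?thesis by (rule neg_inject) (use h in \<open>simp_all add: hom_iff\<close>)
qed

text \<open>The factorisation is the third component of a morphism into the triangle
  \<open>Z \<rightarrow> W = W\<close> extending the pair of a zero map and w. With its rotations
  this is exactness of the contravariant Hom functor.\<close>

lemma tri_factor_through_cone:
  assumes t: "tri A B D f g h" and w: "w \<in> hom C B W" and 0: "w \<cdot> f = zero C A W"
  obtains v where "v \<in> hom C D W" "v \<cdot> g = w"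
proof -
  obtain Z where Z: "zero_object C Z" using zero_object_ex by blast
  have Z': "Z \<in> ob C" using Z unfolding zero_object_def by blast
  note h = tri_hom[OF t]
  have W: "W \<in> ob C" using w by (simp add: hom_iff)
  obtain d where "d \<in> hom C D W" "idm C W \<cdot> w = d \<cdot> g"
    by (rule tri_mor[OF t tri_zero_idm[OF W Z], of "zero C A Z" w])
      (use h w 0 Z' in \<open>auto simp: hom_iff\<close>)
  then show thesis by (intro that[of d]) (use w in \<open>simp_all add: hom_iff\<close>)
qed

lemma tri_factor_through_cone2:
  "tri A B D f g h \<Longrightarrow> w \<in> hom C D W \<Longrightarrow> w \<cdot> g = zero C B W \<Longrightarrow>
    (\<And>v. v \<in> hom C (fob S A) W \<Longrightarrow> v \<cdot> h = w \<Longrightarrow> thesis) \<Longrightarrow> thesis"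
  using tri_factor_through_cone[OF tri_rot] by metis

lemma tri_factor_through_cone3:
  assumes t: "tri A B D f g h" and w: "w \<in> hom C (fob S A) W" and 0: "w \<cdot> h = zero C D W"
  obtains v where "v \<in> hom C (fob S B) W" "v \<cdot> far S f = w"
proof -
  note h = tri_hom[OF t]
  obtain v where v: "v \<in> hom C (fob S B) W" "v \<cdot> (\<ominus> far S f) = w"
    using tri_factor_through_cone[OF tri_rot[OF tri_rot[OF t]] w 0] .
  show thesis by (rule that[of "\<ominus> v"]) (use v h in \<open>auto simp: hom_iff\<close>)
qed

text \<open>Here a first component is wanted, whereas the axiom provides a third one. Both triangles
  are therefore rotated, and the resulting map between suspensions is pulled back by fullness of
  S.\<close>

lemma tri_lift_to_fibre:
  assumes t: "tri A B D f g h" and w: "w \<in> hom C W B" and 0: "g \<cdot> w = zero C W D"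
  obtains v where "v \<in> hom C W A" "f \<cdot> v = w"
proof -
  obtain Z where Z: "zero_object C Z" using zero_object_ex by blast
  have Z': "Z \<in> ob C" using Z unfolding zero_object_def by blast
  note h = tri_hom[OF t]
  have ob: "W \<in> ob C" "A \<in> ob C" using w h by (simp_all add: hom_iff)
  obtain d where d: "d \<in> hom C (fob S W) (fob S A)"
      "(\<ominus> far S f) \<cdot> d = far S w \<cdot> (\<ominus> far S (idm C W))"
    by (rule tri_mor[OF tri_rot[OF tri_idm[OF ob(1) Z]] tri_rot[OF t], of w "zero C Z D"])
      (use h w 0 Z' in \<open>auto simp: hom_iff\<close>)
  obtain v where v: "v \<in> hom C W A" "far S v = d"
    using equivalence_full[OF S_equivalence ob d(1)] .
  have "\<ominus> far S (f \<cdot> v) = \<ominus> far S w"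
    using d v h w by (simp add: hom_iff)
  then have "far S (f \<cdot> v) = far S w"
    by (rule neg_inject) (use v(1) h w in \<open>simp_all add: hom_iff\<close>)
  then show thesis using that[OF v(1)] S_faithful comp_hom[OF v(1) h(1)] w by blast
qed

lemma tri_lift_to_fibre2:
  "tri A B D f g h \<Longrightarrow> w \<in> hom C W D \<Longrightarrow> h \<cdot> w = zero C W (fob S A) \<Longrightarrow>
    (\<And>v. v \<in> hom C W B \<Longrightarrow> g \<cdot> v = w \<Longrightarrow> thesis) \<Longrightarrow> thesis"
  using tri_lift_to_fibre[OF tri_rot] by metis

lemma tri_lift_to_fibre3:
  assumes t: "tri A B D f g h" and w: "w \<in> hom C W (fob S A)" and 0: "far S f \<cdot> w = zero C W (fob S B)"
  obtains v where "v \<in> hom C W D" "h \<cdot> v = w"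
proof -
  note h = tri_hom[OF t]
  show thesis
    by (rule tri_lift_to_fibre[OF tri_rot[OF tri_rot[OF t]] w _ that]) (use 0 w h in \<open>simp_all add: hom_iff\<close>)
qed

text \<open>Write \<open>n = 1 - e\<close>. Then \<open>n \<cdot> g = 0\<close> and \<open>h \<cdot> n = 0\<close>, so \<open>n\<close> factors through \<open>h\<close> and \<open>n\<close> squares
  to zero.\<close>

lemma tri_endo_inverse:
  assumes t: "tri A B D f g h" and e: "e \<in> hom C D D" and eg: "e \<cdot> g = g" and he: "h \<cdot> e = h"
  obtains n where "n \<in> hom C D D" "n \<cdot> e = idm C D" "e \<cdot> n = idm C D"
proof -
  note h = tri_hom[OF t]
  have D: "D \<in> ob C" using e by (simp add: hom_iff)
  define n where "n = idm C D \<oplus> \<ominus> e"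
  have n: "n \<in> hom C D D" unfolding n_def using e D by (simp add: hom_iff)
  have ng: "n \<cdot> g = zero C B D" and hn: "h \<cdot> n = zero C D (fob S A)"
    unfolding n_def using e h eg he D by (simp_all add: hom_iff distrib_arr)
  obtain y where y: "y \<in> hom C (fob S A) D" "y \<cdot> h = n"
    using tri_factor_through_cone2[OF t n ng] .
  have "n \<cdot> n = y \<cdot> (h \<cdot> n)" using y h n by (simp add: hom_iff flip: y(2))
  then have nn: "n \<cdot> n = zero C D D" using hn y D by (simp add: hom_iff)
  have e_n: "e = idm C D \<oplus> \<ominus> n"
    unfolding n_def using e D add_assoc_arr[of "idm C D" "\<ominus> idm C D" e] by (simp add: hom_iff)
  have cancel: "n \<oplus> (idm C D \<oplus> \<ominus> n) = idm C D"
    using n D add_left_commute_arr[of n "idm C D" "\<ominus> n"] by (simp add: hom_iff)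
  have cancel2: "(idm C D \<oplus> n) \<oplus> \<ominus> n = idm C D"
    using n D add_assoc_arr[of "idm C D" n "\<ominus> n"] by (simp add: hom_iff)
  show thesis
    by (rule that[of "idm C D \<oplus> n"])
      (use n D nn cancel cancel2 add_commute_arr[of "idm C D \<oplus> \<ominus> n" n] in \<open>simp_all add: hom_iff e_n distrib_arr\<close>)
qed

text \<open>The inverses of a and b extend to some e in the other direction. It need not be inverse
  to d, but both composites of d and e fix the adjacent maps of their triangle and are invertible by
  \<open>tri_endo_inverse\<close>, so d has a left and a right inverse.\<close>

lemma tri_five:
  assumes t: "tri A B D f g h" and t': "tri A' B' D' f' g' h'"
    and a: "is_iso C A A' a" and b: "is_iso C B B' b" and d: "d \<in> hom C D D'"
    and eq: "f' \<cdot> a = b \<cdot> f" "g' \<cdot> b = d \<cdot> g" "h' \<cdot> d = far S a \<cdot> h"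
  shows "is_iso C D D' d"
proof -
  note h = tri_hom[OF t] and h' = tri_hom[OF t']
  obtain a' where a': "a \<in> hom C A A'" "a' \<in> hom C A' A" "a' \<cdot> a = idm C A" "a \<cdot> a' = idm C A'"
    using a by (rule is_isoE)
  obtain b' where b': "b \<in> hom C B B'" "b' \<in> hom C B' B" "b' \<cdot> b = idm C B" "b \<cdot> b' = idm C B'"
    using b by (rule is_isoE)
  note x = comp_extend1_arr[OF a'(3,2,1)] comp_extend1_arr[OF a'(4,1,2)]
    comp_extend1_arr[OF b'(3,2,1)] comp_extend1_arr[OF b'(4,1,2)]
  have "b' \<cdot> (b \<cdot> (f \<cdot> a')) = b' \<cdot> (f' \<cdot> (a \<cdot> a'))"
    using comp_extend_arr[OF eq(1) h'(1) a'(1) b'(1) h(1), of a'] a' by (simp add: hom_iff)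
  then have sq: "f \<cdot> a' = b' \<cdot> f'" using x a' b' h h' by (simp add: hom_iff)
  obtain e where e: "e \<in> hom C D' D" "g \<cdot> b' = e \<cdot> g'" "h \<cdot> e = far S a' \<cdot> h'"
    using tri_mor[OF t' t a'(2) b'(2) sq] .
  have SS: "far S a' \<cdot> far S a = idm C (fob S A)" "far S a \<cdot> far S a' = idm C (fob S A')"
    using a' by (simp_all add: hom_iff flip: S_comp)
  have Sa: "far S a \<in> hom C (fob S A) (fob S A')" "far S a' \<in> hom C (fob S A') (fob S A)"
    using a' by (simp_all add: hom_iff)
  have "(e \<cdot> d) \<cdot> g = e \<cdot> (g' \<cdot> b)" using eq(2) e d h by (simp add: hom_iff)
  also have "\<dots> = g \<cdot> (b' \<cdot> b)"
    using comp_extend_arr[OF e(2) h(2) b'(2) e(1) h'(2), of b] b' by (simp add: hom_iff)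
  finally have 1: "(e \<cdot> d) \<cdot> g = g" using b' h by (simp add: hom_iff)
  have "h \<cdot> (e \<cdot> d) = far S a' \<cdot> (h' \<cdot> d)"
    using comp_extend_arr[OF e(3) h(3) e(1) Sa(2) h'(3), of d] d by (simp add: hom_iff)
  then have 2: "h \<cdot> (e \<cdot> d) = h"
    using comp_extend1_arr[OF SS(1) Sa(2,1), of h] eq(3) h by (simp add: hom_iff)
  obtain n where n: "n \<in> hom C D D" "n \<cdot> (e \<cdot> d) = idm C D" "(e \<cdot> d) \<cdot> n = idm C D"
    by (rule tri_endo_inverse[OF t _ 1 2]) (use e d in \<open>simp add: hom_iff\<close>)
  have "(d \<cdot> e) \<cdot> g' = d \<cdot> (g \<cdot> b')" using e d h' by (simp add: hom_iff)
  also have "\<dots> = g' \<cdot> (b \<cdot> b')"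
    using comp_extend_arr[OF eq(2) h'(2) b'(1) d h(2), of b'] b' by (simp add: hom_iff)
  finally have 3: "(d \<cdot> e) \<cdot> g' = g'" using b' h' by (simp add: hom_iff)
  have "h' \<cdot> (d \<cdot> e) = far S a \<cdot> (h \<cdot> e)"
    using comp_extend_arr[OF eq(3) h'(3) d Sa(1) h(3), of e] e by (simp add: hom_iff)
  then have 4: "h' \<cdot> (d \<cdot> e) = h'"
    using comp_extend1_arr[OF SS(2) Sa(1,2), of h'] e h' by (simp add: hom_iff)
  obtain m where m: "m \<in> hom C D' D'" "m \<cdot> (d \<cdot> e) = idm C D'" "(d \<cdot> e) \<cdot> m = idm C D'"
    by (rule tri_endo_inverse[OF t' _ 3 4]) (use e d in \<open>simp add: hom_iff\<close>)
  show ?thesis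
    by (rule is_iso_of_inverses[OF d, of "n \<cdot> e" "e \<cdot> m"]) (use e d n m in \<open>simp_all add: hom_iff\<close>)
qed

text \<open>Comparison with a completion of f. Rotated forward often enough, both triangles start
  with \<open>\<ominus> far S f\<close>, so the five lemma gives an isomorphism between the
  suspended third objects; it descends because S is an equivalence.\<close>

lemma tri_rot_back:
  assumes f: "f \<in> hom C A B" and g: "g \<in> hom C B D" and h: "h \<in> hom C D (fob S A)"
    and t: "tri B D (fob S A) g h (\<ominus> far S f)"
  shows "tri A B D f g h"
proof -
  obtain D1 g1 h1 where t1: "tri A B D1 f g1 h1" using tri_ex[OF f] .
  note h1 = tri_hom[OF t1]
  have ob: "A \<in> ob C" "B \<in> ob C" "D \<in> ob C" "D1 \<in> ob C" using f g h1 by (simp_all add: hom_iff)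
  note r = tri_rot[OF tri_rot[OF t]] and r1 = tri_rot[OF tri_rot[OF tri_rot[OF t1]]]
  obtain e where e: "e \<in> hom C (fob S D) (fob S D1)" "(\<ominus> far S g1) \<cdot> idm C (fob S B) = e \<cdot> (\<ominus> far S g)"
      "(\<ominus> far S h1) \<cdot> e = far S (idm C (fob S A)) \<cdot> (\<ominus> far S h)"
    by (rule tri_mor[OF r r1, of "idm C (fob S A)" "idm C (fob S B)"]) (use f ob in \<open>auto simp: hom_iff\<close>)
  have iso: "is_iso C (fob S D) (fob S D1) e"
    by (rule tri_five[OF r r1 is_iso_idm is_iso_idm e(1) _ e(2,3)]) (use f ob in \<open>auto simp: hom_iff\<close>)
  obtain d where d: "d \<in> hom C D D1" "far S d = e" using equivalence_full[OF S_equivalence ob(3,4) e(1)] .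
  have d_iso: "is_iso C D D1 d" using equivalence_reflects_iso[OF S_equivalence d(1)] iso d(2) by simp
  have "far S g1 = far S (d \<cdot> g)"
    by (rule neg_inject) (use e(1,2) d h1 g h ob in \<open>simp_all add: hom_iff\<close>)
  moreover have "far S (h1 \<cdot> d) = far S h"
    by (rule neg_inject) (use e(1,3) d h1 g h ob in \<open>simp_all add: hom_iff\<close>)
  ultimately have eqs: "g1 = d \<cdot> g" "h1 \<cdot> d = h"
    using S_faithful[of g1 B D1 "d \<cdot> g"] S_faithful[of "h1 \<cdot> d" D "fob S A" h] d h1 g h
    by (simp_all add: hom_iff)
  obtain d' where d': "d' \<in> hom C D1 D" "d' \<cdot> d = idm C D" "d \<cdot> d' = idm C D1" "is_iso C D1 D d'"
    using d_iso by (rule is_isoE)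
  have "g = d' \<cdot> g1" unfolding eqs(1) using comp_extend1_arr[OF d'(2,1) d(1), of g] g by (simp add: hom_iff)
  moreover have "h \<cdot> d' = h1" unfolding eqs(2)[symmetric] using d' d h1 by (simp add: hom_iff)
  ultimately show ?thesis
    by (intro tri_transport[OF t1 f g h is_iso_idm is_iso_idm d'(4)])
      (use f g h h1 ob in \<open>simp_all add: hom_iff\<close>)
qed

text \<open>Realises a prescribed connecting map, that is, builds the middle term of an extension.
  The cone of h is first replaced by an isomorphic suspension, as rotating backwards
  requires.\<close>

lemma tri_ex3:
  assumes h: "h \<in> hom C D (fob S A)" and A: "A \<in> ob C"
  obtains B f g where "tri A B D f g h"
proof -
  have D: "D \<in> ob C" using h by (simp add: hom_iff)
  obtain E p q where t: "tri D (fob S A) E h p q" using tri_ex[OF h] .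
  note t' = tri_hom[OF t]
  have E: "E \<in> ob C" using t' by (simp add: hom_iff)
  obtain B \<beta> where B: "B \<in> ob C" and "is_iso C (fob S B) E \<beta>"
    using equivalence_dense[OF S_equivalence E] unfolding isomorphic_def by blast
  then obtain \<beta>' where \<beta>: "\<beta> \<in> hom C (fob S B) E" "\<beta>' \<in> hom C E (fob S B)"
      "\<beta>' \<cdot> \<beta> = idm C (fob S B)" "\<beta> \<cdot> \<beta>' = idm C E" "is_iso C E (fob S B) \<beta>'"
    by (metis is_isoE)
  have "\<ominus> (\<beta>' \<cdot> p) \<in> hom C (fob S A) (fob S B)" using \<beta> t' by (simp add: hom_iff)
  then obtain f where f: "f \<in> hom C A B" "far S f = \<ominus> (\<beta>' \<cdot> p)"
    using equivalence_full[OF S_equivalence A B] by blast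
  have "\<ominus> (q \<cdot> \<beta>) \<in> hom C (fob S B) (fob S D)" using \<beta> t' by (simp add: hom_iff)
  then obtain g where g: "g \<in> hom C B D" "far S g = \<ominus> (q \<cdot> \<beta>)"
    using equivalence_full[OF S_equivalence B D] by blast
  have "tri D (fob S A) (fob S B) h (\<ominus> far S f) (\<ominus> far S g)"
    by (rule tri_transport[OF t h _ _ is_iso_idm is_iso_idm \<beta>(5)])
      (use \<beta> f g t' A D in \<open>auto simp: hom_iff\<close>)
  then have "tri B D (fob S A) g h (\<ominus> far S f)"
    by (rule tri_rot_back[rotated 3]) (use \<beta> t' f g h B A in \<open>simp_all add: hom_iff\<close>)
  then have "tri A B D f g h"
    by (rule tri_rot_back[OF f(1) g(1) h])
  then show thesis using that by blast
qed

text \<open>The octahedral axiom quantifies over all completions of three morphisms. Any two such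
  choices over isomorphic composable pairs are linked by morphisms of triangles that are
  isomorphisms by \<open>tri_five\<close>; conjugating u and v by these carries one octahedron to
  the other.\<close>

lemma octahedron_transport:
  assumes b: "is_iso C B B' b" and e: "is_iso C E E' e"
    and eqs: "b \<cdot> f = f1" "e \<cdot> g = g1 \<cdot> b"
    and t: "tri A B D f f' f''" "tri B E F g g' g''" "tri A E G (g \<cdot> f) k k'"
    and t1: "tri A B' D1 f1 f1' f1''" "tri B' E' F1 g1 g1' g1''" "tri A E' G1 (g1 \<cdot> f1) k1 k1'"
    and uv: "tri D G F u v (far S f' \<cdot> g'')" "u \<cdot> f' = k \<cdot> g" "k' \<cdot> u = f''" "v \<cdot> k = g'"
      "g'' \<cdot> v = far S f \<cdot> k'"
  obtains u1 v1 where "tri D1 G1 F1 u1 v1 (far S f1' \<cdot> g1'')" "u1 \<cdot> f1' = k1 \<cdot> g1" "k1' \<cdot> u1 = f1''"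
    "v1 \<cdot> k1 = g1'" "g1'' \<cdot> v1 = far S f1 \<cdot> k1'"
proof -
  note h = tri_hom[OF t(1)] tri_hom[OF t(2)] tri_hom[OF t(3)] tri_hom[OF uv(1)]
  note h1 = tri_hom[OF t1(1)] tri_hom[OF t1(2)] tri_hom[OF t1(3)]
  obtain b' where b': "b \<in> hom C B B'" "b' \<in> hom C B' B" "b' \<cdot> b = idm C B" "b \<cdot> b' = idm C B'"
    using b by (rule is_isoE)
  obtain e' where e': "e \<in> hom C E E'" "e' \<in> hom C E' E" "e' \<cdot> e = idm C E" "e \<cdot> e' = idm C E'"
    using e by (rule is_isoE)
  have A: "A \<in> ob C" using h by (simp add: hom_iff)
  note idA = is_iso_idm[OF A]
  have sq1: "f1 \<cdot> idm C A = b \<cdot> f" using h1 eqs by (simp add: hom_iff)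
  have sq3: "(g1 \<cdot> f1) \<cdot> idm C A = e \<cdot> (g \<cdot> f)"
    using h h1 e' b' comp_extend_arr[OF eqs(2) e'(1) h(4) h1(4) b'(1), of f] eqs(1)
    by (simp add: hom_iff)
  obtain d where d: "d \<in> hom C D D1" "f1' \<cdot> b = d \<cdot> f'" "f1'' \<cdot> d = far S (idm C A) \<cdot> f''"
    using tri_mor[OF t(1) t1(1) idm_hom[OF A] b'(1) sq1] .
  have d_iso: "is_iso C D D1 d" by (rule tri_five[OF t(1) t1(1) idA b d(1) sq1 d(2,3)])
  obtain \<phi> where \<phi>: "\<phi> \<in> hom C F F1" "g1' \<cdot> e = \<phi> \<cdot> g'" "g1'' \<cdot> \<phi> = far S b \<cdot> g''"
    using tri_mor[OF t(2) t1(2) b'(1) e'(1) eqs(2)[symmetric]] .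
  have \<phi>_iso: "is_iso C F F1 \<phi>" by (rule tri_five[OF t(2) t1(2) b e \<phi>(1) eqs(2)[symmetric] \<phi>(2,3)])
  obtain \<gamma> where \<gamma>: "\<gamma> \<in> hom C G G1" "k1 \<cdot> e = \<gamma> \<cdot> k" "k1' \<cdot> \<gamma> = far S (idm C A) \<cdot> k'"
    using tri_mor[OF t(3) t1(3) idm_hom[OF A] e'(1) sq3] .
  have \<gamma>_iso: "is_iso C G G1 \<gamma>" by (rule tri_five[OF t(3) t1(3) idA e \<gamma>(1) sq3 \<gamma>(2,3)])
  obtain d' where d': "d' \<in> hom C D1 D" "d' \<cdot> d = idm C D" "d \<cdot> d' = idm C D1"
    using d_iso by (rule is_isoE)
  obtain \<gamma>' where \<gamma>': "\<gamma>' \<in> hom C G1 G" "\<gamma>' \<cdot> \<gamma> = idm C G" "\<gamma> \<cdot> \<gamma>' = idm C G1"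
    using \<gamma>_iso by (rule is_isoE)
  note homs = h h1 b'(1,2) e'(1,2) d(1) d'(1) \<phi>(1) \<gamma>(1) \<gamma>'(1)
  have [simp]: "f1'' \<cdot> d = f''" "k1' \<cdot> \<gamma> = k'" using d(3) \<gamma>(3) homs by (simp_all add: hom_iff)
  have fd: "d' \<cdot> f1' = f' \<cdot> b'"
  proof -
    have "d' \<cdot> (f1' \<cdot> (b \<cdot> b')) = d' \<cdot> (d \<cdot> (f' \<cdot> b'))"
      using comp_extend_arr[OF d(2) h1(2) b'(1) d(1) h(2), of b'] homs by (simp add: hom_iff)
    then show ?thesis
      using comp_extend1_arr[OF d'(2,1) d(1), of "f' \<cdot> b'"] b'(4) homs by (simp add: hom_iff)
  qed
  have fd2: "f'' \<cdot> d' = f1''"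
    using comp_extend1_arr[OF _ h1(3) d(1), of f'' d'] d'(3) homs by (simp add: hom_iff)
  have kd2: "k' \<cdot> \<gamma>' = k1'"
    using comp_extend1_arr[OF _ h1(9) \<gamma>(1), of k' \<gamma>'] \<gamma>'(3) homs by (simp add: hom_iff)
  have kg: "\<gamma>' \<cdot> k1 = k \<cdot> e'"
  proof -
    have "\<gamma>' \<cdot> (k1 \<cdot> (e \<cdot> e')) = \<gamma>' \<cdot> (\<gamma> \<cdot> (k \<cdot> e'))"
      using comp_extend_arr[OF \<gamma>(2) h1(8) e'(1) \<gamma>(1) h(8), of e'] homs by (simp add: hom_iff)
    then show ?thesis
      using comp_extend1_arr[OF \<gamma>'(2,1) \<gamma>(1), of "k \<cdot> e'"] e'(4) homs by (simp add: hom_iff)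
  qed
  define u1 where "u1 = \<gamma> \<cdot> (u \<cdot> d')"
  define v1 where "v1 = \<phi> \<cdot> (v \<cdot> \<gamma>')"
  have u1: "u1 \<in> hom C D1 G1" and v1: "v1 \<in> hom C G1 F1"
    unfolding u1_def v1_def using homs by (simp_all add: hom_iff)
  have 1: "u1 \<cdot> f1' = k1 \<cdot> g1"
  proof -
    have "u1 \<cdot> f1' = \<gamma> \<cdot> (u \<cdot> (f' \<cdot> b'))" unfolding u1_def using fd homs by (simp add: hom_iff)
    also have "\<dots> = \<gamma> \<cdot> (k \<cdot> (g \<cdot> b'))"
      using comp_extend_arr[OF uv(2) h(10) h(2) h(8) h(4), of b'] homs by (simp add: hom_iff)
    also have "\<dots> = k1 \<cdot> (e \<cdot> (g \<cdot> b'))"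
      using comp_extend_arr[OF \<gamma>(2) h1(8) e'(1) \<gamma>(1) h(8), of "g \<cdot> b'"] homs by (simp add: hom_iff)
    also have "\<dots> = k1 \<cdot> (g1 \<cdot> (b \<cdot> b'))"
      using comp_extend_arr[OF eqs(2) e'(1) h(4) h1(4) b'(1), of b'] homs by (simp add: hom_iff)
    finally show ?thesis using b' h1 by (simp add: hom_iff)
  qed
  have 2: "k1' \<cdot> u1 = f1''"
    unfolding u1_def using comp_extend1_arr[OF _ h1(9) \<gamma>(1), of k' "u \<cdot> d'"]
      comp_extend1_arr[OF uv(3) h(9) h(10), of d'] homs fd2 by (simp add: hom_iff)
  have 3: "v1 \<cdot> k1 = g1'"
  proof -
    have "v1 \<cdot> k1 = \<phi> \<cdot> (g' \<cdot> e')" unfolding v1_def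
      using kg comp_extend1_arr[OF uv(4) h(11) h(8), of e'] homs by (simp add: hom_iff)
    also have "\<dots> = g1' \<cdot> (e \<cdot> e')"
      using comp_extend_arr[OF \<phi>(2) h1(5) e'(1) \<phi>(1) h(5), of e'] homs by (simp add: hom_iff)
    finally show ?thesis using e' h1 by (simp add: hom_iff)
  qed
  have Sb: "far S b \<in> hom C (fob S B) (fob S B')" "far S f \<in> hom C (fob S A) (fob S B)"
    "far S f' \<in> hom C (fob S B) (fob S D)" "far S f1' \<in> hom C (fob S B') (fob S D1)"
    "far S d \<in> hom C (fob S D) (fob S D1)"
    using homs by (simp_all add: hom_iff)
  have Sbf: "far S b \<cdot> far S f = far S f1" "far S f1' \<cdot> far S b = far S d \<cdot> far S f'"
    using homs eqs(1) d(2) by (simp_all add: hom_iff flip: S_comp)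
  have 4: "g1'' \<cdot> v1 = far S f1 \<cdot> k1'"
  proof -
    have "g1'' \<cdot> v1 = far S b \<cdot> (g'' \<cdot> (v \<cdot> \<gamma>'))" unfolding v1_def
      using comp_extend_arr[OF \<phi>(3) h1(6) \<phi>(1) Sb(1) h(6), of "v \<cdot> \<gamma>'"] homs by (simp add: hom_iff)
    also have "\<dots> = far S b \<cdot> (far S f \<cdot> (k' \<cdot> \<gamma>'))"
      using comp_extend_arr[OF uv(5) h(6) h(11) Sb(2) h(9), of "\<gamma>'"] homs by (simp add: hom_iff)
    also have "\<dots> = far S f1 \<cdot> k1'"
      using comp_extend1_arr[OF Sbf(1) Sb(1,2), of k1'] kd2 homs by (simp add: hom_iff)
    finally show ?thesis .
  qed
  have 5: "tri D1 G1 F1 u1 v1 (far S f1' \<cdot> g1'')"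
  proof (rule tri_transport[OF uv(1) u1 v1 _ d_iso \<gamma>_iso \<phi>_iso])
    show "far S f1' \<cdot> g1'' \<in> hom C F1 (fob S D1)" using homs by (simp add: hom_iff)
    show "u1 \<cdot> d = \<gamma> \<cdot> u" unfolding u1_def using d'(2) homs by (simp add: hom_iff)
    show "v1 \<cdot> \<gamma> = \<phi> \<cdot> v" unfolding v1_def using \<gamma>'(2) homs by (simp add: hom_iff)
    show "far S f1' \<cdot> g1'' \<cdot> \<phi> = far S d \<cdot> (far S f' \<cdot> g'')"
      using \<phi>(3) comp_extend_arr[OF Sbf(2) Sb(4,1,5,3), of g''] homs by (simp add: hom_iff)
  qed
  show thesis using that[OF 5 1 2 3 4] .
qed

text \<open>The hypothesis asks for one octahedron per composable pair, over a pair that is merely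
  isomorphic to it. This freedom permits a passage to morphisms with better cones, which in the
  factor category are the inflations.\<close>

lemma triangulated:
  assumes oct: "\<And>A B E f g. f \<in> hom C A B \<Longrightarrow> g \<in> hom C B E \<Longrightarrow>
    \<exists>B' E' b e f' g' D F G f1 f2 g1 g2 k1 k2 u v.
      is_iso C B' B b \<and> is_iso C E' E e \<and> b \<cdot> f' = f \<and> e \<cdot> g' = g \<cdot> b \<and>
      tri A B' D f' f1 f2 \<and> tri B' E' F g' g1 g2 \<and> tri A E' G (g' \<cdot> f') k1 k2 \<and>
      tri D G F u v (far S f1 \<cdot> g2) \<and> u \<cdot> f1 = k1 \<cdot> g' \<and> k2 \<cdot> u = f2 \<and> v \<cdot> k1 = g1 \<and>
      g2 \<cdot> v = far S f' \<cdot> k2"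
  shows "triangulated_category C S \<Delta>"
proof (unfold_locales, goal_cases)
  case 1 show ?case by (rule S_additive)
next
  case 2 show ?case by (rule S_equivalence)
next
  case 3 then show ?case by (rule tri_has_shape)
next
  case 4 then show ?case by (rule tri_closed_iso)
next
  case 5 then show ?case by (rule tri_of_idm)
next
  case 6 then show ?case by (rule tri_completion)
next
  case (7 A B D f g h)
  then show ?case
    using tri_rot_back[of f A B g D h] tri_rot[of A B D f g h]
    unfolding tri_def triangle_shape_def by (auto simp: hom_iff)
next
  case 8 then show ?case by (rule tri_extend)
next
  case (9 A B D f f' f'' E F g g' g'' G k k')
  have f: "f \<in> hom C A B" and g: "g \<in> hom C B E" using 9 unfolding triangle_shape_def by blast+
  have t: "tri A B D f f' f''" "tri B E F g g' g''" "tri A E G (g \<cdot> f) k k'"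
    unfolding tri_def using 9 by blast+
  obtain B' E' b e fa ga D' F' G' f1 f2 g1 g2 k1 k2 u v where
    o: "is_iso C B' B b" "is_iso C E' E e" "b \<cdot> fa = f" "e \<cdot> ga = g \<cdot> b"
      "tri A B' D' fa f1 f2" "tri B' E' F' ga g1 g2" "tri A E' G' (ga \<cdot> fa) k1 k2"
      "tri D' G' F' u v (far S f1 \<cdot> g2)" "u \<cdot> f1 = k1 \<cdot> ga" "k2 \<cdot> u = f2" "v \<cdot> k1 = g1"
      "g2 \<cdot> v = far S fa \<cdot> k2"
    using oct[OF f g] by (elim exE conjE)
  obtain u1 v1 where "tri D G F u1 v1 (far S f' \<cdot> g'')" "u1 \<cdot> f' = k \<cdot> g" "k' \<cdot> u1 = f''"
    "v1 \<cdot> k = g'" "g'' \<cdot> v1 = far S f \<cdot> k'"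
    using octahedron_transport[OF o(1-7) t o(8-12)] .
  then show ?case unfolding tri_def triangle_shape_def by blast
qed

end

text \<open>The exactness lemmas are thereby shared: they hold in T, and they are available for the
  factor category before its octahedral axiom is known.\<close>

sublocale triangulated_category \<subseteq> weak_triangulated_category C S \<Delta>
proof (unfold_locales, goal_cases)
  case 1 show ?case by (rule suspension_additive)
next
  case 2 show ?case by (rule suspension_equivalence)
next
  case 3 then show ?case by (rule tri_shape)
next
  case 4 then show ?case by (rule tri_iso_closed)
next
  case 5 then show ?case by (rule tri_idm)
next
  case 6 then show ?case by (rule tri_complete)
next
  case 7 then show ?case using tri_rotate by blast
next
  case 8 then show ?case by (rule tri_morphism)
qed

section \<open>Factor categories and full subcategories\<close>

lemma subcategoryD:
  assumes "subcategory C X"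
  shows "X \<subseteq> ob C" "\<exists>Z \<in> X. zero_object C Z" "A \<in> X \<Longrightarrow> isomorphic C A B \<Longrightarrow> B \<in> X"
    "biproduct C A B P i j p q \<Longrightarrow> P \<in> X \<longleftrightarrow> A \<in> X \<and> B \<in> X"
  using assms unfolding subcategory_def by blast+

locale additive_subcategory = additive_category C
  for C :: "('o, 'm, 'z) acat_scheme" (structure) +
  fixes X :: "'o set"
  assumes subcat: "subcategory C X"
begin

abbreviation mc :: "'m \<Rightarrow> 'm set" where "mc \<equiv> mod_class C X"
abbreviation ft :: "'o \<Rightarrow> 'o \<Rightarrow> 'm \<Rightarrow> bool" where "ft \<equiv> factors_through C X"
abbreviation Q :: "('o, 'm set) acat" where "Q \<equiv> factor_cat C X"

lemma X_ob: "P \<in> X \<Longrightarrow> P \<in> ob C"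
  using subcategoryD(1)[OF subcat] by blast

lemma ftI: "P \<in> X \<Longrightarrow> a \<in> hom C A P \<Longrightarrow> b \<in> hom C P B \<Longrightarrow> ft A B (b \<cdot> a)"
  unfolding factors_through_def by blast

lemma ftE:
  assumes "ft A B f"
  obtains P a b where "P \<in> X" "a \<in> hom C A P" "b \<in> hom C P B" "f = b \<cdot> a"
  using assms unfolding factors_through_def by blast

lemma ft_hom: "ft A B f \<Longrightarrow> f \<in> hom C A B"
  by (erule ftE) (auto intro: comp_hom)

lemma ft_comp_left:
  assumes "ft A B f" "g \<in> hom C B D"
  shows "ft A D (g \<cdot> f)"
proof -
  obtain P a b where p: "P \<in> X" "a \<in> hom C A P" "b \<in> hom C P B" "f = b \<cdot> a"
    using assms(1) by (rule ftE)
  have "g \<cdot> f = (g \<cdot> b) \<cdot> a" unfolding p(4) using comp_assoc[OF p(2,3) assms(2)] by simp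
  then show ?thesis using ftI[OF p(1,2) comp_hom[OF p(3) assms(2)]] by simp
qed

lemma ft_comp_right:
  assumes "ft B D f" "g \<in> hom C A B"
  shows "ft A D (f \<cdot> g)"
proof -
  obtain P a b where p: "P \<in> X" "a \<in> hom C B P" "b \<in> hom C P D" "f = b \<cdot> a"
    using assms(1) by (rule ftE)
  have "f \<cdot> g = b \<cdot> (a \<cdot> g)" unfolding p(4) using comp_assoc[OF assms(2) p(2,3)] .
  then show ?thesis using ftI[OF p(1) comp_hom[OF assms(2) p(2)] p(3)] by simp
qed

lemma ft_X_left: "A \<in> X \<Longrightarrow> f \<in> hom C A B \<Longrightarrow> ft A B f"
  using ftI[of A "idm C A" A f B] by (simp add: hom_iff)

lemma ft_X_right: "B \<in> X \<Longrightarrow> f \<in> hom C A B \<Longrightarrow> ft A B f"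
  using ftI[of B f A "idm C B" B] by (simp add: hom_iff)

lemma ft_zero: "A \<in> ob C \<Longrightarrow> B \<in> ob C \<Longrightarrow> ft A B (zero C A B)"
proof -
  assume ob: "A \<in> ob C" "B \<in> ob C"
  obtain Z where Z: "Z \<in> X" using subcategoryD(2)[OF subcat] by blast
  then have "ft A B (zero C Z B \<cdot> zero C A Z)" using ob X_ob[OF Z] by (intro ftI) (auto simp: hom_iff)
  then show ?thesis using ob X_ob[OF Z] by simp
qed

lemma ft_neg:
  assumes "ft A B f"
  shows "ft A B (\<ominus> f)"
proof -
  have "\<ominus> f = \<ominus> (idm C B) \<cdot> f" "\<ominus> (idm C B) \<in> hom C B B" using ft_hom[OF assms] by (auto simp: hom_iff)
  then show ?thesis using ft_comp_left[OF assms] by metis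
qed

text \<open>The sum factors through the biproduct of the two intermediate objects; closure of X
  under sums makes the morphisms through X an ideal.\<close>

lemma ft_add:
  assumes "ft A B f" "ft A B g"
  shows "ft A B (f \<oplus> g)"
proof -
  obtain P a b where p: "P \<in> X" "a \<in> hom C A P" "b \<in> hom C P B" "f = b \<cdot> a"
    using assms(1) by (rule ftE)
  obtain P' a' b' where p': "P' \<in> X" "a' \<in> hom C A P'" "b' \<in> hom C P' B" "g = b' \<cdot> a'"
    using assms(2) by (rule ftE)
  obtain W i j s t where W: "biproduct C P P' W i j s t"
    using biproduct_ex X_ob p(1) p'(1) by meson
  then have "W \<in> X" using subcategoryD(4)[OF subcat W] p(1) p'(1) by blast
  note w = W[unfolded biproduct_def]
  have w': "i \<in> hom C P W" "j \<in> hom C P' W" "s \<in> hom C W P" "t \<in> hom C W P'"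
    "s \<cdot> i = idm C P" "t \<cdot> j = idm C P'" "s \<cdot> j = zero C P' P" "t \<cdot> i = zero C P P'" using w by blast+
  note x = comp_extend1_arr[OF w'(5,3,1)] comp_extend1_arr[OF w'(6,4,2)]
    comp_extend1_arr[OF w'(7,3,2)] comp_extend1_arr[OF w'(8,4,1)]
  have "ft A B (((b \<cdot> s) \<oplus> (b' \<cdot> t)) \<cdot> ((i \<cdot> a) \<oplus> (j \<cdot> a')))"
    by (rule ftI[OF \<open>W \<in> X\<close>]) (use w' p p' in \<open>simp_all add: hom_iff\<close>)
  moreover have "((b \<cdot> s) \<oplus> (b' \<cdot> t)) \<cdot> ((i \<cdot> a) \<oplus> (j \<cdot> a')) = f \<oplus> g"
    using w' p p' x by (simp add: hom_iff distrib_arr)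
  ultimately show ?thesis by simp
qed

lemma diff_swap: "f \<in> hom C A B \<Longrightarrow> g \<in> hom C A B \<Longrightarrow> \<ominus> (f \<oplus> \<ominus> g) = g \<oplus> \<ominus> f"
  using add_commute_arr[of g "\<ominus> f"] by (simp add: hom_iff)

lemma diff_trans:
  "f \<in> hom C A B \<Longrightarrow> g \<in> hom C A B \<Longrightarrow> h \<in> hom C A B \<Longrightarrow> (f \<oplus> \<ominus> g) \<oplus> (g \<oplus> \<ominus> h) = f \<oplus> \<ominus> h"
  using add_assoc_arr[of f "\<ominus> g" "g \<oplus> \<ominus> h"] by (simp add: hom_iff)

lemma in_mc: "f \<in> hom C A B \<Longrightarrow> g \<in> mc f \<longleftrightarrow> g \<in> hom C A B \<and> ft A B (g \<oplus> \<ominus> f)"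
  unfolding mod_class_def using hom_disjoint by blast

lemma mc_self: "f \<in> hom C A B \<Longrightarrow> f \<in> mc f"
  using in_mc ft_zero by (simp add: hom_iff)

lemma mc_eq:
  assumes f: "f \<in> hom C A B" and g: "g \<in> hom C A B"
  shows "mc f = mc g \<longleftrightarrow> ft A B (f \<oplus> \<ominus> g)"
proof
  assume "mc f = mc g"
  then show "ft A B (f \<oplus> \<ominus> g)" using mc_self[OF f] in_mc[OF g] by simp
next
  assume d: "ft A B (f \<oplus> \<ominus> g)"
  have d': "ft A B (g \<oplus> \<ominus> f)" using ft_neg[OF d] diff_swap[OF f g] by simp
  have "h \<in> mc f \<longleftrightarrow> h \<in> mc g" for h
    using in_mc[OF f, of h] in_mc[OF g, of h] diff_trans[OF _ f g, of h] diff_trans[OF _ g f, of h]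
      ft_add[OF _ d, of "h \<oplus> \<ominus> f"] ft_add[OF _ d', of "h \<oplus> \<ominus> g"] by metis
  then show "mc f = mc g" by blast
qed

lemma mc_member_eq: "f \<in> hom C A B \<Longrightarrow> g \<in> mc f \<Longrightarrow> mc g = mc f"
  using in_mc mc_eq by blast

lemma mc_zero_iff: "f \<in> hom C A B \<Longrightarrow> mc f = mc (zero C A B) \<longleftrightarrow> ft A B f"
  by (subst mc_eq) (auto simp: hom_iff)

lemma mc_comp_cong:
  assumes f: "f \<in> hom C A B" "f' \<in> hom C A B" and g: "g \<in> hom C B D" "g' \<in> hom C B D"
    and eq: "mc f' = mc f" "mc g' = mc g"
  shows "mc (g' \<cdot> f') = mc (g \<cdot> f)"
proof -
  have "ft A B (f' \<oplus> \<ominus> f)" "ft B D (g' \<oplus> \<ominus> g)"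
    using eq mc_eq[OF f(2,1)] mc_eq[OF g(2,1)] by simp_all
  \<comment> \<open>The difference of the composites is g'(f' - f) + (g' - g)f, a sum of two
    morphisms through X.\<close>
  from ft_add[OF ft_comp_left[OF this(1) g(2)] ft_comp_right[OF this(2) f(1)]]
  have "ft A D ((g' \<cdot> f' \<oplus> \<ominus> (g' \<cdot> f)) \<oplus> (g' \<cdot> f \<oplus> \<ominus> (g \<cdot> f)))"
    using f g by (simp add: hom_iff distrib_arr)
  then show ?thesis
    using diff_trans[OF comp_hom[OF f(2) g(2)] comp_hom[OF f(1) g(2)] comp_hom[OF f(1) g(1)]]
      mc_eq[OF comp_hom[OF f(2) g(2)] comp_hom[OF f(1) g(1)]] by simp
qed

lemma mc_add_cong:
  assumes f: "f \<in> hom C A B" "f' \<in> hom C A B" and g: "g \<in> hom C A B" "g' \<in> hom C A B"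
    and eq: "mc f' = mc f" "mc g' = mc g"
  shows "mc (f' \<oplus> g') = mc (f \<oplus> g)"
proof -
  have "ft A B (f' \<oplus> \<ominus> f)" "ft A B (g' \<oplus> \<ominus> g)"
    using eq mc_eq[OF f(2,1)] mc_eq[OF g(2,1)] by simp_all
  from ft_add[OF this] have "ft A B ((f' \<oplus> \<ominus> f) \<oplus> (g' \<oplus> \<ominus> g))" .
  moreover have "(f' \<oplus> \<ominus> f) \<oplus> (g' \<oplus> \<ominus> g) = (f' \<oplus> g') \<oplus> \<ominus> (f \<oplus> g)"
    using f g add_left_commute_arr[of "\<ominus> f" g' "\<ominus> g"] by (simp add: hom_iff add_assoc_arr)
  ultimately show ?thesis using mc_eq[OF add_hom[OF f(2) g(2)] add_hom[OF f(1) g(1)]] by simp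
qed

lemma mc_neg_cong:
  assumes f: "f \<in> hom C A B" "f' \<in> hom C A B" and eq: "mc f' = mc f"
  shows "mc (\<ominus> f') = mc (\<ominus> f)"
proof -
  have "ft A B (\<ominus> (f' \<oplus> \<ominus> f))" using eq mc_eq[OF f(2,1)] ft_neg by simp
  moreover have "\<ominus> (f' \<oplus> \<ominus> f) = \<ominus> f' \<oplus> \<ominus> (\<ominus> f)" using f by (simp add: hom_iff)
  ultimately show ?thesis using mc_eq[OF neg_hom[OF f(2)] neg_hom[OF f(1)]] by simp
qed

section \<open>Operations of the factor category on representatives\<close>

lemma factor_ob [simp]: "ob Q = ob C"
  and factor_hom: "hom Q A B = mc ` hom C A B"
  and factor_idm [simp]: "idm Q A = mc (idm C A)"
  and factor_zero [simp]: "zero Q A B = mc (zero C A B)"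
  unfolding factor_cat_def by simp_all

lemma mc_hom: "f \<in> hom C A B \<Longrightarrow> mc f \<in> hom Q A B"
  by (simp add: factor_hom)

lemma factor_homE:
  assumes "F \<in> hom Q A B"
  obtains f where "f \<in> hom C A B" "F = mc f"
  using assms unfolding factor_hom by blast

lemma mc_hom_iff: "f \<in> hom C A B \<Longrightarrow> mc f \<in> hom Q A' B' \<longleftrightarrow> A' = A \<and> B' = B"
  using in_mc mc_self hom_disjoint unfolding factor_hom by blast

text \<open>Composition in \<open>factor_cat\<close> is a union over representatives. All classes
  occurring in it agree and the index sets are nonempty, so the union collapses to a single
  class.\<close>

lemma factor_comp:
  assumes f: "f \<in> hom C A B" and g: "g \<in> hom C B D"
  shows "mc g \<cdot>\<^bsub>Q\<^esub> mc f = mc (g \<cdot> f)"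
proof -
  have "mc (g' \<cdot> f') = mc (g \<cdot> f)" if "g' \<in> mc g" "f' \<in> mc f" for g' f'
    using mc_comp_cong[OF f _ g] that in_mc[OF f] in_mc[OF g] mc_member_eq[OF f] mc_member_eq[OF g] by blast
  then have "(\<Union>g' \<in> mc g. \<Union>f' \<in> mc f. mc (g' \<cdot> f')) = (\<Union>g' \<in> mc g. \<Union>f' \<in> mc f. mc (g \<cdot> f))"
    by (intro SUP_cong refl) simp
  moreover have "mc f \<noteq> {}" "mc g \<noteq> {}" using mc_self[OF f] mc_self[OF g] by blast+
  ultimately show ?thesis unfolding factor_cat_def by simp
qed

lemma factor_add:
  assumes f: "f \<in> hom C A B" and g: "g \<in> hom C A B"
  shows "mc f \<oplus>\<^bsub>Q\<^esub> mc g = mc (f \<oplus> g)"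
proof -
  have "mc (f' \<oplus> g') = mc (f \<oplus> g)" if "g' \<in> mc g" "f' \<in> mc f" for g' f'
    using mc_add_cong[OF f _ g] that in_mc[OF f] in_mc[OF g] mc_member_eq[OF f] mc_member_eq[OF g] by blast
  then have "(\<Union>f' \<in> mc f. \<Union>g' \<in> mc g. mc (f' \<oplus> g')) = (\<Union>f' \<in> mc f. \<Union>g' \<in> mc g. mc (f \<oplus> g))"
    by (intro SUP_cong refl) simp
  moreover have "mc f \<noteq> {}" "mc g \<noteq> {}" using mc_self[OF f] mc_self[OF g] by blast+
  ultimately show ?thesis unfolding factor_cat_def by simp
qed

lemma factor_neg:
  assumes f: "f \<in> hom C A B"
  shows "\<ominus>\<^bsub>Q\<^esub> mc f = mc (\<ominus> f)"
proof -
  have "mc (\<ominus> f') = mc (\<ominus> f)" if "f' \<in> mc f" for f'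
    using mc_neg_cong[OF f] that in_mc[OF f] mc_member_eq[OF f] by blast
  then have "(\<Union>f' \<in> mc f. mc (\<ominus> f')) = (\<Union>f' \<in> mc f. mc (\<ominus> f))"
    by (intro SUP_cong refl) simp
  moreover have "mc f \<noteq> {}" using mc_self[OF f] by blast
  ultimately show ?thesis unfolding factor_cat_def by simp
qed

lemmas factor_ops = factor_comp factor_add factor_neg

lemma factor_biproduct:
  assumes "biproduct C A B P i j p q"
  shows "biproduct Q A B P (mc i) (mc j) (mc p) (mc q)"
proof -
  note b = assms[unfolded biproduct_def]
  then have h: "i \<in> hom C A P" "j \<in> hom C B P" "p \<in> hom C P A" "q \<in> hom C P B" by blast+
  show ?thesis unfolding biproduct_def
    using b h mc_hom[OF h(1)] mc_hom[OF h(2)] mc_hom[OF h(3)] mc_hom[OF h(4)]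
      factor_comp[OF h(1,3)] factor_comp[OF h(2,4)] factor_comp[OF h(1,4)] factor_comp[OF h(2,3)]
      factor_comp[OF h(3,1)] factor_comp[OF h(4,2)]
      factor_add[OF comp_hom[OF h(3,1)] comp_hom[OF h(4,2)]] by simp
qed

lemma factor_zero_object: "zero_object C Z \<Longrightarrow> zero_object Q Z"
  unfolding zero_object_def by simp

sublocale factor: additive_category Q
proof (unfold_locales, goal_cases)
  case 1 then show ?case by (auto elim!: factor_homE simp: hom_iff)
next
  case 2 then show ?case by (metis factor_homE mc_hom_iff)
next
  case 3 then show ?case by (simp add: mc_hom idm_hom)
next
  case 4 then show ?case by (auto elim!: factor_homE simp: factor_ops comp_hom mc_hom)
next
  case 5 then show ?case by (auto elim!: factor_homE simp: factor_comp[OF idm_hom] hom_ob comp_idm)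
next
  case 6 then show ?case by (auto elim!: factor_homE simp: factor_comp[OF _ idm_hom] hom_ob idm_comp)
next
  case (7 F A B G D H E)
  then obtain f g h where "f \<in> hom C A B" "F = mc f" "g \<in> hom C B D" "G = mc g" "h \<in> hom C D E" "H = mc h"
    by (auto elim!: factor_homE)
  then show ?case
    by (simp add: factor_comp[of f A B g D] factor_comp[of g B D h E] factor_comp[of f A B "h \<cdot> g" E]
      factor_comp[of "g \<cdot> f" A D h E] comp_hom[of f A B g D] comp_hom[of g B D h E] comp_assoc)
next
  case 8 then show ?case by (auto elim!: factor_homE simp: factor_add add_hom mc_hom)
next
  case 9 then show ?case by (simp add: mc_hom zero_hom)
next
  case 10 then show ?case by (auto elim!: factor_homE simp: factor_neg neg_hom mc_hom)
next
  case (11 F A B G H)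
  then obtain f g h where "f \<in> hom C A B" "F = mc f" "g \<in> hom C A B" "G = mc g" "h \<in> hom C A B" "H = mc h"
    by (auto elim!: factor_homE)
  then show ?case
    by (simp add: factor_add[of f A B g] factor_add[of g A B h] factor_add[of "f \<oplus> g" A B h]
      factor_add[of f A B "g \<oplus> h"] add_hom add_assoc)
next
  case (12 F A B G)
  then obtain f g where "f \<in> hom C A B" "F = mc f" "g \<in> hom C A B" "G = mc g"
    by (auto elim!: factor_homE)
  then show ?case using add_commute by (simp add: factor_add)
next
  case (13 F A B)
  then obtain f where f: "f \<in> hom C A B" "F = mc f" by (auto elim!: factor_homE)
  then show ?case using hom_ob[OF f(1)] by (simp add: factor_add[OF f(1) zero_hom] add_zero)
next
  case (14 F A B)
  then obtain f where f: "f \<in> hom C A B" "F = mc f" by (auto elim!: factor_homE)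
  then show ?case using factor_add[OF f(1) neg_hom[OF f(1)]] by (simp add: factor_neg add_neg)
next
  case (15 F A B G D G')
  then obtain f g h where f: "f \<in> hom C A B" "F = mc f" "g \<in> hom C B D" "G = mc g" "h \<in> hom C B D" "G' = mc h"
    by (auto elim!: factor_homE)
  then show ?case
    by (simp add: factor_comp factor_add comp_hom[OF f(1)] add_hom comp_add_left
      factor_comp[OF f(1) add_hom[OF f(3,5)]] factor_add[OF comp_hom[OF f(1,3)] comp_hom[OF f(1,5)]])
next
  case (16 F A B F' G D)
  then obtain f h g where f: "f \<in> hom C A B" "F = mc f" "h \<in> hom C A B" "F' = mc h" "g \<in> hom C B D" "G = mc g"
    by (auto elim!: factor_homE)
  then show ?case
    by (simp add: factor_comp factor_add comp_add_right
      factor_comp[OF add_hom[OF f(1,3)] f(5)] factor_add[OF comp_hom[OF f(1,5)] comp_hom[OF f(3,5)]])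
next
  case 17 then show ?case using zero_object_ex factor_zero_object by blast
next
  case (18 A B)
  then show ?case using biproduct_ex[of A B] factor_biproduct by fastforce
qed

text \<open>If the defect factors through W in X as b a, then A is a genuine retract of the
  biproduct of P and W, with components (s, a) and (r, b). This brings statements modulo X back to
  membership in T.\<close>

lemma retract_mod:
  assumes U: "subcategory C U" "X \<subseteq> U" and sp: "idempotents_split C"
    and P: "P \<in> U" and s: "s \<in> hom C A P" and r: "r \<in> hom C P A" and d: "ft A A (idm C A \<oplus> \<ominus> (r \<cdot> s))"
  shows "A \<in> U"
proof -
  obtain W a b where w: "W \<in> X" "a \<in> hom C A W" "b \<in> hom C W A" "idm C A \<oplus> \<ominus> (r \<cdot> s) = b \<cdot> a"
    using d by (rule ftE)
  have ob: "P \<in> ob C" "W \<in> ob C" "A \<in> ob C" using s w by (simp_all add: hom_iff)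
  obtain V i j p q where V: "biproduct C P W V i j p q" using biproduct_ex ob by meson
  then have "V \<in> U" using subcategoryD(4)[OF U(1) V] P U(2) w(1) by blast
  have v: "i \<in> hom C P V" "j \<in> hom C W V" "p \<in> hom C V P" "q \<in> hom C V W"
    "p \<cdot> i = idm C P" "q \<cdot> j = idm C W" "p \<cdot> j = zero C W P" "q \<cdot> i = zero C P W"
    using V[unfolded biproduct_def] by blast+
  note x = comp_extend1_arr[OF v(5,3,1)] comp_extend1_arr[OF v(6,4,2)]
    comp_extend1_arr[OF v(7,3,2)] comp_extend1_arr[OF v(8,4,1)]
  let ?s = "(i \<cdot> s) \<oplus> (j \<cdot> a)" and ?r = "(r \<cdot> p) \<oplus> (b \<cdot> q)"
  have sr: "?s \<in> hom C A V" "?r \<in> hom C V A" using v s r w by (simp_all add: hom_iff)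
  have "?r \<cdot> ?s = (r \<cdot> s) \<oplus> (b \<cdot> a)" using v s r w(2,3) x by (simp add: hom_iff distrib_arr)
  also have "\<dots> = idm C A" unfolding w(4)[symmetric]
    using s r ob add_left_commute_arr[of "r \<cdot> s" "idm C A" "\<ominus> (r \<cdot> s)"] by (simp add: hom_iff)
  finally obtain B j' q' where "biproduct C A B V ?s j' ?r q'"
    using biproduct_of_retract[OF sp sr] by blast
  then show ?thesis using subcategoryD(4)[OF U(1)] \<open>V \<in> U\<close> by blast
qed

lemma factor_retract:
  assumes U: "subcategory C U" "X \<subseteq> U" and sp: "idempotents_split C"
    and P: "P \<in> U" and s: "s \<in> hom Q A P" and r: "r \<in> hom Q P A" and rs: "r \<cdot>\<^bsub>Q\<^esub> s = idm Q A"
  shows "A \<in> U"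
proof -
  obtain s' r' where h: "s' \<in> hom C A P" "s = mc s'" "r' \<in> hom C P A" "r = mc r'"
    using s r by (auto elim!: factor_homE)
  have "mc (idm C A) = mc (r' \<cdot> s')" using rs h by (simp add: factor_comp)
  then have "ft A A (idm C A \<oplus> \<ominus> (r' \<cdot> s'))"
    using mc_eq[of "idm C A" A A "r' \<cdot> s'"] h by (simp add: hom_iff)
  then show ?thesis using retract_mod[OF U sp P h(1,3)] by blast
qed

lemma factor_isomorphic:
  assumes "subcategory C U" "X \<subseteq> U" "idempotents_split C" "A \<in> U" "isomorphic Q A B"
  shows "B \<in> U"
  using assms(5) factor_retract[OF assms(1-4)] unfolding isomorphic_def is_iso_def by metis

lemma factor_subcategory:
  assumes U: "subcategory C U" "X \<subseteq> U" and sp: "idempotents_split C"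
  shows "subcategory Q U"
  unfolding subcategory_def
proof (intro conjI allI impI)
  show "U \<subseteq> ob Q" using subcategoryD(1)[OF U(1)] by simp
  show "\<exists>Z \<in> U. zero_object Q Z" using subcategoryD(2)[OF U(1)] factor_zero_object by blast
  show "B \<in> U" if "A \<in> U \<and> isomorphic Q A B" for A B
    using that factor_isomorphic[OF U sp] by blast
  fix A B P i j p q
  assume b: "biproduct Q A B P i j p q"
  show "P \<in> U \<longleftrightarrow> A \<in> U \<and> B \<in> U"
  proof (intro iffI conjI)
    assume "P \<in> U"
    then show "A \<in> U" "B \<in> U"
      using b factor_retract[OF U sp \<open>P \<in> U\<close>] unfolding biproduct_def by blast+
  next
    assume AB: "A \<in> U \<and> B \<in> U"
    then have "A \<in> ob C" "B \<in> ob C" using subcategoryD(1)[OF U(1)] by blast+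
    then obtain W i' j' p' q' where w: "biproduct C A B W i' j' p' q'" using biproduct_ex by meson
    then have "W \<in> U" using AB subcategoryD(4)[OF U(1)] by blast
    \<comment> \<open>A biproduct formed in T is also one in the factor category, hence isomorphic
      there to the given one, and U is closed under isomorphism modulo X.\<close>
    have wq: "biproduct Q A B W (mc i') (mc j') (mc p') (mc q')" using factor_biproduct[OF w] .
    have "isomorphic Q W P" using factor.biproducts_isomorphic[OF wq b] .
    then show "P \<in> U" using factor_isomorphic[OF U sp \<open>W \<in> U\<close>] by blast
  qed
qed

end

section \<open>Full subcategories\<close>

lemma full_subcat_simps [simp]:
  "ob (full_subcat C Y) = Y" "idm (full_subcat C Y) = idm C" "comp (full_subcat C Y) = comp C"
  "add (full_subcat C Y) = add C" "neg (full_subcat C Y) = neg C" "zero (full_subcat C Y) = zero C"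
  unfolding full_subcat_def by simp_all

lemma full_subcat_hom: "f \<in> hom (full_subcat C Y) A B \<longleftrightarrow> A \<in> Y \<and> B \<in> Y \<and> f \<in> hom C A B"
  unfolding full_subcat_def by auto

lemma full_subcat_is_iso:
  "is_iso (full_subcat C Y) A B f \<longleftrightarrow> A \<in> Y \<and> B \<in> Y \<and> is_iso C A B f"
  unfolding is_iso_def by (auto simp: full_subcat_hom)

lemma full_subcat_biproduct:
  "biproduct (full_subcat C Y) A B P i j p q \<longleftrightarrow> A \<in> Y \<and> B \<in> Y \<and> P \<in> Y \<and> biproduct C A B P i j p q"
  unfolding biproduct_def by (auto simp: full_subcat_hom)

lemma (in additive_category) full_subcat_additive:
  assumes Y: "subcategory C Y"
  shows "additive_category (full_subcat C Y)"
proof -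
  note Yob = subcategoryD(1)[OF Y]
  have ob: "A \<in> Y \<Longrightarrow> A \<in> ob C" for A using Yob by blast
  show ?thesis
  proof (unfold_locales, goal_cases)
    case (18 A B)
    then show ?case
      using biproduct_ex[of A B] subcategoryD(4)[OF Y] ob full_subcat_biproduct[of C Y] by (metis full_subcat_simps(1))
  next
    case 17
    then show ?case using subcategoryD(2)[OF Y] ob by (auto simp: zero_object_def)
  qed (use ob in \<open>auto simp: full_subcat_hom comp_add_left comp_add_right comp_assoc comp_idm
      idm_comp add_assoc add_zero add_neg
      intro: comp_hom idm_hom add_hom neg_hom zero_hom add_commute dest: hom_disjoint\<close>)
qed

section \<open>Triangles up to isomorphism\<close>

context category
begin

lemma triangle_isoI:
  assumes "triangle_shape C S A B D f g h" "triangle_shape C S A' B' D' f' g' h'"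
    "is_iso C A A' a" "is_iso C B B' b" "is_iso C D D' d"
    "f' \<cdot> a = b \<cdot> f" "g' \<cdot> b = d \<cdot> g" "h' \<cdot> d = far S a \<cdot> h"
  shows "triangle_iso C S (f, g, h) (f', g', h')"
  using assms unfolding triangle_iso_def prod.case
  by (rule_tac x = A in exI, rule_tac x = B in exI, rule_tac x = D in exI,
      rule_tac x = A' in exI, rule_tac x = B' in exI, rule_tac x = D' in exI,
      rule_tac x = a in exI, rule_tac x = b in exI, rule_tac x = d in exI) simp

lemma triangle_isoE:
  assumes iso: "triangle_iso C S (f, g, h) (f', g', h')"
  obtains A B D A' B' D' a b d where
    "triangle_shape C S A B D f g h" "triangle_shape C S A' B' D' f' g' h'"
    "is_iso C A A' a" "is_iso C B B' b" "is_iso C D D' d"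
    "f' \<cdot> a = b \<cdot> f" "g' \<cdot> b = d \<cdot> g" "h' \<cdot> d = far S a \<cdot> h"
  using iso unfolding triangle_iso_def prod.case by (elim exE conjE)

lemma triangle_shape_unique:
  assumes "triangle_shape C S A B D f g h" "triangle_shape C S A' B' D' f g h"
  shows "A' = A \<and> B' = B \<and> D' = D"
  using assms unfolding triangle_shape_def by (auto simp: hom_iff)

lemma triangle_iso_refl:
  assumes S: "is_functor C C S" and sh: "triangle_shape C S A B D f g h"
  shows "triangle_iso C S (f, g, h) (f, g, h)"
proof -
  have ob: "A \<in> ob C" "B \<in> ob C" "D \<in> ob C" using sh unfolding triangle_shape_def by (auto simp: hom_iff)
  show ?thesis
    by (rule triangle_isoI[OF sh sh is_iso_idm[OF ob(1)] is_iso_idm[OF ob(2)] is_iso_idm[OF ob(3)]])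
      (use sh functor_idm[OF S ob(1)] in \<open>auto simp: triangle_shape_def hom_iff\<close>)
qed

lemma triangle_iso_trans:
  assumes S: "is_functor C C S" and 1: "triangle_iso C S t t'" and 2: "triangle_iso C S t' t''"
  shows "triangle_iso C S t t''"
proof -
  obtain f g h f' g' h' f'' g'' h'' where t: "t = (f, g, h)" "t' = (f', g', h')" "t'' = (f'', g'', h'')"
    by (metis prod_cases3)
  obtain A B D A' B' D' a b d where
    s: "triangle_shape C S A B D f g h" "triangle_shape C S A' B' D' f' g' h'"
    and i: "is_iso C A A' a" "is_iso C B B' b" "is_iso C D D' d"
    and e: "f' \<cdot> a = b \<cdot> f" "g' \<cdot> b = d \<cdot> g" "h' \<cdot> d = far S a \<cdot> h"
    using triangle_isoE[OF 1[unfolded t]] by blast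
  obtain A1 B1 D1 A2 B2 D2 a' b' d' where
    s1: "triangle_shape C S A1 B1 D1 f' g' h'" and s2: "triangle_shape C S A2 B2 D2 f'' g'' h''"
    and i1: "is_iso C A1 A2 a'" "is_iso C B1 B2 b'" "is_iso C D1 D2 d'"
    and e': "f'' \<cdot> a' = b' \<cdot> f'" "g'' \<cdot> b' = d' \<cdot> g'" "h'' \<cdot> d' = far S a' \<cdot> h'"
    using triangle_isoE[OF 2[unfolded t]] by blast
  have i': "is_iso C A' A2 a'" "is_iso C B' B2 b'" "is_iso C D' D2 d'"
    using triangle_shape_unique[OF s(2) s1] i1 by simp_all
  note h = is_iso_hom[OF i(1)] is_iso_hom[OF i(2)] is_iso_hom[OF i(3)]
    is_iso_hom[OF i'(1)] is_iso_hom[OF i'(2)] is_iso_hom[OF i'(3)]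
  note Sh = functor_hom[OF S h(1)] functor_hom[OF S h(4)]
  have s': "f \<in> hom C A B" "g \<in> hom C B D" "h \<in> hom C D (fob S A)" "f' \<in> hom C A' B'" "g' \<in> hom C B' D'"
      "h' \<in> hom C D' (fob S A')" "f'' \<in> hom C A2 B2" "g'' \<in> hom C B2 D2" "h'' \<in> hom C D2 (fob S A2)"
    using s s2 unfolding triangle_shape_def by blast+
  show ?thesis unfolding t
  proof (rule triangle_isoI[OF s(1) s2 is_iso_comp[OF i(1) i'(1)] is_iso_comp[OF i(2) i'(2)]
        is_iso_comp[OF i(3) i'(3)]])
    show "f'' \<cdot> (a' \<cdot> a) = b' \<cdot> b \<cdot> f"
      using comp_extend_arr[OF e'(1) s'(7) h(4) h(5) s'(4), of a] h s' e(1) by (simp add: hom_iff)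
    show "g'' \<cdot> (b' \<cdot> b) = d' \<cdot> d \<cdot> g"
      using comp_extend_arr[OF e'(2) s'(8) h(5) h(6) s'(5), of b] h s' e(2) by (simp add: hom_iff)
    show "h'' \<cdot> (d' \<cdot> d) = far S (a' \<cdot> a) \<cdot> h"
      using comp_extend_arr[OF e'(3) s'(9) h(6) Sh(2) s'(6), of d] h s' Sh e(3)
        functor_comp[OF S h(1) h(4)] by (simp add: hom_iff)
  qed
qed

end

text \<open>A class of model triangles whose closure under isomorphism is the class of triangles.\<close>

locale triangle_basis = additive_category C
  for C :: "('o, 'm, 'z) acat_scheme" (structure) +
  fixes S :: "('o, 'm, 'o, 'm) fctr"
    and \<Delta>\<^sub>0 :: "('m \<times> 'm \<times> 'm) set"
  assumes basis_additive: "is_additive_functor C C S"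
    and basis_equivalence: "is_equivalence C C S"
    and basis_shape: "(f, g, h) \<in> \<Delta>\<^sub>0 \<Longrightarrow> \<exists>A B D. triangle_shape C S A B D f g h"
    and basis_idm: "A \<in> ob C \<Longrightarrow> zero_object C Z \<Longrightarrow>
      \<exists>t \<in> \<Delta>\<^sub>0. triangle_iso C S t (idm C A, zero C A Z, zero C Z (fob S A))"
    and basis_completion: "f \<in> hom C A B \<Longrightarrow> \<exists>g h. (f, g, h) \<in> \<Delta>\<^sub>0"
    and basis_rotate: "triangle_shape C S A B D f g h \<Longrightarrow> (f, g, h) \<in> \<Delta>\<^sub>0 \<Longrightarrow>
      \<exists>t \<in> \<Delta>\<^sub>0. triangle_iso C S t (g, h, \<ominus> far S f)"
    and basis_extend: "(f, g, h) \<in> \<Delta>\<^sub>0 \<Longrightarrow> (f', g', h') \<in> \<Delta>\<^sub>0 \<Longrightarrow>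
      triangle_shape C S A B D f g h \<Longrightarrow> triangle_shape C S A' B' D' f' g' h' \<Longrightarrow>
      a \<in> hom C A A' \<Longrightarrow> b \<in> hom C B B' \<Longrightarrow> f' \<cdot> a = b \<cdot> f \<Longrightarrow>
      \<exists>d \<in> hom C D D'. g' \<cdot> b = d \<cdot> g \<and> h' \<cdot> d = far S a \<cdot> h"
begin

definition iso_closure :: "('m \<times> 'm \<times> 'm) set" where
  "iso_closure = {t. \<exists>t\<^sub>0 \<in> \<Delta>\<^sub>0. triangle_iso C S t\<^sub>0 t}"

lemma basis_functor: "is_functor C C S"
  using basis_additive unfolding is_additive_functor_def by blast

lemma closure_rotate:
  assumes s: "triangle_shape C S A B D f g h" and t: "(f, g, h) \<in> iso_closure"
  shows "(g, h, \<ominus> far S f) \<in> iso_closure"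
proof -
  obtain t0 where t0: "t0 \<in> \<Delta>\<^sub>0" and iso: "triangle_iso C S t0 (f, g, h)"
    using t unfolding iso_closure_def by blast
  obtain f0 g0 h0 where t0_eq: "t0 = (f0, g0, h0)" by (metis prod_cases3)
  obtain A0 B0 D0 A' B' D' a b d where
    s0: "triangle_shape C S A0 B0 D0 f0 g0 h0" and s': "triangle_shape C S A' B' D' f g h"
    and i': "is_iso C A0 A' a" "is_iso C B0 B' b" "is_iso C D0 D' d"
    and e: "f \<cdot> a = b \<cdot> f0" "g \<cdot> b = d \<cdot> g0" "h \<cdot> d = far S a \<cdot> h0"
    using triangle_isoE[OF iso[unfolded t0_eq]] by blast
  have i: "is_iso C A0 A a" "is_iso C B0 B b" "is_iso C D0 D d"
    using triangle_shape_unique[OF s s'] i' by simp_all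
  note hh = is_iso_hom[OF i(1)] is_iso_hom[OF i(2)] is_iso_hom[OF i(3)]
  have H: "f \<in> hom C A B" "g \<in> hom C B D" "h \<in> hom C D (fob S A)"
      "f0 \<in> hom C A0 B0" "g0 \<in> hom C B0 D0" "h0 \<in> hom C D0 (fob S A0)"
    using s s0 unfolding triangle_shape_def by blast+
  note SH = functor_hom[OF basis_functor H(1)] functor_hom[OF basis_functor H(4)]
    functor_hom[OF basis_functor hh(1)] functor_hom[OF basis_functor hh(2)]
  have "far S f \<cdot> far S a = far S b \<cdot> far S f0"
    using e(1) functor_comp[OF basis_functor hh(1) H(1)] functor_comp[OF basis_functor H(4) hh(2)] by simp
  then have "triangle_iso C S (g0, h0, \<ominus> far S f0) (g, h, \<ominus> far S f)"
    by (intro triangle_isoI[OF _ _ i(2,3) functor_is_iso[OF basis_functor i(1)]])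
      (use H SH e in \<open>auto simp: triangle_shape_def hom_iff\<close>)
  moreover obtain t1 where "t1 \<in> \<Delta>\<^sub>0" "triangle_iso C S t1 (g0, h0, \<ominus> far S f0)"
    using basis_rotate[OF s0] t0 t0_eq by blast
  ultimately show ?thesis
    unfolding iso_closure_def using triangle_iso_trans[OF basis_functor] by blast
qed

text \<open>The square is carried to the model triangles along the given isomorphisms, extended
  there, and the third component is conjugated back.\<close>

lemma closure_extend:
  assumes t: "(f, g, h) \<in> iso_closure" and t': "(f', g', h') \<in> iso_closure"
    and s: "triangle_shape C S A B D f g h" and s': "triangle_shape C S A' B' D' f' g' h'"
    and a: "a \<in> hom C A A'" and b: "b \<in> hom C B B'" and eq: "f' \<cdot> a = b \<cdot> f"
  shows "\<exists>d \<in> hom C D D'. g' \<cdot> b = d \<cdot> g \<and> h' \<cdot> d = far S a \<cdot> h"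
proof -
  obtain f0 g0 h0 where t0: "(f0, g0, h0) \<in> \<Delta>\<^sub>0" and iso: "triangle_iso C S (f0, g0, h0) (f, g, h)"
    using t unfolding iso_closure_def by auto
  obtain f1 g1 h1 where t1: "(f1, g1, h1) \<in> \<Delta>\<^sub>0" and iso1: "triangle_iso C S (f1, g1, h1) (f', g', h')"
    using t' unfolding iso_closure_def by auto
  obtain A0 B0 D0 A2 B2 D2 x y z where
    s0: "triangle_shape C S A0 B0 D0 f0 g0 h0" and s2: "triangle_shape C S A2 B2 D2 f g h"
    and i2: "is_iso C A0 A2 x" "is_iso C B0 B2 y" "is_iso C D0 D2 z"
    and e: "f \<cdot> x = y \<cdot> f0" "g \<cdot> y = z \<cdot> g0" "h \<cdot> z = far S x \<cdot> h0"
    using triangle_isoE[OF iso] by blast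
  have i: "is_iso C A0 A x" "is_iso C B0 B y" "is_iso C D0 D z"
    using triangle_shape_unique[OF s s2] i2 by simp_all
  obtain A1 B1 D1 A2 B2 D2 x' y' z' where
    s1: "triangle_shape C S A1 B1 D1 f1 g1 h1" and s2: "triangle_shape C S A2 B2 D2 f' g' h'"
    and i3: "is_iso C A1 A2 x'" "is_iso C B1 B2 y'" "is_iso C D1 D2 z'"
    and e': "f' \<cdot> x' = y' \<cdot> f1" "g' \<cdot> y' = z' \<cdot> g1" "h' \<cdot> z' = far S x' \<cdot> h1"
    using triangle_isoE[OF iso1] by blast
  have i1: "is_iso C A1 A' x'" "is_iso C B1 B' y'" "is_iso C D1 D' z'"
    using triangle_shape_unique[OF s' s2] i3 by simp_all
  have H: "f \<in> hom C A B" "g \<in> hom C B D" "h \<in> hom C D (fob S A)"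
      "f0 \<in> hom C A0 B0" "g0 \<in> hom C B0 D0" "h0 \<in> hom C D0 (fob S A0)"
    using s s0 unfolding triangle_shape_def by blast+
  have H': "f' \<in> hom C A' B'" "g' \<in> hom C B' D'" "h' \<in> hom C D' (fob S A')"
      "f1 \<in> hom C A1 B1" "g1 \<in> hom C B1 D1" "h1 \<in> hom C D1 (fob S A1)"
    using s' s1 unfolding triangle_shape_def by blast+
  note hh = is_iso_hom[OF i(1)] is_iso_hom[OF i(2)] is_iso_hom[OF i(3)]
    is_iso_hom[OF i1(1)] is_iso_hom[OF i1(2)] is_iso_hom[OF i1(3)]
  obtain u where u: "u \<in> hom C A' A1" "u \<cdot> x' = idm C A1" "x' \<cdot> u = idm C A'" using i1(1) by (metis is_isoE)
  obtain v where v: "v \<in> hom C B' B1" "v \<cdot> y' = idm C B1" "y' \<cdot> v = idm C B'" using i1(2) by (metis is_isoE)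
  obtain y1 where y1: "y1 \<in> hom C B B0" "y1 \<cdot> y = idm C B0" "y \<cdot> y1 = idm C B" using i(2) by (metis is_isoE)
  obtain z1 where z1: "z1 \<in> hom C D D0" "z1 \<cdot> z = idm C D0" "z \<cdot> z1 = idm C D" using i(3) by (metis is_isoE)
  note homs = H H' hh a b u(1) v(1) y1(1) z1(1)
  have fu: "f1 \<cdot> u = v \<cdot> f'"
  proof -
    have "v \<cdot> (y' \<cdot> (f1 \<cdot> u)) = v \<cdot> f'"
      using comp_extend_arr[OF e'(1) H'(1) hh(4) hh(5) H'(4), of u] u(3) homs by (simp add: hom_iff)
    then show ?thesis using comp_extend1_arr[OF v(2,1) hh(5), of "f1 \<cdot> u"] homs by (simp add: hom_iff)
  qed
  have sq: "f1 \<cdot> (u \<cdot> (a \<cdot> x)) = (v \<cdot> (b \<cdot> y)) \<cdot> f0"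
    using comp_extend_arr[OF fu H'(4) u(1) v(1) H'(1), of "a \<cdot> x"]
      comp_extend_arr[OF eq H'(1) a b H(1), of x] e(1) homs by (simp add: hom_iff)
  obtain d0 where d0: "d0 \<in> hom C D0 D1" "g1 \<cdot> (v \<cdot> (b \<cdot> y)) = d0 \<cdot> g0"
      "h1 \<cdot> d0 = far S (u \<cdot> (a \<cdot> x)) \<cdot> h0"
    using basis_extend[OF t0 t1 s0 s1 _ _ sq] homs by (auto simp: hom_iff)
  note SH = functor_hom[OF basis_functor hh(1)] functor_hom[OF basis_functor hh(4)]
    functor_hom[OF basis_functor a] functor_hom[OF basis_functor u(1)]
  have "far S (u \<cdot> (a \<cdot> x)) = far S u \<cdot> (far S a \<cdot> far S x)"
    using functor_comp[OF basis_functor comp_hom[OF hh(1) a] u(1)] functor_comp[OF basis_functor hh(1) a]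
    by simp
  moreover have SS: "far S x' \<cdot> far S u = idm C (fob S A')"
    using functor_comp[OF basis_functor u(1) hh(4)] u(3) functor_idm[OF basis_functor, of A'] homs
    by (simp add: hom_iff)
  ultimately have Su: "far S x' \<cdot> (far S (u \<cdot> (a \<cdot> x)) \<cdot> h0) = far S a \<cdot> (far S x \<cdot> h0)"
    using comp_extend1_arr[OF SS SH(2,4), of "far S a \<cdot> (far S x \<cdot> h0)"] SH homs by (simp add: hom_iff)
  have "g' \<cdot> b = (z' \<cdot> (d0 \<cdot> z1)) \<cdot> g"
  proof -
    have "z1 \<cdot> g = g0 \<cdot> y1"
    proof -
      have "z1 \<cdot> (z \<cdot> (g0 \<cdot> y1)) = z1 \<cdot> g"
        using comp_extend_arr[OF e(2) H(2) hh(2) hh(3) H(5), of y1] y1(3) homs by (simp add: hom_iff)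
      then show ?thesis using comp_extend1_arr[OF z1(2,1) hh(3), of "g0 \<cdot> y1"] homs by (simp add: hom_iff)
    qed
    then have "(z' \<cdot> (d0 \<cdot> z1)) \<cdot> g = z' \<cdot> (d0 \<cdot> (g0 \<cdot> y1))" using homs d0(1) by (simp add: hom_iff)
    also have "\<dots> = z' \<cdot> (g1 \<cdot> (v \<cdot> b))"
      using comp_extend1_arr[OF d0(2)[symmetric] d0(1) H(5), of y1] y1(3) homs by (simp add: hom_iff)
    also have "\<dots> = g' \<cdot> (y' \<cdot> (v \<cdot> b))"
      using comp_extend_arr[OF e'(2) H'(2) hh(5) hh(6) H'(5), of "v \<cdot> b"] homs by (simp add: hom_iff)
    also have "\<dots> = g' \<cdot> b" using comp_extend1_arr[OF v(3) hh(5) v(1), of b] homs by (simp add: hom_iff)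
    finally show ?thesis by simp
  qed
  moreover have "h' \<cdot> (z' \<cdot> (d0 \<cdot> z1)) = far S a \<cdot> h"
  proof -
    have "h' \<cdot> (z' \<cdot> (d0 \<cdot> z1)) = far S x' \<cdot> (h1 \<cdot> (d0 \<cdot> z1))"
      using comp_extend_arr[OF e'(3) H'(3) hh(6) SH(2) H'(6), of "d0 \<cdot> z1"] homs d0(1) by (simp add: hom_iff)
    also have "\<dots> = (far S x' \<cdot> (h1 \<cdot> d0)) \<cdot> z1" using homs SH d0(1) by (simp add: hom_iff)
    also have "\<dots> = (far S a \<cdot> (h \<cdot> z)) \<cdot> z1" unfolding d0(3) Su e(3) ..
    also have "\<dots> = far S a \<cdot> h" using homs SH z1(3) by (simp add: hom_iff)
    finally show ?thesis .
  qed
  ultimately show ?thesis using homs d0(1) by (intro bexI[of _ "z' \<cdot> (d0 \<cdot> z1)"]) (auto simp: hom_iff)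
qed

lemma weak_triangulated: "weak_triangulated_category C S iso_closure"
proof (unfold_locales, goal_cases)
  case 1 show ?case by (rule basis_additive)
next
  case 2 show ?case by (rule basis_equivalence)
next
  case (3 f g h) then show ?case unfolding iso_closure_def triangle_iso_def by (auto; blast)
next
  case (4 t t') then show ?case
    unfolding iso_closure_def using triangle_iso_trans[OF basis_functor] by blast
next
  case 5 then show ?case unfolding iso_closure_def using basis_idm by blast
next
  case (6 f A B)
  then obtain g h where t: "(f, g, h) \<in> \<Delta>\<^sub>0" using basis_completion by blast
  then obtain A' B' D' where "triangle_shape C S A' B' D' f g h" using basis_shape by blast
  then show ?case unfolding iso_closure_def using t triangle_iso_refl[OF basis_functor] by blast
next
  case 7 then show ?case by (rule closure_rotate)
next
  case 8 then show ?case by (rule closure_extend)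
qed

end

section \<open>Approximation triangles\<close>

context linear_triangulated_category
begin

lemma Us_ob [simp]: "A \<in> ob T \<Longrightarrow> fob Us A \<in> ob T"
  using functor_ob[OF unshift_functor] .

lemma Us_arr [simp]:
  assumes "arr f"
  shows "arr (far Us f)" "dm (far Us f) = fob Us (dm f)" "cd (far Us f) = fob Us (cd f)"
  using functor_hom[OF unshift_functor arr_in_hom[OF assms]] by (auto simp: hom_iff)

lemma Sh_Us [simp]: "A \<in> ob T \<Longrightarrow> fob Sh (fob Us A) = A" "arr f \<Longrightarrow> far Sh (far Us f) = f"
  using shift_unshift_ob shift_unshift[OF arr_in_hom] by blast+

lemma Us_Sh [simp]: "A \<in> ob T \<Longrightarrow> fob Us (fob Sh A) = A" "arr f \<Longrightarrow> far Us (far Sh f) = f"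
  using unshift_shift_ob unshift_shift[OF arr_in_hom] by blast+

lemma Sh_preimage:
  assumes "w \<in> hom T (fob Sh A) (fob Sh B)" "A \<in> ob T" "B \<in> ob T"
  obtains v where "v \<in> hom T A B" "far Sh v = w"
  by (rule that[of "far Us w"]) (use assms in \<open>simp_all add: hom_iff\<close>)

text \<open>In a completion of the split monomorphism i the connecting map e vanishes: apply the
  shifted retraction p to \<open>far Sh i \<cdot> e = 0\<close>. The second map is then a split
  epimorphism, and d and \<open>g \<cdot> j\<close> are inverse comparisons of the cone with
  B.\<close>

lemma tri_of_biproduct:
  assumes b: "biproduct T A B P i j p q"
  shows "tri A P B i q (zero T B (fob Sh A))"
proof -
  have h: "i \<in> hom T A P" "j \<in> hom T B P" "p \<in> hom T P A" "q \<in> hom T P B"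
    "p \<cdot> i = idm T A" "q \<cdot> j = idm T B" "p \<cdot> j = zero T B A" "q \<cdot> i = zero T A B"
    "(i \<cdot> p) \<oplus> (j \<cdot> q) = idm T P"
    using b unfolding biproduct_def by blast+
  have ob: "A \<in> ob T" "B \<in> ob T" "P \<in> ob T" using h by (simp_all add: hom_iff)
  obtain D g e where t: "tri A P D i g e" using tri_ex[OF h(1)] .
  note t' = tri_hom[OF t]
  have D: "D \<in> ob T" using t' by (simp add: hom_iff)
  have "far Sh p \<cdot> (far Sh i \<cdot> e) = e"
    using comp_extend1_arr[of "far Sh p" "far Sh i" "idm T (fob Sh A)" "fob Sh P" "fob Sh A" "fob Sh A" e]
      h t' ob by (simp add: hom_iff flip: S_comp)
  then have e0: "e = zero T D (fob Sh A)" using tri_comp_zero3[OF t] h D ob by (simp add: hom_iff)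
  obtain d where d: "d \<in> hom T D B" "d \<cdot> g = q" using tri_factor_through_cone[OF t h(4,8)] .
  have gi: "g \<cdot> i = zero T A D" using tri_comp_zero[OF t] .
  have "g = g \<cdot> ((i \<cdot> p) \<oplus> (j \<cdot> q))" unfolding h(9) using t' by (simp add: hom_iff)
  also have "\<dots> = g \<cdot> (j \<cdot> q)"
    using comp_extend1_arr[OF gi t'(2) h(1), of p] t' h(1-4) ob D by (simp add: hom_iff distrib_arr)
  finally have gjq: "g \<cdot> (j \<cdot> q) = g" by simp
  obtain s where s: "s \<in> hom T D P" "g \<cdot> s = idm T D"
    by (rule tri_lift_to_fibre2[OF t idm_hom[OF D]]) (use e0 D t' in \<open>auto simp: hom_iff\<close>)
  have "(g \<cdot> j) \<cdot> d = idm T D"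
  proof -
    have "((g \<cdot> j) \<cdot> d) \<cdot> g = g" using gjq d t' h by (simp add: hom_iff)
    then have "(((g \<cdot> j) \<cdot> d) \<cdot> g) \<cdot> s = g \<cdot> s" by simp
    then show ?thesis using s t' h(1-4) d(1) by (simp add: hom_iff)
  qed
  moreover have "d \<cdot> (g \<cdot> j) = idm T B"
    using comp_extend1_arr[OF d(2,1) t'(2), of j] h by (simp add: hom_iff)
  ultimately have "is_iso T D B d"
    using d t' h by (intro is_isoI[of _ _ _ "g \<cdot> j"]) (simp_all add: hom_iff)
  then show ?thesis
    by (intro tri_transport[OF t h(1,4) _ is_iso_idm is_iso_idm]) (use d e0 h ob D in \<open>auto simp: hom_iff\<close>)
qed

end

lemma Union_eq_unique: "x \<in> M \<Longrightarrow> (\<And>y. y \<in> M \<Longrightarrow> y = x) \<Longrightarrow> \<Union> M = x"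
  by blast

locale approximation_triangles = linear_triangulated_category T Sh Us \<Delta>
  for T :: "('o, 'm, 'k::field) lincat" (structure)
    and Sh Us :: "('o, 'm, 'o, 'm) fctr"
    and \<Delta> :: "('m \<times> 'm \<times> 'm) set" +
  fixes X :: "'o set" and L R :: "('o, 'm) apx"
  assumes X_subcategory: "subcategory T X"
    and left_choice: "left_apx_choice T Sh Us \<Delta> X L"
    and right_choice: "right_apx_choice T Sh \<Delta> X R"
begin

sublocale additive_subcategory T X
  by unfold_locales (rule X_subcategory)

abbreviation \<Sigma>o :: "'o \<Rightarrow> 'o" where "\<Sigma>o \<equiv> apx_ob L"
abbreviation \<Omega>o :: "'o \<Rightarrow> 'o" where "\<Omega>o \<equiv> apx_ob R"
abbreviation \<Sigma> :: "('o, 'm set, 'o, 'm set) fctr" where "\<Sigma> \<equiv> Sigma_functor T Us X L"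
abbreviation \<Omega> :: "('o, 'm set, 'o, 'm set) fctr" where "\<Omega> \<equiv> Omega_functor T Sh X R"

definition LX :: "'o \<Rightarrow> 'o" where "LX A = cd (apx2 L A)"
definition RX :: "'o \<Rightarrow> 'o" where "RX A = dm (apx2 R A)"

text \<open>Up to sign, \<open>\<delta> A\<close> is the connecting morphism of the triangle \<open>A \<rightarrow> LX A \<rightarrow> \<Sigma>A \<rightarrow> A[1]\<close>.\<close>

definition \<delta> :: "'o \<Rightarrow> 'm" where "\<delta> A = far Sh (apx1 L A)"
abbreviation \<omega> :: "'o \<Rightarrow> 'm" where "\<omega> A \<equiv> apx3 R A"

lemma \<Sigma>o_ob [simp]: "A \<in> ob T \<Longrightarrow> \<Sigma>o A \<in> ob T" and \<Omega>o_ob [simp]: "A \<in> ob T \<Longrightarrow> \<Omega>o A \<in> ob T"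
  using left_choice right_choice unfolding left_apx_choice_def right_apx_choice_def by blast+

lemma L_triangle:
  assumes A: "A \<in> ob T"
  shows "tri (fob Us (\<Sigma>o A)) A (LX A) (apx1 L A) (apx2 L A) (apx3 L A)"
    and "left_approx T X A (LX A) (apx2 L A)"
proof -
  obtain P where P: "triangle_shape T Sh (fob Us (\<Sigma>o A)) A P (apx1 L A) (apx2 L A) (apx3 L A)"
      "(apx1 L A, apx2 L A, apx3 L A) \<in> \<Delta>" "left_approx T X A P (apx2 L A)"
    using left_choice A unfolding left_apx_choice_def by blast
  then have "LX A = P" unfolding LX_def triangle_shape_def by (simp add: hom_iff)
  then show "tri (fob Us (\<Sigma>o A)) A (LX A) (apx1 L A) (apx2 L A) (apx3 L A)"
      "left_approx T X A (LX A) (apx2 L A)"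
    using P unfolding tri_def by simp_all
qed

lemma R_triangle:
  assumes A: "A \<in> ob T"
  shows "tri (\<Omega>o A) (RX A) A (apx1 R A) (apx2 R A) (\<omega> A)"
    and "right_approx T X (RX A) A (apx2 R A)"
proof -
  obtain P where P: "triangle_shape T Sh (\<Omega>o A) P A (apx1 R A) (apx2 R A) (apx3 R A)"
      "(apx1 R A, apx2 R A, apx3 R A) \<in> \<Delta>" "right_approx T X P A (apx2 R A)"
    using right_choice A unfolding right_apx_choice_def by blast
  then have "RX A = P" unfolding RX_def triangle_shape_def by (simp add: hom_iff)
  then show "tri (\<Omega>o A) (RX A) A (apx1 R A) (apx2 R A) (\<omega> A)" "right_approx T X (RX A) A (apx2 R A)"
    using P unfolding tri_def by simp_all
qed

lemma L_hom:
  assumes "A \<in> ob T"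
  shows "apx1 L A \<in> hom T (fob Us (\<Sigma>o A)) A" "apx2 L A \<in> hom T A (LX A)" "apx3 L A \<in> hom T (LX A) (\<Sigma>o A)"
    "LX A \<in> X" "LX A \<in> ob T" "\<delta> A \<in> hom T (\<Sigma>o A) (fob Sh A)"
  using tri_hom[OF L_triangle(1)[OF assms]] L_triangle(2)[OF assms] assms
  unfolding left_approx_def \<delta>_def by (auto simp: hom_iff)

lemma R_hom:
  assumes "A \<in> ob T"
  shows "apx1 R A \<in> hom T (\<Omega>o A) (RX A)" "apx2 R A \<in> hom T (RX A) A" "\<omega> A \<in> hom T A (fob Sh (\<Omega>o A))"
    "RX A \<in> X" "RX A \<in> ob T"
  using tri_hom[OF R_triangle(1)[OF assms]] R_triangle(2)[OF assms]
  unfolding right_approx_def by (auto simp: hom_iff)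

lemma L_approx:
  assumes "P \<in> X" "f \<in> hom T A P"
  obtains g where "g \<in> hom T (LX A) P" "g \<cdot> apx2 L A = f"
  using L_triangle(2)[of A] assms hom_ob unfolding left_approx_def by blast

lemma R_approx:
  assumes "P \<in> X" "f \<in> hom T P A"
  obtains g where "g \<in> hom T P (RX A)" "apx2 R A \<cdot> g = f"
  using R_triangle(2)[of A] assms hom_ob unfolding right_approx_def by blast

section \<open>The connecting maps \<delta> and \<omega> modulo X\<close>

lemma L_triangle_rot: "A \<in> ob T \<Longrightarrow> tri A (LX A) (\<Sigma>o A) (apx2 L A) (apx3 L A) (\<ominus> \<delta> A)"
  using tri_rot[OF L_triangle(1)] by (simp add: \<delta>_def)

text \<open>A map killed by \<delta> lifts to \<open>LX A\<close>, which lies in X. So \<delta> can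
  be cancelled on the left modulo X; \<open>\<delta>_epi\<close> is the corresponding right
  cancellation.\<close>

lemma \<delta>_cancel:
  assumes A: "A \<in> ob T" and w: "w \<in> hom T W (\<Sigma>o A)" and 0: "\<delta> A \<cdot> w = zero T W (fob Sh A)"
  shows "ft W (\<Sigma>o A) w"
proof -
  note h = L_hom[OF A]
  obtain v where "v \<in> hom T W (LX A)" "apx3 L A \<cdot> v = w"
    by (rule tri_lift_to_fibre2[OF L_triangle_rot[OF A] w]) (use 0 w h A in \<open>auto simp: hom_iff\<close>)
  then show ?thesis using ftI[OF h(4), of v W "apx3 L A" "\<Sigma>o A"] h by blast
qed

lemma \<delta>_lift:
  assumes A: "A \<in> ob T" and e: "\<epsilon> \<in> hom T D (fob Sh A)"
    and 0: "far Sh (apx2 L A) \<cdot> \<epsilon> = zero T D (fob Sh (LX A))"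
  obtains w where "w \<in> hom T D (\<Sigma>o A)" "\<delta> A \<cdot> w = \<epsilon>"
proof -
  note h = L_hom[OF A]
  obtain v where v: "v \<in> hom T D (\<Sigma>o A)" "(\<ominus> \<delta> A) \<cdot> v = \<epsilon>"
    using tri_lift_to_fibre3[OF L_triangle_rot[OF A] e 0] .
  show thesis by (rule that[of "\<ominus> v"]) (use v h in \<open>auto simp: hom_iff\<close>)
qed

lemma \<delta>_epi:
  assumes f: "f \<in> hom T A B" and 0: "far Sh f \<cdot> \<delta> A = zero T (\<Sigma>o A) (fob Sh B)"
  shows "ft A B f"
proof -
  have ob: "A \<in> ob T" "B \<in> ob T" using f by (simp_all add: hom_iff)
  note h = L_hom[OF ob(1)]
  have "far Sh (f \<cdot> apx1 L A) = far Sh (zero T (fob Us (\<Sigma>o A)) B)"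
    using 0 f h ob by (simp add: \<delta>_def hom_iff)
  then have "f \<cdot> apx1 L A = zero T (fob Us (\<Sigma>o A)) B"
    using S_faithful[OF comp_hom[OF h(1) f]] ob by (simp add: hom_iff)
  then obtain v where "v \<in> hom T (LX A) B" "v \<cdot> apx2 L A = f"
    using tri_factor_through_cone[OF L_triangle(1)[OF ob(1)] f] by blast
  then show ?thesis using ftI[OF h(4) h(2)] by metis
qed

text \<open>The approximation property is what counts here: the part of f that ends in X extends
  over \<open>apx2 L A\<close>, and \<open>apx2 L A \<cdot> apx1 L A\<close> is zero.\<close>

lemma ft_apx1:
  assumes "ft A B f"
  shows "f \<cdot> apx1 L A = zero T (fob Us (\<Sigma>o A)) B"
proof -
  obtain P a b where p: "P \<in> X" "a \<in> hom T A P" "b \<in> hom T P B" "f = b \<cdot> a" using assms by (rule ftE)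
  have ob: "A \<in> ob T" "B \<in> ob T" "P \<in> ob T" using p by (simp_all add: hom_iff)
  obtain g where g: "g \<in> hom T (LX A) P" "g \<cdot> apx2 L A = a" using L_approx[OF p(1,2)] .
  note h = L_hom[OF ob(1)]
  have "f \<cdot> apx1 L A = b \<cdot> (g \<cdot> (apx2 L A \<cdot> apx1 L A))"
    unfolding p(4) g(2)[symmetric] using g(1) p(3) h by (simp add: hom_iff)
  then show ?thesis using tri_comp_zero[OF L_triangle(1)[OF ob(1)]] g(1) p(3) ob by (simp add: hom_iff)
qed

lemma ft_\<delta>:
  assumes "ft A B f"
  shows "far Sh f \<cdot> \<delta> A = zero T (\<Sigma>o A) (fob Sh B)"
proof -
  have f: "f \<in> hom T A B" using ft_hom[OF assms] .
  then have ob: "A \<in> ob T" "B \<in> ob T" by (simp_all add: hom_iff)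
  have "far Sh (f \<cdot> apx1 L A) = zero T (\<Sigma>o A) (fob Sh B)" using ft_apx1[OF assms] ob by simp
  then show ?thesis using f L_hom[OF ob(1)] by (simp add: \<delta>_def hom_iff)
qed

text \<open>Starts the dual series: \<omega> is cancelled on the left because what it kills lifts to
  \<open>RX A\<close>, and on the right because what kills it extends over
  \<open>apx1 R A\<close>.\<close>

lemma \<omega>_mono:
  assumes f: "f \<in> hom T W A" and 0: "\<omega> A \<cdot> f = zero T W (fob Sh (\<Omega>o A))"
  shows "ft W A f"
proof -
  have ob: "A \<in> ob T" using f by (simp add: hom_iff)
  note h = R_hom[OF ob]
  obtain v where "v \<in> hom T W (RX A)" "apx2 R A \<cdot> v = f"
    using tri_lift_to_fibre2[OF R_triangle(1)[OF ob] f 0] .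
  then show ?thesis using ftI[OF h(4) _ h(2)] by metis
qed

lemma \<omega>_cancel:
  assumes A: "A \<in> ob T" and f: "f \<in> hom T (\<Omega>o A) W" and 0: "far Sh f \<cdot> \<omega> A = zero T A (fob Sh W)"
  shows "ft (\<Omega>o A) W f"
proof -
  note h = R_hom[OF A]
  have W: "W \<in> ob T" using f by (simp add: hom_iff)
  have Sf: "far Sh f \<in> hom T (fob Sh (\<Omega>o A)) (fob Sh W)" using f by (simp add: hom_iff)
  obtain v where v: "v \<in> hom T (fob Sh (RX A)) (fob Sh W)" "v \<cdot> far Sh (apx1 R A) = far Sh f"
    using tri_factor_through_cone3[OF R_triangle(1)[OF A] Sf 0] .
  obtain u where u: "u \<in> hom T (RX A) W" "far Sh u = v" using Sh_preimage[OF v(1) h(5) W] .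
  have "far Sh (u \<cdot> apx1 R A) = far Sh f" using u v(2) h by (simp add: hom_iff)
  then have "u \<cdot> apx1 R A = f" using S_faithful[OF comp_hom[OF h(1) u(1)] f] by blast
  then show ?thesis using ftI[OF h(4,1) u(1)] by simp
qed

lemma \<omega>_extend:
  assumes A: "A \<in> ob T" and e: "\<epsilon> \<in> hom T A (fob Sh W)" and W: "W \<in> ob T"
    and 0: "\<epsilon> \<cdot> apx2 R A = zero T (RX A) (fob Sh W)"
  obtains v where "v \<in> hom T (\<Omega>o A) W" "far Sh v \<cdot> \<omega> A = \<epsilon>"
proof -
  obtain w where w: "w \<in> hom T (fob Sh (\<Omega>o A)) (fob Sh W)" "w \<cdot> \<omega> A = \<epsilon>"
    using tri_factor_through_cone2[OF R_triangle(1)[OF A] e 0] .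
  obtain v where "v \<in> hom T (\<Omega>o A) W" "far Sh v = w" using Sh_preimage[OF w(1) \<Omega>o_ob[OF A] W] .
  then show thesis using that w(2) by blast
qed

lemma ft_\<omega>:
  assumes "ft A B f"
  shows "\<omega> B \<cdot> f = zero T A (fob Sh (\<Omega>o B))"
proof -
  obtain P a b where p: "P \<in> X" "a \<in> hom T A P" "b \<in> hom T P B" "f = b \<cdot> a" using assms by (rule ftE)
  have ob: "A \<in> ob T" "B \<in> ob T" "P \<in> ob T" using p by (simp_all add: hom_iff)
  obtain g where g: "g \<in> hom T P (RX B)" "apx2 R B \<cdot> g = b" using R_approx[OF p(1,3)] .
  note h = R_hom[OF ob(2)]
  have "\<omega> B \<cdot> f = (\<omega> B \<cdot> apx2 R B) \<cdot> (g \<cdot> a)"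
    unfolding p(4) g(2)[symmetric] using g(1) p(2) h by (simp add: hom_iff)
  then show ?thesis using tri_comp_zero2[OF R_triangle(1)[OF ob(2)]] g(1) p(2) ob by (simp add: hom_iff)
qed

section \<open>The functors \<Sigma> and \<Omega> on representatives\<close>

lemma Sigma_ex:
  assumes f: "f \<in> hom T A B"
  obtains s where "s \<in> hom T (\<Sigma>o A) (\<Sigma>o B)" "\<delta> B \<cdot> s = far Sh f \<cdot> \<delta> A"
proof -
  have ob: "A \<in> ob T" "B \<in> ob T" using f by (simp_all add: hom_iff)
  note h = L_hom[OF ob(1)] L_hom[OF ob(2)]
  \<comment> \<open>The obstruction to lifting through \<open>\<delta> B\<close> is the shift of
    this composite applied to \<open>\<delta> A\<close>. It vanishes because the composite ends in
    X.\<close>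
  have "ft A (LX B) (apx2 L B \<cdot> f)" using ft_X_right[OF h(10) comp_hom[OF f h(8)]] .
  from ft_\<delta>[OF this] have "far Sh (apx2 L B) \<cdot> (far Sh f \<cdot> \<delta> A) = zero T (\<Sigma>o A) (fob Sh (LX B))"
    using f h by (simp add: hom_iff)
  then show thesis
    by (rule \<delta>_lift[OF ob(2), rotated]) (use f h ob that in \<open>auto simp: hom_iff\<close>)
qed

lemma Sigma_unique:
  assumes f: "f \<in> hom T A B" "f' \<in> hom T A B" "mc f' = mc f"
    and s: "s \<in> hom T (\<Sigma>o A) (\<Sigma>o B)" "\<delta> B \<cdot> s = far Sh f \<cdot> \<delta> A"
    and s': "s' \<in> hom T (\<Sigma>o A) (\<Sigma>o B)" "\<delta> B \<cdot> s' = far Sh f' \<cdot> \<delta> A"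
  shows "mc s' = mc s"
proof -
  have ob: "A \<in> ob T" "B \<in> ob T" using f by (simp_all add: hom_iff)
  note h = L_hom[OF ob(1)] L_hom[OF ob(2)]
  have "ft A B (f' \<oplus> \<ominus> f)" using f mc_eq by blast
  from ft_\<delta>[OF this] have "\<delta> B \<cdot> (s' \<oplus> \<ominus> s) = zero T (\<Sigma>o A) (fob Sh B)"
    using s s' f h by (simp add: hom_iff distrib_arr)
  moreover have "s' \<oplus> \<ominus> s \<in> hom T (\<Sigma>o A) (\<Sigma>o B)" using s s' by (simp add: hom_iff)
  ultimately have "ft (\<Sigma>o A) (\<Sigma>o B) (s' \<oplus> \<ominus> s)" using \<delta>_cancel[OF ob(2)] by blast
  then show ?thesis using mc_eq[OF s'(1) s(1)] by blast
qed

lemma Sigma_ob [simp]: "fob \<Sigma> A = \<Sigma>o A" and Omega_ob [simp]: "fob \<Omega> A = \<Omega>o A"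
  unfolding Sigma_functor_def Omega_functor_def by simp_all

text \<open>Reduces the union over all morphisms of approximation triangles to one equation. The
  equation is a left square in shifted form, so it completes to such a morphism, and by
  \<open>Sigma_unique\<close> every other member of the union gives the same class.\<close>

lemma Sigma_far:
  assumes f: "f \<in> hom T A B" and s: "s \<in> hom T (\<Sigma>o A) (\<Sigma>o B)" "\<delta> B \<cdot> s = far Sh f \<cdot> \<delta> A"
  shows "far \<Sigma> (mc f) = mc s"
proof -
  have ob: "A \<in> ob T" "B \<in> ob T" using f by (simp_all add: hom_iff)
  note h = L_hom[OF ob(1)] L_hom[OF ob(2)]
  let ?M = "{mod_class T X s | s. \<exists>A B P Q x. \<exists>f \<in> mc f.
      f \<in> hom T A B \<and> apx2 L A \<in> hom T A P \<and> apx2 L B \<in> hom T B Q \<and>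
      x \<in> hom T P Q \<and> s \<in> hom T (apx_ob L A) (apx_ob L B) \<and>
      apx1 L B \<cdot> far Us s = f \<cdot> apx1 L A \<and>
      apx2 L B \<cdot> f = x \<cdot> apx2 L A \<and> apx3 L B \<cdot> x = s \<cdot> apx3 L A}"
  have Uss: "far Us s \<in> hom T (fob Us (\<Sigma>o A)) (fob Us (\<Sigma>o B))" using s by (simp add: hom_iff)
  have "far Sh (apx1 L B \<cdot> far Us s) = far Sh (f \<cdot> apx1 L A)"
    using s f h ob by (simp add: \<delta>_def hom_iff)
  then have sq: "apx1 L B \<cdot> far Us s = f \<cdot> apx1 L A"
    using S_faithful comp_hom[OF Uss h(7)] comp_hom[OF h(1) f] by blast
  obtain x where x: "x \<in> hom T (LX A) (LX B)" "apx2 L B \<cdot> f = x \<cdot> apx2 L A"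
      "apx3 L B \<cdot> x = far Sh (far Us s) \<cdot> apx3 L A"
    using tri_mor[OF L_triangle(1)[OF ob(1)] L_triangle(1)[OF ob(2)] Uss f sq] .
  have x3: "apx3 L B \<cdot> x = s \<cdot> apx3 L A" using x(3) s(1) by (simp add: hom_iff)
  have "mc s \<in> ?M"
    by (rule CollectI, rule exI[of _ s], rule conjI[OF refl], rule exI[of _ A], rule exI[of _ B],
        rule exI[of _ "LX A"], rule exI[of _ "LX B"], rule exI[of _ x], rule bexI[OF _ mc_self[OF f]])
      (intro conjI f h(2,8) x(1,2) s(1) sq x3)
  moreover have "M = mc s" if M: "M \<in> ?M" for M
  proof -
    obtain s' A' B' P Q x f' where M_eq: "M = mc s'" and f'_mem: "f' \<in> mc f" and f'0: "f' \<in> hom T A' B'"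
      and s'0: "s' \<in> hom T (\<Sigma>o A') (\<Sigma>o B')" "apx1 L B' \<cdot> far Us s' = f' \<cdot> apx1 L A'"
      using M by (elim CollectE exE conjE bexE) (rule that)
    have f': "f' \<in> hom T A B" using in_mc[OF f] f'_mem by blast
    then have "A' = A" "B' = B" using f'0 hom_disjoint by blast+
    then have s': "s' \<in> hom T (\<Sigma>o A) (\<Sigma>o B)" "apx1 L B \<cdot> far Us s' = f' \<cdot> apx1 L A" using s'0 by simp_all
    have "far Sh (apx1 L B \<cdot> far Us s') = far Sh (f' \<cdot> apx1 L A)" using s'(2) by simp
    then have "\<delta> B \<cdot> s' = far Sh f' \<cdot> \<delta> A" using s'(1) f' h ob by (simp add: \<delta>_def hom_iff)
    then show "M = mc s"
      using Sigma_unique[OF f f' mc_member_eq[OF f f'_mem] s s'(1)] M_eq by simp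
  qed
  ultimately have "\<Union> ?M = mc s" by (rule Union_eq_unique)
  moreover have "far \<Sigma> (mc f) = \<Union> ?M" unfolding Sigma_functor_def by (simp only: fctr.select_convs)
  ultimately show ?thesis by (rule trans[rotated])
qed

lemma Omega_ex:
  assumes f: "f \<in> hom T A B"
  obtains s where "s \<in> hom T (\<Omega>o A) (\<Omega>o B)" "far Sh s \<cdot> \<omega> A = \<omega> B \<cdot> f"
proof -
  have ob: "A \<in> ob T" "B \<in> ob T" using f by (simp_all add: hom_iff)
  note h = R_hom[OF ob(1)] R_hom[OF ob(2)]
  have "ft (RX A) B (f \<cdot> apx2 R A)" using ft_X_left[OF h(4) comp_hom[OF h(2) f]] .
  from ft_\<omega>[OF this] have "(\<omega> B \<cdot> f) \<cdot> apx2 R A = zero T (RX A) (fob Sh (\<Omega>o B))"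
    using f h by (simp add: hom_iff)
  then show thesis
    by (rule \<omega>_extend[OF ob(1), rotated 2]) (use f h ob that in \<open>auto simp: hom_iff\<close>)
qed

lemma Omega_unique:
  assumes f: "f \<in> hom T A B" "f' \<in> hom T A B" "mc f' = mc f"
    and s: "s \<in> hom T (\<Omega>o A) (\<Omega>o B)" "far Sh s \<cdot> \<omega> A = \<omega> B \<cdot> f"
    and s': "s' \<in> hom T (\<Omega>o A) (\<Omega>o B)" "far Sh s' \<cdot> \<omega> A = \<omega> B \<cdot> f'"
  shows "mc s' = mc s"
proof -
  have ob: "A \<in> ob T" "B \<in> ob T" using f by (simp_all add: hom_iff)
  note h = R_hom[OF ob(1)] R_hom[OF ob(2)]
  have "ft A B (f' \<oplus> \<ominus> f)" using f mc_eq by blast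
  from ft_\<omega>[OF this] have "far Sh (s' \<oplus> \<ominus> s) \<cdot> \<omega> A = zero T A (fob Sh (\<Omega>o B))"
    using s s' f h by (simp add: hom_iff distrib_arr)
  moreover have "s' \<oplus> \<ominus> s \<in> hom T (\<Omega>o A) (\<Omega>o B)" using s s' by (simp add: hom_iff)
  ultimately have "ft (\<Omega>o A) (\<Omega>o B) (s' \<oplus> \<ominus> s)" using \<omega>_cancel[OF ob(1)] by blast
  then show ?thesis using mc_eq[OF s'(1) s(1)] by blast
qed

lemma Omega_far:
  assumes f: "f \<in> hom T A B" and s: "s \<in> hom T (\<Omega>o A) (\<Omega>o B)" "far Sh s \<cdot> \<omega> A = \<omega> B \<cdot> f"
  shows "far \<Omega> (mc f) = mc s"
proof -
  have ob: "A \<in> ob T" "B \<in> ob T" using f by (simp_all add: hom_iff)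
  note h = R_hom[OF ob(1)] R_hom[OF ob(2)]
  let ?M = "{mod_class T X s | s. \<exists>A B P Q x. \<exists>f \<in> mc f.
      f \<in> hom T A B \<and> apx2 R A \<in> hom T P A \<and> apx2 R B \<in> hom T Q B \<and>
      x \<in> hom T P Q \<and> s \<in> hom T (apx_ob R A) (apx_ob R B) \<and>
      apx1 R B \<cdot> s = x \<cdot> apx1 R A \<and>
      apx2 R B \<cdot> x = f \<cdot> apx2 R A \<and> apx3 R B \<cdot> f = far Sh s \<cdot> apx3 R A}"
  \<comment> \<open>The known components are f and s, the outer ones. After two rotations they
    occupy the first two places, and the missing x is the unshifted third component.\<close>
  note rA = tri_rot[OF tri_rot[OF R_triangle(1)[OF ob(1)]]]
    and rB = tri_rot[OF tri_rot[OF R_triangle(1)[OF ob(2)]]]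
  have Ss: "far Sh s \<in> hom T (fob Sh (\<Omega>o A)) (fob Sh (\<Omega>o B))" using s by (simp add: hom_iff)
  obtain y where y: "y \<in> hom T (fob Sh (RX A)) (fob Sh (RX B))"
      "(\<ominus> far Sh (apx1 R B)) \<cdot> far Sh s = y \<cdot> (\<ominus> far Sh (apx1 R A))"
      "(\<ominus> far Sh (apx2 R B)) \<cdot> y = far Sh f \<cdot> (\<ominus> far Sh (apx2 R A))"
    using tri_mor[OF rA rB f Ss s(2)[symmetric]] .
  obtain x where x: "x \<in> hom T (RX A) (RX B)" "far Sh x = y" using Sh_preimage[OF y(1) h(5,10)] .
  have "far Sh (apx1 R B \<cdot> s) = far Sh (x \<cdot> apx1 R A)"
    by (rule neg_inject) (use y(1,2) x h s ob in \<open>simp_all add: hom_iff\<close>)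
  then have x1: "apx1 R B \<cdot> s = x \<cdot> apx1 R A"
    using S_faithful[OF comp_hom[OF s(1) h(6)] comp_hom[OF h(1) x(1)]] by blast
  have "far Sh (apx2 R B \<cdot> x) = far Sh (f \<cdot> apx2 R A)"
    by (rule neg_inject) (use y(1,3) x h f ob in \<open>simp_all add: hom_iff\<close>)
  then have x2: "apx2 R B \<cdot> x = f \<cdot> apx2 R A"
    using S_faithful[OF comp_hom[OF x(1) h(7)] comp_hom[OF h(2) f]] by blast
  have "mc s \<in> ?M"
    by (rule CollectI, rule exI[of _ s], rule conjI[OF refl], rule exI[of _ A], rule exI[of _ B],
        rule exI[of _ "RX A"], rule exI[of _ "RX B"], rule exI[of _ x], rule bexI[OF _ mc_self[OF f]])
      (intro conjI f h(2,7) x(1) s(1) x1 x2 s(2)[symmetric])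
  moreover have "M = mc s" if M: "M \<in> ?M" for M
  proof -
    obtain s' A' B' P Q x f' where M_eq: "M = mc s'" and f'_mem: "f' \<in> mc f" and f'0: "f' \<in> hom T A' B'"
      and s'0: "s' \<in> hom T (\<Omega>o A') (\<Omega>o B')" "apx3 R B' \<cdot> f' = far Sh s' \<cdot> apx3 R A'"
      using M by (elim CollectE exE conjE bexE) (rule that)
    have f': "f' \<in> hom T A B" using in_mc[OF f] f'_mem by blast
    then have "A' = A" "B' = B" using f'0 hom_disjoint by blast+
    then have s': "s' \<in> hom T (\<Omega>o A) (\<Omega>o B)" "far Sh s' \<cdot> \<omega> A = \<omega> B \<cdot> f'" using s'0 by simp_all
    show "M = mc s"
      using Omega_unique[OF f f' mc_member_eq[OF f f'_mem] s s'] M_eq by simp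
  qed
  ultimately have "\<Union> ?M = mc s" by (rule Union_eq_unique)
  moreover have "far \<Omega> (mc f) = \<Union> ?M" unfolding Omega_functor_def by (simp only: fctr.select_convs)
  ultimately show ?thesis by (rule trans[rotated])
qed

lemma Sigma_functor: "is_functor Q Q \<Sigma>"
  unfolding is_functor_def
proof (intro conjI ballI allI)
  show "fob \<Sigma> A \<in> ob Q" if "A \<in> ob Q" for A using that by simp
  show "far \<Sigma> F \<in> hom Q (fob \<Sigma> A) (fob \<Sigma> B)" if F: "F \<in> hom Q A B" for A B F
  proof -
    obtain f where f: "f \<in> hom T A B" "F = mc f" using F by (rule factor_homE)
    obtain s where s: "s \<in> hom T (\<Sigma>o A) (\<Sigma>o B)" "\<delta> B \<cdot> s = far Sh f \<cdot> \<delta> A" using Sigma_ex[OF f(1)] .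
    show ?thesis using Sigma_far[OF f(1) s] f(2) mc_hom[OF s(1)] by simp
  qed
  show "far \<Sigma> (idm Q A) = idm Q (fob \<Sigma> A)" if "A \<in> ob Q" for A
    using that Sigma_far[of "idm T A" A A "idm T (\<Sigma>o A)"] L_hom[of A] by (simp add: hom_iff)
  show "far \<Sigma> (G \<cdot>\<^bsub>Q\<^esub> F) = far \<Sigma> G \<cdot>\<^bsub>Q\<^esub> far \<Sigma> F" if F: "F \<in> hom Q A B" and G: "G \<in> hom Q B E" for A B E F G
  proof -
    obtain f where f: "f \<in> hom T A B" "F = mc f" using F by (rule factor_homE)
    obtain s where s: "s \<in> hom T (\<Sigma>o A) (\<Sigma>o B)" "\<delta> B \<cdot> s = far Sh f \<cdot> \<delta> A" using Sigma_ex[OF f(1)] .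
    obtain g where g: "g \<in> hom T B E" "G = mc g" using G by (rule factor_homE)
    obtain t where t: "t \<in> hom T (\<Sigma>o B) (\<Sigma>o E)" "\<delta> E \<cdot> t = far Sh g \<cdot> \<delta> B" using Sigma_ex[OF g(1)] .
    have ob: "A \<in> ob T" "B \<in> ob T" "E \<in> ob T" using f g by (simp_all add: hom_iff)
    note h = L_hom(6)[OF ob(1)] L_hom(6)[OF ob(2)] L_hom(6)[OF ob(3)]
    have Sg: "far Sh g \<in> hom T (fob Sh B) (fob Sh E)" using g by (simp add: hom_iff)
    have "\<delta> E \<cdot> (t \<cdot> s) = far Sh (g \<cdot> f) \<cdot> \<delta> A"
      using comp_extend_arr[OF t(2) h(3) t(1) Sg h(2), of s] s f g t h by (simp add: hom_iff)
    from Sigma_far[OF comp_hom[OF f(1) g(1)] comp_hom[OF s(1) t(1)] this]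
    show ?thesis
      using f g by (simp add: factor_comp[OF f(1) g(1)] Sigma_far[OF f(1) s] Sigma_far[OF g(1) t]
        factor_comp[OF s(1) t(1)])
  qed
qed

lemma Sigma_additive: "is_additive_functor Q Q \<Sigma>"
  unfolding is_additive_functor_def
proof (intro conjI ballI allI)
  show "is_functor Q Q \<Sigma>" by (rule Sigma_functor)
  show "far \<Sigma> (F \<oplus>\<^bsub>Q\<^esub> G) = far \<Sigma> F \<oplus>\<^bsub>Q\<^esub> far \<Sigma> G" if F: "F \<in> hom Q A B" and G: "G \<in> hom Q A B" for A B F G
  proof -
    obtain f where f: "f \<in> hom T A B" "F = mc f" using F by (rule factor_homE)
    obtain s where s: "s \<in> hom T (\<Sigma>o A) (\<Sigma>o B)" "\<delta> B \<cdot> s = far Sh f \<cdot> \<delta> A" using Sigma_ex[OF f(1)] .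
    obtain g where g: "g \<in> hom T A B" "G = mc g" using G by (rule factor_homE)
    obtain t where t: "t \<in> hom T (\<Sigma>o A) (\<Sigma>o B)" "\<delta> B \<cdot> t = far Sh g \<cdot> \<delta> A" using Sigma_ex[OF g(1)] .
    have ob: "A \<in> ob T" "B \<in> ob T" using f g by (simp_all add: hom_iff)
    note h = L_hom(6)[OF ob(1)] L_hom(6)[OF ob(2)]
    have "\<delta> B \<cdot> (s \<oplus> t) = far Sh (f \<oplus> g) \<cdot> \<delta> A"
      using s f g t h by (simp add: hom_iff distrib_arr)
    from Sigma_far[OF add_hom[OF f(1) g(1)] add_hom[OF s(1) t(1)] this]
    show ?thesis
      using f g by (simp add: factor_add[OF f(1) g(1)] Sigma_far[OF f(1) s] Sigma_far[OF g(1) t]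
        factor_add[OF s(1) t(1)])
  qed
qed

lemma Omega_functor: "is_functor Q Q \<Omega>"
  unfolding is_functor_def
proof (intro conjI ballI allI)
  show "fob \<Omega> A \<in> ob Q" if "A \<in> ob Q" for A using that by simp
  show "far \<Omega> F \<in> hom Q (fob \<Omega> A) (fob \<Omega> B)" if F: "F \<in> hom Q A B" for A B F
  proof -
    obtain f where f: "f \<in> hom T A B" "F = mc f" using F by (rule factor_homE)
    obtain s where s: "s \<in> hom T (\<Omega>o A) (\<Omega>o B)" "far Sh s \<cdot> \<omega> A = \<omega> B \<cdot> f" using Omega_ex[OF f(1)] .
    show ?thesis using Omega_far[OF f(1) s] f(2) mc_hom[OF s(1)] by simp
  qed
  show "far \<Omega> (idm Q A) = idm Q (fob \<Omega> A)" if "A \<in> ob Q" for A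
    using that Omega_far[of "idm T A" A A "idm T (\<Omega>o A)"] R_hom[of A] by (simp add: hom_iff)
  show "far \<Omega> (G \<cdot>\<^bsub>Q\<^esub> F) = far \<Omega> G \<cdot>\<^bsub>Q\<^esub> far \<Omega> F" if F: "F \<in> hom Q A B" and G: "G \<in> hom Q B E" for A B E F G
  proof -
    obtain f where f: "f \<in> hom T A B" "F = mc f" using F by (rule factor_homE)
    obtain s where s: "s \<in> hom T (\<Omega>o A) (\<Omega>o B)" "far Sh s \<cdot> \<omega> A = \<omega> B \<cdot> f" using Omega_ex[OF f(1)] .
    obtain g where g: "g \<in> hom T B E" "G = mc g" using G by (rule factor_homE)
    obtain t where t: "t \<in> hom T (\<Omega>o B) (\<Omega>o E)" "far Sh t \<cdot> \<omega> B = \<omega> E \<cdot> g" using Omega_ex[OF g(1)] .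
    have ob: "A \<in> ob T" "B \<in> ob T" "E \<in> ob T" using f g by (simp_all add: hom_iff)
    note h = R_hom(3)[OF ob(1)] R_hom(3)[OF ob(2)] R_hom(3)[OF ob(3)]
    have St: "far Sh t \<in> hom T (fob Sh (\<Omega>o B)) (fob Sh (\<Omega>o E))" using t by (simp add: hom_iff)
    have "far Sh (t \<cdot> s) \<cdot> \<omega> A = \<omega> E \<cdot> (g \<cdot> f)"
      using comp_extend_arr[OF t(2) St h(2) h(3) g(1), of f] s f g t h by (simp add: hom_iff)
    from Omega_far[OF comp_hom[OF f(1) g(1)] comp_hom[OF s(1) t(1)] this]
    show ?thesis
      using f g by (simp add: factor_comp[OF f(1) g(1)] Omega_far[OF f(1) s] Omega_far[OF g(1) t]
        factor_comp[OF s(1) t(1)])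
  qed
qed

end

section \<open>Factors of extension closed subcategories\<close>

lemma (in triangulated_category) tri_octahedron:
  assumes "tri A B D f f' f''" "tri B E F g g' g''" "tri A E G (g \<cdot> f) k k'"
  obtains u v where "tri D G F u v (far S f' \<cdot> g'')" "u \<cdot> f' = k \<cdot> g" "k' \<cdot> u = f''" "v \<cdot> k = g'"
    "g'' \<cdot> v = far S f \<cdot> k'"
proof -
  note t = assms[unfolded tri_def]
  obtain u v where uv: "u \<in> hom C D G" "v \<in> hom C G F" "(u, v, far S f' \<cdot> g'') \<in> \<Delta>" "u \<cdot> f' = k \<cdot> g"
      "k' \<cdot> u = f''" "v \<cdot> k = g'" "g'' \<cdot> v = far S f \<cdot> k'"
    using octahedral[of A B D f f' f'' E F g g' g'' G k k'] t by blast
  have "tri D G F u v (far S f' \<cdot> g'')"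
    by (rule triI[OF uv(1,2) _ uv(3)])
      (use tri_hom[OF assms(1)] tri_hom[OF assms(2)] in \<open>simp add: hom_iff\<close>)
  then show thesis using that uv(4-) by blast
qed

lemma additive_functor_add:
  "is_additive_functor C D F \<Longrightarrow> f \<in> hom C A B \<Longrightarrow> g \<in> hom C A B \<Longrightarrow>
    far F (f \<oplus>\<^bsub>C\<^esub> g) = far F f \<oplus>\<^bsub>D\<^esub> far F g"
  unfolding is_additive_functor_def by blast

lemma is_functor_full_subcat:
  assumes F: "is_functor C C F" and Y: "Y \<subseteq> ob C" "\<And>A. A \<in> Y \<Longrightarrow> fob F A \<in> Y"
  shows "is_functor (full_subcat C Y) (full_subcat C Y) F"
  unfolding is_functor_def full_subcat_hom full_subcat_simps
proof (intro conjI ballI allI)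
  fix A B E f g
  assume "f \<in> hom (full_subcat C Y) A B" "g \<in> hom (full_subcat C Y) B E"
  then show "far F (g \<cdot>\<^bsub>C\<^esub> f) = far F g \<cdot>\<^bsub>C\<^esub> far F f"
    using functor_comp[OF F] unfolding full_subcat_hom by blast
qed (use functor_hom[OF F] functor_idm[OF F] Y in \<open>auto simp: full_subcat_hom\<close>)

text \<open>What the triangulated structure on U/X requires, stated without Serre duality: X is
  projective and injective relative to U, and the chosen \<Sigma> and \<Omega> preserve U.
  \<open>Ext_extension_factor\<close> supplies this for a heart.\<close>

locale extension_factor = approximation_triangles T Sh Us \<Delta> X L R
  for T :: "('o, 'm, 'k::field) lincat" (structure)
    and Sh Us :: "('o, 'm, 'o, 'm) fctr"
    and \<Delta> :: "('m \<times> 'm \<times> 'm) set"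
    and X :: "'o set" and L R :: "('o, 'm) apx" +
  fixes U :: "'o set"
  assumes U_subcategory: "subcategory T U"
    and X_U: "X \<subseteq> U"
    and U_extension: "extension_closed T Sh \<Delta> U"
    and X_projective: "P \<in> X \<Longrightarrow> A \<in> U \<Longrightarrow> f \<in> hom T P (fob Sh A) \<Longrightarrow> f = zero T P (fob Sh A)"
    and X_injective: "A \<in> U \<Longrightarrow> P \<in> X \<Longrightarrow> f \<in> hom T A (fob Sh P) \<Longrightarrow> f = zero T A (fob Sh P)"
    and Sigma_U: "A \<in> U \<Longrightarrow> apx_ob L A \<in> U"
    and Omega_U: "A \<in> U \<Longrightarrow> apx_ob R A \<in> U"
begin

abbreviation QU :: "('o, 'm set) acat" where "QU \<equiv> full_subcat Q U"

lemma U_ob: "A \<in> U \<Longrightarrow> A \<in> ob T"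
  using subcategoryD(1)[OF U_subcategory] by blast

lemma U_ext: "tri A B D f g h \<Longrightarrow> A \<in> U \<Longrightarrow> D \<in> U \<Longrightarrow> B \<in> U"
  using U_extension unfolding extension_closed_def tri_def by blast

lemma U_factor_subcategory: "subcategory Q U"
  using factor_subcategory[OF U_subcategory X_U split] .

sublocale sub: additive_category QU
  using factor.full_subcat_additive[OF U_factor_subcategory] .

lemma mc_homU: "f \<in> hom T A B \<Longrightarrow> A \<in> U \<Longrightarrow> B \<in> U \<Longrightarrow> mc f \<in> hom QU A B"
  by (simp add: full_subcat_hom mc_hom)

text \<open>The obstruction lies in T(D, \<open>LX A\<close>[1]) and vanishes because
  \<open>LX A\<close> is injective relative to U. The next three lemmas treat the other variances of
  \<delta> and \<omega> in the same way.\<close>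

lemma \<delta>_lift_U:
  assumes A: "A \<in> ob T" and D: "D \<in> U" and e: "\<epsilon> \<in> hom T D (fob Sh A)"
  obtains w where "w \<in> hom T D (\<Sigma>o A)" "\<delta> A \<cdot> w = \<epsilon>"
proof -
  note h = L_hom[OF A]
  have "far Sh (apx2 L A) \<cdot> \<epsilon> \<in> hom T D (fob Sh (LX A))" using e h by (simp add: hom_iff)
  from X_injective[OF D h(4) this] show thesis by (rule \<delta>_lift[OF A e _ that])
qed

lemma \<omega>_extend_U:
  assumes A: "A \<in> ob T" and W: "W \<in> U" and e: "\<epsilon> \<in> hom T A (fob Sh W)"
  obtains v where "v \<in> hom T (\<Omega>o A) W" "far Sh v \<cdot> \<omega> A = \<epsilon>"
proof -
  note h = R_hom[OF A]
  have "\<epsilon> \<cdot> apx2 R A \<in> hom T (RX A) (fob Sh W)" using e h by (simp add: hom_iff)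
  from X_projective[OF h(4) W this] show thesis by (rule \<omega>_extend[OF A e U_ob[OF W] _ that])
qed

lemma \<omega>_lift_U:
  assumes A: "A \<in> ob T" and D: "D \<in> U" and e: "\<epsilon> \<in> hom T D (fob Sh (\<Omega>o A))"
  obtains w where "w \<in> hom T D A" "\<omega> A \<cdot> w = \<epsilon>"
proof -
  note h = R_hom[OF A]
  have "far Sh (apx1 R A) \<cdot> \<epsilon> \<in> hom T D (fob Sh (RX A))" using e h by (simp add: hom_iff)
  from X_injective[OF D h(4) this] show thesis by (rule tri_lift_to_fibre3[OF R_triangle(1)[OF A] e _ that])
qed

lemma \<delta>_extend_U:
  assumes A: "A \<in> ob T" and W: "W \<in> U" and e: "\<epsilon> \<in> hom T (\<Sigma>o A) (fob Sh W)"
  obtains v where "v \<in> hom T A W" "far Sh v \<cdot> \<delta> A = \<epsilon>"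
proof -
  note h = L_hom[OF A]
  have "\<epsilon> \<cdot> apx3 L A \<in> hom T (LX A) (fob Sh W)" using e h by (simp add: hom_iff)
  from X_projective[OF h(4) W this] obtain w
    where w: "w \<in> hom T (fob Sh A) (fob Sh W)" "w \<cdot> (\<ominus> \<delta> A) = \<epsilon>"
    by (rule tri_factor_through_cone2[OF L_triangle_rot[OF A] e])
  obtain v where v: "v \<in> hom T A W" "far Sh v = w" using Sh_preimage[OF w(1) A U_ob[OF W]] .
  show thesis by (rule that[of "\<ominus> v"]) (use v w h in \<open>auto simp: hom_iff\<close>)
qed

text \<open>This and its three variants below are how equality of classes is tested: by one equation
  in T after composition with a connecting map.\<close>

lemma \<delta>_eq:
  assumes "A \<in> ob T" "w \<in> hom T W (\<Sigma>o A)" "w' \<in> hom T W (\<Sigma>o A)" "\<delta> A \<cdot> w = \<delta> A \<cdot> w'"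
  shows "mc w = mc w'"
proof -
  have "\<delta> A \<cdot> (w \<oplus> \<ominus> w') = zero T W (fob Sh A)"
    using assms L_hom[OF assms(1)] by (simp add: hom_iff distrib_arr)
  from \<delta>_cancel[OF assms(1) _ this] show ?thesis
    using mc_eq[OF assms(2,3)] assms(2,3) by (simp add: hom_iff)
qed

lemma \<delta>_epi_eq:
  assumes "f \<in> hom T A B" "f' \<in> hom T A B" "far Sh f \<cdot> \<delta> A = far Sh f' \<cdot> \<delta> A"
  shows "mc f = mc f'"
proof -
  have A: "A \<in> ob T" using assms by (simp add: hom_iff)
  have "far Sh (f \<oplus> \<ominus> f') \<cdot> \<delta> A = zero T (\<Sigma>o A) (fob Sh B)"
    using assms L_hom[OF A] by (simp add: hom_iff distrib_arr)
  from \<delta>_epi[OF _ this] show ?thesis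
    using mc_eq[OF assms(1,2)] assms(1,2) by (simp add: hom_iff)
qed

lemma \<omega>_mono_eq:
  assumes "f \<in> hom T W A" "f' \<in> hom T W A" "\<omega> A \<cdot> f = \<omega> A \<cdot> f'"
  shows "mc f = mc f'"
proof -
  have A: "A \<in> ob T" using assms by (simp add: hom_iff)
  have "\<omega> A \<cdot> (f \<oplus> \<ominus> f') = zero T W (fob Sh (\<Omega>o A))"
    using assms R_hom[OF A] by (simp add: hom_iff distrib_arr)
  from \<omega>_mono[OF _ this] show ?thesis
    using mc_eq[OF assms(1,2)] assms(1,2) by (simp add: hom_iff)
qed

lemma \<omega>_eq:
  assumes "A \<in> ob T" "f \<in> hom T (\<Omega>o A) W" "f' \<in> hom T (\<Omega>o A) W" "far Sh f \<cdot> \<omega> A = far Sh f' \<cdot> \<omega> A"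
  shows "mc f = mc f'"
proof -
  have "far Sh (f \<oplus> \<ominus> f') \<cdot> \<omega> A = zero T A (fob Sh W)"
    using assms R_hom[OF assms(1)] by (simp add: hom_iff distrib_arr)
  from \<omega>_cancel[OF assms(1) _ this] show ?thesis
    using mc_eq[OF assms(2,3)] assms(2,3) by (simp add: hom_iff)
qed

section \<open>\<Sigma> and \<Omega> as inverse equivalences of U/X\<close>

lemma Sigma_functor_U: "is_functor QU QU \<Sigma>"
  by (rule is_functor_full_subcat[OF Sigma_functor]) (simp_all add: subsetI U_ob Sigma_U)

lemma Omega_functor_U: "is_functor QU QU \<Omega>"
  by (rule is_functor_full_subcat[OF Omega_functor]) (simp_all add: subsetI U_ob Omega_U)

lemma Sigma_additive_U: "is_additive_functor QU QU \<Sigma>"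
  unfolding is_additive_functor_def
proof (intro conjI ballI allI Sigma_functor_U)
  show "far \<Sigma> (F \<oplus>\<^bsub>QU\<^esub> G) = far \<Sigma> F \<oplus>\<^bsub>QU\<^esub> far \<Sigma> G" if "F \<in> hom QU A B" "G \<in> hom QU A B" for A B F G
    using that additive_functor_add[OF Sigma_additive, of F A B G] by (simp add: full_subcat_hom)
qed

text \<open>For \<open>A \<in> U\<close> the approximation triangle defining \<open>\<Sigma>A\<close> also serves as one defining \<open>\<Omega>\<Sigma>A\<close>,
  and dually.\<close>

lemma Omega_Sigma: "\<exists>\<tau>. nat_iso QU QU (functor_comp \<Omega> \<Sigma>) functor_id \<tau>"
proof -
  have "\<exists>t. t \<in> hom T (\<Omega>o (\<Sigma>o A)) A \<and> far Sh t \<cdot> \<omega> (\<Sigma>o A) = \<delta> A" if "A \<in> U" for A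
    using \<omega>_extend_U[OF \<Sigma>o_ob[OF U_ob[OF that]] that L_hom(6)[OF U_ob[OF that]]] by metis
  then obtain t where t: "\<And>A. A \<in> U \<Longrightarrow> t A \<in> hom T (\<Omega>o (\<Sigma>o A)) A"
      "\<And>A. A \<in> U \<Longrightarrow> far Sh (t A) \<cdot> \<omega> (\<Sigma>o A) = \<delta> A"
    by metis
  have "nat_iso QU QU (functor_comp \<Omega> \<Sigma>) functor_id (\<lambda>A. mc (t A))"
    unfolding nat_iso_def
  proof (intro conjI ballI allI)
    fix A assume "A \<in> ob QU"
    then have A: "A \<in> U" "A \<in> ob T" using U_ob by auto
    let ?B = "\<Sigma>o A"
    have B: "?B \<in> U" "?B \<in> ob T" "\<Omega>o ?B \<in> U" "\<Omega>o ?B \<in> ob T" using A Sigma_U Omega_U U_ob by auto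
    note h = R_hom(3)[OF B(2)] L_hom(6)[OF A(2)]
    note tA = t[OF A(1)]
    \<comment> \<open>The candidate inverse comes from extending \<open>\<omega> ?B\<close> along
      \<open>\<delta> A\<close>, as t came from extending \<open>\<delta> A\<close> along
      \<open>\<omega> ?B\<close>. Each composite then fixes one of these connecting maps, so it is
      the identity modulo X.\<close>
    obtain s where s: "s \<in> hom T A (\<Omega>o ?B)" "far Sh s \<cdot> \<delta> A = \<omega> ?B"
      using \<delta>_extend_U[OF A(2) B(3) h(1)] .
    have 1: "mc (t A \<cdot> s) = mc (idm T A)"
      by (rule \<delta>_epi_eq[of _ A A]) (use tA s h A B in \<open>auto simp: hom_iff\<close>)
    have 2: "mc (s \<cdot> t A) = mc (idm T (\<Omega>o ?B))"
      by (rule \<omega>_eq[of ?B]) (use tA s h A B in \<open>auto simp: hom_iff\<close>)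
    show "is_iso QU (fob (functor_comp \<Omega> \<Sigma>) A) (fob functor_id A) (mc (t A))"
      using sub.is_isoI[OF mc_homU[OF tA(1) B(3) A(1)] mc_homU[OF s(1) A(1) B(3)]] 1 2
      by (simp add: functor_comp_def functor_id_def factor_comp[OF tA(1) s(1)] factor_comp[OF s(1) tA(1)])
  next
    fix A B F assume F: "F \<in> hom QU A B"
    then have U: "A \<in> U" "B \<in> U" "A \<in> ob T" "B \<in> ob T" using U_ob by (auto simp: full_subcat_hom)
    obtain f where f: "f \<in> hom T A B" "F = mc f" using F by (auto simp: full_subcat_hom elim!: factor_homE)
    obtain s where s: "s \<in> hom T (\<Sigma>o A) (\<Sigma>o B)" "\<delta> B \<cdot> s = far Sh f \<cdot> \<delta> A" using Sigma_ex[OF f(1)] .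
    obtain r where r: "r \<in> hom T (\<Omega>o (\<Sigma>o A)) (\<Omega>o (\<Sigma>o B))" "far Sh r \<cdot> \<omega> (\<Sigma>o A) = \<omega> (\<Sigma>o B) \<cdot> s"
      using Omega_ex[OF s(1)] .
    note h = L_hom(6)[OF U(3)] L_hom(6)[OF U(4)] R_hom(3)[OF \<Sigma>o_ob[OF U(3)]] R_hom(3)[OF \<Sigma>o_ob[OF U(4)]]
    note tA = t[OF U(1)] and tB = t[OF U(2)]
    have StB: "far Sh (t B) \<in> hom T (fob Sh (\<Omega>o (\<Sigma>o B))) (fob Sh B)" using tB by (simp add: hom_iff)
    have "mc (f \<cdot> t A) = mc (t B \<cdot> r)"
      by (rule \<omega>_eq[of "\<Sigma>o A"])
        (use tA tB f s r h U comp_extend1_arr[OF tB(2) StB h(4), of s] in \<open>auto simp: hom_iff\<close>)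
    then show "far functor_id F \<cdot>\<^bsub>QU\<^esub> mc (t A) = mc (t B) \<cdot>\<^bsub>QU\<^esub> far (functor_comp \<Omega> \<Sigma>) F"
      by (simp add: functor_comp_def functor_id_def f(2) Sigma_far[OF f(1) s] Omega_far[OF s(1) r]
        factor_comp[OF tA(1) f(1)] factor_comp[OF r(1) tB(1)])
  qed
  then show ?thesis by blast
qed

lemma Sigma_Omega: "\<exists>\<tau>. nat_iso QU QU (functor_comp \<Sigma> \<Omega>) functor_id \<tau>"
proof -
  have "\<exists>t. t \<in> hom T (\<Sigma>o (\<Omega>o A)) A \<and> \<omega> A \<cdot> t = \<delta> (\<Omega>o A)" if A: "A \<in> U" for A
    using \<omega>_lift_U[OF U_ob[OF A] Sigma_U[OF Omega_U[OF A]] L_hom(6)[OF \<Omega>o_ob[OF U_ob[OF A]]]] by metis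
  then obtain t where t: "\<And>A. A \<in> U \<Longrightarrow> t A \<in> hom T (\<Sigma>o (\<Omega>o A)) A"
      "\<And>A. A \<in> U \<Longrightarrow> \<omega> A \<cdot> t A = \<delta> (\<Omega>o A)"
    by metis
  have "nat_iso QU QU (functor_comp \<Sigma> \<Omega>) functor_id (\<lambda>A. mc (t A))"
    unfolding nat_iso_def
  proof (intro conjI ballI allI)
    fix A assume "A \<in> ob QU"
    then have A: "A \<in> U" "A \<in> ob T" using U_ob by auto
    let ?B = "\<Omega>o A"
    have B: "?B \<in> U" "?B \<in> ob T" "\<Sigma>o ?B \<in> U" "\<Sigma>o ?B \<in> ob T" using A Sigma_U Omega_U U_ob by auto
    note h = R_hom(3)[OF A(2)] L_hom(6)[OF B(2)]
    note tA = t[OF A(1)]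
    obtain s where s: "s \<in> hom T A (\<Sigma>o ?B)" "\<delta> ?B \<cdot> s = \<omega> A"
      using \<delta>_lift_U[OF B(2) A(1) h(1)] .
    have 1: "mc (t A \<cdot> s) = mc (idm T A)"
      by (rule \<omega>_mono_eq[of _ A A])
        (use tA s h A B comp_extend1_arr[OF tA(2) h(1) tA(1), of s] in \<open>auto simp: hom_iff\<close>)
    have 2: "mc (s \<cdot> t A) = mc (idm T (\<Sigma>o ?B))"
      by (rule \<delta>_eq[of ?B])
        (use tA s h A B comp_extend1_arr[OF s(2) h(2) s(1), of "t A"] in \<open>auto simp: hom_iff\<close>)
    show "is_iso QU (fob (functor_comp \<Sigma> \<Omega>) A) (fob functor_id A) (mc (t A))"
      using sub.is_isoI[OF mc_homU[OF tA(1) B(3) A(1)] mc_homU[OF s(1) A(1) B(3)]] 1 2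
      by (simp add: functor_comp_def functor_id_def factor_comp[OF tA(1) s(1)] factor_comp[OF s(1) tA(1)])
  next
    fix A B F assume F: "F \<in> hom QU A B"
    then have U: "A \<in> U" "B \<in> U" "A \<in> ob T" "B \<in> ob T" using U_ob by (auto simp: full_subcat_hom)
    obtain f where f: "f \<in> hom T A B" "F = mc f" using F by (auto simp: full_subcat_hom elim!: factor_homE)
    obtain s where s: "s \<in> hom T (\<Omega>o A) (\<Omega>o B)" "far Sh s \<cdot> \<omega> A = \<omega> B \<cdot> f" using Omega_ex[OF f(1)] .
    obtain r where r: "r \<in> hom T (\<Sigma>o (\<Omega>o A)) (\<Sigma>o (\<Omega>o B))" "\<delta> (\<Omega>o B) \<cdot> r = far Sh s \<cdot> \<delta> (\<Omega>o A)"
      using Sigma_ex[OF s(1)] .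
    note h = R_hom(3)[OF U(3)] R_hom(3)[OF U(4)] L_hom(6)[OF \<Omega>o_ob[OF U(3)]] L_hom(6)[OF \<Omega>o_ob[OF U(4)]]
    note tA = t[OF U(1)] and tB = t[OF U(2)]
    have Ss: "far Sh s \<in> hom T (fob Sh (\<Omega>o A)) (fob Sh (\<Omega>o B))" using s by (simp add: hom_iff)
    have "\<omega> B \<cdot> (f \<cdot> t A) = far Sh s \<cdot> \<delta> (\<Omega>o A)"
      using comp_extend_arr[OF s(2)[symmetric] h(2) f(1) Ss h(1), of "t A"] tA by (simp add: hom_iff)
    also have "\<dots> = \<omega> B \<cdot> (t B \<cdot> r)"
      using comp_extend1_arr[OF tB(2) h(2) tB(1), of r] r by (simp add: hom_iff)
    finally have "mc (f \<cdot> t A) = mc (t B \<cdot> r)"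
      by (rule \<omega>_mono_eq[rotated 2]) (use tA tB f r in \<open>auto simp: hom_iff\<close>)
    then show "far functor_id F \<cdot>\<^bsub>QU\<^esub> mc (t A) = mc (t B) \<cdot>\<^bsub>QU\<^esub> far (functor_comp \<Sigma> \<Omega>) F"
      by (simp add: functor_comp_def functor_id_def f(2) Sigma_far[OF s(1) r] Omega_far[OF f(1) s]
        factor_comp[OF tA(1) f(1)] factor_comp[OF r(1) tB(1)])
  qed
  then show ?thesis by blast
qed

lemma Sigma_equivalence: "is_equivalence QU QU \<Sigma>" and Omega_equivalence: "is_equivalence QU QU \<Omega>"
  unfolding is_equivalence_def
  using Sigma_functor_U Omega_functor_U Omega_Sigma Sigma_Omega by blast+

text \<open>The right triangles before closure under isomorphism, with all three objects in U.
  Keeping representatives in T allows the axioms to be checked on triangles of T.\<close>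

definition std :: "('m set \<times> 'm set \<times> 'm set) set" where
  "std = {t. \<exists>A B D f g h. A \<in> U \<and> B \<in> U \<and> D \<in> U \<and> f \<in> hom T A B \<and>
    tri (fob Us (\<Sigma>o A)) B D (f \<cdot> apx1 L A) g h \<and> t = (mc f, mc g, mc h)}"

lemma stdI:
  "A \<in> U \<Longrightarrow> B \<in> U \<Longrightarrow> D \<in> U \<Longrightarrow> f \<in> hom T A B \<Longrightarrow> tri (fob Us (\<Sigma>o A)) B D (f \<cdot> apx1 L A) g h \<Longrightarrow>
    (mc f, mc g, mc h) \<in> std"
  unfolding std_def by blast

lemma stdE:
  assumes "t \<in> std"
  obtains A B D f g h where "A \<in> U" "B \<in> U" "D \<in> U" "f \<in> hom T A B"
    "tri (fob Us (\<Sigma>o A)) B D (f \<cdot> apx1 L A) g h" "t = (mc f, mc g, mc h)"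
  using assms unfolding std_def by (elim CollectE exE conjE)

lemma std_hom:
  assumes A: "A \<in> U" and t: "tri (fob Us (\<Sigma>o A)) B D (f \<cdot> apx1 L A) g h"
  shows "g \<in> hom T B D" "h \<in> hom T D (\<Sigma>o A)"
  using tri_hom[OF t] U_ob[OF A] by simp_all

text \<open>Rotated once, the triangle exhibits D as an extension of \<open>\<Sigma>o A\<close> by
  B. Composing f with \<open>apx1 L A\<close> thus keeps the cone inside U, where the cone of f
  itself might leave it.\<close>

lemma std_cone:
  assumes A: "A \<in> U" and B: "B \<in> U" and t: "tri (fob Us (\<Sigma>o A)) B D (f \<cdot> apx1 L A) g h"
  shows "D \<in> U"
  by (rule U_ext[OF tri_rot[OF t] B]) (use U_ob[OF A] Sigma_U[OF A] in simp)

lemma std_shape: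
  assumes "A \<in> U" "B \<in> U" "D \<in> U" "f \<in> hom T A B" "tri (fob Us (\<Sigma>o A)) B D (f \<cdot> apx1 L A) g h"
  shows "triangle_shape QU \<Sigma> A B D (mc f) (mc g) (mc h)"
  unfolding triangle_shape_def using assms std_hom[OF assms(1,5)] Sigma_U by (simp add: mc_homU)

text \<open>By the octahedral axiom the third terms of the given and of the standard triangle differ by a
  split summand from \<open>X\<close>.\<close>

lemma conflation:
  assumes U: "A \<in> U" "B \<in> U" "D \<in> U" and t: "tri A B D x y \<epsilon>"
    and w: "w \<in> hom T D (\<Sigma>o A)" "\<delta> A \<cdot> w = \<epsilon>"
  shows "\<exists>t \<in> std. triangle_iso QU \<Sigma> t (mc x, mc y, mc w)"
proof -
  have ob: "A \<in> ob T" "B \<in> ob T" "D \<in> ob T" using U U_ob by blast+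
  note h = L_hom[OF ob(1)] and th = tri_hom[OF t]
  have xa: "x \<cdot> apx1 L A \<in> hom T (fob Us (\<Sigma>o A)) B" using th h by (simp add: hom_iff)
  obtain D' g' h' where t': "tri (fob Us (\<Sigma>o A)) B D' (x \<cdot> apx1 L A) g' h'" using tri_ex[OF xa] .
  note h' = std_hom[OF U(1) t'] and D' = std_cone[OF U(1,2) t']
  obtain u v where uv: "tri (LX A) D' D u v (far Sh (apx2 L A) \<cdot> \<epsilon>)" "v \<cdot> g' = y"
      "\<epsilon> \<cdot> v = far Sh (apx1 L A) \<cdot> h'"
    using tri_octahedron[OF L_triangle(1)[OF ob(1)] t t'] by blast
  note uvh = tri_hom[OF uv(1)]
  \<comment> \<open>This connecting map goes from U to X[1], so it is zero and v acquires a section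
    s.\<close>
  have "far Sh (apx2 L A) \<cdot> \<epsilon> = zero T D (fob Sh (LX A))"
    by (rule X_injective[OF U(3) h(4) uvh(3)])
  then have "(far Sh (apx2 L A) \<cdot> \<epsilon>) \<cdot> idm T D = zero T D (fob Sh (LX A))" using h ob by (simp add: hom_iff)
  then obtain s where s: "s \<in> hom T D D'" "v \<cdot> s = idm T D"
    using tri_lift_to_fibre2[OF uv(1) idm_hom[OF ob(3)]] by blast
  have D'_ob: "D' \<in> ob T" using U_ob[OF D'] .
  have vv: "v \<cdot> (idm T D' \<oplus> \<ominus> (s \<cdot> v)) = zero T D' D"
    using comp_extend1_arr[OF s(2) uvh(2) s(1), of v] s uvh D'_ob by (simp add: hom_iff distrib_arr)
  have n: "idm T D' \<oplus> \<ominus> (s \<cdot> v) \<in> hom T D' D'" using s uvh D'_ob by (simp add: hom_iff)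
  obtain r where r: "r \<in> hom T D' (LX A)" "u \<cdot> r = idm T D' \<oplus> \<ominus> (s \<cdot> v)"
    using tri_lift_to_fibre[OF uv(1) n vv] .
  have "ft D' D' (idm T D' \<oplus> \<ominus> (s \<cdot> v))" using ftI[OF h(4) r(1) uvh(1)] r(2) by simp
  then have sv: "mc (idm T D') = mc (s \<cdot> v)"
    using mc_eq[OF idm_hom[OF D'_ob] comp_hom[OF uvh(2) s(1)]] by simp
  have iso: "is_iso QU D' D (mc v)"
    by (rule sub.is_isoI[OF mc_homU[OF uvh(2) D' U(3)] mc_homU[OF s(1) U(3) D']])
      (simp_all add: factor_comp[OF s(1) uvh(2)] factor_comp[OF uvh(2) s(1)] sv s(2))
  \<comment> \<open>After composition with \<open>\<delta> A\<close> both sides become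
    \<open>far Sh (apx1 L A) \<cdot> h'\<close>, by the last octahedral identity.\<close>
  have wv: "mc (w \<cdot> v) = mc h'"
    by (rule \<delta>_eq[OF ob(1) comp_hom[OF uvh(2) w(1)] h'(2)])
      (use comp_extend1_arr[OF w(2) h(6) w(1), of v] uv(3) uvh in \<open>simp add: hom_iff \<delta>_def\<close>)
  have sh: "triangle_shape QU \<Sigma> A B D (mc x) (mc y) (mc w)"
    unfolding triangle_shape_def using th w(1) U Sigma_U by (simp add: mc_homU)
  have "triangle_iso QU \<Sigma> (mc x, mc g', mc h') (mc x, mc y, mc w)"
  proof (rule sub.triangle_isoI[OF std_shape[OF U(1,2) D' th(1) t'] sh sub.is_iso_idm sub.is_iso_idm iso])
    have idm_Sigma: "far \<Sigma> (idm QU A) = mc (idm T (\<Sigma>o A))"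
      using functor_idm[OF Sigma_functor_U, of A] U by simp
    show "mc w \<cdot>\<^bsub>QU\<^esub> mc v = far \<Sigma> (idm QU A) \<cdot>\<^bsub>QU\<^esub> mc h'"
      unfolding idm_Sigma using wv h'(2) factor_comp[OF h'(2) idm_hom[OF \<Sigma>o_ob[OF ob(1)]]]
      by (simp add: factor_comp[OF uvh(2) w(1)] hom_iff)
    show "mc y \<cdot>\<^bsub>QU\<^esub> idm QU B = mc v \<cdot>\<^bsub>QU\<^esub> mc g'"
      using th by (simp add: factor_comp[OF idm_hom[OF ob(2)] th(2)] factor_comp[OF h'(1) uvh(2)] uv(2) hom_iff)
    show "mc x \<cdot>\<^bsub>QU\<^esub> idm QU A = idm QU B \<cdot>\<^bsub>QU\<^esub> mc x"
      using th by (simp add: factor_comp[OF idm_hom[OF ob(1)] th(1)] factor_comp[OF th(1) idm_hom[OF ob(2)]] hom_iff)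
  qed (use U in simp_all)
  then show ?thesis using stdI[OF U(1,2) D' th(1) t'] by blast
qed

lemma basis: "triangle_basis QU \<Sigma> std"
proof (unfold_locales, goal_cases)
  case 1 show ?case by (rule Sigma_additive_U)
next
  case 2 show ?case by (rule Sigma_equivalence)
next
  case (3 F G H)
  then obtain A B D f g h where "A \<in> U" "B \<in> U" "D \<in> U" "f \<in> hom T A B"
    "tri (fob Us (\<Sigma>o A)) B D (f \<cdot> apx1 L A) g h" "(F, G, H) = (mc f, mc g, mc h)"
    by (rule stdE)
  then show ?case using std_shape by blast
next
  case (4 A Z)
  then have A: "A \<in> U" "A \<in> ob T" and Z: "zero_object QU Z" "Z \<in> U" "Z \<in> ob T"
    using U_ob by (auto simp: zero_object_def)
  note h = L_hom[OF A(2)]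
  have XU: "LX A \<in> U" using h(4) X_U by blast
  have t: "tri (fob Us (\<Sigma>o A)) A (LX A) (idm T A \<cdot> apx1 L A) (apx2 L A) (apx3 L A)"
    using L_triangle(1)[OF A(2)] h by (simp add: hom_iff)
  note SU = Sigma_U[OF A(1)]
  \<comment> \<open>As \<open>LX A\<close> lies in X it is a zero object modulo X, so the
    approximation triangle itself is the model of the identity triangle.\<close>
  have z: "zero_object QU (LX A)"
    unfolding zero_object_def using XU mc_zero_iff[OF idm_hom[OF h(5)]] ft_X_left[OF h(4) idm_hom[OF h(5)]]
    by simp
  have apx3: "mc (apx3 L A) = mc (zero T (LX A) (\<Sigma>o A))"
    using mc_zero_iff[OF h(3)] ft_X_left[OF h(4,3)] by simp
  have sh: "triangle_shape QU \<Sigma> A A Z (idm QU A) (zero QU A Z) (zero QU Z (fob \<Sigma> A))"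
    unfolding triangle_shape_def using A Z SU by (simp add: full_subcat_hom mc_hom idm_hom zero_hom)
  have "triangle_iso QU \<Sigma> (mc (idm T A), mc (apx2 L A), mc (apx3 L A))
      (idm QU A, zero QU A Z, zero QU Z (fob \<Sigma> A))"
  proof (rule sub.triangle_isoI[OF std_shape[OF A(1,1) XU idm_hom[OF A(2)] t] sh sub.is_iso_idm
        sub.is_iso_idm sub.zero_objects_iso[OF z Z(1)]])
    have idm_Sigma: "far \<Sigma> (idm QU A) = mc (idm T (\<Sigma>o A))"
      using functor_idm[OF Sigma_functor_U, of A] A by simp
    show "zero QU Z (fob \<Sigma> A) \<cdot>\<^bsub>QU\<^esub> zero QU (LX A) Z = far \<Sigma> (idm QU A) \<cdot>\<^bsub>QU\<^esub> mc (apx3 L A)"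
      unfolding idm_Sigma apx3 using A Z h factor_comp[OF zero_hom[OF h(5) Z(3)] zero_hom[OF Z(3), of "\<Sigma>o A"]]
        factor_comp[OF zero_hom[OF h(5), of "\<Sigma>o A"] idm_hom] by simp
    show "zero QU A Z \<cdot>\<^bsub>QU\<^esub> idm QU A = zero QU (LX A) Z \<cdot>\<^bsub>QU\<^esub> mc (apx2 L A)"
      using A Z h factor_comp[OF h(2) zero_hom[OF h(5) Z(3)]] factor_comp[OF idm_hom zero_hom[OF A(2) Z(3)]]
      by (simp add: hom_iff)
    show "idm QU A \<cdot>\<^bsub>QU\<^esub> idm QU A = idm QU A \<cdot>\<^bsub>QU\<^esub> mc (idm T A)" by simp
  qed (use A in simp_all)
  then show ?case using stdI[OF A(1,1) XU idm_hom[OF A(2)] t] by auto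
next
  case (5 F A B)
  then have U: "A \<in> U" "B \<in> U" "A \<in> ob T" using U_ob by (auto simp: full_subcat_hom)
  obtain f where f: "f \<in> hom T A B" "F = mc f" using 5 by (auto simp: full_subcat_hom elim!: factor_homE)
  have "f \<cdot> apx1 L A \<in> hom T (fob Us (\<Sigma>o A)) B" using f L_hom[OF U(3)] by (simp add: hom_iff)
  then obtain D g h where t: "tri (fob Us (\<Sigma>o A)) B D (f \<cdot> apx1 L A) g h" using tri_ex by blast
  show ?case unfolding f(2) using stdI[OF U(1,2) std_cone[OF U(1,2) t] f(1) t] by blast
next
  case (6 A' B' D' F G H)
  obtain A B D f g h where U: "A \<in> U" "B \<in> U" "D \<in> U" and f: "f \<in> hom T A B"
    and t: "tri (fob Us (\<Sigma>o A)) B D (f \<cdot> apx1 L A) g h" and eq: "(F, G, H) = (mc f, mc g, mc h)"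
    using 6(2) by (rule stdE)
  have ob: "A \<in> ob T" "B \<in> ob T" "D \<in> ob T" using U U_ob by blast+
  note lh = L_hom[OF ob(1)] L_hom[OF ob(2)]
  obtain s where s: "s \<in> hom T (\<Sigma>o A) (\<Sigma>o B)" "\<delta> B \<cdot> s = far Sh f \<cdot> \<delta> A" using Sigma_ex[OF f] .
  \<comment> \<open>The rotated triangle of T has all terms in U and connecting map
    \<open>\<delta> B \<cdot> \<ominus> s\<close>, where s represents \<Sigma>f; this is the input
    of \<open>conflation\<close>.\<close>
  have r: "tri B D (\<Sigma>o A) g h (\<ominus> far Sh (f \<cdot> apx1 L A))" using tri_rot[OF t] ob by simp
  have w: "\<ominus> s \<in> hom T (\<Sigma>o A) (\<Sigma>o B)" "\<delta> B \<cdot> \<ominus> s = \<ominus> far Sh (f \<cdot> apx1 L A)"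
    using s f lh by (auto simp: hom_iff \<delta>_def)
  have "\<ominus>\<^bsub>QU\<^esub> far \<Sigma> F = mc (\<ominus> s)"
    using eq Sigma_far[OF f s] factor_neg[OF s(1)] by simp
  then show ?case using conflation[OF U(2,3) Sigma_U[OF U(1)] r w] eq by simp
next
  case (7 F G H F' G' H' A0 B0 D0 A0' B0' D0' a b)
  obtain A B D f g h where U: "A \<in> U" "B \<in> U" "D \<in> U" and f: "f \<in> hom T A B"
    and t: "tri (fob Us (\<Sigma>o A)) B D (f \<cdot> apx1 L A) g h" and eq: "(F, G, H) = (mc f, mc g, mc h)"
    using 7(1) by (rule stdE)
  obtain A' B' D' f' g' h' where U': "A' \<in> U" "B' \<in> U" "D' \<in> U" and f': "f' \<in> hom T A' B'"
    and t': "tri (fob Us (\<Sigma>o A')) B' D' (f' \<cdot> apx1 L A') g' h'" and eq': "(F', G', H') = (mc f', mc g', mc h')"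
    using 7(2) by (rule stdE)
  have e0: "A0 = A" "B0 = B" "D0 = D"
    using sub.triangle_shape_unique[OF std_shape[OF U f t]] 7(3) eq by simp_all
  have e0': "A0' = A'" "B0' = B'" "D0' = D'"
    using sub.triangle_shape_unique[OF std_shape[OF U' f' t']] 7(4) eq' by simp_all
  obtain p where p: "p \<in> hom T A A'" "a = mc p"
    using 7(5) unfolding e0 e0' by (auto simp: full_subcat_hom elim!: factor_homE)
  obtain q where q: "q \<in> hom T B B'" "b = mc q"
    using 7(6) unfolding e0 e0' by (auto simp: full_subcat_hom elim!: factor_homE)
  have ob: "A \<in> ob T" "B \<in> ob T" "D \<in> ob T" "A' \<in> ob T" "B' \<in> ob T" "D' \<in> ob T" using U U' U_ob by blast+
  note lh = L_hom[OF ob(1)] L_hom[OF ob(4)]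
  note sh = std_hom[OF U(1) t] std_hom[OF U'(1) t']
  \<comment> \<open>The square commutes only modulo X. Composition with \<open>apx1 L A\<close>,
    which kills everything that factors through X, makes it commute in T.\<close>
  have "mc (f' \<cdot> p) = mc (q \<cdot> f)"
    using 7(7) eq eq' p q by (simp add: factor_comp[OF p(1) f'] factor_comp[OF f q(1)])
  then have "ft A B' (f' \<cdot> p \<oplus> \<ominus> (q \<cdot> f))"
    using mc_eq[OF comp_hom[OF p(1) f'] comp_hom[OF f q(1)]] by simp
  from ft_apx1[OF this]
  have "f' \<cdot> (p \<cdot> apx1 L A) \<oplus> \<ominus> (q \<cdot> (f \<cdot> apx1 L A)) = zero T (fob Us (\<Sigma>o A)) B'"
    using f f' p q lh by (simp add: hom_iff distrib_arr)
  then have sq0: "f' \<cdot> (p \<cdot> apx1 L A) = q \<cdot> (f \<cdot> apx1 L A)"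
    by (subst (asm) diff_eq_zero_iff) (use f f' p q lh in \<open>simp_all add: hom_iff\<close>)
  obtain s where s: "s \<in> hom T (\<Sigma>o A) (\<Sigma>o A')" "\<delta> A' \<cdot> s = far Sh p \<cdot> \<delta> A" using Sigma_ex[OF p(1)] .
  have Uss: "far Us s \<in> hom T (fob Us (\<Sigma>o A)) (fob Us (\<Sigma>o A'))" using s by (simp add: hom_iff)
  have "far Sh (apx1 L A' \<cdot> far Us s) = far Sh (p \<cdot> apx1 L A)"
    using s p lh ob by (simp add: \<delta>_def hom_iff)
  then have ss: "apx1 L A' \<cdot> far Us s = p \<cdot> apx1 L A"
    using S_faithful comp_hom[OF Uss lh(7)] comp_hom[OF lh(1) p(1)] by blast
  have sq: "(f' \<cdot> apx1 L A') \<cdot> far Us s = q \<cdot> (f \<cdot> apx1 L A)"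
    using sq0 ss f' lh Uss by (simp add: hom_iff)
  obtain d where d: "d \<in> hom T D D'" "g' \<cdot> q = d \<cdot> g" "h' \<cdot> d = far Sh (far Us s) \<cdot> h"
    using tri_mor[OF t t' Uss q(1) sq] .
  have hd: "h' \<cdot> d = s \<cdot> h" using d(3) s by (simp add: hom_iff)
  show ?case unfolding e0 e0'
  proof (intro bexI[of _ "mc d"] conjI)
    show "mc d \<in> hom QU D D'" using mc_homU[OF d(1) U(3) U'(3)] .
    show "G' \<cdot>\<^bsub>QU\<^esub> b = mc d \<cdot>\<^bsub>QU\<^esub> G"
      using eq eq' q(2) d(2) by (simp add: factor_comp[OF q(1) sh(3)] factor_comp[OF sh(1) d(1)])
    show "H' \<cdot>\<^bsub>QU\<^esub> mc d = far \<Sigma> a \<cdot>\<^bsub>QU\<^esub> H"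
      using eq eq' p(2) hd by (simp add: factor_comp[OF d(1) sh(4)] Sigma_far[OF p(1) s] factor_comp[OF sh(2) s(1)])
  qed
qed

sublocale basis: triangle_basis QU \<Sigma> std
  by (rule basis)

sublocale weak: weak_triangulated_category QU \<Sigma> "basis.iso_closure"
  by (rule basis.weak_triangulated)

text \<open>The working form of \<open>conflation\<close>: a triangle of T with terms in U gives one
  of U/X as soon as its connecting map is lifted through \<delta>.\<close>

lemma weak_conflation:
  assumes "A \<in> U" "B \<in> U" "D \<in> U" "tri A B D x y \<epsilon>" "w \<in> hom T D (\<Sigma>o A)" "\<delta> A \<cdot> w = \<epsilon>"
  shows "weak.tri A B D (mc x) (mc y) (mc w)"
proof (rule weak.triI)
  note h = tri_hom[OF assms(4)]
  show "mc x \<in> hom QU A B" "mc y \<in> hom QU B D" "mc w \<in> hom QU D (fob \<Sigma> A)"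
    using h assms Sigma_U by (simp_all add: mc_homU)
  show "(mc x, mc y, mc w) \<in> basis.iso_closure"
    using conflation[OF assms] unfolding basis.iso_closure_def by blast
qed

text \<open>Adding a left approximation as a second component turns a morphism into an inflation without
  changing it modulo \<open>X\<close>.\<close>

lemma inflation:
  assumes U: "A \<in> U" "B \<in> U" and f: "f \<in> hom T A B"
  obtains B' p f' D y \<epsilon> where "B' \<in> U" "D \<in> U" "p \<in> hom T B' B" "f' \<in> hom T A B'" "p \<cdot> f' = f"
    "is_iso QU B' B (mc p)" "tri A B' D f' y \<epsilon>"
proof -
  have ob: "A \<in> ob T" "B \<in> ob T" using U U_ob by blast+
  note h = L_hom[OF ob(1)]
  obtain B' i j p q where b: "biproduct T B (LX A) B' i j p q" using biproduct_ex[OF ob(2) h(5)] by blast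
  have bh: "i \<in> hom T B B'" "j \<in> hom T (LX A) B'" "p \<in> hom T B' B" "q \<in> hom T B' (LX A)"
    "p \<cdot> i = idm T B" "q \<cdot> j = idm T (LX A)" "p \<cdot> j = zero T (LX A) B" "q \<cdot> i = zero T B (LX A)"
    "(i \<cdot> p) \<oplus> (j \<cdot> q) = idm T B'"
    using b unfolding biproduct_def by blast+
  have B': "B' \<in> U" using subcategoryD(4)[OF U_subcategory b] U h(4) X_U by blast
  have B'_ob: "B' \<in> ob T" using U_ob[OF B'] .
  have xi: "arr w \<Longrightarrow> cd w = B \<Longrightarrow> p \<cdot> (i \<cdot> w) = w" "arr w \<Longrightarrow> cd w = LX A \<Longrightarrow> q \<cdot> (j \<cdot> w) = w"
    "arr w \<Longrightarrow> cd w = LX A \<Longrightarrow> p \<cdot> (j \<cdot> w) = zero T (dm w) B"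
    "arr w \<Longrightarrow> cd w = B \<Longrightarrow> q \<cdot> (i \<cdot> w) = zero T (dm w) (LX A)" for w
    using comp_extend1_arr[OF bh(5,3,1), of w] comp_extend1_arr[OF bh(6,4,2), of w]
      comp_extend1_arr[OF bh(7,3,2), of w] comp_extend1_arr[OF bh(8,4,1), of w] ob h(5) by simp_all
  define f' where "f' = (i \<cdot> f) \<oplus> (j \<cdot> apx2 L A)"
  have f': "f' \<in> hom T A B'" unfolding f'_def using bh f h by (simp add: hom_iff)
  have pf: "p \<cdot> f' = f" and qf: "q \<cdot> f' = apx2 L A"
    unfolding f'_def using xi f h ob bh(1-4) by (simp_all add: hom_iff distrib_arr)
  \<comment> \<open>The complement of B in B' is \<open>LX A\<close>, so p and i are inverse to each
    other modulo X.\<close>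
  have "ft B' B' (j \<cdot> q)" using ftI[OF h(4) bh(4,2)] .
  moreover have "idm T B' \<oplus> \<ominus> (i \<cdot> p) = j \<cdot> q"
  proof -
    have *: "idm T B' = (j \<cdot> q) \<oplus> (i \<cdot> p)"
      by (subst add_commute_arr) (use bh in \<open>auto simp: hom_iff\<close>)
    have "((j \<cdot> q) \<oplus> (i \<cdot> p)) \<oplus> \<ominus> (i \<cdot> p) = (j \<cdot> q) \<oplus> ((i \<cdot> p) \<oplus> \<ominus> (i \<cdot> p))"
      by (rule add_assoc_arr) (use bh(1-4) in \<open>auto simp: hom_iff\<close>)
    also have "\<dots> = j \<cdot> q" using bh(1-4) by (simp add: hom_iff)
    finally show ?thesis by (subst *)
  qed
  ultimately have "mc (idm T B') = mc (i \<cdot> p)"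
    using mc_eq[OF idm_hom[OF B'_ob] comp_hom[OF bh(3,1)]] by simp
  then have iso: "is_iso QU B' B (mc p)"
    by (intro sub.is_isoI[OF mc_homU[OF bh(3) B' U(2)] mc_homU[OF bh(1) U(2) B']])
      (simp_all add: factor_comp[OF bh(1,3)] factor_comp[OF bh(3,1)] bh(5))
  obtain D y \<epsilon> where t: "tri A B' D f' y \<epsilon>" using tri_ex[OF f'] .
  have tq: "tri B' (LX A) (fob Sh B) q (zero T (LX A) (fob Sh B)) (\<ominus> far Sh i)"
    using tri_rot[OF tri_of_biproduct[OF b]] .
  have tl: "tri A (LX A) (\<Sigma>o A) (q \<cdot> f') (apx3 L A) (\<ominus> \<delta> A)"
    unfolding qf using L_triangle_rot[OF ob(1)] .
  \<comment> \<open>Octahedron on \<open>q \<cdot> f' = apx2 L A\<close>: the three cones are D,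
    B[1] and \<Sigma>A. Rotated back, it presents D as an extension of \<Sigma>A by B, hence D lies
    in U.\<close>
  obtain u v where uv: "tri D (\<Sigma>o A) (fob Sh B) u v (far Sh y \<cdot> \<ominus> far Sh i)"
    using tri_octahedron[OF t tq tl] by blast
  have th: "y \<in> hom T B' D" using tri_hom[OF t] by blast
  have "tri B D (\<Sigma>o A) (y \<cdot> i) u v"
  proof (rule tri_rot_back)
    show "tri D (\<Sigma>o A) (fob Sh B) u v (\<ominus> far Sh (y \<cdot> i))" using uv th bh(1) by (simp add: hom_iff)
  qed (use tri_hom[OF uv] comp_hom[OF bh(1) th] in auto)
  from U_ext[OF this U(2) Sigma_U[OF U(1)]] have "D \<in> U" .
  then show thesis using that[OF B' _ bh(3) f' pf iso t] by blast
qed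

text \<open>After both morphisms are replaced by inflations, the octahedron of T has all six objects
  in U. Its four triangles become triangles of U/X, and the commutativities involving connecting
  maps are tested through \<delta>.\<close>

lemma weak_octahedron:
  assumes F: "F \<in> hom QU A B" and G: "G \<in> hom QU B E"
  shows "\<exists>B' E' b e f' g' D K H f1 f2 g1 g2 k1 k2 u v.
      is_iso QU B' B b \<and> is_iso QU E' E e \<and> b \<cdot>\<^bsub>QU\<^esub> f' = F \<and> e \<cdot>\<^bsub>QU\<^esub> g' = G \<cdot>\<^bsub>QU\<^esub> b \<and>
      weak.tri A B' D f' f1 f2 \<and> weak.tri B' E' K g' g1 g2 \<and> weak.tri A E' H (g' \<cdot>\<^bsub>QU\<^esub> f') k1 k2 \<and>
      weak.tri D H K u v (far \<Sigma> f1 \<cdot>\<^bsub>QU\<^esub> g2) \<and> u \<cdot>\<^bsub>QU\<^esub> f1 = k1 \<cdot>\<^bsub>QU\<^esub> g' \<and> k2 \<cdot>\<^bsub>QU\<^esub> u = f2 \<and>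
      v \<cdot>\<^bsub>QU\<^esub> k1 = g1 \<and> g2 \<cdot>\<^bsub>QU\<^esub> v = far \<Sigma> f' \<cdot>\<^bsub>QU\<^esub> k2"
proof -
  have U: "A \<in> U" "B \<in> U" "E \<in> U" using F G by (auto simp: full_subcat_hom)
  obtain f where f: "f \<in> hom T A B" "F = mc f" using F by (auto simp: full_subcat_hom elim!: factor_homE)
  obtain g where g: "g \<in> hom T B E" "G = mc g" using G by (auto simp: full_subcat_hom elim!: factor_homE)
  obtain B' p f' D y \<epsilon> where i1: "B' \<in> U" "D \<in> U" "p \<in> hom T B' B" "f' \<in> hom T A B'" "p \<cdot> f' = f"
      "is_iso QU B' B (mc p)" and tf: "tri A B' D f' y \<epsilon>"
    using inflation[OF U(1,2) f(1)] .
  have gp: "g \<cdot> p \<in> hom T B' E" using g i1 by (simp add: hom_iff)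
  \<comment> \<open>The second inflation is built from \<open>g \<cdot> p\<close>, so that it starts
    at B', where the first one ends.\<close>
  obtain E' q g' K z \<zeta> where i2: "E' \<in> U" "K \<in> U" "q \<in> hom T E' E" "g' \<in> hom T B' E'" "q \<cdot> g' = g \<cdot> p"
      "is_iso QU E' E (mc q)" and tg: "tri B' E' K g' z \<zeta>"
    using inflation[OF i1(1) U(3) gp] .
  obtain H k \<kappa> where tk: "tri A E' H (g' \<cdot> f') k \<kappa>" using tri_ex[OF comp_hom[OF i1(4) i2(4)]] .
  obtain u v where uv: "tri D H K u v (far Sh y \<cdot> \<zeta>)" "u \<cdot> y = k \<cdot> g'" "\<kappa> \<cdot> u = \<epsilon>" "v \<cdot> k = z"
      "\<zeta> \<cdot> v = far Sh f' \<cdot> \<kappa>"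
    using tri_octahedron[OF tf tg tk] .
  have H: "H \<in> U" using U_ext[OF uv(1) i1(2) i2(2)] .
  have ob: "A \<in> ob T" "B' \<in> ob T" "D \<in> ob T" using U i1 U_ob by blast+
  note th = tri_hom[OF tf] tri_hom[OF tg] tri_hom[OF tk] tri_hom[OF uv(1)]
  note lh = L_hom(6)[OF ob(1)] L_hom(6)[OF ob(2)] L_hom(6)[OF ob(3)]
  \<comment> \<open>In T the connecting maps end in A[1] and B'[1]; their lifts through \<delta> end
    in \<Sigma>A and \<Sigma>B', as triangles of U/X demand.\<close>
  obtain wf where wf: "wf \<in> hom T D (\<Sigma>o A)" "\<delta> A \<cdot> wf = \<epsilon>" using \<delta>_lift_U[OF ob(1) i1(2) th(3)] .
  obtain wg where wg: "wg \<in> hom T K (\<Sigma>o B')" "\<delta> B' \<cdot> wg = \<zeta>" using \<delta>_lift_U[OF ob(2) i2(2) th(6)] .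
  obtain wk where wk: "wk \<in> hom T H (\<Sigma>o A)" "\<delta> A \<cdot> wk = \<kappa>" using \<delta>_lift_U[OF ob(1) H th(9)] .
  obtain sy where sy: "sy \<in> hom T (\<Sigma>o B') (\<Sigma>o D)" "\<delta> D \<cdot> sy = far Sh y \<cdot> \<delta> B'" using Sigma_ex[OF th(2)] .
  obtain sf where sf: "sf \<in> hom T (\<Sigma>o A) (\<Sigma>o B')" "\<delta> B' \<cdot> sf = far Sh f' \<cdot> \<delta> A" using Sigma_ex[OF th(1)] .
  have Shh: "far Sh y \<in> hom T (fob Sh B') (fob Sh D)" "far Sh f' \<in> hom T (fob Sh A) (fob Sh B')"
    using th by (simp_all add: hom_iff)
  have w: "sy \<cdot> wg \<in> hom T K (\<Sigma>o D)" "\<delta> D \<cdot> (sy \<cdot> wg) = far Sh y \<cdot> \<zeta>"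
    using comp_extend_arr[OF sy(2) lh(3) sy(1) Shh(1) lh(2), of wg] sy wg by (simp_all add: hom_iff)
  have 1: "weak.tri A B' D (mc f') (mc y) (mc wf)" by (rule weak_conflation[OF U(1) i1(1,2) tf wf])
  have 2: "weak.tri B' E' K (mc g') (mc z) (mc wg)" by (rule weak_conflation[OF i1(1) i2(1,2) tg wg])
  have 3: "weak.tri A E' H (mc g' \<cdot>\<^bsub>QU\<^esub> mc f') (mc k) (mc wk)"
    using weak_conflation[OF U(1) i2(1) H tk wk] by (simp add: factor_comp[OF th(1) th(4)])
  have 4: "weak.tri D H K (mc u) (mc v) (far \<Sigma> (mc y) \<cdot>\<^bsub>QU\<^esub> mc wg)"
    using weak_conflation[OF i1(2) H i2(2) uv(1) w]
    by (simp add: Sigma_far[OF th(2) sy] factor_comp[OF wg(1) sy(1)])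
  have 5: "mc (wk \<cdot> u) = mc wf"
    by (rule \<delta>_eq[OF ob(1)])
      (use comp_extend1_arr[OF wk(2) lh(1) wk(1), of u] uv(3) wf wk th in \<open>auto simp: hom_iff\<close>)
  have 6: "mc (wg \<cdot> v) = mc (sf \<cdot> wk)"
    by (rule \<delta>_eq[OF ob(2)])
      (use comp_extend1_arr[OF wg(2) lh(2) wg(1), of v] uv(5) wk th wg sf
        comp_extend_arr[OF sf(2) lh(2) sf(1) Shh(2) lh(1), of wk] in \<open>auto simp: hom_iff\<close>)
  have 7: "mc p \<cdot>\<^bsub>QU\<^esub> mc f' = F" "mc q \<cdot>\<^bsub>QU\<^esub> mc g' = G \<cdot>\<^bsub>QU\<^esub> mc p"
    by (simp_all add: f g factor_comp[OF i1(4,3)] factor_comp[OF i2(4,3)] factor_comp[OF i1(3) g(1)] i1(5) i2(5))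
  have 8: "mc u \<cdot>\<^bsub>QU\<^esub> mc y = mc k \<cdot>\<^bsub>QU\<^esub> mc g'" "mc wk \<cdot>\<^bsub>QU\<^esub> mc u = mc wf" "mc v \<cdot>\<^bsub>QU\<^esub> mc k = mc z"
    using 5 uv(2,4) by (simp_all add: factor_comp[OF th(2,10)] factor_comp[OF th(4,8)]
        factor_comp[OF th(10) wk(1)] factor_comp[OF th(8,11)])
  have 9: "mc wg \<cdot>\<^bsub>QU\<^esub> mc v = far \<Sigma> (mc f') \<cdot>\<^bsub>QU\<^esub> mc wk"
    using 6 by (simp add: Sigma_far[OF th(1) sf] factor_comp[OF th(11) wg(1)] factor_comp[OF wk(1) sf(1)])
  show ?thesis
    by (rule exI[of _ B'], rule exI[of _ E'], rule exI[of _ "mc p"], rule exI[of _ "mc q"],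
        rule exI[of _ "mc f'"], rule exI[of _ "mc g'"], rule exI[of _ D], rule exI[of _ K], rule exI[of _ H],
        rule exI[of _ "mc y"], rule exI[of _ "mc wf"], rule exI[of _ "mc z"], rule exI[of _ "mc wg"],
        rule exI[of _ "mc k"], rule exI[of _ "mc wk"], rule exI[of _ "mc u"], rule exI[of _ "mc v"])
      (intro conjI i1(6) i2(6) 1 2 3 4 7 8 9)
qed

lemma triangulated_QU: "triangulated_category QU \<Sigma> basis.iso_closure"
  using weak.triangulated[OF weak_octahedron] .

section \<open>Comparison with the right and left triangles of T/X\<close>

lemma right_triangleE:
  assumes "t \<in> right_triangles T Us \<Delta> X L"
  obtains A B D f g h where "A \<in> ob T" "f \<in> hom T A B"
    "tri (fob Us (\<Sigma>o A)) B D (f \<cdot> apx1 L A) g h" "triangle_iso Q \<Sigma> (mc f, mc g, mc h) t"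
proof -
  obtain A B D f g h where *: "f \<in> hom T A B" "g \<in> hom T B D" "h \<in> hom T D (\<Sigma>o A)"
    "(f \<cdot> apx1 L A, g, h) \<in> \<Delta>" "triangle_iso Q \<Sigma> (mc f, mc g, mc h) t"
    using assms unfolding right_triangles_def by (elim CollectE exE conjE)
  have A: "A \<in> ob T" using *(1) by (simp add: hom_iff)
  have "tri (fob Us (\<Sigma>o A)) B D (f \<cdot> apx1 L A) g h"
    by (rule triI) (use * A L_hom[OF A] in \<open>simp_all add: hom_iff\<close>)
  then show thesis using that A * by blast
qed

lemma right_triangle_shape:
  assumes A: "A \<in> ob T" and f: "f \<in> hom T A B" and t: "tri (fob Us (\<Sigma>o A)) B D (f \<cdot> apx1 L A) g h"
  shows "triangle_shape Q \<Sigma> A B D (mc f) (mc g) (mc h)"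
  unfolding triangle_shape_def using tri_hom[OF t] A f by (simp add: mc_hom)

lemma Q_isoU: "is_iso Q A B a \<Longrightarrow> A \<in> U \<longleftrightarrow> B \<in> U"
  using factor_isomorphic[OF U_subcategory X_U split] factor.isomorphic_sym
  unfolding isomorphic_def by blast

text \<open>U contains X and is therefore closed under isomorphism modulo X. So the first two
  objects of the underlying model lie in U too, \<open>std_cone\<close> puts its third object there,
  and the isomorphism carries this back.\<close>

lemma right_triangles_closed:
  assumes t: "(F, G, H) \<in> right_triangles T Us \<Delta> X L" and s: "triangle_shape Q \<Sigma> A B D F G H"
    and U: "A \<in> U" "B \<in> U"
  shows "D \<in> U \<and> (F, G, H) \<in> basis.iso_closure"
proof -
  obtain A1 B1 D1 f g h where A1: "A1 \<in> ob T" "f \<in> hom T A1 B1"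
    and t1: "tri (fob Us (\<Sigma>o A1)) B1 D1 (f \<cdot> apx1 L A1) g h"
    and iso: "triangle_iso Q \<Sigma> (mc f, mc g, mc h) (F, G, H)"
    using t by (rule right_triangleE)
  note s1 = right_triangle_shape[OF A1 t1]
  obtain A2 B2 D2 A' B' D' a b d where s2: "triangle_shape Q \<Sigma> A2 B2 D2 (mc f) (mc g) (mc h)"
    and s': "triangle_shape Q \<Sigma> A' B' D' F G H"
    and i2: "is_iso Q A2 A' a" "is_iso Q B2 B' b" "is_iso Q D2 D' d"
    and e: "F \<cdot>\<^bsub>Q\<^esub> a = b \<cdot>\<^bsub>Q\<^esub> mc f" "G \<cdot>\<^bsub>Q\<^esub> b = d \<cdot>\<^bsub>Q\<^esub> mc g" "H \<cdot>\<^bsub>Q\<^esub> d = far \<Sigma> a \<cdot>\<^bsub>Q\<^esub> mc h"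
    using factor.triangle_isoE[OF iso] by blast
  have i: "is_iso Q A1 A a" "is_iso Q B1 B b" "is_iso Q D1 D d"
    using factor.triangle_shape_unique[OF s1 s2] factor.triangle_shape_unique[OF s s'] i2 by simp_all
  have U1: "A1 \<in> U" "B1 \<in> U" using Q_isoU i U by blast+
  have D1: "D1 \<in> U" using std_cone[OF U1 t1] .
  have D: "D \<in> U" using Q_isoU[OF i(3)] D1 by blast
  have sU: "triangle_shape QU \<Sigma> A B D F G H"
    using s U D Sigma_U unfolding triangle_shape_def by (simp add: full_subcat_hom)
  have "triangle_iso QU \<Sigma> (mc f, mc g, mc h) (F, G, H)"
    by (rule sub.triangle_isoI[OF std_shape[OF U1 D1 A1(2) t1] sU, of a b d])
      (use i U U1 D D1 e in \<open>simp_all add: full_subcat_is_iso\<close>)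
  then show ?thesis using D stdI[OF U1 D1 A1(2) t1] unfolding basis.iso_closure_def by blast
qed

text \<open>Shows that the structure built from models inside U is the restriction of the ambient
  right triangles, which is what the definition of a triangulated subcategory speaks about.\<close>

lemma iso_closure_eq:
  "basis.iso_closure = {(F, G, H) \<in> right_triangles T Us \<Delta> X L. \<exists>A B D. triangle_shape QU \<Sigma> A B D F G H}"
  (is "_ = ?R")
proof (intro set_eqI iffI)
  fix t assume t: "t \<in> basis.iso_closure"
  obtain F G H where FGH: "t = (F, G, H)" by (metis prod_cases3)
  obtain t0 where t0: "t0 \<in> std" "triangle_iso QU \<Sigma> t0 (F, G, H)"
    using t FGH unfolding basis.iso_closure_def by blast
  obtain A B D f g h where U: "A \<in> U" "B \<in> U" "D \<in> U" "f \<in> hom T A B"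
    and t: "tri (fob Us (\<Sigma>o A)) B D (f \<cdot> apx1 L A) g h" and t0_eq: "t0 = (mc f, mc g, mc h)"
    using t0(1) by (rule stdE)
  obtain A1 B1 D1 A2 B2 D2 a b d where s: "triangle_shape QU \<Sigma> A1 B1 D1 (mc f) (mc g) (mc h)"
      "triangle_shape QU \<Sigma> A2 B2 D2 F G H"
    and i: "is_iso QU A1 A2 a" "is_iso QU B1 B2 b" "is_iso QU D1 D2 d"
    and e: "F \<cdot>\<^bsub>QU\<^esub> a = b \<cdot>\<^bsub>QU\<^esub> mc f" "G \<cdot>\<^bsub>QU\<^esub> b = d \<cdot>\<^bsub>QU\<^esub> mc g" "H \<cdot>\<^bsub>QU\<^esub> d = far \<Sigma> a \<cdot>\<^bsub>QU\<^esub> mc h"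
    using sub.triangle_isoE[OF t0(2)[unfolded t0_eq]] by blast
  have sQ: "triangle_shape Q \<Sigma> A1 B1 D1 (mc f) (mc g) (mc h)" "triangle_shape Q \<Sigma> A2 B2 D2 F G H"
    using s unfolding triangle_shape_def by (simp_all add: full_subcat_hom)
  have "triangle_iso Q \<Sigma> (mc f, mc g, mc h) (F, G, H)"
    by (rule factor.triangle_isoI[OF sQ, of a b d]) (use i e in \<open>simp_all add: full_subcat_is_iso\<close>)
  moreover have "(f \<cdot> apx1 L A, g, h) \<in> \<Delta>" using t unfolding tri_def by blast
  ultimately have "(F, G, H) \<in> right_triangles T Us \<Delta> X L"
    unfolding right_triangles_def using U(4) std_hom[OF U(1) t] by blast
  then show "t \<in> ?R" using s(2) FGH by blast
next
  fix t assume "t \<in> ?R"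
  then obtain F G H A B D where t: "t = (F, G, H)" "(F, G, H) \<in> right_triangles T Us \<Delta> X L"
      "triangle_shape QU \<Sigma> A B D F G H" by blast
  then have "triangle_shape Q \<Sigma> A B D F G H" "A \<in> U" "B \<in> U"
    unfolding triangle_shape_def by (simp_all add: full_subcat_hom)
  then show "t \<in> basis.iso_closure" using right_triangles_closed t by blast
qed

text \<open>On a model, the first object is an extension of \<open>B1\<close> by
  \<open>\<Omega>o D1\<close>, both of which lie in U.\<close>

lemma left_triangles_closed:
  assumes t: "(F, G, H) \<in> left_triangles T Sh \<Delta> X R" and s: "left_triangle_shape Q \<Omega> A B D F G H"
    and U: "B \<in> U" "D \<in> U"
  shows "A \<in> U"
proof -
  obtain A1 B1 D1 f g h where h: "f \<in> hom T (\<Omega>o D1) A1" "g \<in> hom T A1 B1" "h \<in> hom T B1 D1"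
    and t1: "(f, g, \<omega> D1 \<cdot> h) \<in> \<Delta>" and iso: "left_triangle_iso Q \<Omega> (mc f, mc g, mc h) (F, G, H)"
    using t unfolding left_triangles_def by (elim CollectE exE conjE)
  obtain A2 B2 D2 A' B' D' a b d where s2: "left_triangle_shape Q \<Omega> A2 B2 D2 (mc f) (mc g) (mc h)"
    and s': "left_triangle_shape Q \<Omega> A' B' D' F G H"
    and i2: "is_iso Q A2 A' a" "is_iso Q B2 B' b" "is_iso Q D2 D' d"
    using iso unfolding left_triangle_iso_def prod.case by (elim exE conjE)
  have "A' = A" "B' = B" "D' = D"
    using s s' factor.hom_disjoint unfolding left_triangle_shape_def by blast+
  moreover have "A2 = A1" "B2 = B1" "D2 = D1"
    using s2 h(2,3) mc_hom_iff unfolding left_triangle_shape_def by blast+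
  ultimately have i: "is_iso Q A1 A a" "is_iso Q B1 B b" "is_iso Q D1 D d" using i2 by simp_all
  have U1: "B1 \<in> U" "D1 \<in> U" using Q_isoU i U by blast+
  have "tri (\<Omega>o D1) A1 B1 f g (\<omega> D1 \<cdot> h)"
    by (rule triI[OF h(1,2) _ t1]) (use comp_hom[OF h(3) R_hom(3)[OF U_ob[OF U1(2)]]] in simp)
  then have "A1 \<in> U" using U_ext Omega_U[OF U1(2)] U1(1) by blast
  then show ?thesis using Q_isoU[OF i(1)] by blast
qed

theorem triangulated_subcategory: "triangulated_subcategory T Sh Us \<Delta> X L R U"
  unfolding triangulated_subcategory_def Let_def
proof (intro conjI allI impI ballI)
  show "subcategory Q U" by (rule U_factor_subcategory)
  show "fob \<Sigma> A \<in> U" "fob \<Omega> A \<in> U" if "A \<in> U" for A using that Sigma_U Omega_U by simp_all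
  show "D \<in> U" if "(F, G, H) \<in> right_triangles T Us \<Delta> X L \<and> triangle_shape Q \<Sigma> A B D F G H \<and> A \<in> U \<and> B \<in> U"
    for A B D F G H
    using that right_triangles_closed by blast
  show "A \<in> U" if "(F, G, H) \<in> left_triangles T Sh \<Delta> X R \<and> left_triangle_shape Q \<Omega> A B D F G H \<and> B \<in> U \<and> D \<in> U"
    for A B D F G H
    using that left_triangles_closed by blast
  show "triangulated_category QU \<Sigma>
      {(F, G, H) \<in> right_triangles T Us \<Delta> X L. \<exists>A B D. triangle_shape QU \<Sigma> A B D F G H}"
    using triangulated_QU unfolding iso_closure_eq .
  show "is_equivalence QU QU \<Sigma>" "is_equivalence QU QU \<Omega>"
    by (rule Sigma_equivalence, rule Omega_equivalence)
qed

end

section \<open>Minimal approximations\<close>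

text \<open>Gaussian elimination by induction on the equations G, the unknowns being indexed by J.
  An unknown i that occurs in the new equation g is eliminated from all others, which removes one
  equation and one unknown.\<close>

lemma homogeneous_system_solution:
  fixes c :: "nat \<Rightarrow> 'm \<Rightarrow> 'k::field"
  assumes "finite G" "finite J" "card G < card J"
  shows "\<exists>l. (\<exists>j \<in> J. l j \<noteq> 0) \<and> (\<forall>g \<in> G. (\<Sum>j \<in> J. l j * c j g) = 0)"
  using assms
proof (induction G arbitrary: J c rule: finite_induct)
  case empty
  then have "J \<noteq> {}" by auto
  then show ?case by (intro exI[of _ "\<lambda>_. 1"]) auto
next
  case (insert g G)
  show ?case
  proof (cases "\<forall>j \<in> J. c j g = 0")
    case True
    obtain l where "\<exists>j \<in> J. l j \<noteq> 0" "\<forall>g \<in> G. (\<Sum>j \<in> J. l j * c j g) = 0"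
      using insert.IH[OF insert.prems(1), of c] insert.prems(2) insert.hyps by auto
    then show ?thesis using True by (intro exI[of _ l]) auto
  next
    case False
    then obtain i where i: "i \<in> J" "c i g \<noteq> 0" by blast
    let ?J = "J - {i}"
    \<comment> \<open>Coefficients after subtracting the multiple of the i-th column that clears
      equation g.\<close>
    define d where "d = (\<lambda>j x. c j x - c j g / c i g * c i x)"
    have "card G < card ?J" using insert.prems insert.hyps i by simp
    then obtain l where l: "\<exists>j \<in> ?J. l j \<noteq> 0" "\<forall>x \<in> G. (\<Sum>j \<in> ?J. l j * d j x) = 0"
      using insert.IH[of ?J d] insert.prems(1) by auto
    \<comment> \<open>Back substitution: the value at i is the one that makes equation g
      hold.\<close>
    define m where "m = l(i := - (\<Sum>j \<in> ?J. l j * c j g) / c i g)"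
    have sum_m: "(\<Sum>j \<in> J. m j * c j x) = m i * c i x + (\<Sum>j \<in> ?J. l j * c j x)" for x
      using sum.remove[OF insert.prems(1) i(1), of "\<lambda>j. m j * c j x"] by (simp add: m_def)
    have "(\<Sum>j \<in> J. m j * c j x) = (\<Sum>j \<in> ?J. l j * d j x)" for x
    proof -
      have "(\<Sum>j \<in> ?J. l j * d j x) = (\<Sum>j \<in> ?J. l j * c j x - l j * c j g * (c i x / c i g))"
        by (rule sum.cong) (simp_all add: d_def algebra_simps)
      also have "\<dots> = (\<Sum>j \<in> ?J. l j * c j x) - (\<Sum>j \<in> ?J. l j * c j g) * (c i x / c i g)"
        by (simp add: sum_subtractf sum_distrib_right sum_divide_distrib)
      finally show ?thesis unfolding sum_m by (simp add: m_def)
    qed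
    moreover have "(\<Sum>j \<in> J. m j * c j g) = 0" unfolding sum_m using i(2) by (simp add: m_def)
    moreover have "\<exists>j \<in> J. m j \<noteq> 0" using l(1) by (auto simp: m_def)
    ultimately show ?thesis using l(2) by (intro exI[of _ m]) auto
  qed
qed

section \<open>Linear combinations and linear dependence in Hom spaces\<close>

context hom_finite_linear_category
begin

lemma scal_arr [simp]:
  assumes "arr f"
  shows "arr (scal T c f)" "dm (scal T c f) = dm f" "cd (scal T c f) = cd f"
  using scal_hom[OF arr_in_hom[OF assms], of c] by (auto simp: hom_iff)

lemma scal_add_left_arr: "arr f \<Longrightarrow> scal T (c + d) f = scal T c f \<oplus> scal T d f"
  using scal_add_left arr_in_hom by blast

lemma scal_add_right_arr:
  "arr f \<Longrightarrow> arr g \<Longrightarrow> dm f = dm g \<Longrightarrow> cd f = cd g \<Longrightarrow> scal T c (f \<oplus> g) = scal T c f \<oplus> scal T c g"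
  using scal_add_right[of f "dm f" "cd f" g c] arr_in_hom[of f] arr_in_hom[of g] by simp

lemma scal_scal_arr [simp]: "arr f \<Longrightarrow> scal T c (scal T d f) = scal T (c * d) f"
  using scal_scal arr_in_hom by blast

lemma scal_one_arr [simp]: "arr f \<Longrightarrow> scal T 1 f = f"
  using scal_one arr_in_hom by blast

lemma scal_comp_arr [simp]:
  assumes "arr f" "arr g" "cd f = dm g"
  shows "scal T c g \<cdot> f = scal T c (g \<cdot> f)" "g \<cdot> scal T c f = scal T c (g \<cdot> f)"
  using scal_comp_left[of f "dm f" "cd f" g "cd g" c] scal_comp_right[of f "dm f" "cd f" g "cd g" c]
    arr_in_hom[of f] arr_in_hom[of g] assms by simp_all

lemma scal_zero_left [simp]: "arr f \<Longrightarrow> scal T 0 f = zero T (dm f) (cd f)"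
  using scal_add_left_arr[of f 0 0] add_left_imp_eq[of "scal T 0 f" "scal T 0 f" "zero T (dm f) (cd f)"]
  by simp

lemma scal_zero_right [simp]:
  assumes "A \<in> ob T" "B \<in> ob T"
  shows "scal T c (zero T A B) = zero T A B"
proof -
  have "scal T c (zero T A B) = scal T c (scal T 0 (zero T A B))" using assms by simp
  then show ?thesis using assms by (simp del: scal_zero_left) simp
qed

text \<open>Coefficients are attached to morphisms and not to positions, so combinations over one
  list add pointwise; to recover a single generator the list must then be distinct.\<close>

primrec lin_comb :: "'o \<Rightarrow> 'o \<Rightarrow> ('m \<Rightarrow> 'k) \<Rightarrow> 'm list \<Rightarrow> 'm" where
  "lin_comb A B c [] = zero T A B"
| "lin_comb A B c (g # gs) = scal T (c g) g \<oplus> lin_comb A B c gs"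

primrec lin_sum :: "'o \<Rightarrow> 'o \<Rightarrow> (nat \<Rightarrow> 'k) \<Rightarrow> (nat \<Rightarrow> 'm) \<Rightarrow> nat \<Rightarrow> 'm" where
  "lin_sum A B l v 0 = zero T A B"
| "lin_sum A B l v (Suc n) = lin_sum A B l v n \<oplus> scal T (l n) (v n)"

lemma lin_comb_hom:
  "A \<in> ob T \<Longrightarrow> B \<in> ob T \<Longrightarrow> set gs \<subseteq> hom T A B \<Longrightarrow> lin_comb A B c gs \<in> hom T A B"
  by (induction gs) (simp_all add: hom_iff)

lemma lin_sum_hom:
  "A \<in> ob T \<Longrightarrow> B \<in> ob T \<Longrightarrow> (\<And>j. j < n \<Longrightarrow> v j \<in> hom T A B) \<Longrightarrow> lin_sum A B l v n \<in> hom T A B"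
proof (induction n)
  case (Suc n)
  then have "lin_sum A B l v n \<in> hom T A B" "v n \<in> hom T A B" by simp_all
  then show ?case by (simp add: hom_iff)
qed (simp add: hom_iff)

lemma lin_comb_add:
  assumes "A \<in> ob T" "B \<in> ob T" "set gs \<subseteq> hom T A B"
  shows "lin_comb A B (\<lambda>g. c g + d g) gs = lin_comb A B c gs \<oplus> lin_comb A B d gs"
  using assms(3)
proof (induction gs)
  case (Cons g gs)
  then have h: "g \<in> hom T A B" "lin_comb A B c gs \<in> hom T A B" "lin_comb A B d gs \<in> hom T A B"
    using lin_comb_hom assms by simp_all
  have "lin_comb A B (\<lambda>g. c g + d g) (g # gs)
      = (scal T (c g) g \<oplus> scal T (d g) g) \<oplus> (lin_comb A B c gs \<oplus> lin_comb A B d gs)"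
    using Cons h by (simp add: scal_add_left_arr hom_iff)
  also have "\<dots> = scal T (c g) g \<oplus> (scal T (d g) g \<oplus> (lin_comb A B c gs \<oplus> lin_comb A B d gs))"
    by (rule add_assoc_arr) (use h in \<open>auto simp: hom_iff\<close>)
  also have "scal T (d g) g \<oplus> (lin_comb A B c gs \<oplus> lin_comb A B d gs)
      = lin_comb A B c gs \<oplus> (scal T (d g) g \<oplus> lin_comb A B d gs)"
    by (rule add_left_commute_arr) (use h in \<open>auto simp: hom_iff\<close>)
  also have "scal T (c g) g \<oplus> (lin_comb A B c gs \<oplus> (scal T (d g) g \<oplus> lin_comb A B d gs))
      = (scal T (c g) g \<oplus> lin_comb A B c gs) \<oplus> (scal T (d g) g \<oplus> lin_comb A B d gs)"
    by (rule add_assoc_arr[symmetric]) (use h in \<open>auto simp: hom_iff\<close>)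
  finally show ?case by simp
qed (use assms in simp)

lemma lin_comb_scal:
  assumes "A \<in> ob T" "B \<in> ob T" "set gs \<subseteq> hom T A B"
  shows "lin_comb A B (\<lambda>g. a * c g) gs = scal T a (lin_comb A B c gs)"
  using assms(3)
proof (induction gs)
  case (Cons g gs)
  then have h: "g \<in> hom T A B" "lin_comb A B c gs \<in> hom T A B" using lin_comb_hom assms by simp_all
  then show ?case using Cons by (simp add: scal_add_right_arr hom_iff)
qed (use assms in simp)

lemma lin_comb_zero:
  assumes "A \<in> ob T" "B \<in> ob T" "set gs \<subseteq> hom T A B" "\<And>g. g \<in> set gs \<Longrightarrow> c g = 0"
  shows "lin_comb A B c gs = zero T A B"
  using assms(3,4)
proof (induction gs)
  case (Cons g gs)
  then show ?case using assms(1,2) by (simp add: hom_iff)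
qed simp

lemma lin_comb_indicator:
  assumes "A \<in> ob T" "B \<in> ob T" "set gs \<subseteq> hom T A B" "distinct gs" "g \<in> set gs"
  shows "lin_comb A B (\<lambda>x. if x = g then 1 else 0) gs = g"
  using assms(3-)
proof (induction gs)
  case (Cons x gs)
  show ?case
  proof (cases "x = g")
    case True
    then have "lin_comb A B (\<lambda>x. if x = g then 1 else 0) gs = zero T A B"
      using Cons.prems by (intro lin_comb_zero[OF assms(1,2)]) auto
    then show ?thesis using True Cons.prems assms(1,2) by (simp add: hom_iff)
  next
    case False
    then show ?thesis using Cons assms(1,2) by (simp add: hom_iff subset_iff)
  qed
qed simp

lemma lin_span_lin_comb:
  assumes ob: "A \<in> ob T" "B \<in> ob T" and gs: "set gs \<subseteq> hom T A B" "distinct gs"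
    and v: "v \<in> lin_span T A B (set gs)"
  shows "\<exists>c. v = lin_comb A B c gs"
  using v
proof (induction rule: lin_span.induct)
  case 1
  then show ?case using lin_comb_zero[OF ob gs(1), of "\<lambda>_. 0"] by (intro exI[of _ "\<lambda>_. 0"]) simp
next
  case (2 g)
  then show ?case using lin_comb_indicator[OF ob gs] by metis
next
  case (3 f g)
  then show ?case using lin_comb_add[OF ob gs(1)] by metis
next
  case (4 f c)
  then show ?case using lin_comb_scal[OF ob gs(1)] by metis
qed

lemma lin_sum_lin_comb:
  assumes ob: "A \<in> ob T" "B \<in> ob T" and gs: "set gs \<subseteq> hom T A B"
    and v: "\<And>j. j < n \<Longrightarrow> v j = lin_comb A B (c j) gs"
  shows "lin_sum A B l v n = lin_comb A B (\<lambda>g. \<Sum>j<n. l j * c j g) gs"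
  using v
proof (induction n)
  case 0
  then show ?case using lin_comb_zero[OF ob gs, of "\<lambda>_. 0"] by simp
next
  case (Suc n)
  then show ?case by (simp add: lin_comb_add[OF ob gs] lin_comb_scal[OF ob gs])
qed

text \<open>The form in which finite dimension is used: the bound N depends only on the two objects
  and applies to every family, repetitions included.\<close>

lemma linear_dependence:
  assumes ob: "A \<in> ob T" "B \<in> ob T"
  obtains N where "\<And>v. (\<And>j. j < N \<Longrightarrow> v j \<in> hom T A B) \<Longrightarrow>
    \<exists>l. (\<exists>j<N. l j \<noteq> 0) \<and> lin_sum A B l v N = zero T A B"
proof -
  obtain G where G: "G \<subseteq> hom T A B" "finite G" "lin_span T A B G = hom T A B"
    using hom_finite[OF ob] by blast
  obtain gs where gs: "set gs = G" "distinct gs" using finite_distinct_list[OF G(2)] by blast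
  show thesis
  \<comment> \<open>One vector more than there are generators: expanding in the generators gives a
    homogeneous system with more unknowns than equations.\<close>
  proof (rule that[of "Suc (card G)"])
    fix v assume v: "\<And>j. j < Suc (card G) \<Longrightarrow> v j \<in> hom T A B"
    have "\<exists>c. v j = lin_comb A B c gs" if "j < Suc (card G)" for j
      using lin_span_lin_comb[OF ob _ gs(2), of "v j"] v[OF that] G gs(1) by simp
    then obtain c where c: "\<And>j. j < Suc (card G) \<Longrightarrow> v j = lin_comb A B (c j) gs" by metis
    obtain l where l: "\<exists>j \<in> {..<Suc (card G)}. l j \<noteq> 0"
        "\<forall>g \<in> G. (\<Sum>j \<in> {..<Suc (card G)}. l j * c j g) = 0"
      using homogeneous_system_solution[OF G(2), of "{..<Suc (card G)}" c] by auto
    have "lin_sum A B l v (Suc (card G)) = lin_comb A B (\<lambda>g. \<Sum>j<Suc (card G). l j * c j g) gs"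
      by (rule lin_sum_lin_comb[OF ob]) (use G(1) gs(1) c in simp_all)
    also have "\<dots> = zero T A B"
      by (rule lin_comb_zero[OF ob]) (use G(1) gs(1) l(2) in simp_all)
    finally have "lin_sum A B l v (Suc (card G)) = zero T A B" .
    then show "\<exists>l. (\<exists>j<Suc (card G). l j \<noteq> 0) \<and> lin_sum A B l v (Suc (card G)) = zero T A B"
      using l(1) by blast
  qed
qed

section \<open>Powers of an endomorphism and Fitting's lemma\<close>

primrec epow :: "'m \<Rightarrow> nat \<Rightarrow> 'm" where
  "epow e 0 = idm T (dm e)"
| "epow e (Suc n) = e \<cdot> epow e n"

lemma epow_hom: "e \<in> hom T P P \<Longrightarrow> epow e n \<in> hom T P P"
  by (induction n) (simp_all add: hom_iff)

lemma epow_commute: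
  assumes e: "e \<in> hom T P P" and t: "t \<in> hom T P P" and et: "t \<cdot> e = e \<cdot> t"
  shows "t \<cdot> epow e n = epow e n \<cdot> t"
proof (induction n)
  case 0
  then show ?case using e t by (simp add: hom_iff)
next
  case (Suc n)
  have "t \<cdot> (e \<cdot> epow e n) = e \<cdot> (t \<cdot> epow e n)"
    using comp_extend[OF et t e e t epow_hom[OF e]] .
  then show ?case using Suc e t epow_hom[OF e, of n] by (simp add: hom_iff)
qed

lemma epow_add:
  assumes e: "e \<in> hom T P P"
  shows "epow e (m + n) = epow e m \<cdot> epow e n"
proof (induction m)
  case 0
  then show ?case using e epow_hom[OF e, of n] by (simp add: hom_iff)
next
  case (Suc m)
  then show ?case using e epow_hom[OF e, of n] epow_hom[OF e, of m] by (simp add: hom_iff)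
qed

lemma epow_fix:
  assumes e: "e \<in> hom T P P" and f: "f \<in> hom T A P" and ef: "e \<cdot> f = f"
  shows "epow e n \<cdot> f = f"
proof (induction n)
  case 0
  then show ?case using e f by (simp add: hom_iff)
next
  case (Suc n)
  then show ?case using e f ef epow_hom[OF e, of n] by (simp add: hom_iff)
qed

lemma epow_fix_right:
  assumes e: "e \<in> hom T P P" and f: "f \<in> hom T P A" and fe: "f \<cdot> e = f"
  shows "f \<cdot> epow e n = f"
proof (induction n)
  case 0
  then show ?case using e f by (simp add: hom_iff)
next
  case (Suc n)
  then show ?case
    using comp_extend1_arr[OF fe f e, of "epow e n"] e epow_hom[OF e, of n] by (simp add: hom_iff)
qed

text \<open>A linear relation between the powers of \<open>e\<close> whose lowest term is \<open>e\<^sup>m\<close> writes \<open>e\<^sup>m\<close> as a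
  multiple of \<open>e\<^sup>m\<^sup>+\<^sup>1\<close>.\<close>

lemma epow_regular:
  assumes e: "e \<in> hom T P P"
  obtains m t where "t \<in> hom T P P" "t \<cdot> e = e \<cdot> t" "epow e m = epow e (Suc m) \<cdot> t"
proof -
  have P: "P \<in> ob T" using e by (simp add: hom_iff)
  obtain N where N: "\<And>v. (\<And>j. j < N \<Longrightarrow> v j \<in> hom T P P) \<Longrightarrow>
      \<exists>l. (\<exists>j<N. l j \<noteq> 0) \<and> lin_sum P P l v N = zero T P P"
    using linear_dependence[OF P P] by blast
  obtain l where l: "\<exists>j<N. l j \<noteq> 0" "lin_sum P P l (epow e) N = zero T P P"
    using N[of "epow e"] epow_hom[OF e] by blast
  define m where "m = (LEAST j. l j \<noteq> 0)"
  have m: "l m \<noteq> 0" using l(1) LeastI_ex[of "\<lambda>j. l j \<noteq> 0"] unfolding m_def by blast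
  have "m < N" using l(1) Least_le[of "\<lambda>j. l j \<noteq> 0"] unfolding m_def by (meson le_less_trans)
  have below: "l j = 0" if "j < m" for j using not_less_Least[of j "\<lambda>j. l j \<noteq> 0"] that unfolding m_def by blast
  have low: "lin_sum P P l (epow e) n = zero T P P" if "n \<le> m" for n
    using that by (induction n) (use below epow_hom[OF e] P in \<open>simp_all add: hom_iff\<close>)
  \<comment> \<open>All terms after the lowest are divisible by the next power of e. The quotient t
    is a polynomial in e, hence commutes with it.\<close>
  have "\<exists>t \<in> hom T P P. t \<cdot> e = e \<cdot> t \<and>
      lin_sum P P l (epow e) (Suc m + n) = scal T (l m) (epow e m) \<oplus> (epow e (Suc m) \<cdot> t)" for n
  proof (induction n)
    case 0
    show ?case
      by (rule bexI[of _ "zero T P P"]) (use low[of m] e epow_hom[OF e, of m] P in \<open>simp_all add: hom_iff\<close>)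
  next
    case (Suc n)
    then obtain t where t: "t \<in> hom T P P" "t \<cdot> e = e \<cdot> t"
        "lin_sum P P l (epow e) (Suc m + n) = scal T (l m) (epow e m) \<oplus> (epow e (Suc m) \<cdot> t)" by blast
    let ?t = "t \<oplus> scal T (l (Suc m + n)) (epow e n)"
    note pwh = epow_hom[OF e, of m] epow_hom[OF e, of n] epow_hom[OF e, of "Suc m"] epow_hom[OF e, of "Suc m + n"]
    have "lin_sum P P l (epow e) (Suc m + Suc n)
        = (scal T (l m) (epow e m) \<oplus> (epow e (Suc m) \<cdot> t)) \<oplus> scal T (l (Suc m + n)) (epow e (Suc m + n))"
      using t(3) by simp
    also have "\<dots> = scal T (l m) (epow e m) \<oplus> ((epow e (Suc m) \<cdot> t) \<oplus> scal T (l (Suc m + n)) (epow e (Suc m + n)))"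
      by (rule add_assoc_arr) (use t(1) pwh P in \<open>auto simp: hom_iff simp del: epow.simps\<close>)
    also have "(epow e (Suc m) \<cdot> t) \<oplus> scal T (l (Suc m + n)) (epow e (Suc m + n)) = epow e (Suc m) \<cdot> ?t"
      using t(1) pwh P epow_add[OF e, of "Suc m" n] by (simp add: hom_iff distrib_arr del: epow.simps)
    finally show ?case
      using t(1,2) e pwh(2) epow_commute[OF e e refl, of n]
      by (intro bexI[of _ ?t] conjI) (simp_all add: hom_iff distrib_arr)
  qed
  from this[of "N - Suc m"] obtain t where t: "t \<in> hom T P P" "t \<cdot> e = e \<cdot> t"
      "zero T P P = scal T (l m) (epow e m) \<oplus> (epow e (Suc m) \<cdot> t)"
    using l(2) \<open>m < N\<close> by auto
  note pwh = epow_hom[OF e, of m] epow_hom[OF e, of "Suc m"]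
  define t' where "t' = \<ominus> scal T (1 / l m) t"
  have "scal T (1 / l m) (scal T (l m) (epow e m) \<oplus> (epow e (Suc m) \<cdot> t)) = zero T P P"
    unfolding t(3)[symmetric] using P by simp
  then have "epow e m \<oplus> scal T (1 / l m) (epow e (Suc m) \<cdot> t) = zero T P P"
    using t(1) pwh m by (simp add: scal_add_right_arr hom_iff del: epow.simps)
  then have "scal T (1 / l m) (epow e (Suc m) \<cdot> t) = \<ominus> epow e m"
    by (intro neg_unique) (use t(1) pwh in \<open>simp_all add: hom_iff del: epow.simps\<close>)
  then have "epow e m = epow e (Suc m) \<cdot> t'"
    unfolding t'_def using t(1) pwh by (simp add: hom_iff del: epow.simps)
  moreover have "t' \<in> hom T P P" "t' \<cdot> e = e \<cdot> t'" unfolding t'_def using t e by (simp_all add: hom_iff)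
  ultimately show thesis using that by blast
qed

text \<open>p is the projection onto the stable image of e. With c and q the powers of e and t of
  exponent m + 1, iterating the relation of \<open>epow_regular\<close> gives c = c c q, so p = c q
  is idempotent. Whatever e fixes is fixed by c and hence by p; this keeps an approximation intact
  when P is replaced by the summand that p cuts out.\<close>

lemma fitting:
  assumes e: "e \<in> hom T P P"
  obtains p where "p \<in> hom T P P" "p \<cdot> p = p" "p = idm T P \<longrightarrow> is_iso T P P e"
    "\<forall>A. \<forall>f \<in> hom T A P. e \<cdot> f = f \<longrightarrow> p \<cdot> f = f"
    "\<forall>A. \<forall>r \<in> hom T P A. r \<cdot> e = r \<longrightarrow> r \<cdot> p = r"
proof -
  have P: "P \<in> ob T" using e by (simp add: hom_iff)
  obtain m t where t: "t \<in> hom T P P" "t \<cdot> e = e \<cdot> t" "epow e m = epow e (Suc m) \<cdot> t"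
    using epow_regular[OF e] .
  define c where "c = epow e (Suc m)"
  define q where "q = epow t (Suc m)"
  have c: "c \<in> hom T P P" and q: "q \<in> hom T P P" unfolding c_def q_def using epow_hom e t(1) by blast+
  have tc: "t \<cdot> epow e n = epow e n \<cdot> t" for n using epow_commute[OF e t(1,2)] .
  have qc: "q \<cdot> c = c \<cdot> q"
    unfolding q_def using epow_commute[OF t(1) c, of "Suc m"] tc[of "Suc m"] by (simp add: c_def del: epow.simps)
  have step: "epow e n = epow e (Suc n) \<cdot> t" if "n \<ge> m" for n
  proof -
    have "epow e n = epow e (n - m) \<cdot> epow e m" using epow_add[OF e, of "n - m" m] that by simp
    also have "\<dots> = epow e (n - m) \<cdot> (epow e (Suc m) \<cdot> t)" using t(3) by simp
    also have "\<dots> = (epow e (n - m) \<cdot> epow e (Suc m)) \<cdot> t"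
      using comp_assoc[OF t(1) epow_hom[OF e] epow_hom[OF e]] by (simp del: epow.simps)
    also have "\<dots> = epow e (n - m + Suc m) \<cdot> t" using epow_add[OF e, of "n - m" "Suc m"] by simp
    finally show ?thesis using that by simp
  qed
  have steps: "c = epow e (Suc m + k) \<cdot> epow t k" for k
  proof (induction k)
    case 0
    then show ?case using c t(1) unfolding c_def by (simp add: hom_iff)
  next
    case (Suc k)
    have "epow e (Suc m + k) \<cdot> epow t k = (epow e (Suc m + Suc k) \<cdot> t) \<cdot> epow t k"
      using step[of "Suc m + k"] by simp
    also have "\<dots> = epow e (Suc m + Suc k) \<cdot> epow t (Suc k)"
      unfolding epow.simps(2)[of t] using comp_assoc[OF epow_hom[OF t(1)] t(1) epow_hom[OF e]] by (simp del: epow.simps)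
    finally show ?case using Suc by simp
  qed
  have ccq: "c \<cdot> (c \<cdot> q) = c"
    using steps[of "Suc m"] epow_add[OF e, of "Suc m" "Suc m"] comp_assoc[OF q c c]
    unfolding q_def c_def by simp
  define p where "p = c \<cdot> q"
  have p: "p \<in> hom T P P" unfolding p_def using c q by (simp add: hom_iff)
  show thesis
  proof (rule that[OF p]; (intro allI ballI impI)?)
    have "p \<cdot> p = c \<cdot> (c \<cdot> (q \<cdot> q))"
      unfolding p_def using comp_extend_arr[OF qc q c c q, of q] c q by (simp add: hom_iff)
    also have "\<dots> = (c \<cdot> (c \<cdot> q)) \<cdot> q" using c q by (simp add: hom_iff)
    finally show "p \<cdot> p = p" unfolding ccq p_def .
    \<comment> \<open>Since c is e times its m-th power, in either order, c q = 1 provides a left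
      and a right inverse of e.\<close>
    show "is_iso T P P e" if "p = idm T P"
    proof (rule is_iso_of_inverses[OF e, of "q \<cdot> epow e m" "epow e m \<cdot> q"])
      have "epow e m \<cdot> e = c" unfolding c_def using epow_commute[OF e e refl, of m] by simp
      then show "(q \<cdot> epow e m) \<cdot> e = idm T P"
        using that qc epow_hom[OF e, of m] q e unfolding p_def by (simp add: hom_iff)
      have "e \<cdot> (epow e m \<cdot> q) = c \<cdot> q"
        using comp_assoc[OF q epow_hom[OF e] e] unfolding c_def by simp
      then show "e \<cdot> (epow e m \<cdot> q) = idm T P" using that unfolding p_def by simp
    qed (use q epow_hom[OF e, of m] in \<open>simp_all add: hom_iff\<close>)
    show "p \<cdot> f = f" if f: "f \<in> hom T A P" "e \<cdot> f = f" for f A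
    proof -
      have cf: "c \<cdot> f = f" unfolding c_def using epow_fix[OF e f] .
      have "p \<cdot> f = (c \<cdot> (c \<cdot> q)) \<cdot> f"
      proof -
        have "(c \<cdot> (c \<cdot> q)) \<cdot> f = c \<cdot> (q \<cdot> (c \<cdot> f))"
          using comp_extend_arr[OF qc q c c q, of f] c q f(1) by (simp add: hom_iff)
        then show ?thesis unfolding p_def cf using c q f(1) by (simp add: hom_iff)
      qed
      then show ?thesis unfolding ccq cf .
    qed
    show "r \<cdot> p = r" if r: "r \<in> hom T P A" "r \<cdot> e = r" for r A
    proof -
      have rc: "r \<cdot> c = r" unfolding c_def using epow_fix_right[OF e r] .
      have "r \<cdot> p = r \<cdot> (c \<cdot> (c \<cdot> q))"
        unfolding p_def using comp_extend1_arr[OF rc r(1) c, of "c \<cdot> q"] c q by (simp add: hom_iff)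
      then show ?thesis unfolding ccq rc .
    qed
  qed
qed

text \<open>Families of n nonzero, pairwise orthogonal idempotents. The least n for which none
  exists serves as a measure of size that drops on proper summands.\<close>

definition orthogonal :: "nat \<Rightarrow> 'o \<Rightarrow> bool" where
  "orthogonal n P \<longleftrightarrow> (\<exists>k. (\<forall>i<n. k i \<in> hom T P P \<and> k i \<noteq> zero T P P) \<and>
    (\<forall>i<n. \<forall>j<n. k i \<cdot> k j = (if i = j then k i else zero T P P)))"

lemma orthogonal_bounded:
  assumes P: "P \<in> ob T"
  obtains N where "\<not> orthogonal N P"
proof -
  obtain N where N: "\<And>v. (\<And>j. j < N \<Longrightarrow> v j \<in> hom T P P) \<Longrightarrow>
      \<exists>l. (\<exists>j<N. l j \<noteq> 0) \<and> lin_sum P P l v N = zero T P P"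
    using linear_dependence[OF P P] by blast
  have "\<not> orthogonal N P"
  proof
    assume "orthogonal N P"
    then obtain k where k: "\<And>i. i < N \<Longrightarrow> k i \<in> hom T P P" "\<And>i. i < N \<Longrightarrow> k i \<noteq> zero T P P"
        "\<And>i j. i < N \<Longrightarrow> j < N \<Longrightarrow> k i \<cdot> k j = (if i = j then k i else zero T P P)"
      unfolding orthogonal_def by blast
    obtain l where l: "\<exists>j<N. l j \<noteq> 0" "lin_sum P P l k N = zero T P P" using N[of k] k(1) by blast
    then obtain i where i: "i < N" "l i \<noteq> 0" by blast
    \<comment> \<open>Multiplying the relation by \<open>k i\<close> isolates its i-th term, so
      orthogonal idempotents are linearly independent.\<close>
    have "k i \<cdot> lin_sum P P l k n = (if i < n then scal T (l i) (k i) else zero T P P)" if "n \<le> N" for n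
      using that
    proof (induction n)
      case 0
      then show ?case using k(1)[OF i(1)] P by (simp add: hom_iff)
    next
      case (Suc n)
      then have n: "n < N" "k n \<in> hom T P P" "lin_sum P P l k n \<in> hom T P P"
        using k(1) lin_sum_hom[OF P P] by simp_all
      have "k i \<cdot> lin_sum P P l k (Suc n) = (k i \<cdot> lin_sum P P l k n) \<oplus> scal T (l n) (k i \<cdot> k n)"
        using n k(1)[OF i(1)] by (simp add: hom_iff distrib_arr)
      then show ?case using Suc k(3)[OF i(1) n(1)] k(1)[OF i(1)] n P by (auto simp: hom_iff less_Suc_eq)
    qed
    from this[of N] have "scal T (l i) (k i) = zero T P P"
      using i(1) l(2) k(1)[OF i(1)] P by (simp add: hom_iff)
    then have "scal T (1 / l i) (scal T (l i) (k i)) = zero T P P" using P by simp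
    then have "k i = zero T P P" using i(2) k(1)[OF i(1)] by (simp add: hom_iff)
    then show False using k(2)[OF i(1)] by blast
  qed
  then show thesis using that by blast
qed

lemma orthogonal_zero: "orthogonal 0 P"
  unfolding orthogonal_def by simp

text \<open>A family on I is transported to P along s and r, and the complementary idempotent
  \<open>idm T P \<oplus> \<ominus> (s \<cdot> r)\<close> is added; it is nonzero because the
  summand is proper.\<close>

lemma orthogonal_summand:
  assumes s: "s \<in> hom T I P" and r: "r \<in> hom T P I" and rs: "r \<cdot> s = idm T I"
    and proper: "s \<cdot> r \<noteq> idm T P" and orthogonal: "orthogonal n I"
  shows "orthogonal (Suc n) P"
proof -
  obtain k where k: "\<And>i. i < n \<Longrightarrow> k i \<in> hom T I I" "\<And>i. i < n \<Longrightarrow> k i \<noteq> zero T I I"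
      "\<And>i j. i < n \<Longrightarrow> j < n \<Longrightarrow> k i \<cdot> k j = (if i = j then k i else zero T I I)"
    using orthogonal unfolding orthogonal_def by blast
  have ob: "I \<in> ob T" "P \<in> ob T" using s by (simp_all add: hom_iff)
  define e where "e = idm T P \<oplus> \<ominus> (s \<cdot> r)"
  have e: "e \<in> hom T P P" unfolding e_def using s r ob by (simp add: hom_iff)
  have rs': "arr w \<Longrightarrow> cd w = I \<Longrightarrow> r \<cdot> (s \<cdot> w) = w" for w
    using comp_extend1_arr[OF rs r s, of w] ob by simp
  have es: "e \<cdot> s = zero T I P" and re: "r \<cdot> e = zero T P I"
    unfolding e_def using s r ob rs rs' by (simp_all add: hom_iff distrib_arr)
  have "e \<cdot> e = e \<oplus> \<ominus> (s \<cdot> (r \<cdot> e))"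
    using s r ob e by (subst (1) e_def) (simp add: hom_iff distrib_arr)
  then have ee: "e \<cdot> e = e" using re s e ob by (simp add: hom_iff)
  have e0: "e \<noteq> zero T P P"
    unfolding e_def using proper diff_eq_zero_iff[OF idm_hom[OF ob(2)] comp_hom[OF r s]] by metis
  define k' where "k' = (\<lambda>i. if i < n then s \<cdot> (k i \<cdot> r) else e)"
  have skr: "s \<cdot> (k i \<cdot> r) \<in> hom T P P" if "i < n" for i using k(1)[OF that] s r by (simp add: hom_iff)
  have 0: "s \<cdot> (k i \<cdot> r) \<noteq> zero T P P" if i: "i < n" for i
  proof
    assume "s \<cdot> (k i \<cdot> r) = zero T P P"
    then have "r \<cdot> ((s \<cdot> (k i \<cdot> r)) \<cdot> s) = r \<cdot> (zero T P P \<cdot> s)" by simp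
    then have "k i = zero T I I" using k(1)[OF i] s r rs rs' ob by (simp add: hom_iff)
    then show False using k(2)[OF i] by blast
  qed
  have 1: "(s \<cdot> (k i \<cdot> r)) \<cdot> (s \<cdot> (k j \<cdot> r)) = (if i = j then s \<cdot> (k i \<cdot> r) else zero T P P)"
    if ij: "i < n" "j < n" for i j
  proof -
    have "(s \<cdot> (k i \<cdot> r)) \<cdot> (s \<cdot> (k j \<cdot> r)) = s \<cdot> ((k i \<cdot> k j) \<cdot> r)"
      using k(1)[OF ij(1)] k(1)[OF ij(2)] s r rs' by (simp add: hom_iff)
    then show ?thesis using k(3)[OF ij] s r ob by (simp add: hom_iff)
  qed
  have 2: "(s \<cdot> (k i \<cdot> r)) \<cdot> e = zero T P P" "e \<cdot> (s \<cdot> (k i \<cdot> r)) = zero T P P" if i: "i < n" for i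
    using k(1)[OF i] s r e re ob comp_extend1_arr[OF es e s, of "k i \<cdot> r"] by (simp_all add: hom_iff)
  show ?thesis
    unfolding orthogonal_def
    by (rule exI[of _ k']) (use e e0 ee skr 0 1 2 in \<open>auto simp: k'_def less_Suc_eq\<close>)
qed

end

lemma (in preadditive_category) retract_in_subcategory:
  assumes "idempotents_split C" "subcategory C U" "P \<in> U" "s \<in> hom C A P" "r \<in> hom C P A"
    "r \<cdot> s = idm C A"
  shows "A \<in> U"
  using biproduct_of_retract[OF assms(1,4-6)] subcategoryD(4)[OF assms(2)] assms(3) by metis

section \<open>Minimal approximations, Wakamatsu's lemma and Schanuel's lemma\<close>

context linear_triangulated_category
begin

text \<open>As long as some noninvertible e fixes the approximation, its Fitting idempotent fixes it
  too and splits off a proper summand that still approximates. The bound on orthogonal idempotents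
  stops this descent.\<close>

lemma minimal_left_approx:
  assumes U: "subcategory T U" and l: "left_approx T U A P l"
  obtains P' l' where "left_approx T U A P' l'" "\<And>e. e \<in> hom T P' P' \<Longrightarrow> e \<cdot> l' = l' \<Longrightarrow> is_iso T P' P' e"
proof -
  have "\<exists>P' l'. left_approx T U A P' l' \<and> (\<forall>e \<in> hom T P' P'. e \<cdot> l' = l' \<longrightarrow> is_iso T P' P' e)"
    if "left_approx T U A P l" "\<not> orthogonal n P" for n P l
    using that
  proof (induction n arbitrary: P l)
    case 0
    then show ?case using orthogonal_zero by blast
  next
    case (Suc n)
    have PU: "P \<in> U" and lh: "l \<in> hom T A P" using Suc.prems(1) unfolding left_approx_def by blast+
    show ?case
    proof (cases "\<forall>e \<in> hom T P P. e \<cdot> l = l \<longrightarrow> is_iso T P P e")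
      case True
      then show ?thesis using Suc.prems(1) by blast
    next
      case False
      then obtain e where e: "e \<in> hom T P P" "e \<cdot> l = l" "\<not> is_iso T P P e" by blast
      obtain p where p: "p \<in> hom T P P" "p \<cdot> p = p" "p = idm T P \<longrightarrow> is_iso T P P e"
          "\<forall>A. \<forall>f \<in> hom T A P. e \<cdot> f = f \<longrightarrow> p \<cdot> f = f"
          "\<forall>A. \<forall>r \<in> hom T P A. r \<cdot> e = r \<longrightarrow> r \<cdot> p = r"
        using fitting[OF e(1)] .
      obtain I r s where I: "r \<in> hom T P I" "s \<in> hom T I P" "s \<cdot> r = p" "r \<cdot> s = idm T I"
        using split p(1,2) unfolding idempotents_split_def by metis
      have pl: "p \<cdot> l = l" using p(4) lh e(2) by blast
      have IU: "I \<in> U" using retract_in_subcategory[OF split U PU I(2,1,4)] .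
      have "left_approx T U A I (r \<cdot> l)"
        unfolding left_approx_def
      proof (intro conjI ballI)
        show "r \<cdot> l \<in> hom T A I" using I lh by (simp add: hom_iff)
        fix Q f assume "Q \<in> U" "f \<in> hom T A Q"
        then obtain g where g: "g \<in> hom T P Q" "g \<cdot> l = f" using Suc.prems(1) unfolding left_approx_def by blast
        have "(g \<cdot> s) \<cdot> (r \<cdot> l) = g \<cdot> (p \<cdot> l)"
          using comp_extend1_arr[OF I(3,2,1), of l] g I lh by (simp add: hom_iff)
        then show "\<exists>g \<in> hom T I Q. g \<cdot> (r \<cdot> l) = f"
          using g pl I by (intro bexI[of _ "g \<cdot> s"]) (simp_all add: hom_iff)
      qed (rule IU)
      \<comment> \<open>Here \<open>s \<cdot> r = p\<close> is not the identity because e is not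
        invertible, so n idempotents on I would yield n + 1 on P.\<close>
      moreover have "\<not> orthogonal n I"
        using orthogonal_summand[OF I(2,1,4)] Suc.prems(2) p(3) e(3) I(3) by blast
      ultimately show ?thesis using Suc.IH by blast
    qed
  qed
  moreover obtain n where "\<not> orthogonal n P"
    using orthogonal_bounded[of P] l subcategoryD(1)[OF U] unfolding left_approx_def by blast
  ultimately show thesis using l that by blast
qed

text \<open>The same descent, now with the property of the Fitting idempotent that concerns
  morphisms fixed under composition with e on the right.\<close>

lemma minimal_right_approx:
  assumes U: "subcategory T U" and l: "right_approx T U P A l"
  obtains P' l' where "right_approx T U P' A l'" "\<And>e. e \<in> hom T P' P' \<Longrightarrow> l' \<cdot> e = l' \<Longrightarrow> is_iso T P' P' e"
proof -
  have "\<exists>P' l'. right_approx T U P' A l' \<and> (\<forall>e \<in> hom T P' P'. l' \<cdot> e = l' \<longrightarrow> is_iso T P' P' e)"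
    if "right_approx T U P A l" "\<not> orthogonal n P" for n P l
    using that
  proof (induction n arbitrary: P l)
    case 0
    then show ?case using orthogonal_zero by blast
  next
    case (Suc n)
    have PU: "P \<in> U" and lh: "l \<in> hom T P A" using Suc.prems(1) unfolding right_approx_def by blast+
    show ?case
    proof (cases "\<forall>e \<in> hom T P P. l \<cdot> e = l \<longrightarrow> is_iso T P P e")
      case True
      then show ?thesis using Suc.prems(1) by blast
    next
      case False
      then obtain e where e: "e \<in> hom T P P" "l \<cdot> e = l" "\<not> is_iso T P P e" by blast
      obtain p where p: "p \<in> hom T P P" "p \<cdot> p = p" "p = idm T P \<longrightarrow> is_iso T P P e"
          "\<forall>A. \<forall>f \<in> hom T A P. e \<cdot> f = f \<longrightarrow> p \<cdot> f = f"
          "\<forall>A. \<forall>r \<in> hom T P A. r \<cdot> e = r \<longrightarrow> r \<cdot> p = r"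
        using fitting[OF e(1)] .
      obtain I r s where I: "r \<in> hom T P I" "s \<in> hom T I P" "s \<cdot> r = p" "r \<cdot> s = idm T I"
        using split p(1,2) unfolding idempotents_split_def by metis
      have pl: "l \<cdot> p = l" using p(5) lh e(2) by blast
      have IU: "I \<in> U" using retract_in_subcategory[OF split U PU I(2,1,4)] .
      have "right_approx T U I A (l \<cdot> s)"
        unfolding right_approx_def
      proof (intro conjI ballI)
        show "l \<cdot> s \<in> hom T I A" using I lh by (simp add: hom_iff)
        fix Q f assume "Q \<in> U" "f \<in> hom T Q A"
        then obtain g where g: "g \<in> hom T Q P" "l \<cdot> g = f" using Suc.prems(1) unfolding right_approx_def by blast
        have "(l \<cdot> s) \<cdot> (r \<cdot> g) = (l \<cdot> p) \<cdot> g"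
          using comp_extend1_arr[OF I(3,2,1), of g] g I lh p(1) by (simp add: hom_iff)
        then show "\<exists>g \<in> hom T Q I. (l \<cdot> s) \<cdot> g = f"
          using g pl I by (intro bexI[of _ "r \<cdot> g"]) (simp_all add: hom_iff)
      qed (rule IU)
      moreover have "\<not> orthogonal n I"
        using orthogonal_summand[OF I(2,1,4)] Suc.prems(2) p(3) e(3) I(3) by blast
      ultimately show ?thesis using Suc.IH by blast
    qed
  qed
  moreover obtain n where "\<not> orthogonal n P"
    using orthogonal_bounded[of P] l subcategoryD(1)[OF U] unfolding right_approx_def by blast
  ultimately show thesis using l that by blast
qed

text \<open>Wakamatsu's lemma: pulling back along \<open>\<phi> \<cdot> y\<close> gives an extension through which the
  approximation factors, hence an endomorphism \<open>e\<close> of \<open>P\<close> with \<open>e \<cdot> l = l\<close> and \<open>\<phi> \<cdot> y \<cdot> e = 0\<close>.\<close>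

lemma wakamatsu_left:
  assumes U: "subcategory T U" "extension_closed T Sh \<Delta> U"
    and l: "left_approx T U A P l" "\<And>e. e \<in> hom T P P \<Longrightarrow> e \<cdot> l = l \<Longrightarrow> is_iso T P P e"
    and t: "tri A P C l y z" and V: "V \<in> U" and \<phi>: "\<phi> \<in> hom T C (fob Sh V)"
  shows "\<phi> = zero T C (fob Sh V)"
proof -
  have PU: "P \<in> U" using l(1) unfolding left_approx_def by blast
  note h = tri_hom[OF t]
  have ob: "A \<in> ob T" "P \<in> ob T" "C \<in> ob T" "V \<in> ob T"
    using h V subcategoryD(1)[OF U(1)] by (auto simp: hom_iff)
  have \<psi>: "\<phi> \<cdot> y \<in> hom T P (fob Sh V)" using \<phi> h by (simp add: hom_iff)
  obtain E f g where E: "tri V E P f g (\<phi> \<cdot> y)" using tri_ex3[OF \<psi> ob(4)] .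
  note Eh = tri_hom[OF E]
  have EU: "E \<in> U" using U(2) E V PU unfolding extension_closed_def tri_def by blast
  have "(\<phi> \<cdot> y) \<cdot> l = zero T A (fob Sh V)"
    using tri_comp_zero[OF t] \<phi> h ob by (simp add: hom_iff)
  then obtain m where m: "m \<in> hom T A E" "g \<cdot> m = l" using tri_lift_to_fibre2[OF E h(1)] by blast
  obtain k where k: "k \<in> hom T P E" "k \<cdot> l = m" using l(1) EU m(1) unfolding left_approx_def by blast
  have gk: "g \<cdot> k \<in> hom T P P" "(g \<cdot> k) \<cdot> l = l" using Eh k m h by (simp_all add: hom_iff)
  obtain i where i: "i \<in> hom T P P" "(g \<cdot> k) \<cdot> i = idm T P" using l(2)[OF gk] by (metis is_isoE)
  have "\<phi> \<cdot> y = (\<phi> \<cdot> y) \<cdot> ((g \<cdot> k) \<cdot> i)" using i(2) \<psi> by (simp add: hom_iff)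
  also have "\<dots> = ((\<phi> \<cdot> y) \<cdot> g) \<cdot> (k \<cdot> i)" using \<phi> h Eh k i(1) by (simp add: hom_iff)
  finally have "\<phi> \<cdot> y = zero T P (fob Sh V)"
    using tri_comp_zero2[OF E] k i(1) ob by (simp add: hom_iff)
  \<comment> \<open>It remains to pass from \<open>\<phi> \<cdot> y\<close> to \<phi>, which is now
    induced by a map from A to V. That map factors through l, and \<open>far Sh l \<cdot> z\<close>
    is zero.\<close>
  then obtain \<chi> where \<chi>: "\<chi> \<in> hom T (fob Sh A) (fob Sh V)" "\<chi> \<cdot> z = \<phi>"
    using tri_factor_through_cone2[OF t \<phi>] by blast
  obtain \<chi>' where \<chi>': "\<chi>' \<in> hom T A V" "far Sh \<chi>' = \<chi>" using Sh_preimage[OF \<chi>(1) ob(1,4)] .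
  obtain \<xi> where \<xi>: "\<xi> \<in> hom T P V" "\<xi> \<cdot> l = \<chi>'" using l(1) V \<chi>'(1) unfolding left_approx_def by blast
  have "\<phi> = far Sh \<xi> \<cdot> (far Sh l \<cdot> z)"
    unfolding \<chi>(2)[symmetric] \<chi>'(2)[symmetric] \<xi>(2)[symmetric] using \<xi>(1) h by (simp add: hom_iff)
  then show ?thesis using tri_comp_zero3[OF t] \<xi>(1) ob by (simp add: hom_iff)
qed

text \<open>The class \<open>far Sh c \<cdot> \<phi>\<close> defines an extension E of V by P. The
  map r extends to E and lifts back to P, so minimality makes \<open>k \<cdot> f\<close> invertible,
  f splits and the class is zero. Then \<phi> is z applied to a map from V to A, which factors
  through r, and \<open>z \<cdot> r\<close> vanishes.\<close>

lemma wakamatsu_right: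
  assumes U: "subcategory T U" "extension_closed T Sh \<Delta> U"
    and r: "right_approx T U P A r" "\<And>e. e \<in> hom T P P \<Longrightarrow> r \<cdot> e = r \<Longrightarrow> is_iso T P P e"
    and t: "tri C P A c r z" and V: "V \<in> U" and \<phi>: "\<phi> \<in> hom T V (fob Sh C)"
  shows "\<phi> = zero T V (fob Sh C)"
proof -
  have PU: "P \<in> U" using r(1) unfolding right_approx_def by blast
  note h = tri_hom[OF t]
  have ob: "A \<in> ob T" "P \<in> ob T" "C \<in> ob T" "V \<in> ob T"
    using h V subcategoryD(1)[OF U(1)] by (auto simp: hom_iff)
  have \<psi>: "far Sh c \<cdot> \<phi> \<in> hom T V (fob Sh P)" using \<phi> h by (simp add: hom_iff)
  obtain E f g where E: "tri P E V f g (far Sh c \<cdot> \<phi>)" using tri_ex3[OF \<psi> ob(2)] .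
  note Eh = tri_hom[OF E]
  have EU: "E \<in> U" using U(2) E V PU unfolding extension_closed_def tri_def by blast
  have "far Sh r \<cdot> (far Sh c \<cdot> \<phi>) = far Sh (r \<cdot> c) \<cdot> \<phi>" using h \<phi> by (simp add: hom_iff)
  then have 0: "far Sh r \<cdot> (far Sh c \<cdot> \<phi>) = zero T V (fob Sh A)"
    using tri_comp_zero[OF t] \<phi> ob by (simp add: hom_iff)
  have Sr: "far Sh r \<in> hom T (fob Sh P) (fob Sh A)" using h by (simp add: hom_iff)
  obtain m' where m': "m' \<in> hom T (fob Sh E) (fob Sh A)" "m' \<cdot> far Sh f = far Sh r"
    using tri_factor_through_cone3[OF E Sr 0] .
  have E_ob: "E \<in> ob T" using Eh by (simp add: hom_iff)
  obtain m where m: "m \<in> hom T E A" "far Sh m = m'" using Sh_preimage[OF m'(1) E_ob ob(1)] .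
  have "far Sh (m \<cdot> f) = far Sh r" using m m'(2) Eh by (simp add: hom_iff)
  then have mf: "m \<cdot> f = r" using S_faithful[OF comp_hom[OF Eh(1) m(1)] h(2)] by blast
  obtain k where k: "k \<in> hom T E P" "r \<cdot> k = m" using r(1) EU m(1) unfolding right_approx_def by blast
  have kf: "k \<cdot> f \<in> hom T P P" using Eh k by (simp add: hom_iff)
  have rkf: "r \<cdot> (k \<cdot> f) = r" using comp_extend1_arr[OF k(2) h(2) k(1), of f] mf Eh by (simp add: hom_iff)
  obtain i where i: "i \<in> hom T P P" "i \<cdot> (k \<cdot> f) = idm T P" using r(2)[OF kf rkf] by (metis is_isoE)
  have Sid: "far Sh i \<cdot> (far Sh k \<cdot> far Sh f) = idm T (fob Sh P)"
    using i k Eh ob by (simp add: hom_iff flip: S_comp)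
  have "far Sh c \<cdot> \<phi> = (far Sh i \<cdot> (far Sh k \<cdot> far Sh f)) \<cdot> (far Sh c \<cdot> \<phi>)"
    unfolding Sid using \<psi> by (simp add: hom_iff)
  also have "\<dots> = (far Sh i \<cdot> far Sh k) \<cdot> (far Sh f \<cdot> (far Sh c \<cdot> \<phi>))"
    using i(1) k(1) Eh h \<phi> by (simp add: hom_iff)
  finally have "far Sh c \<cdot> \<phi> = zero T V (fob Sh P)"
    using tri_comp_zero3[OF E] i(1) k(1) ob by (simp add: hom_iff)
  then obtain \<chi> where \<chi>: "\<chi> \<in> hom T V A" "z \<cdot> \<chi> = \<phi>" using tri_lift_to_fibre3[OF t \<phi>] by blast
  obtain \<xi> where \<xi>: "\<xi> \<in> hom T V P" "r \<cdot> \<xi> = \<chi>" using r(1) V \<chi>(1) unfolding right_approx_def by blast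
  have "\<phi> = (z \<cdot> r) \<cdot> \<xi>"
    unfolding \<chi>(2)[symmetric] \<xi>(2)[symmetric] using \<xi>(1) h by (simp add: hom_iff)
  then show ?thesis using tri_comp_zero2[OF t] \<xi>(1) ob by (simp add: hom_iff)
qed

text \<open>The approximations factor through each other, which induces \<alpha> and \<beta> between
  the cones. The defect of \<open>\<beta> \<cdot> \<alpha>\<close> is killed by z', so it factors
  through P' in X and V' is a retract of V modulo X. This frees membership in U from the choice of
  approximation.\<close>

lemma schanuel_left:
  assumes X: "subcategory T X" "subcategory T U" "X \<subseteq> U"
    and t: "tri A P V l y z" "tri A P' V' l' y' z'"
    and l: "left_approx T X A P l" "left_approx T X A P' l'" and V: "V \<in> U"
  shows "V' \<in> U"
proof -
  interpret X: additive_subcategory T X by unfold_locales (rule X(1))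
  note h = tri_hom[OF t(1)] tri_hom[OF t(2)]
  have ob: "A \<in> ob T" "V \<in> ob T" "V' \<in> ob T" using h by (simp_all add: hom_iff)
  obtain a where a: "a \<in> hom T P' P" "a \<cdot> l' = l" using l h unfolding left_approx_def by blast
  obtain b where b: "b \<in> hom T P P'" "b \<cdot> l = l'" using l h unfolding left_approx_def by blast
  obtain \<alpha> where \<alpha>: "\<alpha> \<in> hom T V' V" "z \<cdot> \<alpha> = far Sh (idm T A) \<cdot> z'"
    by (rule tri_mor[OF t(2,1) idm_hom[OF ob(1)] a(1)]) (use a h in \<open>auto simp: hom_iff\<close>)
  obtain \<beta> where \<beta>: "\<beta> \<in> hom T V V'" "z' \<cdot> \<beta> = far Sh (idm T A) \<cdot> z"
    by (rule tri_mor[OF t(1,2) idm_hom[OF ob(1)] b(1)]) (use b h in \<open>auto simp: hom_iff\<close>)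
  have z: "z \<cdot> \<alpha> = z'" "z' \<cdot> \<beta> = z" using \<alpha> \<beta> h ob by (simp_all add: hom_iff)
  let ?n = "idm T V' \<oplus> \<ominus> (\<beta> \<cdot> \<alpha>)"
  have n: "?n \<in> hom T V' V'" using \<alpha> \<beta> ob by (simp add: hom_iff)
  have "z' \<cdot> ?n = zero T V' (fob Sh A)"
    using \<alpha>(1) \<beta>(1) z comp_extend1_arr[OF z(2) h(6) \<beta>(1), of \<alpha>] h ob by (simp add: hom_iff distrib_arr)
  then obtain v where v: "v \<in> hom T V' P'" "y' \<cdot> v = ?n" using tri_lift_to_fibre2[OF t(2) n] by blast
  have "P' \<in> X" using l(2) unfolding left_approx_def by blast
  then have "X.ft V' V' ?n" using X.ftI[OF _ v(1) h(5)] v(2) by simp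
  then show ?thesis using X.retract_mod[OF X(2,3) split V \<alpha>(1) \<beta>(1)] by blast
qed

text \<open>Dual to \<open>schanuel_left\<close>; the comparison maps are obtained on shifted
  objects from rotated triangles and then unshifted.\<close>

lemma schanuel_right:
  assumes X: "subcategory T X" "subcategory T U" "X \<subseteq> U"
    and t: "tri V P A y r z" "tri V' P' A y' r' z'"
    and r: "right_approx T X P A r" "right_approx T X P' A r'" and V: "V \<in> U"
  shows "V' \<in> U"
proof -
  interpret X: additive_subcategory T X by unfold_locales (rule X(1))
  note h = tri_hom[OF t(1)] tri_hom[OF t(2)]
  have ob: "A \<in> ob T" "V \<in> ob T" "V' \<in> ob T" "P' \<in> ob T" using h by (simp_all add: hom_iff)
  obtain a where a: "a \<in> hom T P' P" "r \<cdot> a = r'" using r h unfolding right_approx_def by blast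
  obtain b where b: "b \<in> hom T P P'" "r' \<cdot> b = r" using r h unfolding right_approx_def by blast
  obtain \<alpha>' where \<alpha>': "\<alpha>' \<in> hom T (fob Sh V') (fob Sh V)" "z \<cdot> idm T A = \<alpha>' \<cdot> z'"
    by (rule tri_mor[OF tri_rot[OF t(2)] tri_rot[OF t(1)] a(1) idm_hom[OF ob(1)]]) (use a h in \<open>auto simp: hom_iff\<close>)
  obtain \<beta>' where \<beta>': "\<beta>' \<in> hom T (fob Sh V) (fob Sh V')" "z' \<cdot> idm T A = \<beta>' \<cdot> z"
    by (rule tri_mor[OF tri_rot[OF t(1)] tri_rot[OF t(2)] b(1) idm_hom[OF ob(1)]]) (use b h in \<open>auto simp: hom_iff\<close>)
  obtain \<alpha> where \<alpha>: "\<alpha> \<in> hom T V' V" "far Sh \<alpha> = \<alpha>'" using Sh_preimage[OF \<alpha>'(1) ob(3,2)] .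
  obtain \<beta> where \<beta>: "\<beta> \<in> hom T V V'" "far Sh \<beta> = \<beta>'" using Sh_preimage[OF \<beta>'(1) ob(2,3)] .
  have z: "far Sh \<alpha> \<cdot> z' = z" "far Sh \<beta> \<cdot> z = z'" using \<alpha> \<alpha>' \<beta> \<beta>' h ob by (simp_all add: hom_iff)
  let ?n = "idm T V' \<oplus> \<ominus> (\<beta> \<cdot> \<alpha>)"
  have n: "?n \<in> hom T V' V'" using \<alpha> \<beta> ob by (simp add: hom_iff)
  then have Sn: "far Sh ?n \<in> hom T (fob Sh V') (fob Sh V')" by (simp add: hom_iff)
  have "far Sh ?n \<cdot> z' = zero T A (fob Sh V')"
    using \<alpha>(1) \<beta>(1) z h ob by (simp add: hom_iff distrib_arr)
  then obtain v' where v': "v' \<in> hom T (fob Sh P') (fob Sh V')" "v' \<cdot> far Sh y' = far Sh ?n"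
    using tri_factor_through_cone3[OF t(2) Sn] by blast
  obtain v where v: "v \<in> hom T P' V'" "far Sh v = v'" using Sh_preimage[OF v'(1) ob(4,3)] .
  have "far Sh (v \<cdot> y') = far Sh ?n" using v v'(2) h by (simp add: hom_iff)
  then have vy: "v \<cdot> y' = ?n" using S_faithful[OF comp_hom[OF h(4) v(1)] n] by blast
  have "P' \<in> X" using r(2) unfolding right_approx_def by blast
  then have "X.ft V' V' ?n" using X.ftI[OF _ h(4) v(1)] vy by simp
  then show ?thesis using X.retract_mod[OF X(2,3) split V \<alpha>(1) \<beta>(1)] by blast
qed

end

section \<open>Serre duality\<close>

locale serre_category = linear_triangulated_category T Sh Us \<Delta>
  for T :: "('o, 'm, 'k::field) lincat" (structure)
    and Sh Us :: "('o, 'm, 'o, 'm) fctr"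
    and \<Delta> :: "('m \<times> 'm \<times> 'm) set" +
  fixes F :: "('o, 'm, 'o, 'm) fctr"
  assumes serre: "serre_functor T Sh \<Delta> F"
begin

text \<open>Besides the fact that F is an additive equivalence, Serre duality is used only to
  transfer the vanishing of Hom spaces, so this predicate is all that is extracted from the dual
  spaces.\<close>

definition hom_zero :: "'o \<Rightarrow> 'o \<Rightarrow> bool" where
  "hom_zero A B \<longleftrightarrow> (\<forall>f \<in> hom T A B. f = zero T A B)"

lemma hom_zeroD: "hom_zero A B \<Longrightarrow> f \<in> hom T A B \<Longrightarrow> f = zero T A B"
  unfolding hom_zero_def by blast

lemma hom_singleton_iff: "A \<in> ob T \<Longrightarrow> B \<in> ob T \<Longrightarrow> hom T A B = {zero T A B} \<longleftrightarrow> hom_zero A B"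
  unfolding hom_zero_def using zero_hom by blast

lemma hom_zero_left_iso:
  assumes "isomorphic T A A'" "hom_zero A B"
  shows "hom_zero A' B"
  unfolding hom_zero_def
proof
  fix f assume f: "f \<in> hom T A' B"
  obtain a a' where a: "a \<in> hom T A A'" "a' \<in> hom T A' A" "a \<cdot> a' = idm T A'"
    using assms(1) unfolding isomorphic_def by (metis is_isoE)
  have "f = (f \<cdot> a) \<cdot> a'" using f a by (simp add: hom_iff)
  also have "f \<cdot> a = zero T A B" using hom_zeroD[OF assms(2)] f a by (simp add: hom_iff)
  finally show "f = zero T A' B" using f a by (simp add: hom_iff)
qed

lemma hom_zero_right_iso:
  assumes "isomorphic T B B'" "hom_zero A B"
  shows "hom_zero A B'"
  unfolding hom_zero_def
proof
  fix f assume f: "f \<in> hom T A B'"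
  obtain b b' where b: "b \<in> hom T B B'" "b' \<in> hom T B' B" "b \<cdot> b' = idm T B'"
    using assms(1) unfolding isomorphic_def by (metis is_isoE)
  have "f = b \<cdot> (b' \<cdot> f)" using comp_extend1_arr[OF b(3,1,2), of f] f by (simp add: hom_iff)
  also have "b' \<cdot> f = zero T A B" using hom_zeroD[OF assms(2)] f b by (simp add: hom_iff)
  finally show "f = zero T A B'" using f b by (simp add: hom_iff)
qed

lemma hom_zero_shift:
  assumes "A \<in> ob T" "B \<in> ob T"
  shows "hom_zero (fob Sh A) (fob Sh B) \<longleftrightarrow> hom_zero A B"
proof
  assume h: "hom_zero (fob Sh A) (fob Sh B)"
  show "hom_zero A B" unfolding hom_zero_def
  proof
    fix f assume f: "f \<in> hom T A B"
    have "far Sh f = far Sh (zero T A B)" using hom_zeroD[OF h, of "far Sh f"] f assms by (simp add: hom_iff)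
    then show "f = zero T A B" using S_faithful[OF f zero_hom[OF assms]] by blast
  qed
next
  assume h: "hom_zero A B"
  show "hom_zero (fob Sh A) (fob Sh B)" unfolding hom_zero_def
  proof
    fix f assume f: "f \<in> hom T (fob Sh A) (fob Sh B)"
    obtain g where g: "g \<in> hom T A B" "far Sh g = f" using Sh_preimage[OF f assms] .
    show "f = zero T (fob Sh A) (fob Sh B)"
      unfolding g(2)[symmetric] hom_zeroD[OF h g(1)] using assms by simp
  qed
qed

lemma F_equivalence: "is_equivalence T T F" and F_additive: "is_additive_functor T T F"
  using serre unfolding serre_functor_def triangulated_equivalence_def is_linear_functor_def by blast+

lemma F_functor: "is_functor T T F"
  using F_additive unfolding is_additive_functor_def by blast

lemma F_ob [simp]: "A \<in> ob T \<Longrightarrow> fob F A \<in> ob T"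
  using functor_ob[OF F_functor] .

text \<open>A zero Hom space carries a single functional: additivity forces the value 0 at the zero
  map and extensionality fixes the rest. The bijection leaves only one morphism on the other
  side.\<close>

lemma hom_zero_serre1:
  assumes ob: "A \<in> ob T" "B \<in> ob T" and h: "hom_zero A B"
  shows "hom_zero B (fob F A)"
proof -
  obtain \<eta> where \<eta>: "bij_betw (\<eta> A B) (dual T A B) (hom T B (fob F A))"
    using serre ob unfolding serre_functor_def by blast
  have hom: "hom T A B = {zero T A B}" using hom_singleton_iff[OF ob] h by blast
  have "\<phi> = \<psi>" if "\<phi> \<in> dual T A B" "\<psi> \<in> dual T A B" for \<phi> \<psi>
  proof (rule extensionalityI)
    have ext: "\<phi> \<in> extensional (hom T A B)" "\<psi> \<in> extensional (hom T A B)"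
      using that unfolding dual_def by blast+
    show "\<phi> \<in> extensional (hom T A B)" "\<psi> \<in> extensional (hom T A B)" by (rule ext)+
    have z: "\<chi> (zero T A B) = 0" if "\<chi> \<in> dual T A B" for \<chi>
    proof -
      have "\<chi> (zero T A B \<oplus> zero T A B) = \<chi> (zero T A B) + \<chi> (zero T A B)"
        using that zero_hom[OF ob] unfolding dual_def by blast
      then have "\<chi> (zero T A B) = \<chi> (zero T A B) + \<chi> (zero T A B)" using ob by (simp only: add_zero[OF zero_hom])
      then show ?thesis by (simp only: add_cancel_right_right)
    qed
    show "\<phi> x = \<psi> x" if "x \<in> hom T A B" for x
      using that z[OF \<open>\<phi> \<in> dual T A B\<close>] z[OF \<open>\<psi> \<in> dual T A B\<close>] unfolding hom by simp
  qed
  moreover have z: "zero T B (fob F A) \<in> hom T B (fob F A)" using ob by (intro zero_hom) simp_all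
  moreover have "\<exists>\<phi> \<in> dual T A B. f = \<eta> A B \<phi>" if "f \<in> hom T B (fob F A)" for f
    using \<eta> that unfolding bij_betw_def by blast
  ultimately show ?thesis unfolding hom_zero_def by metis
qed

text \<open>The converse direction of Serre duality for vanishing Hom spaces applies the duality twice, so no
  bidual is needed.\<close>

lemma hom_zero_serre:
  assumes ob: "A \<in> ob T" "B \<in> ob T"
  shows "hom_zero B (fob F A) \<longleftrightarrow> hom_zero A B"
proof
  assume "hom_zero B (fob F A)"
  then have h: "hom_zero (fob F A) (fob F B)" using hom_zero_serre1[OF ob(2) F_ob[OF ob(1)]] by blast
  show "hom_zero A B" unfolding hom_zero_def
  proof
    fix f assume f: "f \<in> hom T A B"
    have "far F f = far F (zero T A B)"
      using hom_zeroD[OF h functor_hom[OF F_functor f]] additive_functor_zero[OF F_additive ob] by simp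
    then show "f = zero T A B" using equivalence_faithful[OF F_equivalence f zero_hom[OF ob]] by blast
  qed
qed (rule hom_zero_serre1[OF ob])

section \<open>Stability under the Serre functor and the class \<Psi>(X)\<close>

lemma isomorphic_Us: "isomorphic T A B \<Longrightarrow> isomorphic T (fob Us A) (fob Us B)"
  using functor_isomorphic[OF unshift_functor] .

lemma ess_image_iff: "B \<in> ess_image T G X \<longleftrightarrow> (\<exists>A \<in> X. isomorphic T (fob G A) B)"
  unfolding ess_image_def by blast

text \<open>The strict inverse \<open>Us\<close> of the shift turns an iterated essential image into
  membership of one object.\<close>

lemma ess_image_Sh_Sh:
  assumes U: "subcategory T U" and B: "B \<in> ob T"
  shows "B \<in> ess_image T Sh (ess_image T Sh U) \<longleftrightarrow> fob Us (fob Us B) \<in> U"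
proof
  assume "B \<in> ess_image T Sh (ess_image T Sh U)"
  then obtain B1 A where A: "A \<in> U" "isomorphic T (fob Sh A) B1" "isomorphic T (fob Sh B1) B"
    unfolding ess_image_def by blast
  have ob: "A \<in> ob T" "B1 \<in> ob T" using isomorphic_ob[OF A(2)] A(1) subcategoryD(1)[OF U] by auto
  have "isomorphic T B1 (fob Us B)" using isomorphic_Us[OF A(3)] ob by simp
  then have "isomorphic T (fob Us B1) (fob Us (fob Us B))" by (rule isomorphic_Us)
  moreover have "isomorphic T A (fob Us B1)" using isomorphic_Us[OF A(2)] ob by simp
  ultimately show "fob Us (fob Us B) \<in> U" using isomorphic_trans subcategoryD(3)[OF U A(1)] by blast
next
  assume A: "fob Us (fob Us B) \<in> U"
  have "isomorphic T (fob Sh (fob Us (fob Us B))) (fob Us B)" "isomorphic T (fob Sh (fob Us B)) B"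
    using isomorphic_refl B by simp_all
  then show "B \<in> ess_image T Sh (ess_image T Sh U)" using A unfolding ess_image_def by blast
qed

text \<open>Stability becomes a pointwise equivalence for the functor F[-2]. In this form it passes
  at once to the intersection defining the heart.\<close>

lemma serre_stable_iff:
  assumes U: "subcategory T U"
  shows "serre_stable T Sh F U \<longleftrightarrow> (\<forall>A \<in> ob T. A \<in> U \<longleftrightarrow> fob Us (fob Us (fob F A)) \<in> U)"
proof
  assume s: "serre_stable T Sh F U"
  show "\<forall>A \<in> ob T. A \<in> U \<longleftrightarrow> fob Us (fob Us (fob F A)) \<in> U"
  proof
    fix A assume A: "A \<in> ob T"
    have "fob Us (fob Us (fob F A)) \<in> U \<longleftrightarrow> (\<exists>B \<in> U. isomorphic T (fob F B) (fob F A))"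
      using s ess_image_Sh_Sh[OF U F_ob[OF A]] ess_image_iff[of "fob F A" F U] unfolding serre_stable_def by simp
    also have "\<dots> \<longleftrightarrow> A \<in> U"
    proof
      assume "\<exists>B \<in> U. isomorphic T (fob F B) (fob F A)"
      then obtain B where B: "B \<in> U" "isomorphic T (fob F B) (fob F A)" by blast
      have "B \<in> ob T" using B(1) subcategoryD(1)[OF U] by blast
      then have "isomorphic T B A"
        using equivalence_reflects_isomorphic[OF F_equivalence _ A] B(2) by blast
      then show "A \<in> U" using subcategoryD(3)[OF U B(1)] by blast
    qed (use isomorphic_refl[OF F_ob[OF A]] in blast)
    finally show "A \<in> U \<longleftrightarrow> fob Us (fob Us (fob F A)) \<in> U" by blast
  qed
next
  assume s: "\<forall>A \<in> ob T. A \<in> U \<longleftrightarrow> fob Us (fob Us (fob F A)) \<in> U"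
  have "B \<in> ess_image T F U \<longleftrightarrow> fob Us (fob Us B) \<in> U" if B: "B \<in> ob T" for B
  proof
    assume "B \<in> ess_image T F U"
    then obtain A where A: "A \<in> U" "isomorphic T (fob F A) B" unfolding ess_image_iff by blast
    have "fob Us (fob Us (fob F A)) \<in> U" using s A(1) subcategoryD(1)[OF U] by blast
    then show "fob Us (fob Us B) \<in> U"
      using subcategoryD(3)[OF U] isomorphic_Us[OF isomorphic_Us[OF A(2)]] by blast
  next
    assume BU: "fob Us (fob Us B) \<in> U"
    obtain A where A: "A \<in> ob T" "isomorphic T (fob F A) B" using equivalence_dense[OF F_equivalence B] .
    have "fob Us (fob Us (fob F A)) \<in> U"
      using subcategoryD(3)[OF U BU] isomorphic_Us[OF isomorphic_Us[OF isomorphic_sym[OF A(2)]]] by blast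
    then have "A \<in> U" using s A(1) by blast
    then show "B \<in> ess_image T F U" unfolding ess_image_iff using A(2) by blast
  qed
  moreover have "ess_image T F U \<subseteq> ob T" "ess_image T Sh (ess_image T Sh U) \<subseteq> ob T"
    unfolding ess_image_def using isomorphic_ob by blast+
  ultimately show "serre_stable T Sh F U"
    unfolding serre_stable_def using ess_image_Sh_Sh[OF U] by blast
qed

text \<open>Removes the essential image: \<open>fob Us B\<close> is a witness in the perpendicular
  class whose shift is B itself.\<close>

lemma Psi_iff:
  assumes X: "X \<subseteq> ob T"
  shows "B \<in> Psi T Sh X \<longleftrightarrow> B \<in> ob T \<and> (\<forall>W \<in> X. hom_zero B (fob Sh W))"
proof
  assume "B \<in> Psi T Sh X"
  then obtain A where A: "A \<in> left_perp T X" "isomorphic T (fob Sh A) B"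
    unfolding Psi_def ess_image_def by blast
  have A': "A \<in> ob T" using A(1) unfolding left_perp_def by blast
  have "hom_zero B (fob Sh W)" if W: "W \<in> X" for W
  proof -
    have "W \<in> ob T" using X W by blast
    moreover from this have "hom_zero A W" using A(1) W hom_singleton_iff A' unfolding left_perp_def by blast
    ultimately show ?thesis using hom_zero_shift[OF A'] hom_zero_left_iso[OF A(2)] by blast
  qed
  then show "B \<in> ob T \<and> (\<forall>W \<in> X. hom_zero B (fob Sh W))" using isomorphic_ob[OF A(2)] by blast
next
  assume B: "B \<in> ob T \<and> (\<forall>W \<in> X. hom_zero B (fob Sh W))"
  have "fob Us B \<in> left_perp T X"
    unfolding left_perp_def
  proof (intro CollectI conjI ballI)
    fix W assume W: "W \<in> X"
    then have "W \<in> ob T" "hom_zero (fob Sh (fob Us B)) (fob Sh W)" using X B by auto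
    then show "hom T (fob Us B) W = {zero T (fob Us B) W}"
      using hom_zero_shift[of "fob Us B" W] hom_singleton_iff[of "fob Us B" W] B by simp
  qed (use B in simp)
  moreover have "isomorphic T (fob Sh (fob Us B)) B" using B isomorphic_refl by simp
  ultimately show "B \<in> Psi T Sh X" unfolding Psi_def ess_image_def by blast
qed

lemma Psi_hom_zero: "X \<subseteq> ob T \<Longrightarrow> B \<in> Psi T Sh X \<Longrightarrow> W \<in> X \<Longrightarrow> hom_zero B (fob Sh W)"
  and Psi_ob: "X \<subseteq> ob T \<Longrightarrow> B \<in> Psi T Sh X \<Longrightarrow> B \<in> ob T"
  using Psi_iff by blast+

lemma Phi_eq: "Phi T Sh U = U \<inter> Psi T Sh U"
  unfolding Phi_def Psi_def ..

lemma rigid_iff: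
  assumes X: "X \<subseteq> ob T"
  shows "rigid T Sh X \<longleftrightarrow> (\<forall>A \<in> X. \<forall>B \<in> X. hom_zero A (fob Sh B))"
proof
  assume r: "rigid T Sh X"
  show "\<forall>A \<in> X. \<forall>B \<in> X. hom_zero A (fob Sh B)"
  proof (intro ballI)
    fix A B assume AB: "A \<in> X" "B \<in> X"
    then have ob: "A \<in> ob T" "fob Sh B \<in> ob T" using X by auto
    have "fob Sh B \<in> ess_image T Sh X" unfolding ess_image_iff using AB isomorphic_refl[OF ob(2)] by blast
    then show "hom_zero A (fob Sh B)" using r AB(1) hom_singleton_iff[OF ob] unfolding rigid_def by blast
  qed
next
  assume h: "\<forall>A \<in> X. \<forall>B \<in> X. hom_zero A (fob Sh B)"
  show "rigid T Sh X"
    unfolding rigid_def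
  proof (intro ballI)
    fix A B assume AB: "A \<in> X" "B \<in> ess_image T Sh X"
    then obtain C where C: "C \<in> X" "isomorphic T (fob Sh C) B" unfolding ess_image_iff by blast
    have "hom_zero A B" using h AB(1) C hom_zero_right_iso by blast
    moreover have "A \<in> ob T" "B \<in> ob T" using AB(1) X isomorphic_ob[OF C(2)] by auto
    ultimately show "hom T A B = {zero T A B}" using hom_singleton_iff by blast
  qed
qed

lemma Psi_subcategory:
  assumes X: "X \<subseteq> ob T"
  shows "subcategory T (Psi T Sh X)"
  unfolding subcategory_def
proof (intro conjI allI impI)
  show "Psi T Sh X \<subseteq> ob T" using Psi_ob[OF X] by blast
  obtain Z where Z: "zero_object T Z" using zero_object_ex by blast
  then have "Z \<in> Psi T Sh X"
    unfolding Psi_iff[OF X] hom_zero_def using zero_object_hom_from[OF Z] by (auto simp: zero_object_def)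
  then show "\<exists>Z \<in> Psi T Sh X. zero_object T Z" using Z by blast
  show "B \<in> Psi T Sh X" if "A \<in> Psi T Sh X \<and> isomorphic T A B" for A B
    using that hom_zero_left_iso isomorphic_ob unfolding Psi_iff[OF X] by blast
  fix A B P i j p q
  assume b: "biproduct T A B P i j p q"
  then have h: "i \<in> hom T A P" "j \<in> hom T B P" "p \<in> hom T P A" "q \<in> hom T P B"
    "p \<cdot> i = idm T A" "q \<cdot> j = idm T B" "(i \<cdot> p) \<oplus> (j \<cdot> q) = idm T P"
    unfolding biproduct_def by blast+
  have ob: "A \<in> ob T" "B \<in> ob T" "P \<in> ob T" using h by (simp_all add: hom_iff)
  have "hom_zero P W \<longleftrightarrow> hom_zero A W \<and> hom_zero B W" for W
  proof (intro iffI conjI)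
    assume P: "hom_zero P W"
    show "hom_zero A W" unfolding hom_zero_def
    proof
      fix f assume f: "f \<in> hom T A W"
      have "f = (f \<cdot> p) \<cdot> i" using f h(1,3,5) by (simp add: hom_iff)
      also have "f \<cdot> p = zero T P W" using hom_zeroD[OF P] f h(3) by (simp add: hom_iff)
      finally show "f = zero T A W" using f h(1) by (simp add: hom_iff)
    qed
    show "hom_zero B W" unfolding hom_zero_def
    proof
      fix f assume f: "f \<in> hom T B W"
      have "f = (f \<cdot> q) \<cdot> j" using f h(2,4,6) by (simp add: hom_iff)
      also have "f \<cdot> q = zero T P W" using hom_zeroD[OF P] f h(4) by (simp add: hom_iff)
      finally show "f = zero T B W" using f h(2) by (simp add: hom_iff)
    qed
  next
    assume AB: "hom_zero A W \<and> hom_zero B W"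
    show "hom_zero P W" unfolding hom_zero_def
    proof
      fix f assume f: "f \<in> hom T P W"
      have "f \<cdot> i = zero T A W" "f \<cdot> j = zero T B W" using AB hom_zeroD f h(1,2) comp_hom by blast+
      then have 0: "f \<cdot> (i \<cdot> p) = zero T P W" "f \<cdot> (j \<cdot> q) = zero T P W"
        using comp_extend1_arr[OF _ f h(1), of _ p] comp_extend1_arr[OF _ f h(2), of _ q] f h(3,4)
        by (simp_all add: hom_iff)
      have "f = f \<cdot> ((i \<cdot> p) \<oplus> (j \<cdot> q))" unfolding h(7) using f by (simp add: hom_iff)
      also have "\<dots> = zero T P W" using 0 f h(1-4) by (simp add: hom_iff distrib_arr)
      finally show "f = zero T P W" .
    qed
  qed
  then show "P \<in> Psi T Sh X \<longleftrightarrow> A \<in> Psi T Sh X \<and> B \<in> Psi T Sh X"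
    unfolding Psi_iff[OF X] using ob by blast
qed

lemma Psi_extension_closed:
  assumes X: "X \<subseteq> ob T"
  shows "extension_closed T Sh \<Delta> (Psi T Sh X)"
  unfolding extension_closed_def
proof (intro allI impI)
  fix A B D f g h
  assume "triangle_shape T Sh A B D f g h \<and> (f, g, h) \<in> \<Delta> \<and> A \<in> Psi T Sh X \<and> D \<in> Psi T Sh X"
  then have t: "tri A B D f g h" and AD: "A \<in> Psi T Sh X" "D \<in> Psi T Sh X" unfolding tri_def by blast+
  note th = tri_hom[OF t]
  have "hom_zero B (fob Sh W)" if W: "W \<in> X" for W
    unfolding hom_zero_def
  proof
    fix w assume w: "w \<in> hom T B (fob Sh W)"
    have "w \<cdot> f = zero T A (fob Sh W)" using hom_zeroD[OF Psi_hom_zero[OF X AD(1) W] comp_hom[OF th(1) w]] .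
    then obtain v where v: "v \<in> hom T D (fob Sh W)" "v \<cdot> g = w" using tri_factor_through_cone[OF t w] by blast
    have "v = zero T D (fob Sh W)" using hom_zeroD[OF Psi_hom_zero[OF X AD(2) W] v(1)] .
    then show "w = zero T B (fob Sh W)" using v th w by (auto simp: hom_iff)
  qed
  then show "B \<in> Psi T Sh X" unfolding Psi_iff[OF X] using th by (simp add: hom_iff)
qed

text \<open>The inclusion of U[2] in \<S>(U), for a single object; \<open>serre_stable_iff\<close>
  covers the opposite inclusion.\<close>

lemma serre_twist:
  assumes U: "subcategory T U" "serre_stable T Sh F U" and W: "W \<in> U"
  obtains W' where "W' \<in> U" "isomorphic T (fob F W') (fob Sh (fob Sh W))"
proof -
  have "W \<in> ob T" using W subcategoryD(1)[OF U(1)] by blast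
  then have "fob Sh (fob Sh W) \<in> ess_image T Sh (ess_image T Sh U)"
    using ess_image_Sh_Sh[OF U(1), of "fob Sh (fob Sh W)"] W by simp
  then show thesis using that U(2) unfolding serre_stable_def ess_image_def by blast
qed

text \<open>Serre duality compares T(W, B[1]) with T(B[1], \<S>W). One direction uses that \<S>W is
  the double shift of an object of U, the other that every W[2] is isomorphic to some \<S>W' with W'
  in U.\<close>

lemma Psi_right_iff:
  assumes U: "subcategory T U" "serre_stable T Sh F U"
  shows "B \<in> Psi T Sh U \<longleftrightarrow> B \<in> ob T \<and> (\<forall>W \<in> U. hom_zero W (fob Sh B))"
proof -
  note Uob = subcategoryD(1)[OF U(1)]
  have "(\<forall>W \<in> U. hom_zero B (fob Sh W)) \<longleftrightarrow> (\<forall>W \<in> U. hom_zero W (fob Sh B))" if B: "B \<in> ob T"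
  proof (intro iffI ballI)
    fix W assume h: "\<forall>W \<in> U. hom_zero B (fob Sh W)" and W: "W \<in> U"
    have ob: "W \<in> ob T" using W Uob by blast
    let ?W = "fob Us (fob Us (fob F W))"
    have "?W \<in> U" using W ob U(2) serre_stable_iff[OF U(1)] by blast
    then have "hom_zero (fob Sh B) (fob Sh (fob Sh ?W))" using h hom_zero_shift[OF B] Uob by auto
    then have "hom_zero (fob Sh B) (fob F W)" using ob by simp
    then show "hom_zero W (fob Sh B)" using hom_zero_serre[OF ob] B by simp
  next
    fix W assume h: "\<forall>W \<in> U. hom_zero W (fob Sh B)" and W: "W \<in> U"
    have ob: "W \<in> ob T" using W Uob by blast
    obtain W' where W': "W' \<in> U" "isomorphic T (fob F W') (fob Sh (fob Sh W))" using serre_twist[OF U W] .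
    have "hom_zero (fob Sh B) (fob F W')" using h W'(1) hom_zero_serre[of W' "fob Sh B"] Uob B by auto
    then have "hom_zero (fob Sh B) (fob Sh (fob Sh W))" using hom_zero_right_iso[OF W'(2)] by blast
    then show "hom_zero B (fob Sh W)" using hom_zero_shift[OF B] ob by simp
  qed
  then show ?thesis unfolding Psi_iff[OF Uob] by blast
qed

lemma Psi_hom_zero_right:
  "subcategory T U \<Longrightarrow> serre_stable T Sh F U \<Longrightarrow> B \<in> Psi T Sh U \<Longrightarrow> W \<in> U \<Longrightarrow> hom_zero W (fob Sh B)"
  using Psi_right_iff by blast

text \<open>T(\<S>B[-2], W[1]) shifts to T(\<S>B[-1], W[2]), and W[2] is \<S>W' with W' in U.
  Applying duality twice turns vanishing there into vanishing of T(B, W'[1]).\<close>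

lemma Psi_serre_stable:
  assumes U: "subcategory T U" "serre_stable T Sh F U"
  shows "serre_stable T Sh F (Psi T Sh U)"
  unfolding serre_stable_iff[OF Psi_subcategory[OF subcategoryD(1)[OF U(1)]]]
proof
  note Uob = subcategoryD(1)[OF U(1)]
  fix B assume B: "B \<in> ob T"
  let ?B = "fob Us (fob Us (fob F B))"
  have ob: "fob F B \<in> ob T" "fob Us (fob F B) \<in> ob T" "?B \<in> ob T" using B by simp_all
  have *: "hom_zero ?B (fob Sh W) \<longleftrightarrow> hom_zero (fob Us (fob F B)) (fob Sh (fob Sh W))" if "W \<in> ob T" for W
    using hom_zero_shift[OF ob(3), of "fob Sh W"] that ob by simp
  have **: "hom_zero (fob Us (fob F B)) (fob F W) \<longleftrightarrow> hom_zero B (fob Sh W)" if W: "W \<in> ob T" for W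
  proof -
    have "hom_zero (fob Us (fob F B)) (fob F W) \<longleftrightarrow> hom_zero W (fob Us (fob F B))" using hom_zero_serre[OF W ob(2)] .
    also have "\<dots> \<longleftrightarrow> hom_zero (fob Sh W) (fob F B)" using hom_zero_shift[OF W ob(2)] ob by simp
    also have "\<dots> \<longleftrightarrow> hom_zero B (fob Sh W)" using hom_zero_serre[OF B, of "fob Sh W"] W by simp
    finally show ?thesis .
  qed
  have "(\<forall>W \<in> U. hom_zero B (fob Sh W)) \<longleftrightarrow> (\<forall>W \<in> U. hom_zero ?B (fob Sh W))"
  proof (intro iffI ballI)
    fix W assume h: "\<forall>W \<in> U. hom_zero B (fob Sh W)" and W: "W \<in> U"
    obtain W' where W': "W' \<in> U" "isomorphic T (fob F W') (fob Sh (fob Sh W))" using serre_twist[OF U W] .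
    have W'_ob: "W' \<in> ob T" using W'(1) Uob by blast
    have "hom_zero (fob Us (fob F B)) (fob F W')" using h W'(1) **[OF W'_ob] by blast
    then have "hom_zero (fob Us (fob F B)) (fob Sh (fob Sh W))" using hom_zero_right_iso[OF W'(2)] by blast
    then show "hom_zero ?B (fob Sh W)" using * W Uob by blast
  next
    fix W assume h: "\<forall>W \<in> U. hom_zero ?B (fob Sh W)" and W: "W \<in> U"
    have W_ob: "W \<in> ob T" using W Uob by blast
    let ?W = "fob Us (fob Us (fob F W))"
    have "?W \<in> U" using W W_ob U(2) serre_stable_iff[OF U(1)] by blast
    then have "hom_zero (fob Us (fob F B)) (fob Sh (fob Sh ?W))" using h * Uob by blast
    then show "hom_zero B (fob Sh W)" using **[OF W_ob] W_ob by simp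
  qed
  then show "B \<in> Psi T Sh U \<longleftrightarrow> ?B \<in> Psi T Sh U" unfolding Psi_iff[OF Uob] using B ob by blast
qed

text \<open>By the second description of \<Psi>(U), objects of the heart are injective relative to
  U, and this is the membership condition read from the other side.\<close>

lemma subset_Psi_Phi:
  assumes U: "subcategory T U" "serre_stable T Sh F U"
  shows "U \<subseteq> Psi T Sh (Phi T Sh U)"
proof
  note Uob = subcategoryD(1)[OF U(1)]
  fix A assume A: "A \<in> U"
  have "Phi T Sh U \<subseteq> ob T" unfolding Phi_eq using Uob by blast
  moreover have "hom_zero A (fob Sh W)" if "W \<in> Phi T Sh U" for W
    using that Psi_hom_zero_right[OF U _ A] unfolding Phi_eq by blast
  ultimately show "A \<in> Psi T Sh (Phi T Sh U)" using Psi_iff A Uob by blast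
qed

section \<open>From rigid to extension closed subcategories\<close>

lemma RigidD:
  assumes "X \<in> Rigid T Sh F"
  shows "subcategory T X" "functorially_finite T X" "serre_stable T Sh F X" "X \<subseteq> ob T"
    "A \<in> X \<Longrightarrow> B \<in> X \<Longrightarrow> hom_zero A (fob Sh B)"
  using assms rigid_iff subcategoryD(1) unfolding Rigid_def by blast+

lemma ExtD:
  assumes "U \<in> Ext T Sh \<Delta> F"
  shows "subcategory T U" "functorially_finite T U" "extension_closed T Sh \<Delta> U" "serre_stable T Sh F U"
    "U \<subseteq> ob T"
  using assms subcategoryD(1) unfolding Ext_def by blast+

lemma approximations_ex:
  assumes "functorially_finite T X" "A \<in> ob T"
  obtains P r P' l where "right_approx T X P A r" "left_approx T X A P' l"
  using assms unfolding functorially_finite_def by blast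

text \<open>C is the cone of a left X-approximation l of A[-1]. A map from C to X[1] vanishes on P
  by rigidity, so it comes from a map of A[-1] to X; that one extends over l, so the original map is
  zero. Maps from \<Psi>(X) to A lift to C since T(\<Psi>(X), P[1]) = 0.\<close>

lemma Psi_right_approx:
  assumes X: "X \<in> Rigid T Sh F" and A: "A \<in> ob T"
  shows "\<exists>C r. right_approx T (Psi T Sh X) C A r"
proof -
  note X' = RigidD[OF X]
  have UA: "fob Us A \<in> ob T" using A by simp
  obtain P l where l: "left_approx T X (fob Us A) P l" using approximations_ex[OF X'(2) UA] by blast
  have lh: "P \<in> X" "l \<in> hom T (fob Us A) P" using l unfolding left_approx_def by blast+
  obtain C y z where t: "tri (fob Us A) P C l y z" using tri_ex[OF lh(2)] .
  have th: "y \<in> hom T P C" "z \<in> hom T C A" using tri_hom[OF t] A by simp_all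
  have ob: "P \<in> ob T" "C \<in> ob T" using th by (simp_all add: hom_iff)
  have rot: "tri P C A y z (\<ominus> far Sh l)" using tri_rot[OF t] A by simp
  have "hom_zero C (fob Sh W)" if W: "W \<in> X" for W
    unfolding hom_zero_def
  proof
    fix \<phi> assume \<phi>: "\<phi> \<in> hom T C (fob Sh W)"
    have W_ob: "W \<in> ob T" using W X'(4) by blast
    have "\<phi> \<cdot> y = zero T P (fob Sh W)" using hom_zeroD[OF X'(5)[OF lh(1) W] comp_hom[OF th(1) \<phi>]] .
    then obtain \<chi> where \<chi>: "\<chi> \<in> hom T (fob Sh (fob Us A)) (fob Sh W)" "\<chi> \<cdot> z = \<phi>"
      using tri_factor_through_cone2[OF t \<phi>] by blast
    obtain \<chi>' where \<chi>': "\<chi>' \<in> hom T (fob Us A) W" "far Sh \<chi>' = \<chi>" using Sh_preimage[OF \<chi>(1) UA W_ob] .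
    obtain \<xi> where \<xi>: "\<xi> \<in> hom T P W" "\<xi> \<cdot> l = \<chi>'" using l W \<chi>'(1) unfolding left_approx_def by blast
    have "\<phi> = far Sh \<xi> \<cdot> (far Sh l \<cdot> z)"
      unfolding \<chi>(2)[symmetric] \<chi>'(2)[symmetric] \<xi>(2)[symmetric] using \<xi>(1) th lh(2) A by (simp add: hom_iff)
    then show "\<phi> = zero T C (fob Sh W)" using tri_comp_zero3[OF t] \<xi>(1) ob by (simp add: hom_iff)
  qed
  then have C: "C \<in> Psi T Sh X" unfolding Psi_iff[OF X'(4)] using ob by blast
  have "right_approx T (Psi T Sh X) C A z"
    unfolding right_approx_def
  proof (intro conjI ballI)
    fix V f assume V: "V \<in> Psi T Sh X" and f: "f \<in> hom T V A"
    have "\<ominus> far Sh l \<cdot> f \<in> hom T V (fob Sh P)" using f lh(2) A by (simp add: hom_iff)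
    then have "\<ominus> far Sh l \<cdot> f = zero T V (fob Sh P)" using hom_zeroD[OF Psi_hom_zero[OF X'(4) V lh(1)]] by blast
    then show "\<exists>g \<in> hom T V C. z \<cdot> g = f" using tri_lift_to_fibre2[OF rot f] by blast
  qed (use C th in blast)+
  then show ?thesis by blast
qed

text \<open>Built from a right X-approximation of A[1]. The triangle controls maps into C[1], so
  membership of C is checked through \<open>Psi_right_iff\<close>.\<close>

lemma Psi_left_approx:
  assumes X: "X \<in> Rigid T Sh F" and A: "A \<in> ob T"
  shows "\<exists>C l. left_approx T (Psi T Sh X) A C l"
proof -
  note X' = RigidD[OF X]
  have SA: "fob Sh A \<in> ob T" using A by simp
  obtain P r where r: "right_approx T X P (fob Sh A) r" using approximations_ex[OF X'(2) SA] by blast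
  have rh: "P \<in> X" "r \<in> hom T P (fob Sh A)" using r unfolding right_approx_def by blast+
  obtain C f g where t: "tri A C P f g r" using tri_ex3[OF rh(2) A] .
  note th = tri_hom[OF t]
  have ob: "P \<in> ob T" "C \<in> ob T" using th by (simp_all add: hom_iff)
  have "hom_zero W (fob Sh C)" if W: "W \<in> X" for W
    unfolding hom_zero_def
  proof
    fix \<phi> assume \<phi>: "\<phi> \<in> hom T W (fob Sh C)"
    have "far Sh g \<cdot> \<phi> \<in> hom T W (fob Sh P)" using \<phi> th by (simp add: hom_iff)
    then have "far Sh g \<cdot> \<phi> = zero T W (fob Sh P)" using hom_zeroD[OF X'(5)[OF W rh(1)]] by blast
    then obtain v where v: "v \<in> hom T W (fob Sh A)" "\<ominus> far Sh f \<cdot> v = \<phi>"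
      using tri_lift_to_fibre3[OF tri_rot[OF t] \<phi>] by blast
    obtain v' where v': "v' \<in> hom T W P" "r \<cdot> v' = v" using r W v(1) unfolding right_approx_def by blast
    have "\<phi> = \<ominus> ((far Sh f \<cdot> r) \<cdot> v')"
      unfolding v(2)[symmetric] v'(2)[symmetric] using v'(1) th by (simp add: hom_iff)
    then show "\<phi> = zero T W (fob Sh C)" using tri_comp_zero3[OF t] v'(1) ob by (simp add: hom_iff)
  qed
  then have C: "C \<in> Psi T Sh X" unfolding Psi_right_iff[OF X'(1,3)] using ob by blast
  have "left_approx T (Psi T Sh X) A C f"
    unfolding left_approx_def
  proof (intro conjI ballI)
    fix V h assume V: "V \<in> Psi T Sh X" and h: "h \<in> hom T A V"
    have V_ob: "V \<in> ob T" using Psi_ob[OF X'(4) V] .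
    have Sh_h: "far Sh h \<in> hom T (fob Sh A) (fob Sh V)" using h by (simp add: hom_iff)
    have "far Sh h \<cdot> r = zero T P (fob Sh V)"
      using hom_zeroD[OF Psi_hom_zero_right[OF X'(1,3) V rh(1)] comp_hom[OF rh(2) Sh_h]] .
    then obtain w where w: "w \<in> hom T (fob Sh C) (fob Sh V)" "w \<cdot> far Sh f = far Sh h"
      using tri_factor_through_cone3[OF t Sh_h] by blast
    obtain v where v: "v \<in> hom T C V" "far Sh v = w" using Sh_preimage[OF w(1) ob(2) V_ob] .
    have "far Sh (v \<cdot> f) = far Sh h" using v w(2) th by (simp add: hom_iff)
    then have "v \<cdot> f = h" using S_faithful[OF comp_hom[OF th(1) v(1)] h] by blast
    then show "\<exists>g \<in> hom T C V. g \<cdot> f = h" using v(1) by blast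
  qed (use C th in blast)+
  then show ?thesis by blast
qed

lemma Psi_Ext:
  assumes X: "X \<in> Rigid T Sh F"
  shows "Psi T Sh X \<in> Ext T Sh \<Delta> F"
  unfolding Ext_def functorially_finite_def
  using Psi_subcategory Psi_extension_closed Psi_serre_stable Psi_right_approx[OF X] Psi_left_approx[OF X]
    RigidD[OF X] by blast

lemma Phi_Psi:
  assumes X: "X \<in> Rigid T Sh F"
  shows "Phi T Sh (Psi T Sh X) = X"
proof
  note X' = RigidD[OF X]
  have Psi_sub: "Psi T Sh X \<subseteq> ob T" using Psi_ob[OF X'(4)] by blast
  show "X \<subseteq> Phi T Sh (Psi T Sh X)"
  proof
    fix A assume A: "A \<in> X"
    have "A \<in> Psi T Sh X" unfolding Psi_iff[OF X'(4)] using A X'(4,5) by blast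
    moreover have "A \<in> Psi T Sh (Psi T Sh X)"
      unfolding Psi_iff[OF Psi_sub] using A X'(4) Psi_hom_zero_right[OF X'(1,3) _ A] by blast
    ultimately show "A \<in> Phi T Sh (Psi T Sh X)" unfolding Phi_eq by blast
  qed
  show "Phi T Sh (Psi T Sh X) \<subseteq> X"
  proof
    fix A assume "A \<in> Phi T Sh (Psi T Sh X)"
    then have A: "A \<in> Psi T Sh (Psi T Sh X)" "A \<in> ob T" unfolding Phi_eq using Psi_sub by blast+
    obtain P r where r: "right_approx T X P A r" using approximations_ex[OF X'(2) A(2)] by blast
    have rh: "P \<in> X" "r \<in> hom T P A" using r unfolding right_approx_def by blast+
    obtain C g h where t: "tri P A C r g h" using tri_ex[OF rh(2)] .
    note th = tri_hom[OF t]
    have ob: "P \<in> ob T" "C \<in> ob T" using th by (simp_all add: hom_iff)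
    have "hom_zero W C" if W: "W \<in> X" for W
      unfolding hom_zero_def
    proof
      fix \<phi> assume \<phi>: "\<phi> \<in> hom T W C"
      have "h \<cdot> \<phi> = zero T W (fob Sh P)" using hom_zeroD[OF X'(5)[OF W rh(1)] comp_hom[OF \<phi> th(3)]] .
      then obtain v where v: "v \<in> hom T W A" "g \<cdot> v = \<phi>" using tri_lift_to_fibre2[OF t \<phi>] by blast
      obtain v' where v': "v' \<in> hom T W P" "r \<cdot> v' = v" using r W v(1) unfolding right_approx_def by blast
      have "\<phi> = (g \<cdot> r) \<cdot> v'" unfolding v(2)[symmetric] v'(2)[symmetric] using v'(1) th by (simp add: hom_iff)
      then show "\<phi> = zero T W C" using tri_comp_zero[OF t] v'(1) ob by (simp add: hom_iff)
    qed
    \<comment> \<open>This places C[-1] in \<Psi>(X). Since A is in the heart, T(A, \<Psi>(X)[1]) =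
      0, and in particular T(A, C) = 0.\<close>
    then have "fob Us C \<in> Psi T Sh X" unfolding Psi_right_iff[OF X'(1,3)] using ob by simp
    then have "hom_zero A C" using Psi_hom_zero[OF Psi_sub A(1)] ob by fastforce
    from hom_zeroD[OF this th(2)] have "g \<cdot> idm T A = zero T A C" using ob A(2) by simp
    then obtain s where s: "s \<in> hom T A P" "r \<cdot> s = idm T A"
      using tri_lift_to_fibre[OF t idm_hom[OF A(2)]] by blast
    show "A \<in> X" using retract_in_subcategory[OF split X'(1) rh(1) s(1) rh(2) s(2)] .
  qed
qed

text \<open>The approximation is taken at A[-1] so that rotating its triangle gives V, P, A with
  both ends in U, which puts P in U. Minimality then gives T(P, U[1]) = 0 by
  \<open>wakamatsu_left\<close>.\<close>

lemma enough_projectives: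
  assumes U: "U \<in> Ext T Sh \<Delta> F" and A: "A \<in> U"
  obtains V P y z w where "V \<in> U" "P \<in> Phi T Sh U" "tri V P A y z w" "right_approx T (Phi T Sh U) P A z"
proof -
  note U' = ExtD[OF U]
  have A_ob: "A \<in> ob T" "fob Us A \<in> ob T" using A U'(5) by auto
  obtain V0 l0 where l0: "left_approx T U (fob Us A) V0 l0" using approximations_ex[OF U'(2) A_ob(2)] by blast
  obtain V l where l: "left_approx T U (fob Us A) V l"
      and min: "\<And>e. e \<in> hom T V V \<Longrightarrow> e \<cdot> l = l \<Longrightarrow> is_iso T V V e"
    using minimal_left_approx[OF U'(1) l0] by blast
  have V: "V \<in> U" "l \<in> hom T (fob Us A) V" using l unfolding left_approx_def by blast+
  obtain P y z where t: "tri (fob Us A) V P l y z" using tri_ex[OF V(2)] .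
  have rot: "tri V P A y z (\<ominus> far Sh l)" using tri_rot[OF t] A_ob by simp
  note th = tri_hom[OF rot]
  have PU: "P \<in> U" using U'(3) rot V(1) A unfolding extension_closed_def tri_def by blast
  have "hom_zero P (fob Sh W)" if "W \<in> U" for W
    unfolding hom_zero_def using wakamatsu_left[OF U'(1,3) l min t that] by blast
  then have P: "P \<in> Phi T Sh U" unfolding Phi_eq using PU Psi_iff[OF U'(5)] U'(5) by blast
  have "right_approx T (Phi T Sh U) P A z"
    unfolding right_approx_def
  proof (intro conjI ballI)
    fix W f assume W: "W \<in> Phi T Sh U" and f: "f \<in> hom T W A"
    have "hom_zero W (fob Sh V)" using W Psi_hom_zero[OF U'(5) _ V(1)] unfolding Phi_eq by blast
    then have "\<ominus> far Sh l \<cdot> f = zero T W (fob Sh V)" using hom_zeroD comp_hom[OF f th(3)] by blast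
    then show "\<exists>g \<in> hom T W P. z \<cdot> g = f" using tri_lift_to_fibre2[OF rot f] by blast
  qed (use P th in blast)+
  then show thesis using that[OF V(1) P rot] by blast
qed

text \<open>Here Wakamatsu's lemma gives T(U, P[1]) = 0, and \<open>Psi_right_iff\<close> converts
  this into membership in the heart; projectives and injectives therefore form one class.\<close>

lemma enough_injectives:
  assumes U: "U \<in> Ext T Sh \<Delta> F" and A: "A \<in> U"
  obtains P V y z w where "V \<in> U" "P \<in> Phi T Sh U" "tri A P V y z w" "left_approx T (Phi T Sh U) A P y"
proof -
  note U' = ExtD[OF U]
  have A_ob: "A \<in> ob T" "fob Sh A \<in> ob T" using A U'(5) by auto
  obtain V0 r0 where r0: "right_approx T U V0 (fob Sh A) r0" using approximations_ex[OF U'(2) A_ob(2)] by blast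
  obtain V r where r: "right_approx T U V (fob Sh A) r"
      and min: "\<And>e. e \<in> hom T V V \<Longrightarrow> r \<cdot> e = r \<Longrightarrow> is_iso T V V e"
    using minimal_right_approx[OF U'(1) r0] by blast
  have V: "V \<in> U" "r \<in> hom T V (fob Sh A)" using r unfolding right_approx_def by blast+
  obtain P y z where t: "tri A P V y z r" using tri_ex3[OF V(2) A_ob(1)] .
  note th = tri_hom[OF t]
  have PU: "P \<in> U" using U'(3) t V(1) A unfolding extension_closed_def tri_def by blast
  have P_ob: "P \<in> ob T" using PU U'(5) by blast
  have "hom_zero W (fob Sh P)" if "W \<in> U" for W
    unfolding hom_zero_def using wakamatsu_right[OF U'(1,3) r min tri_rot[OF t] that] by blast
  then have P: "P \<in> Phi T Sh U" unfolding Phi_eq using PU Psi_right_iff[OF U'(1,4)] P_ob by blast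
  have "left_approx T (Phi T Sh U) A P y"
    unfolding left_approx_def
  proof (intro conjI ballI)
    fix W h assume W: "W \<in> Phi T Sh U" and h: "h \<in> hom T A W"
    have W_ob: "W \<in> ob T" using W U'(5) unfolding Phi_eq by blast
    have Sh_h: "far Sh h \<in> hom T (fob Sh A) (fob Sh W)" using h by (simp add: hom_iff)
    have "hom_zero V (fob Sh W)" using W Psi_hom_zero_right[OF U'(1,4) _ V(1)] unfolding Phi_eq by blast
    then have "far Sh h \<cdot> r = zero T V (fob Sh W)" using hom_zeroD comp_hom[OF V(2) Sh_h] by blast
    then obtain w where w: "w \<in> hom T (fob Sh P) (fob Sh W)" "w \<cdot> far Sh y = far Sh h"
      using tri_factor_through_cone3[OF t Sh_h] by blast
    obtain v where v: "v \<in> hom T P W" "far Sh v = w" using Sh_preimage[OF w(1) P_ob W_ob] .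
    have "far Sh (v \<cdot> y) = far Sh h" using v w(2) th by (simp add: hom_iff)
    then have "v \<cdot> y = h" using S_faithful[OF comp_hom[OF th(1) v(1)] h] by blast
    then show "\<exists>g \<in> hom T P W. g \<cdot> y = h" using v(1) by blast
  qed (use P th in blast)+
  then show thesis using that[OF V(1) P t] by blast
qed

lemma Phi_subcategory:
  assumes U: "subcategory T U"
  shows "subcategory T (Phi T Sh U)"
proof -
  note P = Psi_subcategory[OF subcategoryD(1)[OF U]]
  obtain Z where Z: "Z \<in> U" "zero_object T Z" using subcategoryD(2)[OF U] by blast
  obtain Z' where Z': "Z' \<in> Psi T Sh U" "zero_object T Z'" using subcategoryD(2)[OF P] by blast
  \<comment> \<open>The two subcategories come with possibly different zero objects; the isomorphism
    provides one in the intersection.\<close>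
  have "isomorphic T Z' Z" unfolding isomorphic_def using zero_objects_iso[OF Z'(2) Z(2)] by blast
  then have "Z \<in> Psi T Sh U" using subcategoryD(3)[OF P Z'(1)] by blast
  then show ?thesis
    unfolding subcategory_def Phi_eq
    using Z subcategoryD(1)[OF U] subcategoryD(3)[OF U] subcategoryD(4)[OF U]
      subcategoryD(3)[OF P] subcategoryD(4)[OF P] by (intro conjI allI impI; blast)
qed

lemma Phi_Rigid:
  assumes U: "U \<in> Ext T Sh \<Delta> F"
  shows "Phi T Sh U \<in> Rigid T Sh F"
proof -
  note U' = ExtD[OF U]
  note sub = Phi_subcategory[OF U'(1)]
  have "hom_zero A (fob Sh B)" if "A \<in> Phi T Sh U" "B \<in> Phi T Sh U" for A B
    using that Psi_hom_zero[OF U'(5)] unfolding Phi_eq by blast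
  then have rigid: "rigid T Sh (Phi T Sh U)" using rigid_iff[OF subcategoryD(1)[OF sub]] by blast
  have stable: "serre_stable T Sh F (Phi T Sh U)"
    using U'(4) Psi_serre_stable[OF U'(1,4)]
    unfolding Phi_eq serre_stable_iff[OF sub[unfolded Phi_eq]] serre_stable_iff[OF U'(1)]
      serre_stable_iff[OF Psi_subcategory[OF U'(5)]] by blast
  have "functorially_finite T (Phi T Sh U)"
    unfolding functorially_finite_def
  proof (intro ballI conjI)
    fix A assume A: "A \<in> ob T"
    \<comment> \<open>Approximations of an arbitrary A by the heart are composed in two stages:
      first by U, then inside U by enough projectives or injectives.\<close>
    obtain B r C l where r: "right_approx T U B A r" and l: "left_approx T U A C l"
      using approximations_ex[OF U'(2) A] .
    have rh: "B \<in> U" "r \<in> hom T B A" using r unfolding right_approx_def by blast+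
    have lh: "C \<in> U" "l \<in> hom T A C" using l unfolding left_approx_def by blast+
    obtain P z where P: "right_approx T (Phi T Sh U) P B z" using enough_projectives[OF U rh(1)] by blast
    then have zh: "P \<in> Phi T Sh U" "z \<in> hom T P B" unfolding right_approx_def by blast+
    have "right_approx T (Phi T Sh U) P A (r \<cdot> z)"
      unfolding right_approx_def
    proof (intro conjI ballI)
      fix W f assume W: "W \<in> Phi T Sh U" and f: "f \<in> hom T W A"
      have "W \<in> U" using W unfolding Phi_eq by blast
      then obtain g where g: "g \<in> hom T W B" "r \<cdot> g = f" using r f unfolding right_approx_def by blast
      obtain k where k: "k \<in> hom T W P" "z \<cdot> k = g" using P W g(1) unfolding right_approx_def by blast
      have "(r \<cdot> z) \<cdot> k = f" using comp_assoc[OF k(1) zh(2) rh(2)] k(2) g(2) by simp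
      then show "\<exists>g \<in> hom T W P. (r \<cdot> z) \<cdot> g = f" using k(1) by blast
    qed (use zh rh comp_hom in blast)+
    then show "\<exists>P r. right_approx T (Phi T Sh U) P A r" by blast
    obtain P z where P: "left_approx T (Phi T Sh U) C P z" using enough_injectives[OF U lh(1)] by blast
    then have zh: "P \<in> Phi T Sh U" "z \<in> hom T C P" unfolding left_approx_def by blast+
    have "left_approx T (Phi T Sh U) A P (z \<cdot> l)"
      unfolding left_approx_def
    proof (intro conjI ballI)
      fix W f assume W: "W \<in> Phi T Sh U" and f: "f \<in> hom T A W"
      have "W \<in> U" using W unfolding Phi_eq by blast
      then obtain g where g: "g \<in> hom T C W" "g \<cdot> l = f" using l f unfolding left_approx_def by blast
      obtain k where k: "k \<in> hom T P W" "k \<cdot> z = g" using P W g(1) unfolding left_approx_def by blast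
      have "k \<cdot> (z \<cdot> l) = f" using comp_assoc[OF lh(2) zh(2) k(1)] k(2) g(2) by simp
      then show "\<exists>g \<in> hom T P W. g \<cdot> (z \<cdot> l) = f" using k(1) by blast
    qed (use zh lh comp_hom in blast)+
    then show "\<exists>P l. left_approx T (Phi T Sh U) A P l" by blast
  qed
  then show ?thesis unfolding Rigid_def using sub rigid stable by blast
qed

section \<open>Maximality and the triangulated subfactor categories\<close>

lemma Psi_MaxExt:
  assumes X: "X \<in> Rigid T Sh F"
  shows "Psi T Sh X \<in> MaxExt T Sh \<Delta> F"
  unfolding MaxExt_def
proof (intro CollectI conjI allI impI Psi_Ext[OF X])
  fix V assume V: "subcategory T V \<and> extension_closed T Sh \<Delta> V \<and> serre_stable T Sh F V \<and>
    Phi T Sh V = Phi T Sh (Psi T Sh X) \<and> Psi T Sh X \<subseteq> V"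
  then have "V \<subseteq> Psi T Sh (Phi T Sh V)" using subset_Psi_Phi by blast
  then show "Psi T Sh X = V" using V Phi_Psi[OF X] by auto
qed

lemma MaxExt_Ext: "U \<in> MaxExt T Sh \<Delta> F \<Longrightarrow> U \<in> Ext T Sh \<Delta> F"
  unfolding MaxExt_def by blast

text \<open>\<Psi>\<Phi>(U) is itself a competitor in the definition of maximality: it contains U,
  and its heart is \<Phi>(U) by \<open>Phi_Psi\<close>.\<close>

lemma Psi_Phi_MaxExt:
  assumes U: "U \<in> MaxExt T Sh \<Delta> F"
  shows "Psi T Sh (Phi T Sh U) = U"
proof -
  note U1 = MaxExt_Ext[OF U]
  note R = Phi_Rigid[OF U1]
  note V = ExtD[OF Psi_Ext[OF R]]
  have "U \<subseteq> Psi T Sh (Phi T Sh U)" using subset_Psi_Phi[OF ExtD(1,4)[OF U1]] .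
  then show ?thesis using U V(1,3,4) Phi_Psi[OF R] unfolding MaxExt_def by blast
qed

text \<open>The choices L and R are arbitrary, while the triangles with enough projectives and
  injectives are specific ones. Schanuel's lemma transfers membership of the third object in U from
  the latter to the former.\<close>

lemma Ext_extension_factor:
  assumes U: "U \<in> Ext T Sh \<Delta> F"
    and L: "left_apx_choice T Sh Us \<Delta> (Phi T Sh U) L" and R: "right_apx_choice T Sh \<Delta> (Phi T Sh U) R"
  shows "extension_factor T Sh Us \<Delta> (Phi T Sh U) L R U"
proof -
  note U' = ExtD[OF U]
  note sub = Phi_subcategory[OF U'(1)]
  interpret approximation_triangles T Sh Us \<Delta> "Phi T Sh U" L R
    by unfold_locales (rule sub L R)+
  have PhiU: "Phi T Sh U \<subseteq> U" unfolding Phi_eq by blast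
  show ?thesis
  proof (unfold_locales, goal_cases)
    case 1 show ?case by (rule U'(1))
  next
    case 2 show ?case by (rule PhiU)
  next
    case 3 show ?case by (rule U'(3))
  next
    case (4 P A f)
    then show ?case using Psi_hom_zero[OF U'(5)] hom_zeroD unfolding Phi_eq by blast
  next
    case (5 A P f)
    then show ?case using Psi_hom_zero_right[OF U'(1,4)] hom_zeroD unfolding Phi_eq by blast
  next
    case (6 A)
    then have A: "A \<in> ob T" using U'(5) by blast
    obtain P V y z w where "V \<in> U" "P \<in> Phi T Sh U" and t: "tri A P V y z w"
      and "left_approx T (Phi T Sh U) A P y"
      using enough_injectives[OF U 6] .
    then show ?case using schanuel_left[OF sub U'(1) PhiU t L_triangle_rot[OF A] _ L_triangle(2)[OF A]] by simp
  next
    case (7 A)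
    then have A: "A \<in> ob T" using U'(5) by blast
    obtain V P y z w where "V \<in> U" "P \<in> Phi T Sh U" and t: "tri V P A y z w"
      and "right_approx T (Phi T Sh U) P A z"
      using enough_projectives[OF U 7] .
    then show ?case using schanuel_right[OF sub U'(1) PhiU t R_triangle(1)[OF A] _ R_triangle(2)[OF A]] by simp
  qed
qed

text \<open>Rigidity of \<open>X\<close> puts every \<open>\<Omega>B\<close> into \<open>Psi X\<close>, and \<open>\<Omega>\<close> is dense on a triangulated subcategory.\<close>

lemma Psi_maximal_triangulated:
  assumes X: "X \<in> Rigid T Sh F" and L: "left_apx_choice T Sh Us \<Delta> X L" and R: "right_apx_choice T Sh \<Delta> X R"
  shows "maximal_triangulated_subcategory T Sh Us \<Delta> X L R (Psi T Sh X)"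
proof -
  note X' = RigidD[OF X]
  note P = Phi_Psi[OF X]
  interpret extension_factor T Sh Us \<Delta> X L R "Psi T Sh X"
    using Ext_extension_factor[OF Psi_Ext[OF X]] L R unfolding P by blast
  have Omega_Psi: "\<Omega>o B \<in> Psi T Sh X" if B: "B \<in> ob T" for B
  proof -
    note h = R_hom[OF B] and t = R_triangle[OF B]
    have "hom_zero W (fob Sh (\<Omega>o B))" if W: "W \<in> X" for W
      unfolding hom_zero_def
    proof
      fix \<phi> assume \<phi>: "\<phi> \<in> hom T W (fob Sh (\<Omega>o B))"
      have "far Sh (apx1 R B) \<cdot> \<phi> \<in> hom T W (fob Sh (RX B))" using \<phi> h by (simp add: hom_iff)
      then have "far Sh (apx1 R B) \<cdot> \<phi> = zero T W (fob Sh (RX B))" using hom_zeroD[OF X'(5)[OF W h(4)]] by blast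
      then obtain v where v: "v \<in> hom T W B" "\<omega> B \<cdot> v = \<phi>" using tri_lift_to_fibre3[OF t(1) \<phi>] by blast
      \<comment> \<open>Since v starts in X, it factors through the approximation
        \<open>RX B\<close> and is killed by \<omega>.\<close>
      have "ft W B v" using ft_X_left[OF W v(1)] .
      then show "\<phi> = zero T W (fob Sh (\<Omega>o B))" using ft_\<omega> v(2) by blast
    qed
    then show ?thesis unfolding Psi_right_iff[OF X'(1,3)] using B by simp
  qed
  have "Y = Psi T Sh X"
    if Y: "triangulated_subcategory T Sh Us \<Delta> X L R Y" and sub: "Psi T Sh X \<subseteq> Y" for Y
  proof
    show "Y \<subseteq> Psi T Sh X"
    proof
      fix A assume A: "A \<in> Y"
      have Y1: "subcategory Q Y" and Y2: "is_equivalence (full_subcat Q Y) (full_subcat Q Y) \<Omega>"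
        using Y unfolding triangulated_subcategory_def Let_def by blast+
      obtain G \<tau> where G: "is_functor (full_subcat Q Y) (full_subcat Q Y) G"
        and \<tau>: "nat_iso (full_subcat Q Y) (full_subcat Q Y) (functor_comp \<Omega> G) functor_id \<tau>"
        using Y2 unfolding is_equivalence_def by blast
      have GA: "fob G A \<in> Y" using functor_ob[OF G, of A] A by simp
      then have GA_ob: "fob G A \<in> ob T" using subcategoryD(1)[OF Y1] by auto
      have "is_iso (full_subcat Q Y) (\<Omega>o (fob G A)) A (\<tau> A)"
        using \<tau> A unfolding nat_iso_def by (simp add: functor_comp_def functor_id_def)
      then have "isomorphic Q (\<Omega>o (fob G A)) A" unfolding full_subcat_is_iso isomorphic_def by blast
      then show "A \<in> Psi T Sh X"
        using factor_isomorphic[OF U_subcategory X_U split Omega_Psi[OF GA_ob]] by blast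
    qed
  qed (rule sub)
  then show ?thesis
    unfolding maximal_triangulated_subcategory_def using triangulated_subcategory by blast
qed

end

section \<open>The correspondence and its subfactor categories\<close>

theorem theorem3p15:
  fixes T :: "('o, 'm, 'k::field) lincat"
    and Sh Us \<S> :: "('o, 'm, 'o, 'm) fctr"
    and \<Delta> :: "('m \<times> 'm \<times> 'm) set"
  assumes "linear_triangulated_category T Sh Us \<Delta>"
    and "serre_functor T Sh \<Delta> \<S>"
  shows "(Psi T Sh \<in> Rigid T Sh \<S> \<rightarrow> Ext T Sh \<Delta> \<S> \<and>
          Phi T Sh \<in> Ext T Sh \<Delta> \<S> \<rightarrow> Rigid T Sh \<S>) \<and>
         ((\<forall>X \<in> Rigid T Sh \<S>. Phi T Sh (Psi T Sh X) = X) \<and>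
          (\<forall>U \<in> Ext T Sh \<Delta> \<S>. U \<subseteq> Psi T Sh (Phi T Sh U)) \<and>
          bij_betw (Psi T Sh) (Rigid T Sh \<S>) (MaxExt T Sh \<Delta> \<S>) \<and>
          bij_betw (Phi T Sh) (MaxExt T Sh \<Delta> \<S>) (Rigid T Sh \<S>) \<and>
          (\<forall>U \<in> MaxExt T Sh \<Delta> \<S>. Psi T Sh (Phi T Sh U) = U)) \<and>
         ((\<forall>U \<in> Ext T Sh \<Delta> \<S>. \<forall>L R.
             left_apx_choice T Sh Us \<Delta> (Phi T Sh U) L \<and>
             right_apx_choice T Sh \<Delta> (Phi T Sh U) R \<longrightarrow>
             triangulated_subcategory T Sh Us \<Delta> (Phi T Sh U) L R U) \<and>
          (\<forall>X \<in> Rigid T Sh \<S>. \<forall>L R.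
             left_apx_choice T Sh Us \<Delta> X L \<and> right_apx_choice T Sh \<Delta> X R \<longrightarrow>
             maximal_triangulated_subcategory T Sh Us \<Delta> X L R (Psi T Sh X)))"
proof -
  interpret serre_category T Sh Us \<Delta> \<S>
    using assms unfolding serre_category_def serre_category_axioms_def by blast
  show ?thesis
  proof (intro conjI ballI allI impI)
    show "Psi T Sh \<in> Rigid T Sh \<S> \<rightarrow> Ext T Sh \<Delta> \<S>" using Psi_Ext by blast
    show "Phi T Sh \<in> Ext T Sh \<Delta> \<S> \<rightarrow> Rigid T Sh \<S>" using Phi_Rigid by blast
    show "Phi T Sh (Psi T Sh X) = X" if "X \<in> Rigid T Sh \<S>" for X using Phi_Psi[OF that] .
    show "U \<subseteq> Psi T Sh (Phi T Sh U)" if "U \<in> Ext T Sh \<Delta> \<S>" for U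
      using subset_Psi_Phi[OF ExtD(1,4)[OF that]] .
    show "bij_betw (Psi T Sh) (Rigid T Sh \<S>) (MaxExt T Sh \<Delta> \<S>)"
      by (rule bij_betwI[of _ _ _ "Phi T Sh"])
        (use Psi_MaxExt Phi_Rigid MaxExt_Ext Phi_Psi Psi_Phi_MaxExt in blast)+
    show "bij_betw (Phi T Sh) (MaxExt T Sh \<Delta> \<S>) (Rigid T Sh \<S>)"
      by (rule bij_betwI[of _ _ _ "Psi T Sh"])
        (use Psi_MaxExt Phi_Rigid MaxExt_Ext Phi_Psi Psi_Phi_MaxExt in blast)+
    show "Psi T Sh (Phi T Sh U) = U" if "U \<in> MaxExt T Sh \<Delta> \<S>" for U using Psi_Phi_MaxExt[OF that] .
    show "triangulated_subcategory T Sh Us \<Delta> (Phi T Sh U) L R U"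
      if "U \<in> Ext T Sh \<Delta> \<S>"
        "left_apx_choice T Sh Us \<Delta> (Phi T Sh U) L \<and> right_apx_choice T Sh \<Delta> (Phi T Sh U) R" for U L R
      using extension_factor.triangulated_subcategory[OF Ext_extension_factor] that by blast
    show "maximal_triangulated_subcategory T Sh Us \<Delta> X L R (Psi T Sh X)"
      if "X \<in> Rigid T Sh \<S>" "left_apx_choice T Sh Us \<Delta> X L \<and> right_apx_choice T Sh \<Delta> X R" for X L R
      using Psi_maximal_triangulated that by blast
  qed
qed

end
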